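(* Let $0<\varepsilon\ll1$. Suppose a uniform partition of $[0,T]$ in time with step size $\tau$ and $m(0)=m_0(0)$. Assume that the data and $p_0$ are sufficiently smooth. Consider a Runge-Kutta scheme of order $\mathfrak p$ and stage order $\mathfrak q$, $\mathfrak p\ge\mathfrak q+1$, which is algebraically stable, has an invertible coefficient matrix $\mathbf A$, and satisfies $\mathbf b^T\mathbf A^{-1}\mathbf 1=1$. Let $(p,m,\lambda)$ be the solution of the hyperbolic system $(H_\varepsilon)$ with initial values $p(0),m(0)$, and $(p_0,m_0,\lambda_0)$ the solution of the parabolic system $(P_0)$ with $p_0(0)=p(0)$ (see context). Then the piecewise polynomial functions $p^{[\mathfrak q]}_{0,\tau}$ and $m^{[\mathfrak q]}_{0,\tau}$, defined through the interpolation data $p_{0,j},m_{0,j}$ given by the Runge-Kutta discretization (RK) of the context, approximate the solution of $(H_\varepsilon)$ in the sense that $$\|p-p^{[\mathfrak q]}_{0,\tau}\|_{L^2(0,T;H^1(\bar{\mathcal E}))\cap C(0,T;L^2(\mathcal E))}+\|m-m^{[\mathfrak q]}_{0,\tau}\|_{L^2(0,T;L^2(\mathcal E))}\le(\varepsilon+\tau^{\mathfrak q+1})\,C_{\rm data},$$ where $C_{\rm data}$ denotes a constant only depending on the data.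
   Context: Network: $\mathcal G=(\mathcal V,\mathcal E)$ is a directed graph whose edges are identified with bounded intervals; at each boundary vertex all adjacent edges are equally directed. $\mathcal V$ is the disjoint union of $\mathcal V_D$ (boundary vertices where the potential is prescribed) and $\mathcal V_N$ (all other vertices); $n_D=|\mathcal V_D|\ge1$, $n_N=|\mathcal V_N|$, and vectors in $\mathbb R^{n_D},\mathbb R^{n_N}$ are indexed by these vertices. Spaces: $L^2(\mathcal E)$ = functions edgewise in $L^2(e)$, with inner product $(\cdot,\cdot)=\sum_e(\cdot,\cdot)_{L^2(e)}$ and norm $\|\cdot\|$, identified with its dual. $H^1(\bar{\mathcal E})$ = functions edgewise in $H^1(e)$ that are globally continuous on the network (usual $H^1$ norm). Coefficients: time-independent $a,d$ on $\mathcal E$ with $0\le a\le\overline a$ and $0<\underline d\le d\le\overline d<\infty$ a.e. Operators: $\mathcal K:H^1(\bar{\mathcal E})\to[L^2(\mathcal E)]^*$, $\langle\mathcal Kq,m\rangle=(\partial_xq,m)$ (edgewise derivative); $\mathcal B:H^1(\bar{\mathcal E})\to\mathbb R^{n_D}$ and $\mathcal C:H^1(\bar{\mathcal E})\to\mathbb R^{n_N}$ are point evaluation at $\mathcal V_D$ and $\mathcal V_N$. Data: right-hand sides $f:[0,T]\to L^2(\mathcal E)$, $g:[0,T]\to[H^1(\bar{\mathcal E})]^*$, $h:[0,T]\to\mathbb R^{n_D}$, $r:[0,T]\to\mathbb R^{n_N}$ and initial values $p(0)\in H^1(\bar{\mathcal E})$, $m(0)\in L^2(\mathcal E)$. System $(H_\varepsilon)$: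 $\dot p+ap-\mathcal K^*m+\mathcal B^*\lambda=g-\mathcal C^*r$ in $[H^1(\bar{\mathcal E})]^*$; $\varepsilon\dot m+\mathcal Kp+dm=f$ in $[L^2(\mathcal E)]^*$; $\mathcal Bp=h$ in $\mathbb R^{n_D}$. System $(P_0)$: the same with $\varepsilon=0$ and unknowns $(p_0,m_0,\lambda_0)$, with initial condition only for $p_0$; thus $m_0=d^{-1}(f-\mathcal Kp_0)$. Runge-Kutta scheme: $\mathbf A\in\mathbb R^{s\times s}$, $\mathbf b,\mathbf c\in\mathbb R^s$, $\mathbf 1=[1,\dots,1]^T$. Order $\mathfrak p$ and stage order $\mathfrak q$ means $\sum_j\mathbf b_j\mathbf c_j^{k-1}=1/k$ for $k=1,\dots,\mathfrak p$ and $\sum_j\mathbf A_{ij}\mathbf c_j^{k-1}=\mathbf c_i^k/k$ for $k=1,\dots,\mathfrak q$, $i=1,\dots,s$. Algebraic stability: $\mathbf b_i\ge0$ and $(\mathbf b_i\mathbf A_{ij}+\mathbf b_j\mathbf A_{ji}-\mathbf b_i\mathbf b_j)_{ij}$ is positive semidefinite. Discretization (RK): $t_j=j\tau$, $j=0,\dots,n$, $\tau=T/n$; $M\in\mathbb R^{n_D\times n_D}$ is an arbitrary invertible matrix; $p_{0,0}=p_0(0)=p(0)$. For $j=1,\dots,n$ the stage vectors $\mathbf p_{0,j}\in H^1(\bar{\mathcal E})^s$, $\mathbf m_{0,j}\in L^2(\mathcal E)^s$, $\boldsymbol\lambda_{0,j},\boldsymbol\mu_{0,j}\in\mathbb R^{sn_D}$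 solve (operators acting componentwise, $D_\tau\mathbf p_{0,j}=(\mathbf p_{0,j}-p_{0,j-1}\mathbf 1)/\tau$) $\mathbf A^{-1}D_\tau\mathbf p_{0,j}+a\mathbf p_{0,j}-\mathcal K^*\mathbf m_{0,j}+\mathcal B^*\boldsymbol\lambda_{0,j}+\mathcal B^*\boldsymbol\mu_{0,j}=\mathbf g_j-\mathcal C^*\mathbf r_j$ in $[H^1(\bar{\mathcal E})^s]^*$; $\mathcal K\mathbf p_{0,j}+d\mathbf m_{0,j}=\mathbf f_j$ in $[L^2(\mathcal E)^s]^*$; $\mathcal B\mathbf p_{0,j}-M\boldsymbol\mu_{0,j}=\mathbf h_j$ and $\mathcal B\mathbf A^{-1}D_\tau\mathbf p_{0,j}=\dot{\mathbf h}_j$ in $\mathbb R^{sn_D}$. The right-hand sides are continuous in time and given by function evaluations, $\mathbf g_j=[g(t_{j-1}+\tau\mathbf c_1),\dots,g(t_{j-1}+\tau\mathbf c_s)]^T$ and similarly for the others. Then $p_{0,j}=\mathbf b^T\mathbf A^{-1}\mathbf p_{0,j}$, $m_{0,j}=\mathbf b^T\mathbf A^{-1}\mathbf m_{0,j}$. Interpolants: $p^{[\nu]}_{0,\tau}$ restricted to $(t_{j-1},t_j)$ is the interpolation polynomial of degree $\nu$ in the $\nu+1$ points $(t_k,p_{0,k})$ with $k=j-(\nu+1)/2,\dots,j+(\nu-1)/2$ if $\nu$ is odd and $k=j-1-\nu/2,\dots,j-1+\nu/2$ otherwise; if $j$ is too small or too large for this, the first (respectively last) $\nu+1$ time points are used.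 $m^{[\nu]}_{0,\tau}$ is defined in the same way from the values $m_{0,k}$. *)

theory Defs
  imports "HOL-Analysis.Analysis" "Graph_Theory.Digraph"
begin

section \<open>Networks\<close>

text \<open>
  The edge \<open>e\<close> is identified with the interval \<open>[0, edge_len N e]\<close>, the tail of \<open>e\<close> with \<open>0\<close> and
  the head with \<open>edge_len N e\<close>.  \<open>bdry\<close> is the set of boundary vertices, \<open>dirichlet\<close> the set
  \<open>V_D\<close> of those boundary vertices at which the potential is prescribed.
\<close>

record ('v, 'e) network =
  graph :: "('v, 'e) pre_digraph"
  edge_len :: "'e \<Rightarrow> real"
  bdry :: "'v set"
  dirichlet :: "'v set"

abbreviation edges :: "('v, 'e) network \<Rightarrow> 'e set" where
  "edges N \<equiv> arcs (graph N)"

definition neumann :: "('v, 'e) network \<Rightarrow> 'v set" where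
  "neumann N = verts (graph N) - dirichlet N"

text \<open>
  Every vertex is required to be an endpoint of some edge; otherwise point evaluation of a function
  on the edges at that vertex would have no meaning.
\<close>

definition wf_network :: "('v, 'e) network \<Rightarrow> bool" where
  "wf_network N \<longleftrightarrow>
     fin_digraph (graph N) \<and>
     (\<forall>e\<in>edges N. 0 < edge_len N e) \<and>
     (\<forall>v\<in>verts (graph N). in_arcs (graph N) v \<union> out_arcs (graph N) v \<noteq> {}) \<and>
     dirichlet N \<subseteq> bdry N \<and> bdry N \<subseteq> verts (graph N) \<and>
     dirichlet N \<noteq> {} \<and>
     (\<forall>v\<in>bdry N. in_arcs (graph N) v = {} \<or> out_arcs (graph N) v = {})"


section \<open>Function spaces on the network\<close>

text \<open>
  A function on the network is a function of pairs \<open>(e, x)\<close>; only its values for \<open>e \<in> edges N\<close> and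
  \<open>x \<in> {0..edge_len N e}\<close> are relevant.  Elements of the Lebesgue and Sobolev spaces are
  represented by functions (not by equivalence classes); elements of \<open>H1\<close> are represented by their
  continuous representatives.
\<close>

type_synonym 'e edge_fun = "'e \<times> real \<Rightarrow> real"

definition L2_interval :: "real \<Rightarrow> real \<Rightarrow> (real \<Rightarrow> real) set" where
  "L2_interval a b = {u. u \<in> borel_measurable (lebesgue_on {a..b}) \<and>
                         integrable (lebesgue_on {a..b}) (\<lambda>x. (u x)\<^sup>2)}"

definition test_fun :: "real \<Rightarrow> real \<Rightarrow> (real \<Rightarrow> real) \<Rightarrow> bool" where
  "test_fun a b \<phi> \<longleftrightarrow>
     (\<forall>k x. (deriv ^^ k) \<phi> field_differentiable at x) \<and>
     (\<exists>c d. a < c \<and> c \<le> d \<and> d < b \<and> (\<forall>x. x \<notin> {c..d} \<longrightarrow> \<phi> x = 0))"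

definition has_weak_deriv :: "real \<Rightarrow> real \<Rightarrow> (real \<Rightarrow> real) \<Rightarrow> (real \<Rightarrow> real) \<Rightarrow> bool" where
  "has_weak_deriv a b u w \<longleftrightarrow>
     integrable (lebesgue_on {a..b}) u \<and> integrable (lebesgue_on {a..b}) w \<and>
     (\<forall>\<phi>. test_fun a b \<phi> \<longrightarrow>
        (LINT x|lebesgue_on {a..b}. u x * deriv \<phi> x) = - (LINT x|lebesgue_on {a..b}. w x * \<phi> x))"

definition L2 :: "('v, 'e) network \<Rightarrow> 'e edge_fun set" where
  "L2 N = {u. \<forall>e\<in>edges N. (\<lambda>x. u (e, x)) \<in> L2_interval 0 (edge_len N e)}"

definition L2_inner :: "('v, 'e) network \<Rightarrow> 'e edge_fun \<Rightarrow> 'e edge_fun \<Rightarrow> real" where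
  "L2_inner N u v = (\<Sum>e\<in>edges N. LINT x|lebesgue_on {0..edge_len N e}. u (e, x) * v (e, x))"

definition L2_norm :: "('v, 'e) network \<Rightarrow> 'e edge_fun \<Rightarrow> real" where
  "L2_norm N u = sqrt (L2_inner N u u)"

definition ae_eq :: "('v, 'e) network \<Rightarrow> 'e edge_fun \<Rightarrow> 'e edge_fun \<Rightarrow> bool" where
  "ae_eq N u v \<longleftrightarrow> (\<forall>e\<in>edges N. AE x in lebesgue_on {0..edge_len N e}. u (e, x) = v (e, x))"

text \<open>The values that a function on the edges takes at the edge endpoints meeting in \<open>v\<close>.\<close>

definition endpoint_values :: "('v, 'e) network \<Rightarrow> 'e edge_fun \<Rightarrow> 'v \<Rightarrow> real set" where
  "endpoint_values N q v =
     (\<lambda>e. q (e, 0)) ` out_arcs (graph N) v \<union> (\<lambda>e. q (e, edge_len N e)) ` in_arcs (graph N) v"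

definition vertex_value :: "('v, 'e) network \<Rightarrow> 'e edge_fun \<Rightarrow> 'v \<Rightarrow> real" where
  "vertex_value N q v = (THE y. y \<in> endpoint_values N q v)"

definition H1 :: "('v, 'e) network \<Rightarrow> 'e edge_fun set" where
  "H1 N = {q.
     (\<forall>e\<in>edges N. continuous_on {0..edge_len N e} (\<lambda>x. q (e, x)) \<and>
        (\<lambda>x. q (e, x)) \<in> L2_interval 0 (edge_len N e) \<and>
        (\<exists>w \<in> L2_interval 0 (edge_len N e).
           has_weak_deriv 0 (edge_len N e) (\<lambda>x. q (e, x)) w)) \<and>
     (\<forall>v\<in>verts (graph N). \<exists>y. endpoint_values N q v \<subseteq> {y})}"

text \<open>The edgewise weak derivative, which is unique up to null sets.\<close>

definition edge_deriv :: "('v, 'e) network \<Rightarrow> 'e edge_fun \<Rightarrow> 'e edge_fun" where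
  "edge_deriv N q =
     (\<lambda>(e, x). (SOME w. has_weak_deriv 0 (edge_len N e) (\<lambda>y. q (e, y)) w) x)"

definition H1_norm :: "('v, 'e) network \<Rightarrow> 'e edge_fun \<Rightarrow> real" where
  "H1_norm N q = sqrt ((L2_norm N q)\<^sup>2 + (L2_norm N (edge_deriv N q))\<^sup>2)"

definition dual_space :: "('i \<Rightarrow> real) set \<Rightarrow> (('i \<Rightarrow> real) \<Rightarrow> real) \<Rightarrow> (('i \<Rightarrow> real) \<Rightarrow> real) set" where
  "dual_space X nrm = {F.
     (\<forall>u\<in>X. \<forall>v\<in>X. \<forall>\<alpha> \<beta>. F (\<lambda>i. \<alpha> * u i + \<beta> * v i) = \<alpha> * F u + \<beta> * F v) \<and>
     (\<exists>C. \<forall>u\<in>X. \<bar>F u\<bar> \<le> C * nrm u)}"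

definition dual_norm :: "('i \<Rightarrow> real) set \<Rightarrow> (('i \<Rightarrow> real) \<Rightarrow> real) \<Rightarrow> (('i \<Rightarrow> real) \<Rightarrow> real) \<Rightarrow> real" where
  "dual_norm X nrm F = (SUP u\<in>{u \<in> X. nrm u \<le> 1}. \<bar>F u\<bar>)"


section \<open>Functions of time with values in these spaces\<close>

text \<open>
  \<open>u \<in> C^k([0,T]; X)\<close>, where the space \<open>X\<close> of real-valued functions carries the norm \<open>nrm\<close>.  The
  witness \<open>U j\<close> is the \<open>j\<close>-th derivative (one-sided at the endpoints).
\<close>

definition Ck_time :: "nat \<Rightarrow> real \<Rightarrow> ('i \<Rightarrow> real) set \<Rightarrow> (('i \<Rightarrow> real) \<Rightarrow> real) \<Rightarrow>
    (real \<Rightarrow> 'i \<Rightarrow> real) \<Rightarrow> bool" where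
  "Ck_time k T X nrm u \<longleftrightarrow> (\<exists>U.
     (\<forall>t\<in>{0..T}. U 0 t = u t) \<and>
     (\<forall>j\<le>k. \<forall>t\<in>{0..T}. U j t \<in> X \<and>
        ((\<lambda>s. nrm (\<lambda>i. U j s i - U j t i)) \<longlongrightarrow> 0) (at t within {0..T})) \<and>
     (\<forall>j<k. \<forall>t\<in>{0..T}.
        ((\<lambda>s. nrm (\<lambda>i. (U j s i - U j t i) / (s - t) - U (Suc j) t i)) \<longlongrightarrow> 0)
          (at t within {0..T})))"

text \<open>
  The norms of \<open>L^2(0,T; X)\<close> and \<open>C(0,T; X)\<close>, with value \<open>\<infinity>\<close> if the function is not in the space
  because of missing integrability or boundedness.
\<close>

definition L2_time_norm :: "real \<Rightarrow> ('x \<Rightarrow> real) \<Rightarrow> (real \<Rightarrow> 'x) \<Rightarrow> ennreal" where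
  "L2_time_norm T nrm u =
     (if integrable (lebesgue_on {0..T}) (\<lambda>t. (nrm (u t))\<^sup>2)
      then ennreal (sqrt (LINT t|lebesgue_on {0..T}. (nrm (u t))\<^sup>2)) else \<infinity>)"

definition C_time_norm :: "real \<Rightarrow> ('x \<Rightarrow> real) \<Rightarrow> (real \<Rightarrow> 'x) \<Rightarrow> ennreal" where
  "C_time_norm T nrm u = (SUP t\<in>{0..T}. ennreal (nrm (u t)))"


section \<open>Data and operators\<close>

record ('v, 'e) flow_data =
  T_end :: real
  coef_a :: "'e edge_fun"
  coef_d :: "'e edge_fun"
  rhs_f :: "real \<Rightarrow> 'e edge_fun"
  rhs_g :: "real \<Rightarrow> 'e edge_fun \<Rightarrow> real"
  rhs_h :: "real \<Rightarrow> 'v \<Rightarrow> real"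
  rhs_r :: "real \<Rightarrow> 'v \<Rightarrow> real"
  p_init :: "'e edge_fun"
  m_init :: "'e edge_fun"

definition admissible_data :: "('v, 'e) network \<Rightarrow> ('v, 'e) flow_data \<Rightarrow> bool" where
  "admissible_data N D \<longleftrightarrow>
     0 < T_end D \<and>
     (\<forall>e\<in>edges N. (\<lambda>x. coef_a D (e, x)) \<in> borel_measurable (lebesgue_on {0..edge_len N e}) \<and>
                  (\<lambda>x. coef_d D (e, x)) \<in> borel_measurable (lebesgue_on {0..edge_len N e})) \<and>
     (\<exists>a_hi. \<forall>e\<in>edges N. AE x in lebesgue_on {0..edge_len N e}.
        0 \<le> coef_a D (e, x) \<and> coef_a D (e, x) \<le> a_hi) \<and>
     (\<exists>d_lo d_hi. 0 < d_lo \<and> (\<forall>e\<in>edges N. AE x in lebesgue_on {0..edge_len N e}.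
        d_lo \<le> coef_d D (e, x) \<and> coef_d D (e, x) \<le> d_hi)) \<and>
     p_init D \<in> H1 N \<and> m_init D \<in> L2 N"

definition smooth_data :: "nat \<Rightarrow> ('v, 'e) network \<Rightarrow> ('v, 'e) flow_data \<Rightarrow> bool" where
  "smooth_data k N D \<longleftrightarrow>
     Ck_time k (T_end D) (L2 N) (L2_norm N) (rhs_f D) \<and>
     Ck_time k (T_end D) (dual_space (H1 N) (H1_norm N)) (dual_norm (H1 N) (H1_norm N)) (rhs_g D) \<and>
     Ck_time k (T_end D) UNIV (\<lambda>y. L2_set y (dirichlet N)) (rhs_h D) \<and>
     Ck_time k (T_end D) UNIV (\<lambda>y. L2_set y (neumann N)) (rhs_r D)"

text \<open>\<open>op_K N q m\<close> is \<open>\<langle>K q, m\<rangle>\<close>; hence \<open>op_K_adj N m q\<close> is \<open>\<langle>K\<^sup>* m, q\<rangle>\<close>.\<close>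

definition op_K :: "('v, 'e) network \<Rightarrow> 'e edge_fun \<Rightarrow> 'e edge_fun \<Rightarrow> real" where
  "op_K N q m = L2_inner N (edge_deriv N q) m"

definition op_K_adj :: "('v, 'e) network \<Rightarrow> 'e edge_fun \<Rightarrow> 'e edge_fun \<Rightarrow> real" where
  "op_K_adj N m q = op_K N q m"

text \<open>
  \<open>B\<close> and \<open>C\<close> are the restrictions of \<open>vertex_value N q\<close> to \<open>dirichlet N\<close> and \<open>neumann N\<close>.
  Vectors in \<open>\<real>\<^sup>n\<close> indexed by vertices are functions on the vertices of which only
  the values on the respective vertex set matter.
\<close>

definition op_B_adj :: "('v, 'e) network \<Rightarrow> ('v \<Rightarrow> real) \<Rightarrow> 'e edge_fun \<Rightarrow> real" where
  "op_B_adj N y q = (\<Sum>v\<in>dirichlet N. y v * vertex_value N q v)"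

definition op_C_adj :: "('v, 'e) network \<Rightarrow> ('v \<Rightarrow> real) \<Rightarrow> 'e edge_fun \<Rightarrow> real" where
  "op_C_adj N y q = (\<Sum>v\<in>neumann N. y v * vertex_value N q v)"


section \<open>The systems of differential-algebraic equations\<close>

text \<open>
  Weak solutions \<open>p \<in> L^2(0,T; H^1) \<inter> C(0,T; L^2)\<close>, \<open>m \<in> C(0,T; L^2)\<close>, \<open>\<lambda> \<in> L^2(0,T)\<close> of \<open>(H_\<epsilon>)\<close>
  and, for \<open>\<epsilon> = 0\<close>, of \<open>(P_0)\<close>, without initial conditions.  The time derivatives are the
  generalized derivatives in the dual spaces, i.e. the dynamic equations hold after testing, in the
  sense of weak derivatives on \<open>(0,T)\<close>.  For \<open>\<epsilon> = 0\<close> the second dynamic equation says that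
  \<open>K p + d m = f\<close> for almost all times.
\<close>

definition is_solution :: "('v, 'e) network \<Rightarrow> ('v, 'e) flow_data \<Rightarrow> real \<Rightarrow>
    (real \<Rightarrow> 'e edge_fun) \<Rightarrow> (real \<Rightarrow> 'e edge_fun) \<Rightarrow> (real \<Rightarrow> 'v \<Rightarrow> real) \<Rightarrow> bool" where
  "is_solution N D \<epsilon> p m lam \<longleftrightarrow>
     Ck_time 0 (T_end D) (L2 N) (L2_norm N) p \<and>
     (AE t in lebesgue_on {0..T_end D}. p t \<in> H1 N) \<and>
     integrable (lebesgue_on {0..T_end D}) (\<lambda>t. (H1_norm N (p t))\<^sup>2) \<and>
     Ck_time 0 (T_end D) (L2 N) (L2_norm N) m \<and>
     (\<forall>v\<in>dirichlet N. (\<lambda>t. lam t v) \<in> L2_interval 0 (T_end D)) \<and>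
     (\<forall>q\<in>H1 N. has_weak_deriv 0 (T_end D) (\<lambda>t. L2_inner N (p t) q)
        (\<lambda>t. rhs_g D t q - op_C_adj N (rhs_r D t) q
             - L2_inner N (\<lambda>z. coef_a D z * p t z) q + op_K_adj N (m t) q - op_B_adj N (lam t) q)) \<and>
     (\<forall>w\<in>L2 N. has_weak_deriv 0 (T_end D) (\<lambda>t. \<epsilon> * L2_inner N (m t) w)
        (\<lambda>t. L2_inner N (rhs_f D t) w - op_K N (p t) w
             - L2_inner N (\<lambda>z. coef_d D z * m t z) w)) \<and>
     (AE t in lebesgue_on {0..T_end D}. \<forall>v\<in>dirichlet N. vertex_value N (p t) v = rhs_h D t v)"

definition solves_H :: "('v, 'e) network \<Rightarrow> ('v, 'e) flow_data \<Rightarrow> real \<Rightarrow>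
    (real \<Rightarrow> 'e edge_fun) \<Rightarrow> (real \<Rightarrow> 'e edge_fun) \<Rightarrow> (real \<Rightarrow> 'v \<Rightarrow> real) \<Rightarrow> bool" where
  "solves_H N D \<epsilon> p m lam \<longleftrightarrow>
     is_solution N D \<epsilon> p m lam \<and> ae_eq N (p 0) (p_init D) \<and> ae_eq N (m 0) (m_init D)"

definition solves_P0 :: "('v, 'e) network \<Rightarrow> ('v, 'e) flow_data \<Rightarrow>
    (real \<Rightarrow> 'e edge_fun) \<Rightarrow> (real \<Rightarrow> 'e edge_fun) \<Rightarrow> (real \<Rightarrow> 'v \<Rightarrow> real) \<Rightarrow> bool" where
  "solves_P0 N D p\<^sub>0 m\<^sub>0 lam\<^sub>0 \<longleftrightarrow>
     is_solution N D 0 p\<^sub>0 m\<^sub>0 lam\<^sub>0 \<and> ae_eq N (p\<^sub>0 0) (p_init D)"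


section \<open>Runge-Kutta schemes\<close>

definition rk_order :: "real^'s \<Rightarrow> real^'s \<Rightarrow> nat \<Rightarrow> bool" where
  "rk_order b c P \<longleftrightarrow> (\<forall>k\<in>{1..P}. (\<Sum>j\<in>UNIV. b $ j * (c $ j) ^ (k - 1)) = 1 / real k)"

definition rk_stage_order :: "real^'s^'s \<Rightarrow> real^'s \<Rightarrow> nat \<Rightarrow> bool" where
  "rk_stage_order A c Q \<longleftrightarrow>
     (\<forall>k\<in>{1..Q}. \<forall>i. (\<Sum>j\<in>UNIV. A $ i $ j * (c $ j) ^ (k - 1)) = (c $ i) ^ k / real k)"

definition pos_semidef :: "real^'s^'s \<Rightarrow> bool" where
  "pos_semidef S \<longleftrightarrow> transpose S = S \<and> (\<forall>x. 0 \<le> x \<bullet> (S *v x))"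

definition algebraically_stable :: "real^'s^'s \<Rightarrow> real^'s \<Rightarrow> bool" where
  "algebraically_stable A b \<longleftrightarrow> (\<forall>i. 0 \<le> b $ i) \<and>
     pos_semidef (\<chi> i j. b $ i * A $ i $ j + b $ j * A $ j $ i - b $ i * b $ j)"

text \<open>Invertibility of the square matrix \<open>M\<close> with rows and columns indexed by the finite set \<open>S\<close>.\<close>

definition invertible_on :: "'v set \<Rightarrow> ('v \<Rightarrow> 'v \<Rightarrow> real) \<Rightarrow> bool" where
  "invertible_on S M \<longleftrightarrow> (\<exists>M'. \<forall>v\<in>S. \<forall>w\<in>S.
     (\<Sum>u\<in>S. M v u * M' u w) = (if v = w then 1 else 0) \<and>
     (\<Sum>u\<in>S. M' v u * M u w) = (if v = w then 1 else 0))"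

text \<open>
  \<open>P j\<close>, \<open>Q j\<close> are \<open>p_{0,j}\<close>, \<open>m_{0,j}\<close>, and \<open>Ps j i\<close>, \<open>Qs j i\<close>, \<open>lam j i\<close>, \<open>mu j i\<close> are the \<open>i\<close>-th
  components of the stage vectors in step \<open>j\<close>.  The value \<open>m_{0,0}\<close> is the initial value \<open>m(0)\<close>.
\<close>

definition rk_discretization :: "('v, 'e) network \<Rightarrow> ('v, 'e) flow_data \<Rightarrow>
    real^'s^'s \<Rightarrow> real^'s \<Rightarrow> real^'s \<Rightarrow> ('v \<Rightarrow> 'v \<Rightarrow> real) \<Rightarrow> nat \<Rightarrow>
    (nat \<Rightarrow> 's \<Rightarrow> 'e edge_fun) \<Rightarrow> (nat \<Rightarrow> 's \<Rightarrow> 'e edge_fun) \<Rightarrow>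
    (nat \<Rightarrow> 's \<Rightarrow> 'v \<Rightarrow> real) \<Rightarrow> (nat \<Rightarrow> 's \<Rightarrow> 'v \<Rightarrow> real) \<Rightarrow>
    (nat \<Rightarrow> 'e edge_fun) \<Rightarrow> (nat \<Rightarrow> 'e edge_fun) \<Rightarrow> bool" where
  "rk_discretization N D A b c M n Ps Qs lam mu P Q \<longleftrightarrow>
     (let \<tau> = T_end D / real n;
          st = (\<lambda>j i. real (j - 1) * \<tau> + \<tau> * c $ i);
          AinvD = (\<lambda>j i z. \<Sum>k\<in>UNIV. matrix_inv A $ i $ k * ((Ps j k z - P (j - 1) z) / \<tau>))
      in P 0 = p_init D \<and> Q 0 = m_init D \<and>
         (\<forall>j\<in>{1..n}.
            (\<forall>i. Ps j i \<in> H1 N \<and> Qs j i \<in> L2 N \<and>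
               (\<forall>q\<in>H1 N. L2_inner N (AinvD j i) q + L2_inner N (\<lambda>z. coef_a D z * Ps j i z) q
                    - op_K_adj N (Qs j i) q + op_B_adj N (lam j i) q + op_B_adj N (mu j i) q
                  = rhs_g D (st j i) q - op_C_adj N (rhs_r D (st j i)) q) \<and>
               (\<forall>w\<in>L2 N. op_K N (Ps j i) w + L2_inner N (\<lambda>z. coef_d D z * Qs j i z) w
                  = L2_inner N (rhs_f D (st j i)) w) \<and>
               (\<forall>v\<in>dirichlet N. vertex_value N (Ps j i) v - (\<Sum>u\<in>dirichlet N. M v u * mu j i u)
                  = rhs_h D (st j i) v) \<and>
               (\<forall>v\<in>dirichlet N. vertex_value N (AinvD j i) v
                  = vector_derivative (\<lambda>t. rhs_h D t v) (at (st j i) within {0..T_end D}))) \<and>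
            P j = (\<lambda>z. \<Sum>k\<in>UNIV. (b v* matrix_inv A) $ k * Ps j k z) \<and>
            Q j = (\<lambda>z. \<Sum>k\<in>UNIV. (b v* matrix_inv A) $ k * Qs j k z)))"


section \<open>Piecewise polynomial interpolation in time\<close>

text \<open>
  Index of the first of the \<open>\<nu> + 1\<close> interpolation points used on \<open>(t_{j-1}, t_j)\<close>.  The truncated
  subtraction selects the first \<open>\<nu> + 1\<close> time points if \<open>j\<close> is too small, the minimum the last ones if
  \<open>j\<close> is too large; \<open>\<nu> \<le> n\<close> is presupposed.
\<close>

definition interp_start :: "nat \<Rightarrow> nat \<Rightarrow> nat \<Rightarrow> nat" where
  "interp_start \<nu> n j = min (if odd \<nu> then j - (\<nu> + 1) div 2 else j - 1 - \<nu> div 2) (n - \<nu>)"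

text \<open>
  Lagrange form of the interpolation polynomial.  A time \<open>t\<close> belongs to the interval with index
  \<open>j = \<lceil>t / \<tau>\<rceil>\<close>, and \<open>t = 0\<close> to the first one; for \<open>\<nu> \<ge> 1\<close> the
  polynomials of neighbouring intervals agree in the common time point.
\<close>

definition interpolant :: "real \<Rightarrow> nat \<Rightarrow> nat \<Rightarrow> (nat \<Rightarrow> 'i \<Rightarrow> real) \<Rightarrow> real \<Rightarrow> 'i \<Rightarrow> real" where
  "interpolant T n \<nu> y t z =
     (let \<tau> = T / real n;
          j = max 1 (nat \<lceil>t / \<tau>\<rceil>);
          I = {interp_start \<nu> n j..interp_start \<nu> n j + \<nu>}
      in \<Sum>k\<in>I. (\<Prod>i\<in>I - {k}. (t - real i * \<tau>) / (real k * \<tau> - real i * \<tau>)) * y k z)"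

end

theory Submission
  imports Defs "HOL-Real_Asymp.Real_Asymp" "HOL-Computational_Algebra.Polynomial"
begin

text \<open>
  The error is split into \<open>p - p0\<close>, the error of interpolating \<open>p0\<close> in time, and the interpolated nodal errors
  \<open>p0 (t_j) - P j\<close>; the variable \<open>m\<close> is treated likewise.

  The pair \<open>u = p - p0\<close>, \<open>v = m - m0\<close> solves the hyperbolic system with homogeneous data except for the residual
  \<open>\<epsilon>\<close> times the time derivative of \<open>m0\<close> in the second equation.  Testing with \<open>(u, v)\<close> bounds \<open>u\<close> in
  \<open>C(L2)\<close> and \<open>v\<close> in \<open>L2(L2)\<close> by \<open>O(\<epsilon>)\<close>; the same estimate for the difference quotients in time bounds the time
  derivative of \<open>v\<close>, and then the second equation bounds the spatial derivative of \<open>u\<close>.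

  For the nodal errors, the Runge-Kutta formulas are first fed with the exact time derivative of \<open>p0\<close>.  The
  resulting reference trajectory has the correct boundary values and, by the order conditions, the error
  \<open>O(\<tau>^(q+1))\<close> in \<open>H1\<close>.  The difference to the discrete solution obeys the Runge-Kutta recursion, so algebraic
  stability gives a discrete energy estimate for it whose right-hand side consists of the stage defects.

  Lagrange interpolation of degree \<open>q\<close> reproduces Taylor polynomials of degree \<open>q\<close>, which gives the order
  \<open>q + 1\<close> in time.
\<close>

section \<open>Weak derivatives on an interval\<close>

text \<open>Testing with \<open>(u, v)\<close> is only formal: \<open>u t\<close> lies in
  \<open>H1\<close> for almost every time, its spatial derivative is known to be measurable only
  after pairing with fixed functions, and no time derivative in \<open>L2\<close> is given. Energy
  estimates are therefore derived from time increments, and bounds on time derivatives from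
  difference quotients. The condition \<open>m(0) = m0(0)\<close> removes the initial layer: the
  energy of \<open>(u, v)\<close> at time \<open>h\<close> is then \<open>O(\<epsilon> h^2)\<close>,
  so the difference quotients of \<open>v\<close> are bounded in \<open>L2\<close> uniformly in
  \<open>\<epsilon>\<close>, and \<open>\<epsilon> v'\<close> is of order \<open>\<epsilon>\<close>.
  The smoothness \<open>q + 2\<close> comes from the reference trajectory: a step has quadrature
  error \<open>\<tau>^(q+2)\<close>, and summation over \<open>n\<close> steps costs one power.
  Algebraic stability dissipates only stage derivatives weighted by \<open>b\<close>; they control
  the nodes because stages with \<open>b $ i = 0\<close> do not enter \<open>b^T A^{-1}\<close>.
  Functions are representatives, not classes, and spatial derivatives are fixed only up to null
  sets. Norms are thus seminorms, and linearity of the derivative holds almost everywhere or inside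
  inner products.\<close>

lemma integral_restrict_subset:
  fixes f :: "real \<Rightarrow> real"
  assumes "S \<subseteq> T"
  shows "integral T (%x. if x \<in> S then f x else 0) = integral S f"
  unfolding integral_def integrable_on_def has_integral_restrict[OF assms] ..

section \<open>Smooth test functions built from \<open>exp (- 1 / x)\<close>\<close>

primrec times_differentiable :: "nat \<Rightarrow> (real \<Rightarrow> real) \<Rightarrow> bool" where
  "times_differentiable 0 f = True"
| "times_differentiable (Suc n) f =
     (\<exists>f'. (\<forall>x. (f has_real_derivative f' x) (at x)) \<and> times_differentiable n f')"

lemma times_differentiable_SucI:
  assumes "\<And>x. (f has_real_derivative f' x) (at x)" "times_differentiable n f'"
  shows "times_differentiable (Suc n) f"
  using assms by auto

lemma times_differentiable_less: "times_differentiable (Suc n) f ==> times_differentiable n f"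
  by (induction n arbitrary: f) (simp, metis times_differentiable.simps(2))

lemma times_differentiable_add:
  "times_differentiable n f ==> times_differentiable n g ==> times_differentiable n (%x. f x + g x)"
proof (induction n arbitrary: f g)
  case (Suc n)
  then obtain f' g' where "\<forall>x. (f has_real_derivative f' x) (at x)" "times_differentiable n f'"
     "\<forall>x. (g has_real_derivative g' x) (at x)" "times_differentiable n g'" by auto
  then show ?case
    using Suc.IH by (intro times_differentiable_SucI[of _ "%x. f' x + g' x"]) (auto intro!: derivative_eq_intros)
qed simp

lemma times_differentiable_const: "times_differentiable n (%x. k)"
proof (induction n arbitrary: k)
  case (Suc n)
  show ?case
    by (rule times_differentiable_SucI[of _ "%x. 0"]) (use Suc in auto)
qed simp

lemma times_differentiable_mult:
  "times_differentiable n f ==> times_differentiable n g ==> times_differentiable n (%x. f x * g x)"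
proof (induction n arbitrary: f g)
  case (Suc n)
  then obtain f' g' where *: "\<forall>x. (f has_real_derivative f' x) (at x)" "times_differentiable n f'"
     "\<forall>x. (g has_real_derivative g' x) (at x)" "times_differentiable n g'" by auto
  moreover have "times_differentiable n f" "times_differentiable n g"
    using Suc.prems times_differentiable_less by auto
  ultimately show ?case
    using Suc.IH
    by (intro times_differentiable_SucI[of _ "%x. f' x * g x + f x * g' x"])
      (auto intro!: derivative_eq_intros times_differentiable_add)
qed simp

lemma times_differentiable_inverse:
  assumes "\<And>x. f x \<noteq> 0"
  shows "times_differentiable n f ==> times_differentiable n (%x. inverse (f x))"
proof (induction n)
  case (Suc n)
  then obtain f' where *: "\<forall>x. (f has_real_derivative f' x) (at x)" "times_differentiable n f'"
    by auto
  have i: "times_differentiable n (%x. inverse (f x))"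
    using Suc times_differentiable_less by auto
  have "times_differentiable n (%x. (- 1) * (f' x * (inverse (f x) * inverse (f x))))"
    using i * by (intro times_differentiable_mult times_differentiable_const)
  moreover have "((%x. inverse (f x)) has_real_derivative (- 1) * (f' x * (inverse (f x) * inverse (f x)))) (at x)" for x
    using * assms by (auto intro!: derivative_eq_intros)
  ultimately show ?case
    by (intro times_differentiable_SucI)
qed simp

lemma times_differentiable_affine:
  "times_differentiable n f ==> times_differentiable n (%x. f (\<alpha> * x + \<beta>))"
proof (induction n arbitrary: f)
  case (Suc n)
  then obtain f' where *: "\<forall>x. (f has_real_derivative f' x) (at x)" "times_differentiable n f'"
    by auto
  show ?case
  proof (rule times_differentiable_SucI)
    show "times_differentiable n (%x. \<alpha> * f' (\<alpha> * x + \<beta>))"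
      using Suc.IH * by (intro times_differentiable_mult times_differentiable_const) auto
    show "((%x. f (\<alpha> * x + \<beta>)) has_real_derivative \<alpha> * f' (\<alpha> * x + \<beta>)) (at x)" for x
    proof -
      have "((%x. \<alpha> * x + \<beta>) has_real_derivative \<alpha>) (at x)"
        by (auto intro!: derivative_eq_intros)
      from DERIV_chain2[OF *(1)[rule_format] this] show ?thesis by (simp add: mult.commute)
    qed
  qed
qed simp

text \<open>Bridge to \<open>test_fun\<close>, which is phrased with iterated \<open>deriv\<close>.
  The closure properties are proved for \<open>times_differentiable\<close> because it carries the
  derivatives as witnesses and so admits plain inductions.\<close>

lemma higher_deriv_differentiable:
  assumes "times_differentiable (Suc k) f"
  shows "(deriv ^^ k) f field_differentiable at x"
  using assms
proof (induction k arbitrary: f)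
  case 0
  then show ?case by (auto simp: field_differentiable_def)
next
  case (Suc k)
  then obtain f' where *: "\<forall>x. (f has_real_derivative f' x) (at x)" "times_differentiable (Suc k) f'"
    by (metis times_differentiable.simps(2))
  then have "deriv f = f'"
    by (auto intro!: DERIV_imp_deriv)
  then show ?case
    using Suc.IH[of f'] * by (simp only: funpow_Suc_right o_apply)
qed

text \<open>The standard flat function with a power of \<open>1 / x\<close> attached. The exponent
  \<open>k\<close> makes the family closed under differentiation up to linear combinations, so one
  induction covers all derivatives, and the exponential beats every power at
  \<open>0\<close>.\<close>

definition flat_exp :: "nat \<Rightarrow> real \<Rightarrow> real" where
  "flat_exp k x = (if x \<le> 0 then 0 else exp (- inverse x) * inverse x ^ k)"

lemma flat_exp_tendsto_0: "(flat_exp k \<longlongrightarrow> 0) (at_right 0)"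
proof -
  have "((%x. x ^ k / exp x) \<longlongrightarrow> (0::real)) at_top"
    by (rule tendsto_power_div_exp_0)
  then have "((%x. inverse x ^ k / exp (inverse x)) \<longlongrightarrow> (0::real)) (at_right 0)"
    by (rule filterlim_compose) (rule filterlim_inverse_at_top_right)
  then show ?thesis
    by (rule Lim_transform_eventually)
      (auto simp: eventually_at_filter flat_exp_def exp_minus field_simps)
qed

lemma has_real_derivative_flat_exp:
  "(flat_exp k has_real_derivative flat_exp (k + 2) x - real k * flat_exp (k + 1) x) (at x)"
proof -
  consider "x < 0" | "x = 0" | "x > 0" by linarith
  then show ?thesis
  proof cases
    case 1
    have "((%x. 0) has_real_derivative 0) (at x)" by simp
    then have "(flat_exp k has_real_derivative 0) (at x)"
      by (rule has_field_derivative_transform_within_open[where S = "{..<0}"])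
        (use 1 in \<open>auto simp: flat_exp_def\<close>)
    then show ?thesis using 1 by (simp add: flat_exp_def)
  next
    case 2
    \<comment> \<open>From the right the difference quotient at \<open>0\<close> is again a member
      of the family, with exponent \<open>Suc k\<close>.\<close>
    have "((%h. flat_exp k h / h) \<longlongrightarrow> 0) (at_right 0)"
      using flat_exp_tendsto_0[of "Suc k"]
      by (rule Lim_transform_eventually)
        (auto simp: eventually_at_filter flat_exp_def field_simps)
    moreover have "((%h. flat_exp k h / h) \<longlongrightarrow> 0) (at_left 0)"
      by (rule tendsto_eventually) (auto simp: eventually_at_filter flat_exp_def)
    ultimately have "((%h. flat_exp k h / h) \<longlongrightarrow> 0) (at 0)"
      by (simp add: filterlim_at_split)
    then show ?thesis
      using 2 by (simp add: DERIV_def flat_exp_def)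
  next
    case 3
    have "((%x. exp (- inverse x) * inverse x ^ k) has_real_derivative
        flat_exp (k + 2) x - real k * flat_exp (k + 1) x) (at x)"
    proof -
      have "((%x. inverse x ^ k) has_real_derivative - real k * inverse x ^ (k + 1)) (at x)"
      proof (cases k)
        case (Suc m)
        have "(inverse has_real_derivative - (inverse x * 1 * inverse x)) (at x)"
          using 3 by (intro DERIV_inverse') auto
        from DERIV_power[OF this, of k] show ?thesis by (simp add: Suc algebra_simps)
      qed simp
      moreover have "((%x. exp (- inverse x)) has_real_derivative exp (- inverse x) * inverse x ^ 2) (at x)"
        using 3 by (auto intro!: derivative_eq_intros simp: power2_eq_square)
      ultimately have "((%x. exp (- inverse x) * inverse x ^ k) has_real_derivative
          exp (- inverse x) * inverse x ^ 2 * inverse x ^ k + - real k * inverse x ^ (k + 1) * exp (- inverse x)) (at x)"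
        by (rule DERIV_mult[rotated])
      also have "exp (- inverse x) * inverse x ^ 2 * inverse x ^ k + - real k * inverse x ^ (k + 1) * exp (- inverse x)
          = flat_exp (k + 2) x - real k * flat_exp (k + 1) x"
        using 3 by (simp add: flat_exp_def power_add power2_eq_square algebra_simps)
      finally show ?thesis .
    qed
    then show ?thesis
      by (rule has_field_derivative_transform_within_open[where S = "{0<..}"])
        (use 3 in \<open>auto simp: flat_exp_def\<close>)
  qed
qed

lemma times_differentiable_flat_exp: "times_differentiable n (flat_exp k)"
proof (induction n arbitrary: k)
  case (Suc n)
  have "times_differentiable n (%x. flat_exp (k + 2) x + (- real k) * flat_exp (k + 1) x)"
    using Suc by (intro times_differentiable_add times_differentiable_mult times_differentiable_const)
  then show ?case
    using has_real_derivative_flat_exp[of k] by (intro times_differentiable_SucI) auto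
qed simp

text \<open>A smooth transition from \<open>0\<close> on the nonpositive axis to \<open>1\<close>
  beyond \<open>1\<close>. The denominator never vanishes since \<open>x\<close> or
  \<open>1 - x\<close> is positive.\<close>

definition smooth_step :: "real \<Rightarrow> real" where
  "smooth_step x = flat_exp 0 x * inverse (flat_exp 0 x + flat_exp 0 (1 - x))"

lemma smooth_step_denominator_pos: "0 < flat_exp 0 x + flat_exp 0 (1 - x)"
  by (auto simp: flat_exp_def add_pos_pos)

lemma times_differentiable_smooth_step: "times_differentiable n smooth_step"
proof -
  have "times_differentiable n (%x. flat_exp 0 ((-1) * x + 1))"
    by (rule times_differentiable_affine[OF times_differentiable_flat_exp])
  then have "times_differentiable n (%x. flat_exp 0 (1 - x))" by simp
  then show ?thesis
    unfolding smooth_step_def [abs_def]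
    using smooth_step_denominator_pos
    by (intro times_differentiable_mult times_differentiable_inverse times_differentiable_add
        times_differentiable_flat_exp) (metis less_irrefl)+
qed

lemma smooth_step_le_0: "x \<le> 0 ==> smooth_step x = 0"
  and smooth_step_ge_1: "1 \<le> x ==> smooth_step x = 1"
  by (auto simp: smooth_step_def flat_exp_def)

lemma smooth_step_bounds: "0 \<le> smooth_step x \<and> smooth_step x \<le> 1"
  using smooth_step_denominator_pos[of x]
  by (auto simp: smooth_step_def flat_exp_def field_simps)

lemma smooth_step_derivative:
  obtains \<psi> where "\<And>x. (smooth_step has_real_derivative \<psi> x) (at x)" "continuous_on UNIV \<psi>"
    "\<And>x. x \<notin> {0..1} ==> \<psi> x = 0"
proof -
  have "times_differentiable (Suc (Suc 0)) smooth_step"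
    by (rule times_differentiable_smooth_step)
  then obtain \<psi> \<psi>' where \<psi>: "\<And>x. (smooth_step has_real_derivative \<psi> x) (at x)"
    "\<And>x. (\<psi> has_real_derivative \<psi>' x) (at x)" by auto
  have "\<psi> x = 0" if "x \<notin> {0..1}" for x
  proof (cases "x < 0")
    case True
    have "((%x. 0) has_real_derivative 0) (at x)" by simp
    then have "(smooth_step has_real_derivative 0) (at x)"
      by (rule has_field_derivative_transform_within_open[where S = "{..<0}"])
        (use True in \<open>auto simp: smooth_step_le_0\<close>)
    then show ?thesis using \<psi>(1) DERIV_unique by blast
  next
    case False
    have "((%x. 1) has_real_derivative 0) (at x)" by simp
    then have "(smooth_step has_real_derivative 0) (at x)"
      by (rule has_field_derivative_transform_within_open[where S = "{1<..}"])
        (use False that in \<open>auto simp: smooth_step_ge_1\<close>)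
    then show ?thesis using \<psi>(1) DERIV_unique by blast
  qed
  moreover have "continuous_on UNIV \<psi>"
    using \<psi>(2) by (meson DERIV_continuous_on has_field_derivative_at_within)
  ultimately show ?thesis using \<psi>(1) that by blast
qed

text \<open>Smooth replacement of the indicator of \<open>{s<..t}\<close>. Both ramps lie to the
  right of their base points, so the derivative averages over \<open>{s..s + \<delta>}\<close> and
  \<open>{t..t + \<delta>}\<close>.\<close>

definition smooth_window :: "real \<Rightarrow> real \<Rightarrow> real \<Rightarrow> real \<Rightarrow> real" where
  "smooth_window \<delta> s t x = smooth_step ((x - s) / \<delta>) - smooth_step ((x - t) / \<delta>)"

lemma test_fun_smooth_window:
  assumes "a < s" "s < t" "0 < \<delta>" "t + \<delta> < b"
  shows "test_fun a b (smooth_window \<delta> s t)"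
proof -
  have step: "times_differentiable n (%x. smooth_step ((x - s) / \<delta>))" for n s
    using times_differentiable_affine[OF times_differentiable_smooth_step, of n "1/\<delta>" "-s/\<delta>"]
    by (simp add: diff_divide_distrib)
  have "times_differentiable n (%x. smooth_step ((x - s) / \<delta>) + (-1) * smooth_step ((x - t) / \<delta>))" for n
    using step by (intro times_differentiable_add times_differentiable_mult times_differentiable_const)
  then have "times_differentiable n (smooth_window \<delta> s t)" for n
    by (simp add: smooth_window_def [abs_def])
  moreover have "smooth_window \<delta> s t x = 0" if "x \<notin> {s..t + \<delta>}" for x
  proof (cases "x < s")
    case True
    then show ?thesis using assms
      by (simp add: smooth_window_def smooth_step_le_0 divide_nonpos_pos)
  next
    case False
    then have "1 \<le> (x - s) / \<delta>" "1 \<le> (x - t) / \<delta>" using assms that by (auto simp: field_simps)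
    then show ?thesis by (simp add: smooth_window_def smooth_step_ge_1)
  qed
  ultimately show ?thesis
    unfolding test_fun_def
    using assms
    by (intro conjI allI exI[of _ s] exI[of _ "t + \<delta>"] higher_deriv_differentiable)
      (auto simp del: times_differentiable.simps)
qed

text \<open>The kernel has mass one, being the derivative of a rescaled \<open>smooth_step\<close>,
  and is supported in \<open>{s..s + \<delta>}\<close>; as \<open>\<delta>\<close> shrinks it picks
  out the value of a continuous function.\<close>

lemma mollified_value:
  fixes u \<psi> :: "real \<Rightarrow> real"
  assumes u: "continuous_on {a..b} u" and s: "a \<le> s" "s < b"
    and \<psi>: "\<And>x. (smooth_step has_real_derivative \<psi> x) (at x)" "continuous_on UNIV \<psi>"
      "\<And>x. x \<notin> {0..1} ==> \<psi> x = 0"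
  shows "((%\<delta>. integral {a..b} (%x. u x * (\<psi> ((x - s) / \<delta>) / \<delta>))) \<longlongrightarrow> u s) (at_right 0)"
proof -
  have "compact (\<psi> ` {0..1})"
    by (intro compact_continuous_image continuous_on_subset[OF \<psi>(2)]) auto
  then obtain K where K: "0 < K" "\<And>x. x \<in> {0..1} ==> \<bar>\<psi> x\<bar> \<le> K"
    using compact_imp_bounded bounded_pos by (metis image_eqI real_norm_def)
  show ?thesis
  proof (rule tendstoI)
    fix e :: real assume e: "0 < e"
    \<comment> \<open>The sign of \<open>\<psi>\<close> is left open, so the integral of the
      absolute value of the kernel is estimated by \<open>K\<close> instead of one; hence the
      tolerance \<open>e / (2 * K)\<close>.\<close>
    obtain d where d: "0 < d" "\<And>x. x \<in> {a..b} ==> \<bar>x - s\<bar> < d ==> \<bar>u x - u s\<bar> < e / (2 * K)"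
      using u s e K(1) unfolding continuous_on_iff dist_real_def
      by (metis atLeastAtMost_iff divide_pos_pos less_eq_real_def mult_pos_pos zero_less_numeral)
    have "\<bar>integral {a..b} (%x. u x * (\<psi> ((x - s) / \<delta>) / \<delta>)) - u s\<bar> < e"
      if \<delta>: "0 < \<delta>" "\<delta> < d" "\<delta> < b - s" for \<delta>
    proof -
      let ?k = "%x. \<psi> ((x - s) / \<delta>) / \<delta>"
      have k: "continuous_on S ?k" for S
        by (intro continuous_intros continuous_on_compose2[OF \<psi>(2)]) (use \<delta> in auto)
      have "((%x. smooth_step ((x - s) / \<delta>)) has_real_derivative ?k x) (at x)" for x
      proof -
        have "((%x. (x - s) / \<delta>) has_real_derivative 1 / \<delta>) (at x)"
          using \<delta> by (auto intro!: derivative_eq_intros)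
        from DERIV_chain2[OF \<psi>(1) this] show ?thesis by simp
      qed
      then have "(?k has_integral (smooth_step ((s + \<delta> - s) / \<delta>) - smooth_step ((s - s) / \<delta>))) {s..s + \<delta>}"
        using \<delta> by (intro fundamental_theorem_of_calculus)
          (auto intro: has_field_derivative_at_within simp: has_real_derivative_iff_has_vector_derivative[symmetric])
      then have k1: "(?k has_integral 1) {s..s + \<delta>}"
        using \<delta> by (simp add: smooth_step_ge_1 smooth_step_le_0)
      have sub: "{s..s + \<delta>} \<subseteq> {a..b}" using s \<delta> by auto
      have "integral {a..b} (%x. u x * ?k x) = integral {s..s + \<delta>} (%x. u x * ?k x)"
      proof -
        have "?k x = 0" if "x \<notin> {s..s + \<delta>}" for x
          using that \<delta> \<psi>(3)[of "(x - s) / \<delta>"] by (auto simp: field_simps)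
        then have "(%x. u x * ?k x) = (%x. if x \<in> {s..s + \<delta>} then u x * ?k x else 0)" by force
        from trans[OF arg_cong[OF this, of "integral {a..b}"] integral_restrict_subset[OF sub]]
        show ?thesis .
      qed
      also have "\<dots> - u s = integral {s..s + \<delta>} (%x. (u x - u s) * ?k x)"
      proof -
        have "(%x. u x * ?k x) integrable_on {s..s + \<delta>}"
          by (intro integrable_continuous_interval continuous_on_mult continuous_on_subset[OF u sub] k)
        moreover have "((%x. u s * ?k x) has_integral u s * 1) {s..s + \<delta>}"
          by (rule has_integral_mult_right[OF k1])
        ultimately have "((%x. u x * ?k x - u s * ?k x) has_integral
            integral {s..s + \<delta>} (%x. u x * ?k x) - u s * 1) {s..s + \<delta>}"
          by (intro has_integral_diff integrable_integral)
        from integral_unique[OF this] show ?thesis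
          by (simp only: left_diff_distrib mult_1_right)
      qed
      finally have eq: "integral {a..b} (%x. u x * ?k x) - u s = integral {s..s + \<delta>} (%x. (u x - u s) * ?k x)" .
      have "norm (integral {s..s + \<delta>} (%x. (u x - u s) * ?k x)) \<le> (e / (2 * K) * (K / \<delta>)) * (s + \<delta> - s)"
      proof (rule integral_bound)
        show "continuous_on {s..s + \<delta>} (%x. (u x - u s) * ?k x)"
          by (intro continuous_intros continuous_on_subset[OF u sub] k)
        fix x assume x: "x \<in> {s..s + \<delta>}"
        have "\<bar>u x - u s\<bar> \<le> e / (2 * K)" using d(2)[of x] x sub \<delta>(2)
          by (cases "x = s + \<delta>") (auto intro: less_imp_le)
        moreover have "\<bar>?k x\<bar> \<le> K / \<delta>"
          using K(2)[of "(x - s) / \<delta>"] x \<delta> by (auto simp: abs_mult abs_divide field_simps)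
        ultimately show "norm ((u x - u s) * ?k x) \<le> e / (2 * K) * (K / \<delta>)"
          unfolding real_norm_def abs_mult by (intro mult_mono) (use e K in auto)
      qed (use \<delta> in auto)
      also have "\<dots> = e / 2" using \<delta> K by (simp add: field_simps)
      finally show ?thesis using e unfolding eq real_norm_def by linarith
    qed
    moreover have "0 < min d (b - s)" using d s by auto
    ultimately show "\<forall>\<^sub>F \<delta> in at_right 0. dist (integral {a..b} (%x. u x * (\<psi> ((x - s) / \<delta>) / \<delta>))) (u s) < e"
      unfolding eventually_at_right_field dist_real_def
      by (intro exI[of _ "min d (b - s)"]) auto
  qed
qed

text \<open>Testing with smooth windows that shrink to the indicator of \<open>{s<..t}\<close>: the
  side with the derivative of the test function tends to \<open>u s - u t\<close> by mollification,
  the other side to the integral of \<open>w\<close> by dominated convergence.\<close>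

lemma weak_deriv_increment_interior:
  assumes w: "has_weak_deriv a b u w" and u: "continuous_on {a..b} u"
    and st: "a < s" "s < t" "t < b"
  shows "u t - u s = integral {s..t} w"
proof -
  obtain \<psi> where \<psi>: "\<And>x. (smooth_step has_real_derivative \<psi> x) (at x)" "continuous_on UNIV \<psi>"
    "\<And>x. x \<notin> {0..1} ==> \<psi> x = 0"
    by (rule smooth_step_derivative) blast
  \<comment> \<open>The ramp width is at most half the distance from \<open>t\<close> to
    \<open>b\<close>, which keeps the support of the window inside the open interval.\<close>
  define \<delta> where "\<delta> n = (b - t) / (real n + 2)" for n :: nat
  have \<delta>: "0 < \<delta> n" "t + \<delta> n < b" for n
  proof -
    have "\<delta> n \<le> (b - t) / 2" unfolding \<delta>_def using st by (intro divide_left_mono) auto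
    then show "t + \<delta> n < b" "0 < \<delta> n" using st by (auto simp: \<delta>_def field_simps)
  qed
  have \<delta>0: "filterlim \<delta> (at_right 0) sequentially"
  proof -
    have "(%n. (b - t) / (real n + 2)) \<longlonglongrightarrow> 0"
      by real_asymp
    then show ?thesis
      unfolding \<delta>_def [abs_def, symmetric] filterlim_at using \<delta> by (auto simp: less_imp_neq[THEN not_sym])
  qed
  have int_w: "integrable (lebesgue_on {a..b}) w"
    using w by (simp add: has_weak_deriv_def)
  let ?\<phi> = "%n. smooth_window (\<delta> n) s t"
  let ?k = "%s n x. \<psi> ((x - s) / \<delta> n) / \<delta> n"
  have d\<phi>: "(?\<phi> n has_real_derivative ?k s n x - ?k t n x) (at x)" for n x
  proof -
    have "((%x. (x - s) / \<delta> n) has_real_derivative 1 / \<delta> n) (at x)" for s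
      using \<delta>[of n] by (auto intro!: derivative_eq_intros)
    from DERIV_diff[OF DERIV_chain2[OF \<psi>(1) this[of s]] DERIV_chain2[OF \<psi>(1) this[of t]]]
    show ?thesis by (simp add: smooth_window_def [abs_def])
  qed
  have k_cont: "continuous_on S (?k s n)" for S s n
    by (intro continuous_intros continuous_on_compose2[OF \<psi>(2)]) (use \<delta>[of n] in auto)
  have uk: "continuous_on {a..b} (%x. u x * ?k s n x)" for s n
    by (intro continuous_on_mult u k_cont)
  have lhs: "(LINT x|lebesgue_on {a..b}. u x * deriv (?\<phi> n) x)
      = integral {a..b} (%x. u x * ?k s n x) - integral {a..b} (%x. u x * ?k t n x)" for n
  proof -
    have "deriv (?\<phi> n) = (%x. ?k s n x - ?k t n x)"
      using d\<phi> by (auto intro!: DERIV_imp_deriv)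
    then have "(%x. u x * deriv (?\<phi> n) x) = (%x. u x * ?k s n x - u x * ?k t n x)"
      by (simp add: right_diff_distrib)
    moreover have "continuous_on {a..b} (%x. u x * ?k s n x - u x * ?k t n x)"
      by (intro continuous_on_diff uk)
    ultimately have "(LINT x|lebesgue_on {a..b}. u x * deriv (?\<phi> n) x)
        = integral {a..b} (%x. u x * ?k s n x - u x * ?k t n x)"
      using st
      by (metis continuous_imp_integrable_real fmeasurableD lebesgue_integral_eq_integral lmeasurable_interval(1))
    also have "\<dots> = integral {a..b} (%x. u x * ?k s n x) - integral {a..b} (%x. u x * ?k t n x)"
      by (intro Henstock_Kurzweil_Integration.integral_diff integrable_continuous_interval uk)
    finally show ?thesis .
  qed
  have "(%n. integral {a..b} (%x. u x * ?k s n x)) \<longlonglongrightarrow> u s"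
    by (rule filterlim_compose[OF mollified_value[OF u _ _ \<psi>] \<delta>0]) (use st in auto)
  moreover have "(%n. integral {a..b} (%x. u x * ?k t n x)) \<longlonglongrightarrow> u t"
    by (rule filterlim_compose[OF mollified_value[OF u _ _ \<psi>] \<delta>0]) (use st in auto)
  ultimately have L: "(%n. LINT x|lebesgue_on {a..b}. u x * deriv (?\<phi> n) x) \<longlonglongrightarrow> u s - u t"
    unfolding lhs by (rule tendsto_diff)
  \<comment> \<open>The ramps start at their base points and rise to the right, hence the limit is
    the indicator of the open half-line.\<close>
  have step_lim: "(%n. smooth_step ((x - s) / \<delta> n)) \<longlonglongrightarrow> indicator {s<..} x" for x s
  proof (cases "x \<le> s")
    case True
    then have "smooth_step ((x - s) / \<delta> n) = 0" for n
      using \<delta>[of n] by (intro smooth_step_le_0) (simp add: divide_nonpos_pos)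
    then show ?thesis using True by simp
  next
    case False
    have "\<forall>\<^sub>F n in sequentially. \<delta> n < x - s"
      using \<delta>0 False by (auto simp: filterlim_at intro: order_tendstoD)
    then have "\<forall>\<^sub>F n in sequentially. smooth_step ((x - s) / \<delta> n) = indicator {s<..} x"
      by (rule eventually_mono) (use \<delta> False in \<open>auto simp: field_simps intro!: smooth_step_ge_1\<close>)
    then show ?thesis by (rule tendsto_eventually)
  qed
  have R: "(%n. LINT x|lebesgue_on {a..b}. w x * ?\<phi> n x) \<longlonglongrightarrow> (LINT x|lebesgue_on {a..b}. w x * indicator {s<..t} x)"
  proof (rule integral_dominated_convergence[where w = "%x. \<bar>w x\<bar>"])
    show "(%x. w x * ?\<phi> n x) \<in> borel_measurable (lebesgue_on {a..b})" for n
    proof (rule borel_measurable_times)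
      have "continuous_on {a..b} (?\<phi> n)"
        by (rule DERIV_continuous_on) (rule has_field_derivative_at_within[OF d\<phi>])
      then show "?\<phi> n \<in> borel_measurable (lebesgue_on {a..b})"
        by (intro continuous_imp_measurable_on_sets_lebesgue) auto
    qed (use int_w in auto)
    show "(%x. w x * indicator {s<..t} x) \<in> borel_measurable (lebesgue_on {a..b})"
      using int_w st by (intro borel_measurable_times borel_measurable_indicator) (auto simp: sets_restrict_space_iff)
    show "integrable (lebesgue_on {a..b}) (%x. \<bar>w x\<bar>)" using int_w by simp
    show "AE x in lebesgue_on {a..b}. (%n. w x * ?\<phi> n x) \<longlonglongrightarrow> w x * indicator {s<..t} x"
    proof (rule AE_I2)
      fix x
      have "indicator {s<..} x - indicator {t<..} x = (indicator {s<..t} x :: real)"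
        using st by (auto simp: indicator_def)
      then show "(%n. w x * ?\<phi> n x) \<longlonglongrightarrow> w x * indicator {s<..t} x"
        unfolding smooth_window_def using tendsto_diff[OF step_lim[of x s] step_lim[of x t]]
        by (intro tendsto_mult_left) simp
    qed
    show "AE x in lebesgue_on {a..b}. norm (w x * ?\<phi> n x) \<le> \<bar>w x\<bar>" for n
    proof (rule AE_I2)
      fix x
      have "\<bar>?\<phi> n x\<bar> \<le> 1"
        using smooth_step_bounds[of "(x - s) / \<delta> n"] smooth_step_bounds[of "(x - t) / \<delta> n"]
        unfolding smooth_window_def by linarith
      then show "norm (w x * ?\<phi> n x) \<le> \<bar>w x\<bar>"
        by (simp add: abs_mult mult_left_le)
    qed
  qed
  have "(LINT x|lebesgue_on {a..b}. u x * deriv (?\<phi> n) x) = - (LINT x|lebesgue_on {a..b}. w x * ?\<phi> n x)" for n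
    using w test_fun_smooth_window[OF st(1,2) \<delta>[of n]] by (simp add: has_weak_deriv_def)
  then have "u s - u t = - (LINT x|lebesgue_on {a..b}. w x * indicator {s<..t} x)"
    using LIMSEQ_unique[OF L] tendsto_minus[OF R] by simp
  also have "(LINT x|lebesgue_on {a..b}. w x * indicator {s<..t} x) = integral {s..t} w"
  proof -
    have "integrable (lebesgue_on {a..b}) (%x. w x * indicator {s<..t} x)"
      using int_w st by (intro integrable_mult_indicator[of _ "lebesgue_on {a..b}" w, simplified mult.commute[of "indicator _ _"] real_scaleR_def])
         (auto simp: sets_restrict_space_iff)
    then have "(LINT x|lebesgue_on {a..b}. w x * indicator {s<..t} x) = integral {a..b} (%x. w x * indicator {s<..t} x)"
      by (simp add: lebesgue_integral_eq_integral)
    also have "\<dots> = integral {a..b} (%x. if x \<in> {s<..t} then w x else 0)"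
      by (intro integral_cong) (auto simp: indicator_def)
    also have "\<dots> = integral {s<..t} w"
      using st by (intro integral_restrict_subset) auto
    also have "\<dots> = integral {s..t} w"
      by (rule integral_spike_set; rule negligible_subset[of "{s}"]) auto
    finally show ?thesis .
  qed
  finally show ?thesis by simp
qed

text \<open>Extends the interior statement to the closed interval: \<open>u\<close> minus the
  primitive of \<open>w\<close> is constant inside and continuous up to the ends. Weak derivatives
  in space and in time enter the later arguments mainly in this form.\<close>

lemma weak_deriv_increment:
  assumes w: "has_weak_deriv a b u w" and u: "continuous_on {a..b} u"
    and st: "a \<le> s" "s \<le> t" "t \<le> b"
  shows "u t - u s = integral {s..t} w"
proof (cases "a < b")
  case ab: True
  have int_w: "w integrable_on {a..b}"
    using w integrable_on_lebesgue_on[of "{a..b}" w] by (simp add: has_weak_deriv_def)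
  let ?W = "%x. integral {a..x} w"
  define k where "k = u ((a + b) / 2) - ?W ((a + b) / 2)"
  have "u x - ?W x = k" if "x \<in> {a<..<b}" for x
  proof -
    have inc: "u t - u s = ?W t - ?W s" if "a < s" "s < t" "t < b" for s t
      using weak_deriv_increment_interior[OF w u that] that
        Henstock_Kurzweil_Integration.integral_combine[of a s t w] integrable_subinterval_real[OF int_w, of a t] by simp
    show ?thesis
    proof (rule linorder_cases[of x "(a + b) / 2"])
      assume "x < (a + b) / 2"
      then show ?thesis using inc[of x "(a + b) / 2"] that unfolding k_def by simp
    next
      assume "x > (a + b) / 2"
      then show ?thesis using inc[of "(a + b) / 2" x] that unfolding k_def by simp
    qed (simp only: k_def)
  qed
  moreover have "continuous_on {a..b} (%x. u x - ?W x)"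
    by (intro continuous_intros u indefinite_integral_continuous_1 int_w)
  ultimately have "u x - ?W x = k" if "x \<in> {a..b}" for x
    using continuous_constant_on_closure[of "{a<..<b}" "%x. u x - ?W x" k x] that
    unfolding closure_greaterThanLessThan[OF ab] by blast
  from this[of s] this[of t] have "u t - u s = ?W t - ?W s" using st by auto
  also have "\<dots> = integral {s..t} w"
    using Henstock_Kurzweil_Integration.integral_combine[of a s t w] integrable_subinterval_real[OF int_w, of a t] st by simp
  finally show ?thesis .
next
  case False
  then have "s = t" using st by linarith
  then show ?thesis by simp
qed

section \<open>Curves in semi-inner-product spaces\<close>

text \<open>The two constituents of \<open>Ck_time\<close>, separated so that a curve and its
  successive derivatives can be mapped, shifted and subtracted one at a time.\<close>

definition continuous_curve ::
    "real \<Rightarrow> ('i \<Rightarrow> real) set \<Rightarrow> (('i \<Rightarrow> real) \<Rightarrow> real) \<Rightarrow> (real \<Rightarrow> 'i \<Rightarrow> real) \<Rightarrow> bool" where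
  "continuous_curve T X nrm u \<longleftrightarrow> (\<forall>t\<in>{0..T}. u t \<in> X \<and>
     ((%s. nrm (%i. u s i - u t i)) \<longlongrightarrow> 0) (at t within {0..T}))"

definition derivative_curve ::
    "real \<Rightarrow> (('i \<Rightarrow> real) \<Rightarrow> real) \<Rightarrow> (real \<Rightarrow> 'i \<Rightarrow> real) \<Rightarrow> (real \<Rightarrow> 'i \<Rightarrow> real) \<Rightarrow> bool" where
  "derivative_curve T nrm u u' \<longleftrightarrow> (\<forall>t\<in>{0..T}.
     ((%s. nrm (%i. (u s i - u t i) / (s - t) - u' t i)) \<longlongrightarrow> 0) (at t within {0..T}))"

lemma Ck_time_curves:
  assumes "Ck_time k T X nrm u"
  obtains U where "\<And>t. U 0 t = u t" "\<And>j. j \<le> k ==> continuous_curve T X nrm (U j)"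
    "\<And>j. j < k ==> derivative_curve T nrm (U j) (U (Suc j))"
proof -
  obtain V where V: "\<forall>t\<in>{0..T}. V 0 t = u t"
    "\<forall>j\<le>k. \<forall>t\<in>{0..T}. V j t \<in> X \<and> ((%s. nrm (%i. V j s i - V j t i)) \<longlongrightarrow> 0) (at t within {0..T})"
    "\<forall>j<k. \<forall>t\<in>{0..T}. ((%s. nrm (%i. (V j s i - V j t i) / (s - t) - V (Suc j) t i)) \<longlongrightarrow> 0)
          (at t within {0..T})"
    using assms unfolding Ck_time_def by blast
  \<comment> \<open>The witness is prescribed on \<open>{0..T}\<close> only. Replacing its zeroth
    member by \<open>u\<close> makes \<open>U 0 = u\<close> an identity of functions, usable for
    rewriting.\<close>
  define U where "U j = (if j = 0 then u else V j)" for j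
  have UV: "U j t = V j t" if "t \<in> {0..T}" for j t
    using V(1) that by (simp add: U_def)
  have "continuous_curve T X nrm (U j)" if "j \<le> k" for j
    unfolding continuous_curve_def
  proof
    fix t assume t: "t \<in> {0..T}"
    have "((%s. nrm (%i. V j s i - V j t i)) \<longlongrightarrow> 0) (at t within {0..T})"
      using V(2) that t by blast
    then have "((%s. nrm (%i. U j s i - U j t i)) \<longlongrightarrow> 0) (at t within {0..T})"
      by (rule Lim_transform_eventually) (use UV t in \<open>auto simp: eventually_at_topological intro!: exI[of _ UNIV]\<close>)
    then show "U j t \<in> X \<and> ((%s. nrm (%i. U j s i - U j t i)) \<longlongrightarrow> 0) (at t within {0..T})"
      using V(2) that t UV by auto
  qed
  moreover have "derivative_curve T nrm (U j) (U (Suc j))" if "j < k" for j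
    unfolding derivative_curve_def
  proof
    fix t assume t: "t \<in> {0..T}"
    have "((%s. nrm (%i. (V j s i - V j t i) / (s - t) - V (Suc j) t i)) \<longlongrightarrow> 0) (at t within {0..T})"
      using V(3) that t by blast
    then show "((%s. nrm (%i. (U j s i - U j t i) / (s - t) - U (Suc j) t i)) \<longlongrightarrow> 0) (at t within {0..T})"
      by (rule Lim_transform_eventually) (use UV t in \<open>auto simp: eventually_at_topological intro!: exI[of _ UNIV]\<close>)
  qed
  ultimately show ?thesis using that[of U] by (simp add: U_def)
qed

lemma Ck_time_continuous:
  assumes "Ck_time k T X nrm u"
  shows "continuous_curve T X nrm u"
proof -
  obtain U where U: "\<And>t. U 0 t = u t" "\<And>j. j \<le> k ==> continuous_curve T X nrm (U j)"
    by (rule Ck_time_curves[OF assms]) (rule that)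
  have "U 0 = u" by (rule ext) (rule U(1))
  then show ?thesis using U(2)[OF le0] by simp
qed

lemma tendsto_0_dominated:
  fixes f g :: "'a \<Rightarrow> real"
  assumes "(g \<longlongrightarrow> 0) F" "\<forall>\<^sub>F x in F. \<bar>f x\<bar> \<le> g x"
  shows "(f \<longlongrightarrow> 0) F"
  by (rule Lim_null_comparison[OF _ assms(1)]) (use assms(2) in simp)

lemma tendsto_0_dominated_within:
  fixes f g :: "real \<Rightarrow> real"
  assumes "(g \<longlongrightarrow> 0) (at t within S)" "\<And>s. s \<in> S ==> \<bar>f s\<bar> \<le> g s"
  shows "(f \<longlongrightarrow> 0) (at t within S)"
  by (rule tendsto_0_dominated[OF assms(1)]) (auto simp: eventually_at_topological assms(2))

lemma continuous_curve_map:
  assumes u: "continuous_curve T X nX u"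
    and L: "\<And>x. x \<in> X ==> L x \<in> Y"
    and lip: "\<And>x y. x \<in> X ==> y \<in> X ==> \<bar>nY (%i. L x i - L y i)\<bar> \<le> C * nX (%i. x i - y i)"
  shows "continuous_curve T Y nY (%t. L (u t))"
  unfolding continuous_curve_def
proof
  fix t assume t: "t \<in> {0..T}"
  have "((%s. C * nX (%i. u s i - u t i)) \<longlongrightarrow> C * 0) (at t within {0..T})"
    using u t by (intro tendsto_mult_left) (auto simp: continuous_curve_def)
  then have "((%s. C * nX (%i. u s i - u t i)) \<longlongrightarrow> 0) (at t within {0..T})" by simp
  then have "((%s. nY (%i. L (u s) i - L (u t) i)) \<longlongrightarrow> 0) (at t within {0..T})"
    by (rule tendsto_0_dominated_within) (use u t lip in \<open>simp add: continuous_curve_def\<close>)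
  then show "L (u t) \<in> Y \<and> ((%s. nY (%i. L (u s) i - L (u t) i)) \<longlongrightarrow> 0) (at t within {0..T})"
    using u t L by (auto simp: continuous_curve_def)
qed

lemma continuous_curve_shift:
  assumes "continuous_curve T X nX u" "0 \<le> h"
  shows "continuous_curve (T - h) X nX (%t. u (t + h))"
  unfolding continuous_curve_def
proof
  fix t assume t: "t \<in> {0..T - h}"
  have "((%s. nX (%i. u s i - u (t + h) i)) \<longlongrightarrow> 0) (at (t + h) within {0..T})"
    using assms t by (auto simp: continuous_curve_def)
  moreover have "filterlim (%s. s + h) (at (t + h) within {0..T}) (at t within {0..T - h})"
    unfolding filterlim_at using assms(2)
    by (auto intro!: tendsto_eq_intros simp: eventually_at_filter)
  ultimately show "u (t + h) \<in> X \<and> ((%s. nX (%i. u (s + h) i - u (t + h) i)) \<longlongrightarrow> 0) (at t within {0..T - h})"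
    using assms t by (auto simp: continuous_curve_def intro: filterlim_compose)
qed

lemma continuous_curve_mono:
  assumes "continuous_curve T X nX u" "T' \<le> T"
  shows "continuous_curve T' X nX u"
  using assms unfolding continuous_curve_def
  by (meson atLeastatMost_subset_iff order_refl subsetD tendsto_within_subset)

text \<open>Elements are functions rather than equivalence classes, so the form is only
  semidefinite. One development serves \<open>L2\<close>, \<open>H1\<close> and the
  coefficient-weighted products of \<open>semi_inner_weighted\<close>.\<close>

locale semi_inner =
  fixes X :: "('i \<Rightarrow> real) set" and ip :: "('i \<Rightarrow> real) \<Rightarrow> ('i \<Rightarrow> real) \<Rightarrow> real"
  assumes zero_mem: "(%i. 0) \<in> X"
    and comb_mem: "\<And>u v \<alpha> \<beta>. u \<in> X ==> v \<in> X ==> (%i. \<alpha> * u i + \<beta> * v i) \<in> X"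
    and ip_comb_left: "\<And>u v w \<alpha> \<beta>. u \<in> X ==> v \<in> X ==> w \<in> X ==>
      ip (%i. \<alpha> * u i + \<beta> * v i) w = \<alpha> * ip u w + \<beta> * ip v w"
    and ip_sym: "\<And>u v. u \<in> X ==> v \<in> X ==> ip u v = ip v u"
    and ip_nonneg: "\<And>u. u \<in> X ==> 0 \<le> ip u u"
begin

definition nrm :: "('i \<Rightarrow> real) \<Rightarrow> real" where
  "nrm u = sqrt (ip u u)"

lemma add_mem: "u \<in> X ==> v \<in> X ==> (%i. u i + v i) \<in> X"
  using comb_mem[of u v 1 1] by simp

lemma diff_mem: "u \<in> X ==> v \<in> X ==> (%i. u i - v i) \<in> X"
  using comb_mem[of u v 1 "-1"] by simp

lemma scale_mem: "u \<in> X ==> (%i. \<alpha> * u i) \<in> X"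
  using comb_mem[of u u \<alpha> 0] by simp

lemma sum_mem: "(\<And>k. k \<in> K ==> u k \<in> X) ==> (%i. \<Sum>k\<in>K. c k * u k i) \<in> X"
proof (induction K rule: infinite_finite_induct)
  case (insert k K)
  then have "(%i. c k * u k i + 1 * (\<Sum>k\<in>K. c k * u k i)) \<in> X"
    by (intro comb_mem) auto
  then show ?case using insert by simp
qed (simp_all add: zero_mem)

lemma ip_add_left: "u \<in> X ==> v \<in> X ==> w \<in> X ==> ip (%i. u i + v i) w = ip u w + ip v w"
  using ip_comb_left[of u v w 1 1] by simp

lemma ip_diff_left: "u \<in> X ==> v \<in> X ==> w \<in> X ==> ip (%i. u i - v i) w = ip u w - ip v w"
  using ip_comb_left[of u v w 1 "-1"] by simp

lemma ip_scale_left: "u \<in> X ==> w \<in> X ==> ip (%i. \<alpha> * u i) w = \<alpha> * ip u w"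
  using ip_comb_left[of u u w \<alpha> 0] by simp

lemma ip_zero_left: "w \<in> X ==> ip (%i. 0) w = 0"
  using ip_scale_left[of w w 0] by simp

lemma ip_add_right: "u \<in> X ==> v \<in> X ==> w \<in> X ==> ip w (%i. u i + v i) = ip w u + ip w v"
  using ip_add_left[of u v w] ip_sym[of w u] ip_sym[of w v] ip_sym[OF _ add_mem, of w u v] by simp

lemma ip_diff_right: "u \<in> X ==> v \<in> X ==> w \<in> X ==> ip w (%i. u i - v i) = ip w u - ip w v"
  using ip_diff_left[of u v w] ip_sym[of w u] ip_sym[of w v] ip_sym[OF _ diff_mem, of w u v] by simp

lemma ip_scale_right: "u \<in> X ==> w \<in> X ==> ip w (%i. \<alpha> * u i) = \<alpha> * ip w u"
  using ip_scale_left[of u w \<alpha>] ip_sym[of w u] ip_sym[OF _ scale_mem, of w u \<alpha>] by simp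

lemma ip_sum_left:
  "(\<And>k. k \<in> K ==> u k \<in> X) ==> w \<in> X ==> ip (%i. \<Sum>k\<in>K. c k * u k i) w = (\<Sum>k\<in>K. c k * ip (u k) w)"
proof (induction K rule: infinite_finite_induct)
  case (insert k K)
  then have "ip (%i. c k * u k i + 1 * (\<Sum>k\<in>K. c k * u k i)) w
      = c k * ip (u k) w + 1 * ip (%i. \<Sum>k\<in>K. c k * u k i) w"
    by (intro ip_comb_left sum_mem) auto
  then show ?case using insert by simp
qed (simp_all add: ip_zero_left)

lemma ip_sum_right:
  "(\<And>k. k \<in> K ==> u k \<in> X) ==> w \<in> X ==> ip w (%i. \<Sum>k\<in>K. c k * u k i) = (\<Sum>k\<in>K. c k * ip w (u k))"
  using ip_sum_left[of K u w c] ip_sym[OF _ sum_mem, of w K u c] by (simp add: ip_sym[of w] cong: sum.cong)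

lemma nrm_nonneg: "u \<in> X ==> 0 \<le> nrm u"
  by (simp add: nrm_def ip_nonneg)

lemma nrm_power2: "u \<in> X ==> (nrm u)^2 = ip u u"
  by (simp add: nrm_def ip_nonneg)

lemma nrm_zero: "nrm (%i. 0) = 0"
  by (simp add: nrm_def ip_zero_left zero_mem)

lemma ip_diff_self:
  "u \<in> X ==> v \<in> X ==> ip (%i. u i - v i) (%i. u i - v i) = ip u u - 2 * ip u v + ip v v"
  by (simp add: ip_diff_left ip_diff_right diff_mem ip_sym)

lemma cauchy_schwarz:
  assumes "u \<in> X" "v \<in> X"
  shows "\<bar>ip u v\<bar> \<le> nrm u * nrm v"
proof -
  have q: "0 \<le> ip u u + 2 * x * ip u v + x^2 * ip v v" for x
  proof -
    have "0 \<le> ip (%i. 1 * u i + x * v i) (%i. 1 * u i + x * v i)"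
      using assms by (intro ip_nonneg comb_mem)
    also have "\<dots> = ip u (%i. 1 * u i + x * v i) + x * ip v (%i. 1 * u i + x * v i)"
      using ip_comb_left[OF assms comb_mem[OF assms, of 1 x], of 1 x] by simp
    also have "\<dots> = ip (%i. 1 * u i + x * v i) u + x * ip (%i. 1 * u i + x * v i) v"
      using assms by (simp only: ip_sym comb_mem)
    also have "\<dots> = ip u u + 2 * x * ip u v + x^2 * ip v v"
      using assms by (simp only: ip_comb_left ip_sym[of v u]) (simp add: power2_eq_square algebra_simps)
    finally show ?thesis .
  qed
  have "(ip u v)^2 \<le> ip u u * ip v v"
  proof (cases "ip v v = 0")
    case True
    \<comment> \<open>In the degenerate case the quadratic in \<open>q\<close> is affine in
      \<open>x\<close>; being bounded below, it must have slope zero.\<close>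
    have "ip u v = 0"
    proof (rule ccontr)
      assume "ip u v \<noteq> 0"
      then show False
        using q[of "- (ip u u + 1) / (2 * ip u v)"] True by (simp add: field_simps)
    qed
    then show ?thesis using True by simp
  next
    case False
    then have "0 < ip v v" using ip_nonneg[OF assms(2)] by linarith
    then show ?thesis
      using q[of "- ip u v / ip v v"] by (simp add: field_simps power2_eq_square)
  qed
  then have "sqrt ((ip u v)^2) \<le> sqrt (ip u u * ip v v)"
    by (rule real_sqrt_le_mono)
  then show ?thesis by (simp add: nrm_def real_sqrt_mult)
qed

lemma nrm_scale: "u \<in> X ==> nrm (%i. \<alpha> * u i) = \<bar>\<alpha>\<bar> * nrm u"
  by (simp add: nrm_def ip_scale_left ip_scale_right scale_mem real_sqrt_mult flip: mult.assoc)

lemma nrm_triangle: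
  assumes "u \<in> X" "v \<in> X"
  shows "nrm (%i. u i + v i) \<le> nrm u + nrm v"
proof -
  have "(nrm (%i. u i + v i))^2 = ip u u + 2 * ip u v + ip v v"
    using assms by (simp add: nrm_power2 add_mem ip_add_left ip_add_right ip_sym)
  also have "\<dots> \<le> (nrm u + nrm v)^2"
    using cauchy_schwarz[OF assms] nrm_power2 assms by (simp add: power2_sum)
  finally show ?thesis
    using nrm_nonneg assms by (meson add_nonneg_nonneg power2_le_imp_le)
qed

lemma nrm_minus: "u \<in> X ==> nrm (%i. - u i) = nrm u"
  using nrm_scale[of u "-1"] by simp

lemma nrm_diff_commute: "u \<in> X ==> v \<in> X ==> nrm (%i. u i - v i) = nrm (%i. v i - u i)"
  using nrm_minus[OF diff_mem[of v u]] by simp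

lemma nrm_triangle_diff:
  assumes "u \<in> X" "v \<in> X" "w \<in> X"
  shows "nrm (%i. u i - w i) \<le> nrm (%i. u i - v i) + nrm (%i. v i - w i)"
  using nrm_triangle[OF diff_mem[OF assms(1,2)] diff_mem[OF assms(2,3)]] by simp

lemma nrm_diff_le:
  assumes "u \<in> X" "v \<in> X"
  shows "nrm (%i. u i - v i) \<le> nrm u + nrm v"
  using nrm_triangle_diff[OF assms(1) zero_mem assms(2)] assms by (simp add: nrm_minus)

lemma nrm_diff_ge:
  assumes "u \<in> X" "v \<in> X"
  shows "\<bar>nrm u - nrm v\<bar> \<le> nrm (%i. u i - v i)"
  using nrm_triangle[OF diff_mem[OF assms] assms(2)] nrm_triangle[OF diff_mem[OF assms(2,1)] assms(1)]
    nrm_diff_commute[OF assms] by simp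

lemma nrm_sum_le:
  "finite K ==> (\<And>k. k \<in> K ==> u k \<in> X) ==> nrm (%i. \<Sum>k\<in>K. c k * u k i) \<le> (\<Sum>k\<in>K. \<bar>c k\<bar> * nrm (u k))"
proof (induction K rule: finite_induct)
  case (insert k K)
  then have "nrm (%i. c k * u k i + (\<Sum>k\<in>K. c k * u k i)) \<le> nrm (%i. c k * u k i) + nrm (%i. \<Sum>k\<in>K. c k * u k i)"
    by (intro nrm_triangle sum_mem scale_mem) auto
  then show ?case using insert by (simp add: nrm_scale)
qed (simp add: nrm_zero)

lemma young:
  assumes "u \<in> X" "v \<in> X" "0 < \<alpha>"
  shows "2 * \<bar>ip u v\<bar> \<le> \<alpha> * ip u u + ip v v / \<alpha>"
proof -
  have "0 \<le> (\<alpha> * nrm u - nrm v)^2" by simp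
  then have "2 * (nrm u * nrm v) \<le> \<alpha> * (nrm u)^2 + (nrm v)^2 / \<alpha>"
    using assms(3) by (simp add: field_simps power2_eq_square)
  then show ?thesis
    using cauchy_schwarz[OF assms(1,2)] nrm_power2 assms by simp
qed

section \<open>Continuous curves with values in the space\<close>

abbreviation "cont_curve T \<equiv> continuous_curve T X nrm"

lemma cont_curve_mem: "cont_curve T u ==> t \<in> {0..T} ==> u t \<in> X"
  by (auto simp: continuous_curve_def)

lemma cont_curve_const: "x \<in> X ==> cont_curve T (%t. x)"
  by (simp add: continuous_curve_def nrm_zero)

lemma cont_curve_scaled:
  assumes u: "cont_curve T u" and f: "continuous_on {0..T} f"
  shows "cont_curve T (%t i. f t * u t i)"
  unfolding continuous_curve_def
proof
  fix t assume t: "t \<in> {0..T}"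
  have f_lim: "(f \<longlongrightarrow> f t) (at t within {0..T})" using f t by (auto simp: continuous_on)
  have u_lim: "((%s. nrm (%i. u s i - u t i)) \<longlongrightarrow> 0) (at t within {0..T})"
    using u t by (auto simp: continuous_curve_def)
  have "((%s. \<bar>f s\<bar> * nrm (%i. u s i - u t i) + \<bar>f s - f t\<bar> * nrm (u t)) \<longlongrightarrow> \<bar>f t\<bar> * 0 + \<bar>f t - f t\<bar> * nrm (u t)) (at t within {0..T})"
    by (intro tendsto_intros f_lim u_lim)
  then have lim: "((%s. \<bar>f s\<bar> * nrm (%i. u s i - u t i) + \<bar>f s - f t\<bar> * nrm (u t)) \<longlongrightarrow> 0) (at t within {0..T})"
    by simp
  have "\<bar>nrm (%i. f s * u s i - f t * u t i)\<bar> \<le> \<bar>f s\<bar> * nrm (%i. u s i - u t i) + \<bar>f s - f t\<bar> * nrm (u t)"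
    if "s \<in> {0..T}" for s
  proof -
    have m: "u s \<in> X" "u t \<in> X" using cont_curve_mem u t that by auto
    have "(%i. f s * u s i - f t * u t i) = (%i. f s * (u s i - u t i) + (f s - f t) * u t i)"
      by (simp add: algebra_simps)
    then show ?thesis
      using nrm_triangle[of "%i. f s * (u s i - u t i)" "%i. (f s - f t) * u t i"] m
      by (simp add: nrm_scale diff_mem scale_mem add_mem nrm_nonneg)
  qed
  from tendsto_0_dominated_within[OF lim this]
  have "((%s. nrm (%i. f s * u s i - f t * u t i)) \<longlongrightarrow> 0) (at t within {0..T})" .
  then show "(%i. f t * u t i) \<in> X \<and> ((%s. nrm (%i. f s * u s i - f t * u t i)) \<longlongrightarrow> 0) (at t within {0..T})"
    using scale_mem cont_curve_mem u t by auto
qed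

lemma cont_curve_add:
  assumes u: "cont_curve T u" and v: "cont_curve T v"
  shows "cont_curve T (%t i. u t i + v t i)"
  unfolding continuous_curve_def
proof
  fix t assume t: "t \<in> {0..T}"
  have "((%s. nrm (%i. u s i - u t i) + nrm (%i. v s i - v t i)) \<longlongrightarrow> 0 + 0) (at t within {0..T})"
    using u v t by (intro tendsto_add) (auto simp: continuous_curve_def)
  then have lim: "((%s. nrm (%i. u s i - u t i) + nrm (%i. v s i - v t i)) \<longlongrightarrow> 0) (at t within {0..T})"
    by simp
  have "\<bar>nrm (%i. u s i + v s i - (u t i + v t i))\<bar> \<le> nrm (%i. u s i - u t i) + nrm (%i. v s i - v t i)"
    if "s \<in> {0..T}" for s
  proof -
    have m: "u s \<in> X" "u t \<in> X" "v s \<in> X" "v t \<in> X"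
      using cont_curve_mem[OF u] cont_curve_mem[OF v] that t by auto
    have "(%i. u s i + v s i - (u t i + v t i)) = (%i. (u s i - u t i) + (v s i - v t i))"
      by (simp add: algebra_simps)
    then show ?thesis
      using nrm_triangle[of "%i. u s i - u t i" "%i. v s i - v t i"] m
      by (simp add: diff_mem add_mem nrm_nonneg)
  qed
  from tendsto_0_dominated_within[OF lim this]
  have "((%s. nrm (%i. u s i + v s i - (u t i + v t i))) \<longlongrightarrow> 0) (at t within {0..T})" .
  then show "(%i. u t i + v t i) \<in> X \<and> ((%s. nrm (%i. u s i + v s i - (u t i + v t i))) \<longlongrightarrow> 0) (at t within {0..T})"
    using add_mem cont_curve_mem[OF u] cont_curve_mem[OF v] t by auto
qed

lemma cont_curve_scale: "cont_curve T u ==> cont_curve T (%t i. \<alpha> * u t i)"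
  by (rule cont_curve_scaled) auto

lemma cont_curve_diff: "cont_curve T u ==> cont_curve T v ==> cont_curve T (%t i. u t i - v t i)"
  using cont_curve_add[of T u "%t i. (- 1) * v t i"] cont_curve_scale[of T v "-1"] by simp

lemma continuous_on_ip_curves:
  assumes u: "cont_curve T u" and v: "cont_curve T v"
  shows "continuous_on {0..T} (%t. ip (u t) (v t))"
  unfolding continuous_on_def
proof
  fix t assume t: "t \<in> {0..T}"
  let ?du = "%s. nrm (%i. u s i - u t i)" and ?dv = "%s. nrm (%i. v s i - v t i)"
  have lim: "(?du \<longlongrightarrow> 0) (at t within {0..T})" "(?dv \<longlongrightarrow> 0) (at t within {0..T})"
    using u v t by (auto simp: continuous_curve_def)
  have "((%s. ?du s * ?dv s + ?du s * nrm (v t) + nrm (u t) * ?dv s) \<longlongrightarrow> 0 * 0 + 0 * nrm (v t) + nrm (u t) * 0) (at t within {0..T})"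
    by (intro tendsto_intros lim)
  then have lim: "((%s. ?du s * ?dv s + ?du s * nrm (v t) + nrm (u t) * ?dv s) \<longlongrightarrow> 0) (at t within {0..T})"
    by simp
  have "\<bar>ip (u s) (v s) - ip (u t) (v t)\<bar> \<le> ?du s * ?dv s + ?du s * nrm (v t) + nrm (u t) * ?dv s"
    if s: "s \<in> {0..T}" for s
  proof -
    note m = cont_curve_mem[OF u] cont_curve_mem[OF v]
    have "ip (u s) (v s) - ip (u t) (v t) = ip (%i. u s i - u t i) (%i. v s i - v t i)
        + ip (%i. u s i - u t i) (v t) + ip (u t) (%i. v s i - v t i)"
      using m s t by (simp add: ip_diff_left ip_diff_right diff_mem)
    moreover have "\<bar>ip (%i. u s i - u t i) (%i. v s i - v t i)\<bar> \<le> ?du s * ?dv s"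
        "\<bar>ip (%i. u s i - u t i) (v t)\<bar> \<le> ?du s * nrm (v t)"
        "\<bar>ip (u t) (%i. v s i - v t i)\<bar> \<le> nrm (u t) * ?dv s"
      using m s t by (auto intro!: cauchy_schwarz diff_mem)
    ultimately show ?thesis by linarith
  qed
  from tendsto_0_dominated_within[OF lim this]
  have "((%s. ip (u s) (v s) - ip (u t) (v t)) \<longlongrightarrow> 0) (at t within {0..T})" .
  then show "((%s. ip (u s) (v s)) \<longlongrightarrow> ip (u t) (v t)) (at t within {0..T})"
    by (rule LIM_zero_cancel)
qed

lemma continuous_on_nrm_curve: "cont_curve T u ==> continuous_on {0..T} (%t. nrm (u t))"
  using continuous_on_real_sqrt[OF continuous_on_ip_curves[of T u u]] by (simp add: nrm_def)

lemma continuous_on_ip_curve: "cont_curve T u ==> w \<in> X ==> continuous_on {0..T} (%t. ip (u t) w)"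
  by (intro continuous_on_ip_curves cont_curve_const)

lemma cont_curve_bounded:
  assumes "cont_curve T u"
  obtains K where "0 \<le> K" "\<And>t. t \<in> {0..T} ==> nrm (u t) \<le> K"
proof -
  have "compact ((%t. nrm (u t)) ` {0..T})"
    by (intro compact_continuous_image continuous_on_nrm_curve assms) auto
  then obtain K where "0 < K" "\<forall>x\<in>(%t. nrm (u t)) ` {0..T}. norm x \<le> K"
    using compact_imp_bounded bounded_pos by metis
  then show ?thesis by (intro that[of K]) (auto simp: abs_le_iff)
qed

text \<open>The curve lives in a set with a seminorm and not in a metric type. Compactness is
  therefore applied to the real function \<open>\<phi>\<close> of two times, which vanishes on the
  diagonal.\<close>

lemma cont_curve_uniform:
  assumes u: "cont_curve T u" and e: "0 < e"
  obtains d where "0 < d" "\<And>s t. s \<in> {0..T} ==> t \<in> {0..T} ==> \<bar>s - t\<bar> < d ==> nrm (%i. u s i - u t i) < e"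
proof -
  define \<phi> where "\<phi> = (%(s, t). nrm (%i. u s i - u t i))"
  note m = cont_curve_mem[OF u]
  have "continuous_on ({0..T} \<times> {0..T}) \<phi>"
    unfolding continuous_on_def
  proof clarify
    fix s t assume st: "s \<in> {0..T}" "t \<in> {0..T}"
    let ?F = "at (s, t) within {0..T} \<times> {0..T}"
    have c: "continuous_on {0..T} (%r. nrm (%i. u r i - u t i))" if "t \<in> {0..T}" for t
      using that by (intro continuous_on_nrm_curve cont_curve_diff u cont_curve_const m)
    have 1: "((%x. nrm (%i. u (fst x) i - u s i)) \<longlongrightarrow> nrm (%i. u s i - u s i)) ?F"
    proof -
      have "continuous_on ({0..T} \<times> {0..T}) (%x. nrm (%i. u (fst x) i - u s i))"
        by (rule continuous_on_compose2[OF c[OF st(1)]]) (auto intro: continuous_intros)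
      from this[unfolded continuous_on_def, rule_format, of "(s, t)"] show ?thesis using st by simp
    qed
    have 2: "((%x. nrm (%i. u (snd x) i - u t i)) \<longlongrightarrow> nrm (%i. u t i - u t i)) ?F"
    proof -
      have "continuous_on ({0..T} \<times> {0..T}) (%x. nrm (%i. u (snd x) i - u t i))"
        by (rule continuous_on_compose2[OF c[OF st(2)]]) (auto intro: continuous_intros)
      from this[unfolded continuous_on_def, rule_format, of "(s, t)"] show ?thesis using st by simp
    qed
    have "\<bar>\<phi> x - \<phi> (s, t)\<bar> \<le> nrm (%i. u (fst x) i - u s i) + nrm (%i. u (snd x) i - u t i)"
      if x_mem: "x \<in> {0..T} \<times> {0..T}" for x
    proof -
      obtain s' t' where x: "x = (s', t')" and st': "s' \<in> {0..T}" "t' \<in> {0..T}"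
        using x_mem by auto
      have "\<bar>nrm (%i. u s' i - u t' i) - nrm (%i. u s i - u t i)\<bar> \<le> nrm (%i. (u s' i - u t' i) - (u s i - u t i))"
        using st st' m by (intro nrm_diff_ge diff_mem)
      also have "\<dots> = nrm (%i. (u s' i - u s i) - (u t' i - u t i))"
        by (simp add: algebra_simps)
      also have "\<dots> \<le> nrm (%i. u s' i - u s i) + nrm (%i. u t' i - u t i)"
        using st st' m by (intro nrm_diff_le diff_mem)
      finally show ?thesis by (simp add: \<phi>_def x)
    qed
    then have ev: "\<forall>\<^sub>F x in ?F. \<bar>\<phi> x - \<phi> (s, t)\<bar> \<le> nrm (%i. u (fst x) i - u s i) + nrm (%i. u (snd x) i - u t i)"
      unfolding eventually_at_topological by blast
    have "((%x. \<phi> x - \<phi> (s, t)) \<longlongrightarrow> 0) ?F"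
      by (rule tendsto_0_dominated[OF _ ev]) (use tendsto_add[OF 1 2] in \<open>simp add: nrm_zero\<close>)
    then show "(\<phi> \<longlongrightarrow> \<phi> (s, t)) ?F" by (rule LIM_zero_cancel)
  qed
  then have "uniformly_continuous_on ({0..T} \<times> {0..T}) \<phi>"
    by (intro compact_uniformly_continuous compact_Times) auto
  then obtain d where d: "0 < d"
      "\<And>x y. x \<in> {0..T} \<times> {0..T} ==> y \<in> {0..T} \<times> {0..T} ==> dist y x < d ==> dist (\<phi> y) (\<phi> x) < e"
    unfolding uniformly_continuous_on_def using e by metis
  show ?thesis
  proof (rule that[OF d(1)])
    fix s t assume "s \<in> {0..T}" "t \<in> {0..T}" "\<bar>s - t\<bar> < d"
    then have "dist (\<phi> (s, t)) (\<phi> (t, t)) < e"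
      by (intro d(2)) (auto simp: dist_prod_def dist_real_def)
    then show "nrm (%i. u s i - u t i) < e"
      by (simp add: \<phi>_def nrm_zero dist_real_def)
  qed
qed

section \<open>Differentiable and weakly measurable curves\<close>

lemma has_real_derivative_ip_curve:
  assumes u: "cont_curve T u" and u': "cont_curve T u'" and d: "derivative_curve T nrm u u'"
    and w: "w \<in> X" and t: "t \<in> {0..T}"
  shows "((%s. ip (u s) w) has_real_derivative ip (u' t) w) (at t within {0..T})"
proof -
  note m = cont_curve_mem[OF u] cont_curve_mem[OF u']
  let ?g = "%s. nrm (%i. (u s i - u t i) / (s - t) - u' t i)"
  have "((%s. ?g s * nrm w) \<longlongrightarrow> 0 * nrm w) (at t within {0..T})"
    using d t by (intro tendsto_intros) (auto simp: derivative_curve_def)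
  then have lim: "((%s. ?g s * nrm w) \<longlongrightarrow> 0) (at t within {0..T})" by simp
  have "\<bar>(ip (u s) w - ip (u t) w) / (s - t) - ip (u' t) w\<bar> \<le> ?g s * nrm w" if s: "s \<in> {0..T}" for s
  proof -
    have "(%i. (u s i - u t i) / (s - t) - u' t i) = (%i. (1 / (s - t)) * (u s i - u t i) - u' t i)" by simp
    moreover have "ip (%i. (1 / (s - t)) * (u s i - u t i) - u' t i) w = (1 / (s - t)) * (ip (u s) w - ip (u t) w) - ip (u' t) w"
      using ip_diff_left[OF scale_mem[OF diff_mem] _ w, of "u s" "u t" "u' t" "1 / (s - t)"]
        ip_scale_left[OF diff_mem w, of "u s" "u t" "1 / (s - t)"] ip_diff_left[OF _ _ w, of "u s" "u t"] m s t
      by simp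
    moreover have "\<bar>ip (%i. (1 / (s - t)) * (u s i - u t i) - u' t i) w\<bar>
        \<le> nrm (%i. (1 / (s - t)) * (u s i - u t i) - u' t i) * nrm w"
      using m s t w by (intro cauchy_schwarz diff_mem scale_mem)
    ultimately show ?thesis by simp
  qed
  from tendsto_0_dominated_within[OF lim this]
  have "((%s. (ip (u s) w - ip (u t) w) / (s - t) - ip (u' t) w) \<longlongrightarrow> 0) (at t within {0..T})" .
  then show ?thesis
    unfolding has_field_derivative_iff by (rule LIM_zero_cancel)
qed

text \<open>The scalar Taylor formula is applied to the inner product with the remainder itself.\<close>

lemma curve_taylor:
  assumes U: "\<And>j. j \<le> Suc n ==> cont_curve T (U j)"
    and U': "\<And>j. j \<le> n ==> derivative_curve T nrm (U j) (U (Suc j))"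
    and K: "\<And>t. t \<in> {0..T} ==> nrm (U (Suc n) t) \<le> K"
    and s: "s \<in> {0..T}" and t: "t \<in> {0..T}"
  shows "nrm (%i. U 0 s i - (\<Sum>l\<le>n. (s - t) ^ l / fact l * U l t i)) \<le> K * \<bar>s - t\<bar> ^ Suc n"
proof -
  define R where "R = (%i. U 0 s i - (\<Sum>l\<le>n. (s - t) ^ l / fact l * U l t i))"
  have Um: "U l r \<in> X" if "l \<le> Suc n" "r \<in> {0..T}" for l r
    by (rule cont_curve_mem[OF U]) (use that in auto)
  have R: "R \<in> X"
    unfolding R_def using s t by (intro diff_mem sum_mem) (auto intro!: Um)
  have K0: "0 \<le> K"
    using K[OF t] nrm_nonneg[OF cont_curve_mem[OF U t, of "Suc n"]] by simp
  have "norm (ip (U 0 s) R - (\<Sum>l\<le>n. ip (U l t) R * (s - t) ^ l / fact l))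
      \<le> (K * nrm R) * norm (s - t) ^ Suc n / fact n"
  proof (rule field_Taylor[where S = "{0..T}" and f = "%l r. ip (U l r) R"])
    show "((%r. ip (U i r) R) has_field_derivative ip (U (Suc i) x) R) (at x within {0..T})"
      if "x \<in> {0..T}" "i \<le> n" for i x
      using that by (intro has_real_derivative_ip_curve U U' R) auto
    show "norm (ip (U (Suc n) x) R) \<le> K * nrm R" if "x \<in> {0..T}" for x
      unfolding real_norm_def
      using cauchy_schwarz[OF cont_curve_mem[OF U that] R] K[OF that] nrm_nonneg[OF R]
      by (meson le_refl mult_right_mono order_trans)
  qed (use s t in auto)
  also have "\<dots> \<le> (K * nrm R) * norm (s - t) ^ Suc n"
  proof -
    have "(K * nrm R) * norm (s - t) ^ Suc n / fact n \<le> (K * nrm R) * norm (s - t) ^ Suc n / 1"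
      using K0 nrm_nonneg[OF R] fact_ge_1[of n] by (intro divide_left_mono mult_nonneg_nonneg) auto
    then show ?thesis by simp
  qed
  also have "ip (U 0 s) R - (\<Sum>l\<le>n. ip (U l t) R * (s - t) ^ l / fact l) = ip R R"
  proof -
    have "ip (%i. \<Sum>l\<le>n. (s - t) ^ l / fact l * U l t i) R = (\<Sum>l\<le>n. (s - t) ^ l / fact l * ip (U l t) R)"
      using R t by (intro ip_sum_left) (auto intro!: Um)
    moreover have "ip R R = ip (U 0 s) R - ip (%i. \<Sum>l\<le>n. (s - t) ^ l / fact l * U l t i) R"
      unfolding R_def using R[unfolded R_def] s t
      by (intro ip_diff_left sum_mem) (auto intro!: Um)
    ultimately show ?thesis by (simp add: mult.commute)
  qed
  finally have "nrm R * nrm R \<le> nrm R * (K * \<bar>s - t\<bar> ^ Suc n)"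
    using nrm_power2[OF R] by (simp add: power2_eq_square algebra_simps)
  then have "nrm R \<le> K * \<bar>s - t\<bar> ^ Suc n"
    using nrm_nonneg[OF R] K0 by (cases "nrm R = 0") auto
  then show ?thesis by (simp add: R_def)
qed

text \<open>The curve \<open>x\<close> is measurable only when paired with fixed elements. Freezing
  \<open>v\<close> on a grid of mesh \<open>1 / Suc n\<close> leaves countably many fixed elements,
  and continuity of \<open>v\<close> gives the pointwise limit.\<close>

lemma measurable_ip_curve:
  assumes x: "\<And>t. t \<in> {0..T} ==> x t \<in> X"
    and meas: "\<And>w. w \<in> X ==> (%t. ip (x t) w) \<in> borel_measurable (lebesgue_on {0..T})"
    and v: "cont_curve T v"
  shows "(%t. ip (x t) (v t)) \<in> borel_measurable (lebesgue_on {0..T})"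
proof (cases "0 \<le> T")
  case T: True
  \<comment> \<open>The default \<open>0\<close> keeps every grid point in \<open>{0..T}\<close>,
    where \<open>v\<close> has values in the space; it does not occur for the grid cell containing a
    time of the interval.\<close>
  define \<gamma> where "\<gamma> n k = (if real_of_int k / real (Suc n) \<in> {0..T} then real_of_int k / real (Suc n) else 0)" for n k
  have \<gamma>: "\<gamma> n k \<in> {0..T}" for n k using T by (auto simp: \<gamma>_def)
  show ?thesis
  proof (rule borel_measurable_LIMSEQ_real)
    show "(%t. ip (x t) (v (\<gamma> n \<lfloor>t * real (Suc n)\<rfloor>))) \<in> borel_measurable (lebesgue_on {0..T})" for n
    proof (rule measurable_compose_countable[where f = "%k t. ip (x t) (v (\<gamma> n k))"])
      show "(%t. ip (x t) (v (\<gamma> n k))) \<in> borel_measurable (lebesgue_on {0..T})" for k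
        by (intro meas cont_curve_mem[OF v] \<gamma>)
      have "(%t. \<lfloor>t * real (Suc n)\<rfloor>) \<in> measurable borel (count_space UNIV)" by measurable
      then show "(%t. \<lfloor>t * real (Suc n)\<rfloor>) \<in> measurable (lebesgue_on {0..T}) (count_space UNIV)"
        by (intro measurable_restrict_space1 measurable_completion) simp
    qed
    fix t assume "t \<in> space (lebesgue_on {0..T})"
    then have t: "t \<in> {0..T}" by simp
    have \<gamma>t: "\<gamma> n \<lfloor>t * real (Suc n)\<rfloor> \<in> {0..T}" "\<bar>\<gamma> n \<lfloor>t * real (Suc n)\<rfloor> - t\<bar> \<le> 1 / real (Suc n)" for n
    proof -
      have *: "real_of_int \<lfloor>t * real (Suc n)\<rfloor> / real (Suc n) \<le> t"
        "t - 1 / real (Suc n) \<le> real_of_int \<lfloor>t * real (Suc n)\<rfloor> / real (Suc n)"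
        "0 \<le> real_of_int \<lfloor>t * real (Suc n)\<rfloor> / real (Suc n)"
      proof -
        define N where "N = real (Suc n)"
        have N: "0 < N" by (simp add: N_def)
        show "real_of_int \<lfloor>t * real (Suc n)\<rfloor> / real (Suc n) \<le> t"
          unfolding N_def[symmetric] using N by (simp add: pos_divide_le_eq)
        have "t * N - 1 \<le> real_of_int \<lfloor>t * N\<rfloor>" by linarith
        then have "(t * N - 1) / N \<le> real_of_int \<lfloor>t * N\<rfloor> / N"
          using N by (simp add: divide_right_mono)
        then show "t - 1 / real (Suc n) \<le> real_of_int \<lfloor>t * real (Suc n)\<rfloor> / real (Suc n)"
          unfolding N_def[symmetric] using N by (simp add: diff_divide_distrib)
        show "0 \<le> real_of_int \<lfloor>t * real (Suc n)\<rfloor> / real (Suc n)"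
          unfolding N_def[symmetric] using N t by simp
      qed
      then have "\<gamma> n \<lfloor>t * real (Suc n)\<rfloor> = real_of_int \<lfloor>t * real (Suc n)\<rfloor> / real (Suc n)"
        using t by (simp add: \<gamma>_def del: of_nat_Suc)
      then show "\<bar>\<gamma> n \<lfloor>t * real (Suc n)\<rfloor> - t\<bar> \<le> 1 / real (Suc n)" using * by linarith
    qed (rule \<gamma>)
    have "(%n. \<gamma> n \<lfloor>t * real (Suc n)\<rfloor>) \<longlonglongrightarrow> t"
    proof (rule LIM_zero_cancel, rule tendsto_0_dominated)
      show "(%n. 1 / real (Suc n)) \<longlonglongrightarrow> 0" using LIMSEQ_inverse_real_of_nat by (simp add: divide_inverse)
    qed (use \<gamma>t in simp)
    then have "(%n. ip (v (\<gamma> n \<lfloor>t * real (Suc n)\<rfloor>)) (x t)) \<longlonglongrightarrow> ip (v t) (x t)"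
      using continuous_on_ip_curve[OF v x[OF t]] \<gamma>t t
      by (intro continuous_on_tendsto_compose[of "{0..T}" "%r. ip (v r) (x t)"]) auto
    then show "(%n. ip (x t) (v (\<gamma> n \<lfloor>t * real (Suc n)\<rfloor>))) \<longlonglongrightarrow> ip (x t) (v t)"
      using ip_sym x[OF t] cont_curve_mem[OF v] \<gamma> t by auto
  qed
next
  case False
  then show ?thesis by (intro measurableI) (auto simp: space_restrict_space)
qed

end

section \<open>Function spaces on the network\<close>

text \<open>Lebesgue points in one-sided form: the averages run over \<open>{x..x + h}\<close>, and
  extension of \<open>g\<close> by zero makes the theorem on the whole line applicable. The right
  end is discarded, since averages there would reach outside the interval.\<close>

lemma lebesgue_differentiation_right:
  fixes g :: "real \<Rightarrow> real"
  assumes g: "integrable (lebesgue_on {a..b}) g"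
  shows "AE x in lebesgue_on {a..b}. ((%h. integral {x..x + h} g / h) \<longlongrightarrow> g x) (at_right 0)"
proof -
  define G where "G x = (if x \<in> {a..b} then g x else 0)" for x
  have "(G has_integral i) UNIV \<longleftrightarrow> (g has_integral i) {a..b}" for i
    unfolding G_def by (rule has_integral_restrict_UNIV)
  then have "G integrable_on UNIV"
    using integrable_on_lebesgue_on[OF g] by (auto simp: integrable_on_def)
  then have G: "G integrable_on cbox c d" for c d
    by (rule integrable_on_subcbox) auto
  obtain N where N: "negligible N"
    "\<And>x e. x \<notin> N ==> 0 < e ==>
       \<exists>d>0. \<forall>h. 0 < h \<and> h < d \<longrightarrow> norm (integral (cbox x (x + h *\<^sub>R One)) G /\<^sub>R h ^ DIM(real) - G x) < e"
    using integrable_ccontinuous_explicit[of G, OF G] by metis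
  have "((%h. integral {x..x + h} g / h) \<longlongrightarrow> g x) (at_right 0)" if x: "x \<in> {a..b}" "x \<notin> N \<union> {b}" for x
  proof (rule tendstoI)
    fix e :: real assume "0 < e"
    then obtain d where d: "0 < d" "\<And>h. 0 < h ==> h < d ==> \<bar>integral {x..x + h} G / h - G x\<bar> < e"
      using N(2)[of x e] x by (auto simp: divide_inverse mult.commute)
    have "\<bar>integral {x..x + h} g / h - g x\<bar> < e" if "0 < h" "h < min d (b - x)" for h
    proof -
      have "integral {x..x + h} G = integral {x..x + h} g"
        using x that by (intro Henstock_Kurzweil_Integration.integral_cong) (auto simp: G_def)
      then show ?thesis using d(2)[of h] that x by (simp add: G_def)
    qed
    moreover have "0 < min d (b - x)" using d x by auto
    ultimately show "\<forall>\<^sub>F h in at_right 0. dist (integral {x..x + h} g / h) (g x) < e"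
      unfolding eventually_at_right_field dist_real_def by blast
  qed
  moreover have "AE x in lebesgue_on {a..b}. x \<notin> N \<union> {b}"
  proof (rule AE_I')
    have "negligible ((N \<union> {b}) \<inter> {a..b})"
      using N(1) by (simp add: negligible_Int)
    then show "(N \<union> {b}) \<inter> {a..b} \<in> null_sets (lebesgue_on {a..b})"
      by (simp add: null_sets_restrict_space negligible_iff_null_sets)
  qed auto
  ultimately show ?thesis
    by (elim lebesgue_on_mono) auto
qed

text \<open>Reflection of the right-sided statement. The two one-sided forms are combined in
  \<open>cell_averages_tendsto\<close>.\<close>

lemma lebesgue_differentiation_left:
  fixes g :: "real \<Rightarrow> real"
  assumes g: "integrable (lebesgue_on {a..b}) g"
  shows "AE x in lebesgue_on {a..b}. ((%h. integral {x - h..x} g / h) \<longlongrightarrow> g x) (at_right 0)"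
proof -
  have "integrable (lebesgue_on {-b..-a}) (%x. g (- x))"
    using g by simp
  from lebesgue_differentiation_right[OF this]
  have "AE x in lebesgue_on {-b..-a}. ((%h. integral {x..x + h} (%x. g (- x)) / h) \<longlongrightarrow> g (- x)) (at_right 0)" .
  moreover have "integral {x..x + h} (%x. g (- x)) = integral {- x - h..- x} g" for x h
    using Henstock_Kurzweil_Integration.integral_reflect_real[of "- x" "- x - h" g] by (simp add: algebra_simps)
  ultimately have "AE x in lebesgue_on {-b..-a}. ((%h. integral {- x - h..- x} g / h) \<longlongrightarrow> g (- x)) (at_right 0)"
    by simp
  then obtain N where N: "negligible N" "N \<subseteq> {-b..-a}"
      "\<And>x. x \<in> {-b..-a} ==> x \<notin> N ==> ((%h. integral {- x - h..- x} g / h) \<longlongrightarrow> g (- x)) (at_right 0)"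
    by (elim AE_E3) (auto simp: null_sets_restrict_space negligible_iff_null_sets)
  have "negligible (uminus ` N)"
    by (rule negligible_differentiable_image_negligible[OF order_refl N(1)]) (auto intro!: derivative_intros)
  then have "AE x in lebesgue_on {a..b}. x \<notin> uminus ` N \<inter> {a..b}"
    by (intro AE_not_in) (auto simp: null_sets_restrict_space negligible_iff_null_sets[symmetric] negligible_Int)
  then show ?thesis
  proof (rule lebesgue_on_mono)
    fix x assume "x \<notin> uminus ` N \<inter> {a..b}" "x \<in> {a..b}"
    then have "- x \<notin> N" "- x \<in> {-b..-a}" by (auto simp: image_iff)
    from N(3)[OF this(2,1)] show "((%h. integral {x - h..x} g / h) \<longlongrightarrow> g x) (at_right 0)" by simp
  qed
qed

lemma AE_zero_if_increments_zero:
  fixes g :: "real \<Rightarrow> real"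
  assumes g: "integrable (lebesgue_on {a..b}) g"
    and zero: "\<And>s t. a \<le> s ==> s \<le> t ==> t \<le> b ==> integral {s..t} g = 0"
  shows "AE x in lebesgue_on {a..b}. g x = 0"
proof -
  have "AE x in lebesgue_on {a..b}. x \<noteq> b"
    by (rule AE_I'[of "{b} \<inter> {a..b}"])
      (auto simp: null_sets_restrict_space negligible_iff_null_sets[symmetric] negligible_Int)
  with lebesgue_differentiation_right[OF g]
  have "AE x in lebesgue_on {a..b}. x \<noteq> b \<and> ((%h. integral {x..x + h} g / h) \<longlongrightarrow> g x) (at_right 0)"
    by (simp add: AE_conj_iff)
  then show ?thesis
  proof (rule lebesgue_on_mono)
    fix x assume x: "x \<noteq> b \<and> ((%h. integral {x..x + h} g / h) \<longlongrightarrow> g x) (at_right 0)" "x \<in> {a..b}"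
    have "\<forall>\<^sub>F h in at_right 0. integral {x..x + h} g / h = 0"
      unfolding eventually_at_right_field using x zero
      by (intro exI[of _ "b - x"]) auto
    then have "((%h. integral {x..x + h} g / h) \<longlongrightarrow> 0) (at_right 0)"
      by (rule tendsto_eventually)
    then show "g x = 0"
      using x tendsto_unique[OF trivial_limit_at_right_real] by blast
  qed
qed

text \<open>\<open>edge_deriv\<close> is selected by choice; uniqueness up to null sets is what
  connects it with any concrete weak derivative.\<close>

lemma weak_deriv_unique:
  assumes w: "has_weak_deriv a b u w" "has_weak_deriv a b u w'" and u: "continuous_on {a..b} u"
  shows "AE x in lebesgue_on {a..b}. w x = w' x"
proof -
  have int: "integrable (lebesgue_on {a..b}) w" "integrable (lebesgue_on {a..b}) w'"
    using w by (auto simp: has_weak_deriv_def)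
  have "integral {s..t} (%x. w x - w' x) = 0" if "a \<le> s" "s \<le> t" "t \<le> b" for s t
  proof -
    have "w integrable_on {s..t}" "w' integrable_on {s..t}"
      using int[THEN integrable_on_lebesgue_on] that by (auto intro: integrable_subinterval_real)
    then show ?thesis
      using weak_deriv_increment[OF w(1) u that] weak_deriv_increment[OF w(2) u that]
      by (simp add: Henstock_Kurzweil_Integration.integral_diff)
  qed
  then have "AE x in lebesgue_on {a..b}. w x - w' x = 0"
    using int by (intro AE_zero_if_increments_zero Bochner_Integration.integrable_diff)
  then show ?thesis by simp
qed

section \<open>Square integrable functions on the edges\<close>

lemma L2_interval_mult:
  assumes "u \<in> L2_interval a b" "v \<in> L2_interval a b"
  shows "integrable (lebesgue_on {a..b}) (%x. u x * v x)"
proof (rule Bochner_Integration.integrable_bound)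
  show "integrable (lebesgue_on {a..b}) (%x. (u x)^2 + (v x)^2)"
    using assms by (auto simp: L2_interval_def)
  show "(%x. u x * v x) \<in> borel_measurable (lebesgue_on {a..b})"
    using assms by (auto simp: L2_interval_def)
  have "\<bar>x * y\<bar> \<le> x^2 + y^2" for x y :: real
  proof -
    have "2 * (\<bar>x\<bar> * \<bar>y\<bar>) \<le> x^2 + y^2"
      using sum_squares_bound[of "\<bar>x\<bar>" "\<bar>y\<bar>"] by simp
    then show ?thesis using mult_nonneg_nonneg[of "\<bar>x\<bar>" "\<bar>y\<bar>"] unfolding abs_mult by linarith
  qed
  then show "AE x in lebesgue_on {a..b}. norm (u x * v x) \<le> norm ((u x)^2 + (v x)^2)"
    by (intro AE_I2) (simp add: abs_mult)
qed

lemma L2_interval_comb: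
  assumes "u \<in> L2_interval a b" "v \<in> L2_interval a b"
  shows "(%x. \<alpha> * u x + \<beta> * v x) \<in> L2_interval a b"
proof -
  have "(%x. (\<alpha> * u x + \<beta> * v x)^2) = (%x. \<alpha>^2 * (u x)^2 + 2 * \<alpha> * \<beta> * (u x * v x) + \<beta>^2 * (v x)^2)"
    by (simp add: power2_eq_square algebra_simps)
  then show ?thesis
    using assms L2_interval_mult[OF assms]
    by (auto simp: L2_interval_def intro!: borel_measurable_add borel_measurable_times)
qed

lemma L2_interval_integrable:
  assumes "u \<in> L2_interval a b"
  shows "integrable (lebesgue_on {a..b}) u"
  using L2_interval_mult[OF assms, of "%_. 1"] by (simp add: L2_interval_def)

lemma L2_interval_cong_AE:
  assumes "u \<in> L2_interval a b" "AE x in lebesgue_on {a..b}. w x = u x" "w \<in> borel_measurable (lebesgue_on {a..b})"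
  shows "w \<in> L2_interval a b"
proof -
  have "integrable (lebesgue_on {a..b}) (%x. (w x)^2) \<longleftrightarrow> integrable (lebesgue_on {a..b}) (%x. (u x)^2)"
    using assms by (intro integrable_cong_AE) (auto simp: L2_interval_def)
  then show ?thesis using assms by (simp add: L2_interval_def)
qed

lemma L2D: "u \<in> L2 N ==> e \<in> edges N ==> (%x. u (e, x)) \<in> L2_interval 0 (edge_len N e)"
  by (simp add: L2_def)

lemma L2_edge_measurable:
  "u \<in> L2 N ==> e \<in> edges N ==> (%x. u (e, x)) \<in> borel_measurable (lebesgue_on {0..edge_len N e})"
  by (simp add: L2_def L2_interval_def)

lemma L2_edge_integrable_mult:
  "u \<in> L2 N ==> v \<in> L2 N ==> e \<in> edges N ==>
     integrable (lebesgue_on {0..edge_len N e}) (%x. u (e, x) * v (e, x))"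
  by (intro L2_interval_mult L2D)

lemma L2_inner_self_nonneg: "0 \<le> L2_inner N u u"
  by (simp add: L2_inner_def sum_nonneg)

lemma L2_norm_power2: "(L2_norm N u)^2 = L2_inner N u u"
  by (simp add: L2_norm_def L2_inner_self_nonneg)

lemma semi_inner_L2: "semi_inner (L2 N) (L2_inner N)"
proof
  show "(%i. 0) \<in> L2 N" by (simp add: L2_def L2_interval_def)
  show "(%i. \<alpha> * u i + \<beta> * v i) \<in> L2 N" if "u \<in> L2 N" "v \<in> L2 N" for u v \<alpha> \<beta>
    using that by (auto simp: L2_def intro: L2_interval_comb)
  show "L2_inner N (%i. \<alpha> * u i + \<beta> * v i) w = \<alpha> * L2_inner N u w + \<beta> * L2_inner N v w"
    if "u \<in> L2 N" "v \<in> L2 N" "w \<in> L2 N" for u v w \<alpha> \<beta>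
  proof -
    have "(LINT x|lebesgue_on {0..edge_len N e}. (\<alpha> * u (e, x) + \<beta> * v (e, x)) * w (e, x))
        = \<alpha> * (LINT x|lebesgue_on {0..edge_len N e}. u (e, x) * w (e, x))
          + \<beta> * (LINT x|lebesgue_on {0..edge_len N e}. v (e, x) * w (e, x))" if e: "e \<in> edges N" for e
    proof -
      have "(%x. (\<alpha> * u (e, x) + \<beta> * v (e, x)) * w (e, x))
          = (%x. \<alpha> * (u (e, x) * w (e, x)) + \<beta> * (v (e, x) * w (e, x)))"
        by (simp add: algebra_simps)
      then show ?thesis
        using L2_edge_integrable_mult[OF \<open>u \<in> L2 N\<close> \<open>w \<in> L2 N\<close> e]
          L2_edge_integrable_mult[OF \<open>v \<in> L2 N\<close> \<open>w \<in> L2 N\<close> e] by simp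
    qed
    then show ?thesis
      by (simp add: L2_inner_def sum.distrib sum_distrib_left)
  qed
  show "L2_inner N u v = L2_inner N v u" for u v
    by (simp add: L2_inner_def mult.commute)
qed (rule L2_inner_self_nonneg)

lemma nrm_L2: "semi_inner.nrm (L2_inner N) = L2_norm N"
  by (rule ext) (simp add: semi_inner.nrm_def[OF semi_inner_L2] L2_norm_def)

interpretation L2: semi_inner "L2 N" "L2_inner N"
  rewrites "semi_inner.nrm (L2_inner N) = L2_norm N" for N
  by (rule semi_inner_L2) (rule nrm_L2)

lemma L2_inner_commute: "L2_inner N u v = L2_inner N v u"
  by (simp add: L2_inner_def mult.commute)

lemma L2_norm_ge_0: "0 \<le> L2_norm N u"
  by (simp add: L2_norm_def L2_inner_self_nonneg)

lemma L2_inner_mono: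
  assumes "u \<in> L2 N" "v \<in> L2 N" "u' \<in> L2 N" "v' \<in> L2 N"
    and "\<And>e. e \<in> edges N ==> AE x in lebesgue_on {0..edge_len N e}. u (e, x) * v (e, x) \<le> u' (e, x) * v' (e, x)"
  shows "L2_inner N u v \<le> L2_inner N u' v'"
  unfolding L2_inner_def using assms
  by (intro sum_mono integral_mono_AE L2_edge_integrable_mult) auto

lemma L2_inner_cong_ae:
  assumes "u \<in> L2 N" "u' \<in> L2 N" "v \<in> L2 N" "ae_eq N u u'"
  shows "L2_inner N u v = L2_inner N u' v"
proof -
  have ae: "AE x in lebesgue_on {0..edge_len N e}. u (e, x) = u' (e, x)" if "e \<in> edges N" for e
    using assms that by (simp add: ae_eq_def)
  show ?thesis
    by (rule antisym; rule L2_inner_mono[OF _ assms(3) _ assms(3)])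
      (use assms(1,2) ae in \<open>auto intro: eventually_mono[OF ae]\<close>)
qed

lemma L2_norm_cong_ae:
  assumes "u \<in> L2 N" "u' \<in> L2 N" "ae_eq N u u'"
  shows "L2_norm N u = L2_norm N u'"
  using L2_inner_cong_ae[OF assms(1,2,1,3)] L2_inner_cong_ae[OF assms(1,2,2,3)]
  by (simp add: L2_norm_def L2_inner_commute)

lemma ae_eq_sym: "ae_eq N u v ==> ae_eq N v u"
  by (simp add: ae_eq_def eq_commute)

lemma L2_norm_zero_imp_inner_zero:
  assumes "u \<in> L2 N" "w \<in> L2 N" "L2_norm N u = 0"
  shows "L2_inner N u w = 0"
  using L2.cauchy_schwarz[OF assms(1,2)] assms(3) by simp

section \<open>Multiplication by bounded coefficients\<close>

definition coef_bounds :: "('v, 'e) network \<Rightarrow> 'e edge_fun \<Rightarrow> real \<Rightarrow> real \<Rightarrow> bool" where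
  "coef_bounds N k lo hi \<longleftrightarrow> (\<forall>e\<in>edges N.
     (%x. k (e, x)) \<in> borel_measurable (lebesgue_on {0..edge_len N e}) \<and>
     (AE x in lebesgue_on {0..edge_len N e}. lo \<le> k (e, x) \<and> k (e, x) \<le> hi))"

lemma mult_mem_L2:
  assumes k: "coef_bounds N k lo hi" and u: "u \<in> L2 N"
  shows "(%z. k z * u z) \<in> L2 N"
  unfolding L2_def mem_Collect_eq L2_interval_def
proof (intro ballI conjI)
  fix e assume e: "e \<in> edges N"
  let ?M = "lebesgue_on {0..edge_len N e}"
  have u': "(%x. u (e, x)) \<in> borel_measurable ?M" "integrable ?M (%x. (u (e, x))^2)"
    using L2D[OF u e] by (auto simp: L2_interval_def)
  have k': "(%x. k (e, x)) \<in> borel_measurable ?M" "AE x in ?M. lo \<le> k (e, x) \<and> k (e, x) \<le> hi"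
    using k e by (auto simp: coef_bounds_def)
  show m: "(%x. k (e, x) * u (e, x)) \<in> borel_measurable ?M"
    using u' k' by simp
  show "integrable ?M (%x. (k (e, x) * u (e, x))^2)"
  proof (rule Bochner_Integration.integrable_bound)
    show "integrable ?M (%x. (max \<bar>lo\<bar> \<bar>hi\<bar>)^2 * (u (e, x))^2)" using u' by simp
    show "(%x. (k (e, x) * u (e, x))^2) \<in> borel_measurable ?M" using m by simp
    show "AE x in ?M. norm ((k (e, x) * u (e, x))^2) \<le> norm ((max \<bar>lo\<bar> \<bar>hi\<bar>)^2 * (u (e, x))^2)"
      using k'(2)
    proof (rule eventually_mono)
      fix x assume x: "lo \<le> k (e, x) \<and> k (e, x) \<le> hi"
      then have "\<bar>k (e, x)\<bar> \<le> \<bar>max \<bar>lo\<bar> \<bar>hi\<bar>\<bar>" by auto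
      then have "(k (e, x))^2 \<le> (max \<bar>lo\<bar> \<bar>hi\<bar>)^2" by (simp only: abs_le_square_iff)
      then show "norm ((k (e, x) * u (e, x))^2) \<le> norm ((max \<bar>lo\<bar> \<bar>hi\<bar>)^2 * (u (e, x))^2)"
        by (simp add: power_mult_distrib mult_right_mono)
    qed
  qed
qed

lemma L2_inner_mult_bounds:
  assumes k: "coef_bounds N k lo hi" and u: "u \<in> L2 N"
  shows "lo * L2_inner N u u \<le> L2_inner N (%z. k z * u z) u"
    and "L2_inner N (%z. k z * u z) u \<le> hi * L2_inner N u u"
proof -
  have ae: "AE x in lebesgue_on {0..edge_len N e}. lo \<le> k (e, x) \<and> k (e, x) \<le> hi" if "e \<in> edges N" for e
    using k that by (auto simp: coef_bounds_def)
  have "L2_inner N (%z. lo * u z) u \<le> L2_inner N (%z. k z * u z) u"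
  proof (rule L2_inner_mono)
    fix e assume "e \<in> edges N"
    from ae[OF this] show "AE x in lebesgue_on {0..edge_len N e}.
        lo * u (e, x) * u (e, x) \<le> k (e, x) * u (e, x) * u (e, x)"
      by (rule eventually_mono) (simp add: mult.assoc mult_right_mono)
  qed (use u mult_mem_L2[OF k u] L2.scale_mem in auto)
  then show "lo * L2_inner N u u \<le> L2_inner N (%z. k z * u z) u"
    by (simp add: L2.ip_scale_left u)
  have "L2_inner N (%z. k z * u z) u \<le> L2_inner N (%z. hi * u z) u"
  proof (rule L2_inner_mono)
    fix e assume "e \<in> edges N"
    from ae[OF this] show "AE x in lebesgue_on {0..edge_len N e}.
        k (e, x) * u (e, x) * u (e, x) \<le> hi * u (e, x) * u (e, x)"
      by (rule eventually_mono) (simp add: mult.assoc mult_right_mono)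
  qed (use u mult_mem_L2[OF k u] L2.scale_mem in auto)
  then show "L2_inner N (%z. k z * u z) u \<le> hi * L2_inner N u u"
    by (simp add: L2.ip_scale_left u)
qed

lemma L2_norm_mult_le:
  assumes k: "coef_bounds N k lo hi" and u: "u \<in> L2 N" and lo: "0 \<le> lo" "0 \<le> hi"
  shows "L2_norm N (%z. k z * u z) \<le> hi * L2_norm N u"
proof -
  have ae: "AE x in lebesgue_on {0..edge_len N e}. lo \<le> k (e, x) \<and> k (e, x) \<le> hi" if "e \<in> edges N" for e
    using k that by (auto simp: coef_bounds_def)
  have "L2_inner N (%z. k z * u z) (%z. k z * u z) \<le> L2_inner N (%z. hi * u z) (%z. hi * u z)"
  proof (rule L2_inner_mono)
    fix e assume "e \<in> edges N"
    from ae[OF this] show "AE x in lebesgue_on {0..edge_len N e}.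
        k (e, x) * u (e, x) * (k (e, x) * u (e, x)) \<le> hi * u (e, x) * (hi * u (e, x))"
    proof (rule eventually_mono)
      fix x assume x: "lo \<le> k (e, x) \<and> k (e, x) \<le> hi"
      have "k (e, x) * u (e, x) * (k (e, x) * u (e, x)) = (k (e, x))^2 * (u (e, x))^2"
        by (simp add: power2_eq_square)
      also have "\<dots> \<le> hi^2 * (u (e, x))^2"
        using x lo by (intro mult_right_mono power_mono) auto
      finally show "k (e, x) * u (e, x) * (k (e, x) * u (e, x)) \<le> hi * u (e, x) * (hi * u (e, x))"
        by (simp add: power2_eq_square algebra_simps)
    qed
  qed (use u mult_mem_L2[OF k u] L2.scale_mem in auto)
  then have "L2_norm N (%z. k z * u z) \<le> L2_norm N (%z. hi * u z)"
    unfolding L2_norm_def by (rule real_sqrt_le_mono)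
  then show ?thesis using lo by (simp add: L2.nrm_scale u)
qed

lemma coef_bounds_inverse:
  assumes k: "coef_bounds N k lo hi" and lo: "0 < lo"
  shows "coef_bounds N (%z. inverse (k z)) (inverse hi) (inverse lo)"
  unfolding coef_bounds_def
proof (intro ballI conjI)
  fix e assume e: "e \<in> edges N"
  then show "(%x. inverse (k (e, x))) \<in> borel_measurable (lebesgue_on {0..edge_len N e})"
    using k by (auto simp: coef_bounds_def)
  have "AE x in lebesgue_on {0..edge_len N e}. lo \<le> k (e, x) \<and> k (e, x) \<le> hi"
    using k e by (auto simp: coef_bounds_def)
  then show "AE x in lebesgue_on {0..edge_len N e}. inverse hi \<le> inverse (k (e, x)) \<and> inverse (k (e, x)) \<le> inverse lo"
    by (rule eventually_mono) (use lo in \<open>auto intro: le_imp_inverse_le\<close>)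
qed

lemma coef_bounds_cancel:
  assumes k: "coef_bounds N k lo hi" and lo: "0 < lo"
  shows "ae_eq N (%z. inverse (k z) * (k z * u z)) u"
  unfolding ae_eq_def
proof
  fix e assume e: "e \<in> edges N"
  have "AE x in lebesgue_on {0..edge_len N e}. lo \<le> k (e, x) \<and> k (e, x) \<le> hi"
    using k e by (auto simp: coef_bounds_def)
  then show "AE x in lebesgue_on {0..edge_len N e}. inverse (k (e, x)) * (k (e, x) * u (e, x)) = u (e, x)"
    by (rule eventually_mono) (use lo in auto)
qed

section \<open>Sobolev functions and the edgewise derivative\<close>

lemma H1_subset_L2: "q \<in> H1 N ==> q \<in> L2 N"
  by (simp add: H1_def L2_def)

lemma H1_continuous_edge: "q \<in> H1 N ==> e \<in> edges N ==> continuous_on {0..edge_len N e} (%x. q (e, x))"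
  by (simp add: H1_def)

lemma edge_deriv_weak:
  assumes "q \<in> H1 N" "e \<in> edges N"
  shows "has_weak_deriv 0 (edge_len N e) (%x. q (e, x)) (%x. edge_deriv N q (e, x))"
proof -
  obtain w where "has_weak_deriv 0 (edge_len N e) (%x. q (e, x)) w"
    using assms by (auto simp: H1_def)
  then have "has_weak_deriv 0 (edge_len N e) (%x. q (e, x))
      (SOME w. has_weak_deriv 0 (edge_len N e) (%x. q (e, x)) w)"
    by (rule someI[of "has_weak_deriv 0 (edge_len N e) (%x. q (e, x))"])
  then show ?thesis by (simp add: edge_deriv_def)
qed

lemma edge_deriv_unique:
  assumes "q \<in> H1 N" "e \<in> edges N" "has_weak_deriv 0 (edge_len N e) (%x. q (e, x)) w"
  shows "AE x in lebesgue_on {0..edge_len N e}. edge_deriv N q (e, x) = w x"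
  by (rule weak_deriv_unique[OF edge_deriv_weak[OF assms(1,2)] assms(3) H1_continuous_edge[OF assms(1,2)]])

lemma edge_deriv_mem_L2:
  assumes "q \<in> H1 N"
  shows "edge_deriv N q \<in> L2 N"
  unfolding L2_def mem_Collect_eq
proof
  fix e assume e: "e \<in> edges N"
  obtain w where w: "w \<in> L2_interval 0 (edge_len N e)" "has_weak_deriv 0 (edge_len N e) (%x. q (e, x)) w"
    using assms e by (auto simp: H1_def)
  show "(%x. edge_deriv N q (e, x)) \<in> L2_interval 0 (edge_len N e)"
    by (rule L2_interval_cong_AE[OF w(1) edge_deriv_unique[OF assms e w(2)]])
      (use edge_deriv_weak[OF assms e] in \<open>auto simp: has_weak_deriv_def\<close>)
qed

lemma has_weak_deriv_comb:
  assumes u: "has_weak_deriv a b u w" "has_weak_deriv a b u' w'"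
  shows "has_weak_deriv a b (%x. \<alpha> * u x + \<beta> * u' x) (%x. \<alpha> * w x + \<beta> * w' x)"
  unfolding has_weak_deriv_def
proof (intro conjI allI impI)
  have int: "integrable (lebesgue_on {a..b}) u" "integrable (lebesgue_on {a..b}) u'"
    "integrable (lebesgue_on {a..b}) w" "integrable (lebesgue_on {a..b}) w'"
    using u by (auto simp: has_weak_deriv_def)
  then show "integrable (lebesgue_on {a..b}) (%x. \<alpha> * u x + \<beta> * u' x)"
    "integrable (lebesgue_on {a..b}) (%x. \<alpha> * w x + \<beta> * w' x)" by auto
  fix \<phi> assume \<phi>: "test_fun a b \<phi>"
  have mult: "integrable (lebesgue_on {a..b}) (%x. f x * g x)"
    if f: "integrable (lebesgue_on {a..b}) f" and g: "continuous_on UNIV g" for f g :: "real \<Rightarrow> real"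
  proof -
    have "compact (g ` {a..b})"
      by (intro compact_continuous_image continuous_on_subset[OF g]) auto
    then obtain K where K: "\<And>x. x \<in> {a..b} ==> \<bar>g x\<bar> \<le> K"
      using compact_imp_bounded bounded_iff by (metis image_eqI real_norm_def)
    show ?thesis
    proof (rule Bochner_Integration.integrable_bound)
      show "integrable (lebesgue_on {a..b}) (%x. f x * K)" using f by simp
      have "g \<in> borel_measurable (lebesgue_on {a..b})"
        by (intro continuous_imp_measurable_on_sets_lebesgue continuous_on_subset[OF g]) auto
      then show "(%x. f x * g x) \<in> borel_measurable (lebesgue_on {a..b})" using f by simp
      show "AE x in lebesgue_on {a..b}. norm (f x * g x) \<le> norm (f x * K)"
        using K by (intro AE_I2) (fastforce simp: abs_mult intro!: mult_left_mono)
    qed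
  qed
  have "(deriv ^^ 0) \<phi> field_differentiable at x" "(deriv ^^ 1) \<phi> field_differentiable at x" for x
    using \<phi> unfolding test_fun_def by blast+
  then have "continuous_on UNIV \<phi>" "continuous_on UNIV (deriv \<phi>)"
    by (auto intro!: continuous_at_imp_continuous_on field_differentiable_imp_continuous_at)
  note m = mult[OF int(1) this(2)] mult[OF int(2) this(2)] mult[OF int(3) this(1)] mult[OF int(4) this(1)]
  have eq: "(LINT x|lebesgue_on {a..b}. u x * deriv \<phi> x) = - (LINT x|lebesgue_on {a..b}. w x * \<phi> x)"
     "(LINT x|lebesgue_on {a..b}. u' x * deriv \<phi> x) = - (LINT x|lebesgue_on {a..b}. w' x * \<phi> x)"
    using u \<phi> by (auto simp: has_weak_deriv_def)
  have "(LINT x|lebesgue_on {a..b}. (\<alpha> * u x + \<beta> * u' x) * deriv \<phi> x)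
      = (LINT x|lebesgue_on {a..b}. \<alpha> * (u x * deriv \<phi> x) + \<beta> * (u' x * deriv \<phi> x))"
    by (simp add: algebra_simps)
  also have "\<dots> = - (\<alpha> * (LINT x|lebesgue_on {a..b}. w x * \<phi> x) + \<beta> * (LINT x|lebesgue_on {a..b}. w' x * \<phi> x))"
    using m eq by simp
  also have "\<dots> = - (LINT x|lebesgue_on {a..b}. \<alpha> * (w x * \<phi> x) + \<beta> * (w' x * \<phi> x))"
    using m by simp
  also have "\<dots> = - (LINT x|lebesgue_on {a..b}. (\<alpha> * w x + \<beta> * w' x) * \<phi> x)"
    by (simp add: algebra_simps)
  finally show "(LINT x|lebesgue_on {a..b}. (\<alpha> * u x + \<beta> * u' x) * deriv \<phi> x)
      = - (LINT x|lebesgue_on {a..b}. (\<alpha> * w x + \<beta> * w' x) * \<phi> x)" .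
qed

lemma comb_mem_H1:
  assumes u: "u \<in> H1 N" and v: "v \<in> H1 N"
  shows "(%z. \<alpha> * u z + \<beta> * v z) \<in> H1 N"
  unfolding H1_def mem_Collect_eq
proof (intro conjI ballI)
  fix e assume e: "e \<in> edges N"
  show "continuous_on {0..edge_len N e} (%x. \<alpha> * u (e, x) + \<beta> * v (e, x))"
    using u v e by (intro continuous_intros H1_continuous_edge)
  show "(%x. \<alpha> * u (e, x) + \<beta> * v (e, x)) \<in> L2_interval 0 (edge_len N e)"
    using u v e by (intro L2_interval_comb L2D H1_subset_L2)
  show "\<exists>w\<in>L2_interval 0 (edge_len N e). has_weak_deriv 0 (edge_len N e) (%x. \<alpha> * u (e, x) + \<beta> * v (e, x)) w"
    by (rule bexI, rule has_weak_deriv_comb[OF edge_deriv_weak[OF u e] edge_deriv_weak[OF v e]],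
        rule L2_interval_comb[OF L2D[OF edge_deriv_mem_L2[OF u] e] L2D[OF edge_deriv_mem_L2[OF v] e]])
next
  fix x assume "x \<in> verts (graph N)"
  then have "\<exists>y. endpoint_values N u x \<subseteq> {y}" "\<exists>y. endpoint_values N v x \<subseteq> {y}"
    using u v by (simp_all add: H1_def)
  then obtain y y' where "endpoint_values N u x \<subseteq> {y}" "endpoint_values N v x \<subseteq> {y'}" by blast
  then have "endpoint_values N (%z. \<alpha> * u z + \<beta> * v z) x \<subseteq> {\<alpha> * y + \<beta> * y'}"
    by (simp add: endpoint_values_def image_subset_iff)
  then show "\<exists>y. endpoint_values N (%z. \<alpha> * u z + \<beta> * v z) x \<subseteq> {y}" by blast
qed

lemma edge_deriv_comb:
  assumes u: "u \<in> H1 N" and v: "v \<in> H1 N"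
  shows "ae_eq N (edge_deriv N (%z. \<alpha> * u z + \<beta> * v z)) (%z. \<alpha> * edge_deriv N u z + \<beta> * edge_deriv N v z)"
  unfolding ae_eq_def
proof
  fix e assume e: "e \<in> edges N"
  show "AE x in lebesgue_on {0..edge_len N e}. edge_deriv N (%z. \<alpha> * u z + \<beta> * v z) (e, x)
      = \<alpha> * edge_deriv N u (e, x) + \<beta> * edge_deriv N v (e, x)"
    by (rule edge_deriv_unique[OF comb_mem_H1[OF u v] e])
      (use has_weak_deriv_comb[OF edge_deriv_weak[OF u e] edge_deriv_weak[OF v e]] in simp)
qed

definition H1_inner :: "('v, 'e) network \<Rightarrow> 'e edge_fun \<Rightarrow> 'e edge_fun \<Rightarrow> real" where
  "H1_inner N u v = L2_inner N u v + L2_inner N (edge_deriv N u) (edge_deriv N v)"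

text \<open>The choice inside \<open>edge_deriv\<close> makes it linear only almost everywhere.
  Paired with an \<open>L2\<close> function it becomes exactly linear, and most later uses of
  linearity go through such pairings.\<close>

lemma op_K_comb:
  assumes "u \<in> H1 N" "v \<in> H1 N" "w \<in> L2 N"
  shows "L2_inner N (edge_deriv N (%z. \<alpha> * u z + \<beta> * v z)) w
     = \<alpha> * L2_inner N (edge_deriv N u) w + \<beta> * L2_inner N (edge_deriv N v) w"
proof -
  note m = edge_deriv_mem_L2[OF assms(1)] edge_deriv_mem_L2[OF assms(2)]
  have "L2_inner N (edge_deriv N (%z. \<alpha> * u z + \<beta> * v z)) w
      = L2_inner N (%z. \<alpha> * edge_deriv N u z + \<beta> * edge_deriv N v z) w"
    using assms m by (intro L2_inner_cong_ae edge_deriv_comb edge_deriv_mem_L2 comb_mem_H1 L2.comb_mem)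
  then show ?thesis using m assms by (simp add: L2.ip_comb_left)
qed

lemma semi_inner_H1: "semi_inner (H1 N) (H1_inner N)"
proof
  show "(%i. 0) \<in> H1 N"
  proof -
    have "has_weak_deriv 0 l (%x. 0) (%x. 0)" for l by (simp add: has_weak_deriv_def)
    moreover have "(%x. 0) \<in> L2_interval 0 l" for l by (simp add: L2_interval_def)
    moreover have "\<exists>y. endpoint_values N (%i. 0) v \<subseteq> {y}" for v
      by (rule exI[of _ 0]) (auto simp: endpoint_values_def)
    ultimately show ?thesis unfolding H1_def by auto
  qed
  show "(%i. \<alpha> * u i + \<beta> * v i) \<in> H1 N" if "u \<in> H1 N" "v \<in> H1 N" for u v \<alpha> \<beta>
    using that by (rule comb_mem_H1)
  show "H1_inner N (%i. \<alpha> * u i + \<beta> * v i) w = \<alpha> * H1_inner N u w + \<beta> * H1_inner N v w"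
    if "u \<in> H1 N" "v \<in> H1 N" "w \<in> H1 N" for u v w \<alpha> \<beta>
    using that unfolding H1_inner_def
    by (simp add: op_K_comb edge_deriv_mem_L2 L2.ip_comb_left H1_subset_L2 algebra_simps)
  show "H1_inner N u v = H1_inner N v u" for u v
    by (simp add: H1_inner_def L2_inner_commute)
  show "0 \<le> H1_inner N u u" for u
    by (simp add: H1_inner_def L2_inner_self_nonneg)
qed

lemma nrm_H1: "semi_inner.nrm (H1_inner N) = H1_norm N"
  by (rule ext) (simp add: semi_inner.nrm_def[OF semi_inner_H1] H1_norm_def H1_inner_def L2_norm_power2)

interpretation H1: semi_inner "H1 N" "H1_inner N"
  rewrites "semi_inner.nrm (H1_inner N) = H1_norm N" for N
  by (rule semi_inner_H1) (rule nrm_H1)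

lemma H1_norm_ge_0: "0 \<le> H1_norm N u"
  by (simp add: H1_norm_def)

lemma H1_norm_power2: "(H1_norm N u)^2 = (L2_norm N u)^2 + (L2_norm N (edge_deriv N u))^2"
  by (simp add: H1_norm_def)

lemma L2_norm_le_H1_norm: "L2_norm N u \<le> H1_norm N u"
  by (rule power2_le_imp_le) (simp_all add: H1_norm_power2 H1_norm_ge_0)

lemma L2_norm_edge_deriv_le_H1_norm: "L2_norm N (edge_deriv N u) \<le> H1_norm N u"
  by (rule power2_le_imp_le) (simp_all add: H1_norm_power2 H1_norm_ge_0)

lemma edge_deriv_diff:
  assumes "u \<in> H1 N" "v \<in> H1 N"
  shows "ae_eq N (edge_deriv N (%z. u z - v z)) (%z. edge_deriv N u z - edge_deriv N v z)"
  using edge_deriv_comb[OF assms, of 1 "-1"] by simp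

lemma op_K_diff:
  assumes "u \<in> H1 N" "v \<in> H1 N" "w \<in> L2 N"
  shows "L2_inner N (edge_deriv N (%z. u z - v z)) w = L2_inner N (edge_deriv N u) w - L2_inner N (edge_deriv N v) w"
  using op_K_comb[OF assms, of 1 "-1"] by simp

lemma op_K_sum:
  "(\<And>k. k \<in> K ==> u k \<in> H1 N) ==> w \<in> L2 N ==>
   L2_inner N (edge_deriv N (%z. \<Sum>k\<in>K. c k * u k z)) w = (\<Sum>k\<in>K. c k * L2_inner N (edge_deriv N (u k)) w)"
proof (induction K rule: infinite_finite_induct)
  case (insert k K)
  then have "L2_inner N (edge_deriv N (%z. c k * u k z + 1 * (\<Sum>k\<in>K. c k * u k z))) w
      = c k * L2_inner N (edge_deriv N (u k)) w + 1 * L2_inner N (edge_deriv N (%z. \<Sum>k\<in>K. c k * u k z)) w"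
    by (intro op_K_comb H1.sum_mem) auto
  then show ?case using insert by simp
next
  case (infinite K)
  \<comment> \<open>Even the chosen derivative of the zero function vanishes only almost everywhere;
    coefficients zero in \<open>op_K_comb\<close> show that its pairing vanishes.\<close>
  then show ?case using op_K_comb[OF H1.zero_mem H1.zero_mem, where w = w and \<alpha> = 0 and \<beta> = 0] by simp
next
  case empty
  then show ?case using op_K_comb[OF H1.zero_mem H1.zero_mem, where w = w and \<alpha> = 0 and \<beta> = 0] by simp
qed

lemma continuous_curve_H1_L2:
  assumes "continuous_curve T (H1 N) (H1_norm N) u"
  shows "continuous_curve T (L2 N) (L2_norm N) u"
  by (rule continuous_curve_map[OF assms, where L = "%x. x" and C = 1])
    (simp_all add: H1_subset_L2 L2_norm_ge_0 L2_norm_le_H1_norm)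

lemma continuous_curve_edge_deriv:
  assumes "continuous_curve T (H1 N) (H1_norm N) u"
  shows "continuous_curve T (L2 N) (L2_norm N) (%t. edge_deriv N (u t))"
proof (rule continuous_curve_map[OF assms, where L = "edge_deriv N" and C = 1])
  fix x y assume xy: "x \<in> H1 N" "y \<in> H1 N"
  have "L2_norm N (%i. edge_deriv N x i - edge_deriv N y i) = L2_norm N (edge_deriv N (%i. x i - y i))"
    using xy by (intro L2_norm_cong_ae[symmetric] edge_deriv_diff edge_deriv_mem_L2 H1.diff_mem L2.diff_mem)
  then show "\<bar>L2_norm N (%i. edge_deriv N x i - edge_deriv N y i)\<bar> \<le> 1 * H1_norm N (%i. x i - y i)"
    using L2_norm_edge_deriv_le_H1_norm by (simp add: L2_norm_ge_0)
qed (rule edge_deriv_mem_L2)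

lemma continuous_curve_mult:
  assumes u: "continuous_curve T (L2 N) (L2_norm N) u" and k: "coef_bounds N k lo hi" and lo: "0 \<le> lo" "0 \<le> hi"
  shows "continuous_curve T (L2 N) (L2_norm N) (%t z. k z * u t z)"
proof (rule continuous_curve_map[OF u, where L = "%x z. k z * x z" and C = hi])
  fix x y assume xy: "x \<in> L2 N" "y \<in> L2 N"
  have "L2_norm N (%z. k z * (x z - y z)) \<le> hi * L2_norm N (%z. x z - y z)"
    using xy by (intro L2_norm_mult_le[OF k _ lo] L2.diff_mem)
  then show "\<bar>L2_norm N (%i. k i * x i - k i * y i)\<bar> \<le> hi * L2_norm N (%i. x i - y i)"
    by (simp add: L2_norm_ge_0 right_diff_distrib)
qed (rule mult_mem_L2[OF k])

section \<open>Values at the vertices\<close>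

lemma wf_networkD:
  assumes "wf_network N"
  shows "finite (edges N)" "finite (dirichlet N)" "\<And>e. e \<in> edges N ==> 0 < edge_len N e"
    "dirichlet N \<subseteq> verts (graph N)" "finite (neumann N)" "neumann N \<subseteq> verts (graph N)"
proof -
  interpret fin_digraph "graph N" using assms by (simp add: wf_network_def)
  show "finite (edges N)" "finite (dirichlet N)" "finite (neumann N)" "neumann N \<subseteq> verts (graph N)"
    "dirichlet N \<subseteq> verts (graph N)"
    using assms finite_verts finite_arcs finite_subset[of "dirichlet N" "verts (graph N)"]
    by (auto simp: wf_network_def neumann_def)
  show "\<And>e. e \<in> edges N ==> 0 < edge_len N e" using assms by (simp add: wf_network_def)
qed

text \<open>The endpoint \<open>(e, x)\<close> is chosen independently of \<open>q\<close>, so the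
  value at a vertex is evaluation at one fixed point and inherits linearity and bounds.\<close>

lemma vertex_value_endpoint:
  assumes N: "wf_network N" and v: "v \<in> verts (graph N)"
  obtains e x where "e \<in> edges N" "x = 0 \<or> x = edge_len N e" "\<And>q. q \<in> H1 N ==> vertex_value N q v = q (e, x)"
proof -
  have vv: "vertex_value N q v = y" if q_mem: "q \<in> H1 N" "y \<in> endpoint_values N q v" for q y
  proof -
    obtain y' where "endpoint_values N q v \<subseteq> {y'}" using q_mem v by (auto simp: H1_def)
    then have "endpoint_values N q v = {y}" using q_mem by auto
    then show ?thesis by (simp add: vertex_value_def)
  qed
  have "in_arcs (graph N) v \<union> out_arcs (graph N) v \<noteq> {}"
    using N v by (simp add: wf_network_def)
  then consider e where "e \<in> out_arcs (graph N) v" | e where "e \<in> in_arcs (graph N) v" by blast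
  then show ?thesis
  proof cases
    case 1
    then show ?thesis
      by (intro that[of e 0] vv) (auto simp: endpoint_values_def)
  next
    case 2
    then show ?thesis
      by (intro that[of e "edge_len N e"] vv) (auto simp: endpoint_values_def)
  qed
qed

lemma vertex_value_comb:
  assumes N: "wf_network N" and v: "v \<in> verts (graph N)" and q: "q \<in> H1 N" "q' \<in> H1 N"
  shows "vertex_value N (%z. \<alpha> * q z + \<beta> * q' z) v = \<alpha> * vertex_value N q v + \<beta> * vertex_value N q' v"
proof -
  obtain e x where ex: "\<And>q. q \<in> H1 N ==> vertex_value N q v = q (e, x)"
    by (rule vertex_value_endpoint[OF N v]) (rule that)
  show ?thesis using ex comb_mem_H1[OF q] q by simp
qed

text \<open>Cauchy-Schwarz for the mean of the absolute value, read off from the nonnegative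
  variance around \<open>W / l\<close>.\<close>

lemma integral_abs_power2_le:
  assumes w: "w \<in> L2_interval 0 l" and l: "0 < l"
  shows "(LINT x|lebesgue_on {0..l}. \<bar>w x\<bar>)^2 \<le> l * (LINT x|lebesgue_on {0..l}. (w x)^2)"
proof -
  define W where "W = (LINT x|lebesgue_on {0..l}. \<bar>w x\<bar>)"
  have i1: "integrable (lebesgue_on {0..l}) (%x. \<bar>w x\<bar>)"
    using L2_interval_integrable[OF w] by simp
  have i2: "integrable (lebesgue_on {0..l}) (%x. (w x)^2)"
    using w by (simp add: L2_interval_def)
  have "0 \<le> (LINT x|lebesgue_on {0..l}. (\<bar>w x\<bar> - W / l)^2)" by simp
  also have "\<dots> = (LINT x|lebesgue_on {0..l}. (w x)^2 - 2 * (W / l) * \<bar>w x\<bar> + (W / l)^2)"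
    by (intro Bochner_Integration.integral_cong) (auto simp: power2_diff)
  also have "\<dots> = (LINT x|lebesgue_on {0..l}. (w x)^2) - 2 * (W / l) * W + (W / l)^2 * l"
    using i1 i2 l by (simp add: W_def measure_restrict_space)
  also have "\<dots> = (LINT x|lebesgue_on {0..l}. (w x)^2) - W^2 / l"
    using l by (simp add: field_simps power2_eq_square)
  finally show ?thesis using l by (simp add: W_def field_simps)
qed

text \<open>The trace estimate: the value at the endpoint differs from the value at any other point
  of the edge by at most the integral \<open>W\<close> of the modulus of the derivative, and
  averaging the squares over the edge brings in both parts of the \<open>H1\<close> norm.\<close>

lemma vertex_value_bounded:
  assumes N: "wf_network N" and v: "v \<in> verts (graph N)"
  obtains C where "0 \<le> C" "\<And>q. q \<in> H1 N ==> \<bar>vertex_value N q v\<bar> \<le> C * H1_norm N q"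
proof -
  obtain e y where e: "e \<in> edges N" and y: "y = 0 \<or> y = edge_len N e"
    and ex: "\<And>q. q \<in> H1 N ==> vertex_value N q v = q (e, y)"
    by (rule vertex_value_endpoint[OF N v]) (rule that)
  define l where "l = edge_len N e"
  have l: "0 < l" using wf_networkD(3)[OF N e] by (simp add: l_def)
  \<comment> \<open>The constant results from \<open>(f y)^2 \<le> 2 * (f x)^2 + 2 * W^2\<close>,
    averaged over the edge of length \<open>l\<close>, where \<open>W^2\<close> is at most
    \<open>l\<close> times the square integral of the derivative.\<close>
  have "\<bar>q (e, y)\<bar> \<le> sqrt (2 / l + 2 * l) * H1_norm N q" if q: "q \<in> H1 N" for q
  proof -
    define f w where "f = (%x. q (e, x))" and "w = (%x. edge_deriv N q (e, x))"
    have wd: "has_weak_deriv 0 l f w" and fc: "continuous_on {0..l} f"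
      and f2: "f \<in> L2_interval 0 l" and w2: "w \<in> L2_interval 0 l"
      unfolding f_def w_def l_def
      by (rule edge_deriv_weak[OF q e] H1_continuous_edge[OF q e] L2D[OF H1_subset_L2[OF q] e]
          L2D[OF edge_deriv_mem_L2[OF q] e])+
    define W where "W = (LINT x|lebesgue_on {0..l}. \<bar>w x\<bar>)"
    have wi: "integrable (lebesgue_on {0..l}) w" by (rule L2_interval_integrable[OF w2])
    then have wi': "integrable (lebesgue_on {0..l}) (%x. \<bar>w x\<bar>)" by simp
    have inc: "\<bar>f t - f s\<bar> \<le> W" if "0 \<le> s" "s \<le> t" "t \<le> l" for s t
    proof -
      have "w integrable_on {s..t}" "(%x. \<bar>w x\<bar>) integrable_on {0..l}" "(%x. \<bar>w x\<bar>) integrable_on {s..t}"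
        using integrable_on_lebesgue_on[OF wi] integrable_on_lebesgue_on[OF wi'] that
        by (auto intro: integrable_subinterval_real)
      then have "\<bar>integral {s..t} w\<bar> \<le> integral {s..t} (%x. \<bar>w x\<bar>)"
          "integral {s..t} (%x. \<bar>w x\<bar>) \<le> integral {0..l} (%x. \<bar>w x\<bar>)"
        using that by (auto intro!: integral_norm_bound_integral[where 'a = real, simplified real_norm_def] integral_subset_le)
      moreover have "integral {0..l} (%x. \<bar>w x\<bar>) = W"
        unfolding W_def using wi' by (intro lebesgue_integral_eq_integral[symmetric]) auto
      ultimately show ?thesis using weak_deriv_increment[OF wd fc that] by simp
    qed
    have "(f y)^2 \<le> 2 * (f x)^2 + 2 * W^2" if "x \<in> {0..l}" for x
    proof -
      have "\<bar>f y - f x\<bar> \<le> W"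
        using inc[of 0 x] inc[of x l] y that by (auto simp: l_def abs_minus_commute)
      then have "(f y - f x)^2 \<le> W^2"
        by (metis abs_ge_zero order_trans power2_abs power_mono)
      moreover have "(f y)^2 \<le> 2 * (f x)^2 + 2 * (f y - f x)^2"
        using zero_le_power2[of "f y - 2 * f x"] by (simp add: power2_eq_square algebra_simps)
      ultimately show ?thesis by linarith
    qed
    then have "(LINT x|lebesgue_on {0..l}. (f y)^2) \<le> (LINT x|lebesgue_on {0..l}. 2 * (f x)^2 + 2 * W^2)"
      using f2 by (intro integral_mono) (auto simp: L2_interval_def)
    then have "(f y)^2 * l \<le> 2 * (LINT x|lebesgue_on {0..l}. (f x)^2) + 2 * W^2 * l"
      using f2 l by (simp add: L2_interval_def measure_restrict_space mult.commute)
    moreover have "W^2 \<le> l * (LINT x|lebesgue_on {0..l}. (w x)^2)"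
      unfolding W_def by (rule integral_abs_power2_le[OF w2 l])
    moreover have single: "(LINT x|lebesgue_on {0..l}. (u (e, x))^2) \<le> (L2_norm N u)^2" for u
    proof -
      have "(LINT x|lebesgue_on {0..edge_len N e}. u (e, x) * u (e, x)) \<le> L2_inner N u u"
        unfolding L2_inner_def using wf_networkD(1)[OF N] e
        by (intro member_le_sum) auto
      then show ?thesis unfolding L2_norm_power2 l_def by (simp add: power2_eq_square)
    qed
    moreover have "(L2_norm N q)^2 \<le> (H1_norm N q)^2" "(L2_norm N (edge_deriv N q))^2 \<le> (H1_norm N q)^2"
      by (simp_all add: H1_norm_power2)
    ultimately have fy: "(f y)^2 * l \<le> 2 * (H1_norm N q)^2 + 2 * W^2 * l"
      and W2: "W^2 \<le> l * (LINT x|lebesgue_on {0..l}. (w x)^2)"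
      and w_le: "(LINT x|lebesgue_on {0..l}. (w x)^2) \<le> (H1_norm N q)^2"
      using single[of q] single[of "edge_deriv N q"] unfolding f_def w_def by linarith+
    have "W^2 \<le> l * (H1_norm N q)^2"
      using W2 mult_left_mono[OF w_le, of l] l by linarith
    then have "2 * W^2 * l \<le> 2 * (l * (H1_norm N q)^2) * l"
      using l by (intro mult_right_mono) auto
    with fy have "(f y)^2 * l \<le> 2 * (H1_norm N q)^2 + 2 * (l * (H1_norm N q)^2) * l"
      by linarith
    then have "(f y)^2 \<le> (2 / l + 2 * l) * (H1_norm N q)^2"
      using l by (simp add: field_simps power2_eq_square)
    then have "sqrt ((f y)^2) \<le> sqrt ((2 / l + 2 * l) * (H1_norm N q)^2)"
      by (rule real_sqrt_le_mono)
    then show ?thesis by (simp add: real_sqrt_mult f_def H1_norm_ge_0)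
  qed
  then show ?thesis
    using ex l by (intro that[of "sqrt (2 / l + 2 * l)"]) auto
qed

section \<open>The energy identity\<close>

text \<open>Bridge between the Lebesgue integral of the definitions and the gauge integral, whose
  calculus on subintervals is used for increments in time.\<close>

lemma integrable_lebesgue_on_Icc_iff:
  fixes f :: "real \<Rightarrow> real"
  shows "integrable (lebesgue_on {a..b}) f \<longleftrightarrow> f integrable_on {a..b} \<and> (%x. \<bar>f x\<bar>) integrable_on {a..b}"
proof -
  have "integrable (lebesgue_on {a..b}) f \<longleftrightarrow> f absolutely_integrable_on {a..b}"
    by (simp add: set_integrable_def integrable_restrict_space)
  then show ?thesis by (simp add: absolutely_integrable_on_def)
qed

lemma integrable_lebesgue_on_Icc_subset:
  fixes f :: "real \<Rightarrow> real"
  assumes "integrable (lebesgue_on {a..b}) f" "a \<le> c" "d \<le> b"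
  shows "integrable (lebesgue_on {c..d}) f"
  using assms unfolding integrable_lebesgue_on_Icc_iff
  by (meson atLeastatMost_subset_iff integrable_subinterval_real)

lemma integrable_lebesgue_on_Icc_shift:
  fixes f :: "real \<Rightarrow> real"
  assumes "integrable (lebesgue_on {a..b}) f" "a \<le> c + h" "d + h \<le> b"
  shows "integrable (lebesgue_on {c..d}) (%t. f (t + h))"
proof -
  have "integrable (lebesgue_on {c + h..d + h}) f"
    by (rule integrable_lebesgue_on_Icc_subset[OF assms])
  then show ?thesis
    using integrable_on_shift_Icc_real[of f h c d] integrable_on_shift_Icc_real[of "%x. \<bar>f x\<bar>" h c d]
    by (simp add: integrable_lebesgue_on_Icc_iff o_def add.commute)
qed

lemma integral_Icc_shift:
  fixes f :: "real \<Rightarrow> real"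
  shows "integral {c..d} (%t. f (t + h)) = integral {c + h..d + h} f"
  using integral_shift_Icc_real[of c d f h] by (simp add: o_def add.commute)

lemma integral_Icc_diff:
  fixes f :: "real \<Rightarrow> real"
  assumes "f integrable_on {a..b}" "a \<le> c" "c \<le> d" "d \<le> b"
  shows "integral {a..d} f - integral {a..c} f = integral {c..d} f"
  using Henstock_Kurzweil_Integration.integral_combine[of a c d f] integrable_subinterval_real[OF assms(1), of a d] assms
  by simp

text \<open>After a shift of the variable, only the averages over the last and over the first
  interval of length \<open>h\<close> remain.\<close>

lemma integral_average_tendsto:
  fixes \<phi> :: "real \<Rightarrow> real"
  assumes \<phi>: "continuous_on {0..R} \<phi>" and R: "0 < R"
  shows "((%h. integral {0..R - h} (%t. \<phi> (t + h) - \<phi> t) / h) \<longlongrightarrow> \<phi> R - \<phi> 0) (at_right 0)"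
proof -
  let ?\<Phi> = "%x. integral {0..x} \<phi>"
  have d: "(?\<Phi> has_real_derivative \<phi> x) (at x within {0..R})" if "x \<in> {0..R}" for x
    using \<phi> that by (rule integral_has_real_derivative)
  have "((%x. (?\<Phi> x - ?\<Phi> 0) / (x - 0)) \<longlongrightarrow> \<phi> 0) (at 0 within {0..R})"
    using d[of 0] R by (simp add: has_field_derivative_iff)
  moreover have "at 0 within {0..R} = at_right 0"
    using R by (rule at_within_Icc_at_right)
  ultimately have L0: "((%h. ?\<Phi> h / h) \<longlongrightarrow> \<phi> 0) (at_right 0)" by simp
  have "((%x. (?\<Phi> x - ?\<Phi> R) / (x - R)) \<longlongrightarrow> \<phi> R) (at_left R)"
    using d[of R] R at_within_Icc_at_left[OF R] by (simp add: has_field_derivative_iff)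
  moreover have "filterlim (%h. R - h) (at_left R) (at_right 0)"
    unfolding filterlim_at by (auto intro!: tendsto_eq_intros simp: eventually_at_filter)
  ultimately have "((%h. (?\<Phi> (R - h) - ?\<Phi> R) / (R - h - R)) \<longlongrightarrow> \<phi> R) (at_right 0)"
    by (rule filterlim_compose)
  then have LR: "((%h. (?\<Phi> R - ?\<Phi> (R - h)) / h) \<longlongrightarrow> \<phi> R) (at_right 0)"
    by (rule Lim_transform_eventually)
      (auto simp: eventually_at_filter field_simps)
  have "((%h. (?\<Phi> R - ?\<Phi> (R - h)) / h - ?\<Phi> h / h) \<longlongrightarrow> \<phi> R - \<phi> 0) (at_right 0)"
    by (rule tendsto_diff[OF LR L0])
  moreover have "\<forall>\<^sub>F h in at_right 0. (?\<Phi> R - ?\<Phi> (R - h)) / h - ?\<Phi> h / h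
      = integral {0..R - h} (%t. \<phi> (t + h) - \<phi> t) / h"
    unfolding eventually_at_right_field
  proof (intro exI[of _ R] conjI allI impI R)
    fix h assume h: "0 < h" "h < R"
    have i: "\<phi> integrable_on {0..R}" by (rule integrable_continuous_interval[OF \<phi>])
    have "(%t. \<phi> (t + h)) integrable_on {0..R - h}" "\<phi> integrable_on {0..R - h}"
      using h by (auto intro!: integrable_continuous_interval continuous_on_compose2[OF \<phi>] continuous_intros
          intro: continuous_on_subset[OF \<phi>])
    then have "integral {0..R - h} (%t. \<phi> (t + h) - \<phi> t) = integral {h..R} \<phi> - ?\<Phi> (R - h)"
      by (simp add: Henstock_Kurzweil_Integration.integral_diff integral_Icc_shift)
    also have "integral {h..R} \<phi> = ?\<Phi> R - ?\<Phi> h"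
      using integral_Icc_diff[OF i, of h R] h by simp
    finally show "(?\<Phi> R - ?\<Phi> (R - h)) / h - ?\<Phi> h / h = integral {0..R - h} (%t. \<phi> (t + h) - \<phi> t) / h"
      by (simp add: diff_divide_distrib)
  qed
  ultimately show ?thesis
    by (rule Lim_transform_eventually)
qed

text \<open>Integrating the hypothesis over \<open>t\<close>, dividing by \<open>h\<close> and
  letting \<open>h\<close> tend to zero replaces a pointwise derivative: \<open>f\<close> and
  \<open>g\<close> are merely integrable, and the comparison of increments is available for almost
  all \<open>t\<close> only.\<close>

lemma increment_from_averages:
  fixes \<Psi> f g :: "real \<Rightarrow> real"
  assumes R: "0 < R" and \<Psi>: "continuous_on {0..R} \<Psi>"
    and f: "integrable (lebesgue_on {0..R}) f"
    and g: "integrable (lebesgue_on {0..R}) g"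
    and close: "\<And>\<delta>. 0 < \<delta> ==> \<exists>h0>0. \<forall>h. 0 < h \<longrightarrow> h < h0 \<longrightarrow> h < R \<longrightarrow>
       (AE t in lebesgue_on {0..R - h}. \<bar>\<Psi> (t + h) - \<Psi> t - h * f (t + h) - h * f t\<bar>
          \<le> \<delta> * (h * g (t + h) + h * g t + integral {t..t + h} g))"
  shows "\<Psi> R - \<Psi> 0 = 2 * integral {0..R} f"
proof -
  let ?F = "%x. integral {0..x} f" and ?G = "%x. integral {0..x} g"
  have fi: "f integrable_on {0..R}" and gi: "g integrable_on {0..R}"
    using f g by (auto simp: integrable_lebesgue_on_Icc_iff)
  have Fc: "continuous_on {0..R} ?F" and Gc: "continuous_on {0..R} ?G"
    by (intro indefinite_integral_continuous_1 fi gi)+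
  have atR: "((%h. \<phi> (R - h)) \<longlongrightarrow> \<phi> R) (at_right 0)" and at0: "(\<phi> \<longlongrightarrow> \<phi> 0) (at_right 0)"
    if \<phi>: "continuous_on {0..R} \<phi>" for \<phi> :: "real \<Rightarrow> real"
  proof -
    have "(\<phi> \<longlongrightarrow> \<phi> R) (at_left R)"
      using \<phi> R at_within_Icc_at_left[OF R] by (auto simp: continuous_on_def dest: bspec[of _ _ R])
    moreover have "filterlim (%h. R - h) (at_left R) (at_right 0)"
      unfolding filterlim_at by (auto intro!: tendsto_eq_intros simp: eventually_at_filter)
    ultimately show "((%h. \<phi> (R - h)) \<longlongrightarrow> \<phi> R) (at_right 0)"
      by (rule filterlim_compose)
    show "(\<phi> \<longlongrightarrow> \<phi> 0) (at_right 0)"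
      using \<phi> R at_within_Icc_at_right[OF R] by (auto simp: continuous_on_def dest: bspec[of _ _ 0])
  qed
  let ?a = "%h. integral {0..R - h} (%t. \<Psi> (t + h) - \<Psi> t) / h"
  let ?b = "%h. ?F R - ?F h + ?F (R - h)"
  let ?c = "%h. integral {0..R - h} (%t. ?G (t + h) - ?G t) / h"
  let ?d = "%h. ?G R - ?G h + ?G (R - h)"
  have a: "(?a \<longlongrightarrow> \<Psi> R - \<Psi> 0) (at_right 0)"
    by (rule integral_average_tendsto[OF \<Psi> R])
  have c: "(?c \<longlongrightarrow> ?G R - ?G 0) (at_right 0)"
    by (rule integral_average_tendsto[OF Gc R])
  have b: "(?b \<longlongrightarrow> ?F R - ?F 0 + ?F R) (at_right 0)"
    by (intro tendsto_intros at0 atR Fc)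
  have d: "(?d \<longlongrightarrow> ?G R - ?G 0 + ?G R) (at_right 0)"
    by (intro tendsto_intros at0 atR Gc)
  \<comment> \<open>In the limit \<open>?d\<close> contributes \<open>2 * ?G R\<close> and
    \<open>?c\<close> contributes \<open>?G R\<close> to the error, whence the factor three.\<close>
  have le_mult: "\<bar>\<Psi> R - \<Psi> 0 - 2 * ?F R\<bar> \<le> \<delta> * (3 * ?G R)" if \<delta>: "0 < \<delta>" for \<delta>
  proof -
    obtain h0 where h0: "0 < h0" "\<And>h. 0 < h ==> h < h0 ==> h < R ==>
       (AE t in lebesgue_on {0..R - h}. \<bar>\<Psi> (t + h) - \<Psi> t - h * f (t + h) - h * f t\<bar>
          \<le> \<delta> * (h * g (t + h) + h * g t + integral {t..t + h} g))"
      using close[OF \<delta>] by blast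
    have ev: "\<forall>\<^sub>F h in at_right 0. \<bar>?a h - ?b h\<bar> \<le> \<delta> * (?d h + ?c h)"
      unfolding eventually_at_right_field
    proof (intro exI[of _ "min h0 R"] conjI allI impI)
      fix h assume "0 < h" "h < min h0 R"
      then have h: "0 < h" "h < h0" "h < R" by auto
      let ?M = "lebesgue_on {0..R - h}"
      have shift: "integrable ?M (%t. k (t + h))" "integrable ?M k"
          "(LINT t|?M. k (t + h)) = integral {0..R} k - integral {0..h} k"
          "(LINT t|?M. k t) = integral {0..R - h} k"
        if k: "integrable (lebesgue_on {0..R}) k" for k :: "real \<Rightarrow> real"
      proof -
        show i: "integrable ?M (%t. k (t + h))" "integrable ?M k"
          using h by (auto intro: integrable_lebesgue_on_Icc_shift[OF k] integrable_lebesgue_on_Icc_subset[OF k])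
        have "(LINT t|?M. k (t + h)) = integral {0..R - h} (%t. k (t + h))"
          using i by (intro lebesgue_integral_eq_integral) auto
        also have "\<dots> = integral {0..R} k - integral {0..h} k"
          using integral_Icc_shift[of 0 "R - h" k h] integral_Icc_diff[of k 0 R h R] k h
          by (simp add: integrable_lebesgue_on_Icc_iff)
        finally show "(LINT t|?M. k (t + h)) = integral {0..R} k - integral {0..h} k" .
        show "(LINT t|?M. k t) = integral {0..R - h} k"
          using i by (intro lebesgue_integral_eq_integral) auto
      qed
      have cont: "integrable ?M (%t. k (t + h) - k t)"
        "(LINT t|?M. k (t + h) - k t) = integral {0..R - h} (%t. k (t + h) - k t)"
        if k: "continuous_on {0..R} k" for k :: "real \<Rightarrow> real"
      proof -
        have "continuous_on {0..R - h} (%t. k (t + h) - k t)"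
          using h by (auto intro!: continuous_intros continuous_on_compose2[OF k] intro: continuous_on_subset[OF k])
        then show "integrable ?M (%t. k (t + h) - k t)"
          by (rule continuous_imp_integrable_real)
        then show "(LINT t|?M. k (t + h) - k t) = integral {0..R - h} (%t. k (t + h) - k t)"
          by (rule lebesgue_integral_eq_integral) auto
      qed
      let ?D = "%t. (\<Psi> (t + h) - \<Psi> t) - h * f (t + h) - h * f t"
      let ?B = "%t. \<delta> * (h * g (t + h) + h * g t + (?G (t + h) - ?G t))"
      have "\<bar>LINT t|?M. ?D t\<bar> \<le> (LINT t|?M. \<bar>?D t\<bar>)"
        by (rule integral_abs_bound)
      also have "\<dots> \<le> (LINT t|?M. ?B t)"
      proof (rule integral_mono_AE)
        show "integrable ?M (%t. \<bar>?D t\<bar>)"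
          by (intro integrable_abs Bochner_Integration.integrable_diff[OF Bochner_Integration.integrable_diff[OF cont(1)[OF \<Psi>]]]
              integrable_mult_right shift(1,2)[OF f])
        show "integrable ?M ?B"
          by (intro integrable_mult_right Bochner_Integration.integrable_add[OF _ cont(1)[OF Gc]]
              Bochner_Integration.integrable_add[of ?M "%t. h * g (t + h)" "%t. h * g t"] shift(1,2)[OF g])
        have "AE t in ?M. \<bar>\<Psi> (t + h) - \<Psi> t - h * f (t + h) - h * f t\<bar>
          \<le> \<delta> * (h * g (t + h) + h * g t + integral {t..t + h} g)"
          by (rule h0(2)[OF h])
        then show "AE t in ?M. \<bar>?D t\<bar> \<le> ?B t"
        proof (rule lebesgue_on_mono)
          fix t assume t: "\<bar>\<Psi> (t + h) - \<Psi> t - h * f (t + h) - h * f t\<bar>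
            \<le> \<delta> * (h * g (t + h) + h * g t + integral {t..t + h} g)" "t \<in> {0..R - h}"
          then have "?G (t + h) - ?G t = integral {t..t + h} g"
            using h by (intro integral_Icc_diff[OF gi]) auto
          then show "\<bar>?D t\<bar> \<le> ?B t" using t by simp
        qed
      qed
      also have "(LINT t|?M. ?B t) = \<delta> * (h * (?G R - ?G h) + h * ?G (R - h) + h * ?c h)"
        using cont[OF Gc] shift[OF g] h by simp
      also have "(LINT t|?M. ?D t) = h * ?a h - h * (?F R - ?F h) - h * ?F (R - h)"
        using cont[OF \<Psi>] shift[OF f] h by simp
      finally have "\<bar>h * (?a h - ?b h)\<bar> \<le> h * (\<delta> * (?d h + ?c h))"
        using h by (simp add: algebra_simps)
      then show "\<bar>?a h - ?b h\<bar> \<le> \<delta> * (?d h + ?c h)"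
        using h by (simp add: abs_mult)
    qed (use h0 R in auto)
    have "\<bar>(\<Psi> R - \<Psi> 0) - (?F R - ?F 0 + ?F R)\<bar> \<le> \<delta> * ((?G R - ?G 0 + ?G R) + (?G R - ?G 0))"
      by (rule tendsto_le[OF trivial_limit_at_right_real _ _ ev]; intro tendsto_intros a b c d)
    then show ?thesis by simp
  qed
  have "\<bar>\<Psi> R - \<Psi> 0 - 2 * ?F R\<bar> \<le> 0 + e" if "0 < e" for e
  proof (cases "?G R \<le> 0")
    case True
    have "\<bar>\<Psi> R - \<Psi> 0 - 2 * ?F R\<bar> \<le> 1 * (3 * ?G R)" by (rule le_mult) simp
    then show ?thesis using True that by linarith
  next
    case False
    then have "\<bar>\<Psi> R - \<Psi> 0 - 2 * ?F R\<bar> \<le> (e / (3 * ?G R)) * (3 * ?G R)"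
      using that by (intro le_mult) simp
    then show ?thesis using False by simp
  qed
  then have "\<bar>\<Psi> R - \<Psi> 0 - 2 * ?F R\<bar> \<le> 0"
    by (rule field_le_epsilon)
  then show ?thesis by simp
qed

context semi_inner
begin

text \<open>
  Only \<open>u\<close> and \<open>v\<close> are continuous with values in the space; \<open>x\<close>, which stands for the spatial derivative
  of \<open>u\<close>, is merely weakly measurable.  The cross terms \<open>ip (x t) (v s)\<close> and \<open>ip (x s) (v t)\<close> become
  averages of the one scalar integrable function \<open>ip (x t) (v t)\<close>, up to the modulus of continuity of \<open>v\<close>,
  and these averages cancel.
\<close>

lemma energy_identity:
  fixes \<epsilon> :: real
  assumes u: "cont_curve T u" and v: "cont_curve T v" and y: "cont_curve T y" and y': "cont_curve T y'"
    and x: "\<And>t. t \<in> {0..T} ==> x t \<in> X"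
    and x_int: "\<And>w. w \<in> X ==> integrable (lebesgue_on {0..T}) (%t. ip (x t) w)"
    and g: "integrable (lebesgue_on {0..T}) g" and xg: "\<And>t. t \<in> {0..T} ==> nrm (x t) \<le> g t"
    and eq_u: "AE t in lebesgue_on {0..T}. \<forall>s r. 0 \<le> s \<longrightarrow> s \<le> r \<longrightarrow> r \<le> T \<longrightarrow>
       ip (%i. u r i - u s i) (u t) = integral {s..r} (%\<sigma>. ip (x t) (v \<sigma>) - ip (y \<sigma>) (u t))"
    and eq_v: "\<And>w s r. w \<in> X ==> 0 \<le> s ==> s \<le> r ==> r \<le> T ==>
       \<epsilon> * ip (%i. v r i - v s i) w = - integral {s..r} (%\<sigma>. ip (x \<sigma>) w + ip (y' \<sigma>) w)"
    and R: "0 \<le> R" "R \<le> T"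
  shows "ip (u R) (u R) + \<epsilon> * ip (v R) (v R) - (ip (u 0) (u 0) + \<epsilon> * ip (v 0) (v 0))
     = - 2 * integral {0..R} (%t. ip (y t) (u t) + ip (y' t) (v t))"
proof (cases "R = 0")
  case False
  then have R0: "0 < R" using R by simp
  note m = cont_curve_mem[OF u] cont_curve_mem[OF v] cont_curve_mem[OF y] cont_curve_mem[OF y'] x
  define f where "f t = ip (x t) (v t)" for t
  define k where "k t = ip (y t) (u t) + ip (y' t) (v t)" for t
  define E where "E t = ip (u t) (u t) + \<epsilon> * ip (v t) (v t)" for t
  obtain V where V: "0 \<le> V" "\<And>t. t \<in> {0..T} ==> nrm (v t) \<le> V" using cont_curve_bounded[OF v] by blast
  obtain Y where Y: "0 \<le> Y" "\<And>t. t \<in> {0..T} ==> nrm (y t) \<le> Y" using cont_curve_bounded[OF y] by blast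
  obtain Y' where Y': "0 \<le> Y'" "\<And>t. t \<in> {0..T} ==> nrm (y' t) \<le> Y'" using cont_curve_bounded[OF y'] by blast
  have g0: "0 \<le> g t" if "t \<in> {0..T}" for t
    using xg[OF that] nrm_nonneg[OF x[OF that]] by linarith
  have fT: "integrable (lebesgue_on {0..T}) f"
  proof (rule Bochner_Integration.integrable_bound)
    show "integrable (lebesgue_on {0..T}) (%t. g t * V)" using g by simp
    show "f \<in> borel_measurable (lebesgue_on {0..T})"
      unfolding f_def by (rule measurable_ip_curve[OF x _ v]) (use x_int in auto)
    show "AE t in lebesgue_on {0..T}. norm (f t) \<le> norm (g t * V)"
    proof (rule AE_I2)
      fix t assume "t \<in> space (lebesgue_on {0..T})"
      then have t: "t \<in> {0..T}" by simp
      have "\<bar>f t\<bar> \<le> nrm (x t) * nrm (v t)"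
        unfolding f_def by (intro cauchy_schwarz m t)
      also have "\<dots> \<le> g t * V"
        using xg[OF t] V(2)[OF t] g0[OF t] nrm_nonneg m t by (intro mult_mono) auto
      finally show "norm (f t) \<le> norm (g t * V)" using g0[OF t] V(1) by simp
    qed
  qed
  have kT: "continuous_on {0..T} k" and ET: "continuous_on {0..T} E"
    unfolding k_def E_def by (intro continuous_intros continuous_on_ip_curves u v y y')+
  \<comment> \<open>With the primitives of \<open>f\<close> and \<open>k\<close> added, the
    increments of \<open>\<Psi>\<close> are comparable with \<open>h * f (t + h) + h * f t\<close>.
    Once \<open>increment_from_averages\<close> gives the total increment, the two contributions of
    \<open>f\<close> cancel and the energy identity remains.\<close>
  define \<Psi> where "\<Psi> t = E t + 2 * integral {0..t} f + 2 * integral {0..t} k" for t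
  define g' where "g' t = 2 * g t + 2 * (Y + Y')" for t
  have fi: "f integrable_on {0..T}" "k integrable_on {0..T}" "g integrable_on {0..T}"
    using fT g integrable_continuous_interval[OF kT] by (auto simp: integrable_lebesgue_on_Icc_iff)
  have "\<Psi> R - \<Psi> 0 = 2 * integral {0..R} f"
  proof (rule increment_from_averages[OF R0, where g = g'])
    show "continuous_on {0..R} \<Psi>"
      unfolding \<Psi>_def using R fi
      by (intro continuous_intros continuous_on_subset[OF ET] indefinite_integral_continuous_1)
        (auto intro: integrable_subinterval_real)
    show "integrable (lebesgue_on {0..R}) f" "integrable (lebesgue_on {0..R}) g'"
      using R integrable_lebesgue_on_Icc_subset[OF fT] integrable_lebesgue_on_Icc_subset[OF g]
      unfolding g'_def by auto
    fix \<delta> :: real assume \<delta>: "0 < \<delta>"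
    obtain d1 where d1: "0 < d1"
      "\<And>s t. s \<in> {0..T} ==> t \<in> {0..T} ==> \<bar>s - t\<bar> < d1 ==> nrm (%i. u s i - u t i) < \<delta>"
      using cont_curve_uniform[OF u \<delta>] by blast
    obtain d2 where d2: "0 < d2"
      "\<And>s t. s \<in> {0..T} ==> t \<in> {0..T} ==> \<bar>s - t\<bar> < d2 ==> nrm (%i. v s i - v t i) < \<delta>"
      using cont_curve_uniform[OF v \<delta>] by blast
    show "\<exists>h0>0. \<forall>h. 0 < h \<longrightarrow> h < h0 \<longrightarrow> h < R \<longrightarrow>
       (AE t in lebesgue_on {0..R - h}. \<bar>\<Psi> (t + h) - \<Psi> t - h * f (t + h) - h * f t\<bar>
          \<le> \<delta> * (h * g' (t + h) + h * g' t + integral {t..t + h} g'))"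
    proof (intro exI[of _ "min d1 d2"] conjI allI impI)
      fix h assume h: "0 < h" "h < min d1 d2" "h < R"
      define good where "good t \<longleftrightarrow> (\<forall>s r. 0 \<le> s \<longrightarrow> s \<le> r \<longrightarrow> r \<le> T \<longrightarrow>
         ip (%i. u r i - u s i) (u t) = integral {s..r} (%\<sigma>. ip (x t) (v \<sigma>) - ip (y \<sigma>) (u t)))" for t
      have "AE t in lebesgue_on {0..T}. good t" using eq_u by (simp add: good_def)
      then obtain Z where Z: "negligible Z" "\<And>t. t \<in> {0..T} ==> t \<notin> Z ==> good t"
        by (elim AE_E3) (auto simp: null_sets_restrict_space negligible_iff_null_sets)
      \<comment> \<open>The first equation may be tested with \<open>u\<close> only at good times
        and is needed at \<open>t\<close> as well as at \<open>t + h\<close>, so the exceptional set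
        is removed together with its translate.\<close>
      have "negligible ((Z \<union> (+) (- h) ` Z) \<inter> {0..R - h})"
        by (rule negligible_subset[OF negligible_Un[OF Z(1) negligible_translation[OF Z(1), of "- h"]]]) blast
      then have "AE t in lebesgue_on {0..R - h}. t \<notin> (Z \<union> (+) (- h) ` Z) \<inter> {0..R - h}"
        by (intro AE_not_in) (auto simp: null_sets_restrict_space negligible_iff_null_sets[symmetric])
      then have "AE t in lebesgue_on {0..R - h}. good t \<and> good (t + h)"
      proof (rule lebesgue_on_mono)
        fix t assume t: "t \<notin> (Z \<union> (+) (- h) ` Z) \<inter> {0..R - h}" "t \<in> {0..R - h}"
        then have "t \<notin> Z" "t + h \<notin> Z" by (auto simp: image_iff)
        then show "good t \<and> good (t + h)" using Z(2) t R h by auto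
      qed
      then show "AE t in lebesgue_on {0..R - h}. \<bar>\<Psi> (t + h) - \<Psi> t - h * f (t + h) - h * f t\<bar>
          \<le> \<delta> * (h * g' (t + h) + h * g' t + integral {t..t + h} g')"
      proof (rule lebesgue_on_mono)
        fix t assume gt: "good t \<and> good (t + h)" and "t \<in> {0..R - h}"
        then have t: "0 \<le> t" "t \<le> t + h" "t + h \<le> T" "t \<in> {0..T}" "t + h \<in> {0..T}" using R h by auto
        have sub: "{t..t + h} \<subseteq> {0..T}" using t by auto
        note mt = m[OF t(4)] m[OF t(5)]
        let ?I = "%\<phi>. integral {t..t + h} \<phi>"
        have ix: "(%\<sigma>. ip (x \<sigma>) w) integrable_on {t..t + h}" if "w \<in> X" for w
          using x_int[OF that] t integrable_subinterval_real[of _ 0 T t "t + h"]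
          by (auto simp: integrable_lebesgue_on_Icc_iff)
        have ic: "(%\<sigma>. ip (z \<sigma>) w) integrable_on {t..t + h}" if "cont_curve T z" "w \<in> X" for w z
          using that sub
          by (intro integrable_continuous_interval continuous_on_subset[OF continuous_on_ip_curve[of T z w]])
        have ic': "(%\<sigma>. ip w (z \<sigma>)) integrable_on {t..t + h}" if "cont_curve T z" "w \<in> X" for w z
        proof -
          have "(%\<sigma>. ip (z \<sigma>) w) integrable_on {t..t + h}" by (rule ic[OF that])
          then show ?thesis
            by (rule integrable_eq) (use that sub in \<open>auto intro!: ip_sym intro: cont_curve_mem[OF that(1)]\<close>)
        qed
        have fi': "f integrable_on {t..t + h}" "k integrable_on {t..t + h}" "g integrable_on {t..t + h}"
          using fi t by (auto intro: integrable_subinterval_real)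
        define J where "J \<sigma> = (ip (x (t + h)) (v \<sigma>) - ip (y \<sigma>) (u (t + h))) + (ip (x t) (v \<sigma>) - ip (y \<sigma>) (u t))
           - (ip (x \<sigma>) (v (t + h)) + ip (y' \<sigma>) (v (t + h))) - (ip (x \<sigma>) (v t) + ip (y' \<sigma>) (v t))" for \<sigma>
        have Ji: "J integrable_on {t..t + h}"
          unfolding J_def using mt u v y y'
          by (intro Henstock_Kurzweil_Integration.integrable_diff Henstock_Kurzweil_Integration.integrable_add ix ic ic')
        \<comment> \<open>Symmetric form of a difference of squares. Each increment is paired with
          the values at both ends of the step, which are admissible fixed elements for the
          respective equation.\<close>
        have "E (t + h) - E t = ip (%i. u (t + h) i - u t i) (u (t + h)) + ip (%i. u (t + h) i - u t i) (u t)
            + \<epsilon> * ip (%i. v (t + h) i - v t i) (v (t + h)) + \<epsilon> * ip (%i. v (t + h) i - v t i) (v t)"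
          using mt ip_sym[of "u t" "u (t + h)"] ip_sym[of "v t" "v (t + h)"] unfolding E_def
          by (simp add: ip_diff_left right_diff_distrib)
        also have "\<dots> = ?I (%\<sigma>. ip (x (t + h)) (v \<sigma>) - ip (y \<sigma>) (u (t + h))) + ?I (%\<sigma>. ip (x t) (v \<sigma>) - ip (y \<sigma>) (u t))
            - ?I (%\<sigma>. ip (x \<sigma>) (v (t + h)) + ip (y' \<sigma>) (v (t + h))) - ?I (%\<sigma>. ip (x \<sigma>) (v t) + ip (y' \<sigma>) (v t))"
          using gt t eq_v[of "v t" t "t + h"] eq_v[of "v (t + h)" t "t + h"] mt by (simp add: good_def)
        also have "\<dots> = ?I J"
          unfolding J_def using mt u v y y'
          by (intro integral_unique[symmetric] has_integral_diff has_integral_add integrable_integral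
              Henstock_Kurzweil_Integration.integrable_diff Henstock_Kurzweil_Integration.integrable_add ix ic ic')
        finally have dE: "E (t + h) - E t = ?I J" .
        have "\<Psi> (t + h) - \<Psi> t - h * f (t + h) - h * f t
            = ?I J + 2 * ?I f + 2 * ?I k - h * f (t + h) - h * f t"
          using integral_Icc_diff[OF fi(1), of t "t + h"] integral_Icc_diff[OF fi(2), of t "t + h"] t dE
          by (simp add: \<Psi>_def)
        also have "\<dots> = ?I (%\<sigma>. J \<sigma> + 2 * f \<sigma> + 2 * k \<sigma> - (f (t + h) + f t))"
        proof -
          have "((%\<sigma>. J \<sigma> + 2 * f \<sigma> + 2 * k \<sigma> - (f (t + h) + f t)) has_integral
              (?I J + 2 * ?I f + 2 * ?I k - (t + h - t) *\<^sub>R (f (t + h) + f t))) {t..t + h}"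
            using Ji fi' t
            by (intro has_integral_diff has_integral_add has_integral_mult_right integrable_integral
                has_integral_const_real[of _ t "t + h", simplified content_real[OF t(2)]])
          from integral_unique[OF this] show ?thesis by (simp add: algebra_simps)
        qed
        finally have eq: "\<Psi> (t + h) - \<Psi> t - h * f (t + h) - h * f t
            = ?I (%\<sigma>. J \<sigma> + 2 * f \<sigma> + 2 * k \<sigma> - (f (t + h) + f t))" .
        have "norm (?I (%\<sigma>. J \<sigma> + 2 * f \<sigma> + 2 * k \<sigma> - (f (t + h) + f t)))
            \<le> ?I (%\<sigma>. \<delta> * (g (t + h) + g t + 2 * g \<sigma> + 2 * (Y + Y')))"
        proof (rule integral_norm_bound_integral)
          show "(%\<sigma>. J \<sigma> + 2 * f \<sigma> + 2 * k \<sigma> - (f (t + h) + f t)) integrable_on {t..t + h}"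
            using Ji fi' by (intro Henstock_Kurzweil_Integration.integrable_diff Henstock_Kurzweil_Integration.integrable_add
                integrable_on_cmult_left[of _ _ "2::real", simplified] integrable_const_ivl) auto
          show "(%\<sigma>. \<delta> * (g (t + h) + g t + 2 * g \<sigma> + 2 * (Y + Y'))) integrable_on {t..t + h}"
            using fi' by (intro Henstock_Kurzweil_Integration.integrable_add
                integrable_on_mult_right integrable_const_ivl) auto
          fix \<sigma> assume "\<sigma> \<in> {t..t + h}"
          then have \<sigma>: "\<sigma> \<in> {0..T}" "\<bar>\<sigma> - t\<bar> \<le> h" "\<bar>t + h - \<sigma>\<bar> \<le> h" using t by auto
          have hd: "h < d1" "h < d2" using h by auto
          note ms = m[OF \<sigma>(1)]
          have nu: "nrm (%i. u (t + h) i - u \<sigma> i) \<le> \<delta>" "nrm (%i. u t i - u \<sigma> i) \<le> \<delta>"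
            using d1(2)[of "t + h" \<sigma>] d1(2)[of t \<sigma>] \<sigma> t hd by (auto simp: abs_minus_commute)
          have nv: "nrm (%i. v (t + h) i - v \<sigma> i) \<le> \<delta>" "nrm (%i. v t i - v \<sigma> i) \<le> \<delta>"
            using d2(2)[of "t + h" \<sigma>] d2(2)[of t \<sigma>] \<sigma> t hd by (auto simp: abs_minus_commute)
          have bound: "\<bar>ip a (%i. b i - c i)\<bar> \<le> \<delta> * K"
            if "a \<in> X" "b \<in> X" "c \<in> X" "nrm a \<le> K" "nrm (%i. b i - c i) \<le> \<delta>" for a b c K
          proof -
            have "\<bar>ip a (%i. b i - c i)\<bar> \<le> nrm a * nrm (%i. b i - c i)"
              using that by (intro cauchy_schwarz diff_mem)
            also have "\<dots> \<le> K * \<delta>"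
              using that nrm_nonneg[OF that(1)] nrm_nonneg[OF diff_mem[OF that(2,3)]] by (intro mult_mono) auto
            finally show ?thesis by (simp add: mult.commute)
          qed
          \<comment> \<open>The pairings at equal times cancel; every remaining term contains an
            increment of \<open>u\<close> or \<open>v\<close> over a time of at most
            \<open>h\<close>, which is smaller than \<open>\<delta>\<close> by uniform
            continuity.\<close>
          have J_eq: "J \<sigma> + 2 * f \<sigma> + 2 * k \<sigma> - (f (t + h) + f t)
              = - ip (x (t + h)) (%i. v (t + h) i - v \<sigma> i) - ip (x t) (%i. v t i - v \<sigma> i)
                - ip (y \<sigma>) (%i. u (t + h) i - u \<sigma> i) - ip (y \<sigma>) (%i. u t i - u \<sigma> i)
                - ip (x \<sigma>) (%i. v (t + h) i - v \<sigma> i) - ip (x \<sigma>) (%i. v t i - v \<sigma> i)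
                - ip (y' \<sigma>) (%i. v (t + h) i - v \<sigma> i) - ip (y' \<sigma>) (%i. v t i - v \<sigma> i)"
            unfolding J_def f_def k_def using mt ms by (simp add: ip_diff_right algebra_simps)
          have bounds: "\<bar>ip (x (t + h)) (%i. v (t + h) i - v \<sigma> i)\<bar> \<le> \<delta> * g (t + h)"
            "\<bar>ip (x t) (%i. v t i - v \<sigma> i)\<bar> \<le> \<delta> * g t"
            "\<bar>ip (y \<sigma>) (%i. u (t + h) i - u \<sigma> i)\<bar> \<le> \<delta> * Y" "\<bar>ip (y \<sigma>) (%i. u t i - u \<sigma> i)\<bar> \<le> \<delta> * Y"
            "\<bar>ip (x \<sigma>) (%i. v (t + h) i - v \<sigma> i)\<bar> \<le> \<delta> * g \<sigma>" "\<bar>ip (x \<sigma>) (%i. v t i - v \<sigma> i)\<bar> \<le> \<delta> * g \<sigma>"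
            "\<bar>ip (y' \<sigma>) (%i. v (t + h) i - v \<sigma> i)\<bar> \<le> \<delta> * Y'" "\<bar>ip (y' \<sigma>) (%i. v t i - v \<sigma> i)\<bar> \<le> \<delta> * Y'"
            by (intro bound mt ms nu nv xg[OF t(4)] xg[OF t(5)] xg[OF \<sigma>(1)] Y(2)[OF \<sigma>(1)] Y'(2)[OF \<sigma>(1)])+
          show "norm (J \<sigma> + 2 * f \<sigma> + 2 * k \<sigma> - (f (t + h) + f t))
              \<le> \<delta> * (g (t + h) + g t + 2 * g \<sigma> + 2 * (Y + Y'))"
            using bounds[THEN abs_le_D1] bounds[THEN abs_le_D2]
            unfolding real_norm_def J_eq distrib_left by (intro abs_leI) linarith+
        qed
        also have "\<dots> = \<delta> * (h * g (t + h) + h * g t + ?I g')"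
        proof -
          have "((%\<sigma>. \<delta> * (g (t + h) + g t + g' \<sigma>)) has_integral
              \<delta> * ((t + h - t) *\<^sub>R (g (t + h) + g t) + ?I g')) {t..t + h}"
            using fi' t unfolding g'_def
            by (intro has_integral_add has_integral_mult_right integrable_integral
                has_integral_const_real[of _ t "t + h", simplified content_real[OF t(2)]]
                Henstock_Kurzweil_Integration.integrable_add integrable_on_mult_right integrable_const_ivl) auto
          from integral_unique[OF this] show ?thesis by (simp add: g'_def algebra_simps)
        qed
        also have "\<dots> \<le> \<delta> * (h * g' (t + h) + h * g' t + ?I g')"
        proof -
          have "g s \<le> g' s" if "s \<in> {0..T}" for s
            using g0[OF that] Y(1) Y'(1) by (simp add: g'_def)
          then show ?thesis
            using t h \<delta> by (intro mult_left_mono add_mono) auto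
        qed
        finally show "\<bar>\<Psi> (t + h) - \<Psi> t - h * f (t + h) - h * f t\<bar>
            \<le> \<delta> * (h * g' (t + h) + h * g' t + integral {t..t + h} g')"
          unfolding eq by simp
      qed
    qed (use d1 d2 in auto)
  qed
  then have "E R - E 0 = - 2 * integral {0..R} k"
    by (simp add: \<Psi>_def)
  then show ?thesis by (simp add: E_def k_def [abs_def])
qed simp

end

section \<open>Square integrability of weak time derivatives\<close>

context semi_inner
begin

text \<open>The weak derivative \<open>- z / \<epsilon>\<close> of \<open>v\<close> is bounded
  through difference quotients. At common Lebesgue points of the countably many functions
  \<open>ip (z t) (\<omega> k)\<close> the quotients converge to it when paired with elements of the
  span of the \<open>\<omega> k\<close>; the norming hypothesis recovers the norm, and Fatou's lemma
  transfers the integral bound. The conclusion is a nonnegative integral, which makes sense before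
  the norm of \<open>z\<close> is known to be measurable.\<close>

lemma weak_curve_L2_bound:
  fixes \<omega> :: "'k \<Rightarrow> 'i \<Rightarrow> real" and \<epsilon> C T :: real
  assumes J: "countable J" "\<And>k. k \<in> J ==> \<omega> k \<in> X"
    and norming: "\<And>y c. y \<in> X ==> 0 \<le> c ==>
      (\<And>K a. finite K ==> K \<subseteq> J ==>
         \<bar>ip y (%i. \<Sum>k\<in>K. a k * \<omega> k i)\<bar> \<le> c * nrm (%i. \<Sum>k\<in>K. a k * \<omega> k i)) ==> nrm y \<le> c"
    and v: "cont_curve T v" and T: "0 < T" and \<epsilon>: "0 < \<epsilon>"
    and z: "\<And>t. t \<in> {0..T} ==> z t \<in> X"
    and z_int: "\<And>w. w \<in> X ==> integrable (lebesgue_on {0..T}) (%t. ip (z t) w)"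
    and eq: "\<And>w s r. w \<in> X ==> 0 \<le> s ==> s \<le> r ==> r \<le> T ==>
       \<epsilon> * ip (%i. v r i - v s i) w = - integral {s..r} (%\<sigma>. ip (z \<sigma>) w)"
    and diff_quot: "\<And>h. 0 < h ==> h < T ==>
       integral {0..T - h} (%t. ip (%i. v (t + h) i - v t i) (%i. v (t + h) i - v t i)) \<le> C * h^2"
  shows "(\<integral>\<^sup>+t. ennreal (ip (z t) (z t)) \<partial>lebesgue_on {0..T}) \<le> ennreal (\<epsilon>^2 * C)"
proof -
  define h where "h n = T / (real n + 2)" for n :: nat
  have h: "0 < h n" "h n < T" for n
    using T by (auto simp: h_def divide_less_eq)
  have h0: "filterlim h (at_right 0) sequentially"
  proof -
    have "h \<longlonglongrightarrow> 0" unfolding h_def by real_asymp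
    then show ?thesis unfolding filterlim_at using h by (auto simp: less_imp_neq[THEN not_sym])
  qed
  let ?\<delta> = "%n t i. v (t + h n) i - v t i"
  \<comment> \<open>Squared difference quotient, set to zero on the last piece, where
    \<open>t + h n\<close> would leave the interval.\<close>
  define q where "q n t = (if t \<in> {0..T - h n} then ip (?\<delta> n t) (?\<delta> n t) / (h n)^2 else 0)" for n t
  have dc: "cont_curve (T - h n) (?\<delta> n)" for n
    using h[of n] continuous_curve_mono[OF v, of "T - h n"]
    by (intro cont_curve_diff continuous_curve_shift[OF v]) auto
  have qc: "continuous_on {0..T - h n} (%t. ip (?\<delta> n t) (?\<delta> n t) / (h n)^2)" for n
    using h[of n] by (intro continuous_intros continuous_on_ip_curves dc) auto
  have q_meas: "q n \<in> borel_measurable (lebesgue_on {0..T})" for n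
    unfolding q_def using h[of n]
    by (subst borel_measurable_if_lebesgue_on)
      (auto intro!: continuous_imp_measurable_on_sets_lebesgue[OF qc])
  have q_nonneg: "0 \<le> q n t" for n t
    using cont_curve_mem[OF dc, of t n] by (auto simp: q_def intro!: divide_nonneg_nonneg ip_nonneg)
  define \<gamma> where "\<gamma> t = liminf (%n. ennreal (q n t))" for t
  have q_int: "(\<integral>\<^sup>+t. ennreal (q n t) \<partial>lebesgue_on {0..T}) \<le> ennreal C" for n
  proof -
    have ci: "(%t. ip (?\<delta> n t) (?\<delta> n t) / (h n)^2) integrable_on {0..T - h n}"
      by (rule integrable_continuous_interval[OF qc])
    have sub: "{0..T - h n} \<subseteq> {0..T}" using h[of n] by auto
    have "(q n has_integral integral {0..T - h n} (%t. ip (?\<delta> n t) (?\<delta> n t) / (h n)^2)) {0..T}"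
      unfolding q_def has_integral_restrict[OF sub] using ci by (rule integrable_integral)
    then have qi: "q n integrable_on {0..T}" "integral {0..T} (q n) = integral {0..T - h n} (%t. ip (?\<delta> n t) (?\<delta> n t) / (h n)^2)"
      by (auto simp: has_integral_iff)
    have "integrable (lebesgue_on {0..T}) (q n)"
      using qi q_nonneg by (simp add: integrable_lebesgue_on_Icc_iff)
    then have "(\<integral>\<^sup>+t. ennreal (q n t) \<partial>lebesgue_on {0..T}) = ennreal (integral {0..T} (q n))"
      using q_nonneg by (subst nn_integral_eq_integral) (auto simp: lebesgue_integral_eq_integral)
    also have "\<dots> \<le> ennreal C"
      unfolding qi(2) using diff_quot[OF h(1)[of n] h(2)] h(1)[of n] by (intro ennreal_leI) (simp add: divide_le_eq)
    finally show ?thesis .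
  qed
  have "(\<integral>\<^sup>+t. \<gamma> t \<partial>lebesgue_on {0..T}) \<le> liminf (%n. \<integral>\<^sup>+t. ennreal (q n t) \<partial>lebesgue_on {0..T})"
    unfolding \<gamma>_def using q_meas by (intro nn_integral_liminf) simp
  also have "\<dots> \<le> ennreal C"
    using q_int by (intro Liminf_le) (auto intro: always_eventually)
  finally have \<gamma>_int: "(\<integral>\<^sup>+t. \<gamma> t \<partial>lebesgue_on {0..T}) \<le> ennreal C" .
  have \<gamma>_meas: "\<gamma> \<in> borel_measurable (lebesgue_on {0..T})"
    unfolding \<gamma>_def using q_meas by measurable
  have "AE t in lebesgue_on {0..T}. \<forall>k\<in>J. ((%h. integral {t..t + h} (%\<sigma>. ip (z \<sigma>) (\<omega> k)) / h) \<longlongrightarrow> ip (z t) (\<omega> k)) (at_right 0)"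
    using J by (intro AE_ball_countable[THEN iffD2] ballI lebesgue_differentiation_right z_int) auto
  moreover have "AE t in lebesgue_on {0..T}. t \<noteq> T"
    by (rule AE_I'[of "{T} \<inter> {0..T}"])
      (auto simp: null_sets_restrict_space negligible_iff_null_sets[symmetric] negligible_Int)
  ultimately have "AE t in lebesgue_on {0..T}. t \<noteq> T \<and>
      (\<forall>k\<in>J. ((%h. integral {t..t + h} (%\<sigma>. ip (z \<sigma>) (\<omega> k)) / h) \<longlongrightarrow> ip (z t) (\<omega> k)) (at_right 0))"
    by (simp add: AE_conj_iff)
  then have "AE t in lebesgue_on {0..T}. ennreal (ip (z t) (z t)) \<le> ennreal (\<epsilon>^2) * \<gamma> t"
  proof (rule lebesgue_on_mono)
    fix t assume t: "t \<noteq> T \<and> (\<forall>k\<in>J. ((%h. integral {t..t + h} (%\<sigma>. ip (z \<sigma>) (\<omega> k)) / h) \<longlongrightarrow> ip (z t) (\<omega> k)) (at_right 0))"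
      and tT: "t \<in> {0..T}"
    note zt = z[OF tT]
    \<comment> \<open>\<open>\<gamma> t\<close> may be infinite; a real number \<open>r\<close>
      above it allows real arithmetic, and a density argument returns to \<open>\<gamma> t\<close>
      afterwards.\<close>
    have le: "ip (z t) (z t) \<le> \<epsilon>^2 * r" if r: "\<gamma> t < ennreal r" for r
    proof -
      have r0: "0 < r" using r by (metis ennreal_neg linorder_not_le not_less_zero less_eq_real_def order_less_le_trans ennreal_0 zero_le)
      have "nrm (z t) \<le> \<epsilon> * sqrt r"
      proof (rule norming[OF zt])
        fix K a assume K: "finite K" "K \<subseteq> J"
        define w where "w = (%i. \<Sum>k\<in>K. a k * \<omega> k i)"
        have w: "w \<in> X" unfolding w_def using K J by (intro sum_mem) auto
        have zw: "ip (z \<sigma>) w = (\<Sum>k\<in>K. a k * ip (z \<sigma>) (\<omega> k))" if "\<sigma> \<in> {0..T}" for \<sigma>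
          unfolding w_def using K J z[OF that] by (intro ip_sum_right) auto
        have "((%h. \<Sum>k\<in>K. a k * (integral {t..t + h} (%\<sigma>. ip (z \<sigma>) (\<omega> k)) / h)) \<longlongrightarrow> (\<Sum>k\<in>K. a k * ip (z t) (\<omega> k))) (at_right 0)"
          using t K by (intro tendsto_sum tendsto_mult_left) auto
        then have lim: "(%n. \<Sum>k\<in>K. a k * (integral {t..t + h n} (%\<sigma>. ip (z \<sigma>) (\<omega> k)) / h n)) \<longlonglongrightarrow> ip (z t) w"
          unfolding zw[OF tT] by (rule filterlim_compose[OF _ h0])
        define x where "x n = (\<Sum>k\<in>K. a k * (integral {t..t + h n} (%\<sigma>. ip (z \<sigma>) (\<omega> k)) / h n))" for n
        have small: "\<forall>\<^sub>F n in sequentially. t + h n \<le> T"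
        proof -
          have "\<forall>\<^sub>F n in sequentially. h n < T - t"
            using h0 t tT by (auto simp: filterlim_at intro!: order_tendstoD)
          then show ?thesis by (rule eventually_mono) simp
        qed
        \<comment> \<open>The equation converts the averages of \<open>z\<close> into increments of
          \<open>v\<close>, and Cauchy-Schwarz bounds these by \<open>q n t\<close>.\<close>
        have x_le: "(x n)^2 \<le> \<epsilon>^2 * (nrm w)^2 * q n t" if n: "t + h n \<le> T" for n
        proof -
          have hn: "0 < h n" by (rule h)
          have mem: "t \<in> {0..T - h n}" using n tT by auto
          have "x n * h n = (\<Sum>k\<in>K. a k * integral {t..t + h n} (%\<sigma>. ip (z \<sigma>) (\<omega> k)))"
            using hn by (simp add: x_def sum_distrib_right)
          also have "\<dots> = (\<Sum>k\<in>K. a k * - (\<epsilon> * ip (?\<delta> n t) (\<omega> k)))"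
            using eq[of _ t "t + h n"] K J tT n hn by (intro sum.cong) auto
          also have "\<dots> = - \<epsilon> * (\<Sum>k\<in>K. a k * ip (?\<delta> n t) (\<omega> k))"
            by (simp add: sum_distrib_left algebra_simps flip: sum_negf)
          also have "(\<Sum>k\<in>K. a k * ip (?\<delta> n t) (\<omega> k)) = ip (?\<delta> n t) w"
            unfolding w_def using K J cont_curve_mem[OF dc mem] by (intro ip_sum_right[symmetric]) auto
          finally have e1: "(x n * h n)^2 = \<epsilon>^2 * (ip (?\<delta> n t) w)^2" by (simp add: power_mult_distrib)
          have "(ip (?\<delta> n t) w)^2 \<le> (nrm (?\<delta> n t) * nrm w)^2"
            using cauchy_schwarz[OF cont_curve_mem[OF dc mem] w]
            by (metis abs_ge_zero power2_abs power_mono)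
          also have "\<dots> = q n t * (h n)^2 * (nrm w)^2"
            using mem hn cont_curve_mem[OF dc mem] by (simp add: q_def power_mult_distrib nrm_power2)
          finally have "\<epsilon>^2 * (ip (?\<delta> n t) w)^2 \<le> \<epsilon>^2 * (q n t * (h n)^2 * (nrm w)^2)"
            by (rule mult_left_mono) simp
          then have "(x n)^2 * (h n)^2 \<le> (\<epsilon>^2 * (nrm w)^2 * q n t) * (h n)^2"
            unfolding e1[symmetric] by (simp add: power_mult_distrib mult_ac)
          then show ?thesis using hn by simp
        qed
        have "(ip (z t) w)^2 \<le> \<epsilon>^2 * (nrm w)^2 * r"
        proof (rule ccontr)
          assume neg: "\<not> (ip (z t) w)^2 \<le> \<epsilon>^2 * (nrm w)^2 * r"
          have "(%n. (x n)^2) \<longlonglongrightarrow> (ip (z t) w)^2"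
            using lim unfolding x_def by (rule tendsto_power)
          then have "\<forall>\<^sub>F n in sequentially. \<epsilon>^2 * (nrm w)^2 * r < (x n)^2"
            using neg by (intro order_tendstoD(1)) auto
          with small have "\<forall>\<^sub>F n in sequentially. ennreal r \<le> ennreal (q n t)"
          proof eventually_elim
            case (elim n)
            then have "(\<epsilon>^2 * (nrm w)^2) * r < (\<epsilon>^2 * (nrm w)^2) * q n t" using x_le[of n] by linarith
            then have "r \<le> q n t" by (simp add: mult_less_cancel_left)
            then show ?case by (rule ennreal_leI)
          qed
          then have "ennreal r \<le> \<gamma> t" unfolding \<gamma>_def by (rule Liminf_bounded)
          then show False using r by simp
        qed
        then have "sqrt ((ip (z t) w)^2) \<le> sqrt (\<epsilon>^2 * (nrm w)^2 * r)" by (rule real_sqrt_le_mono)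
        then show "\<bar>ip (z t) (%i. \<Sum>k\<in>K. a k * \<omega> k i)\<bar> \<le> \<epsilon> * sqrt r * nrm (%i. \<Sum>k\<in>K. a k * \<omega> k i)"
          using \<epsilon> nrm_nonneg[OF w] by (simp add: real_sqrt_mult w_def mult_ac)
      qed (use \<epsilon> r0 in auto)
      then have "(nrm (z t))^2 \<le> (\<epsilon> * sqrt r)^2"
        using nrm_nonneg[OF zt] by (intro power_mono)
      then show ?thesis using r0 nrm_power2[OF zt] by (simp add: power_mult_distrib)
    qed
    show "ennreal (ip (z t) (z t)) \<le> ennreal (\<epsilon>^2) * \<gamma> t"
    proof (rule ccontr)
      assume neg: "\<not> ennreal (ip (z t) (z t)) \<le> ennreal (\<epsilon>^2) * \<gamma> t"
      have "\<gamma> t < ennreal (ip (z t) (z t) / \<epsilon>^2)"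
      proof (rule ccontr)
        assume "\<not> \<gamma> t < ennreal (ip (z t) (z t) / \<epsilon>^2)"
        then have "ennreal (\<epsilon>^2) * ennreal (ip (z t) (z t) / \<epsilon>^2) \<le> ennreal (\<epsilon>^2) * \<gamma> t"
          by (intro mult_left_mono) auto
        then show False using neg \<epsilon> ip_nonneg[OF zt] by (simp flip: ennreal_mult)
      qed
      then obtain y where y: "\<gamma> t < y" "y < ennreal (ip (z t) (z t) / \<epsilon>^2)" using dense by blast
      then obtain r where r: "y = ennreal r" "0 \<le> r" by (cases y) auto
      have "r < ip (z t) (z t) / \<epsilon>^2" using y(2) r by (simp add: ennreal_less_iff)
      then have "\<epsilon>^2 * r < ip (z t) (z t)" using \<epsilon> by (simp add: field_simps)
      then show False using le[of r] y(1) r by simp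
    qed
  qed
  then have "(\<integral>\<^sup>+t. ennreal (ip (z t) (z t)) \<partial>lebesgue_on {0..T}) \<le> (\<integral>\<^sup>+t. ennreal (\<epsilon>^2) * \<gamma> t \<partial>lebesgue_on {0..T})"
    by (rule nn_integral_mono_AE)
  also have "\<dots> = ennreal (\<epsilon>^2) * (\<integral>\<^sup>+t. \<gamma> t \<partial>lebesgue_on {0..T})"
    by (rule nn_integral_cmult[OF \<gamma>_meas])
  also have "\<dots> \<le> ennreal (\<epsilon>^2) * ennreal C"
    by (intro mult_left_mono \<gamma>_int) simp
  also have "\<dots> = ennreal (\<epsilon>^2 * C)"
    by (simp add: ennreal_mult')
  finally show ?thesis .
qed

end

section \<open>Step functions on uniform partitions of the edges\<close>

lemma LINT_indicator_Ico:
  fixes w :: "real \<Rightarrow> real"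
  assumes w: "integrable (lebesgue_on {a..b}) w" and st: "a \<le> s" "s \<le> t" "t \<le> b"
  shows "(LINT x|lebesgue_on {a..b}. w x * indicator {s..<t} x) = integral {s..t} w"
proof -
  have "integrable (lebesgue_on {a..b}) (%x. w x * indicator {s..<t} x)"
    using w st by (intro integrable_mult_indicator[of _ "lebesgue_on {a..b}" w, simplified mult.commute[of "indicator _ _"] real_scaleR_def])
       (auto simp: sets_restrict_space_iff)
  then have "(LINT x|lebesgue_on {a..b}. w x * indicator {s..<t} x) = integral {a..b} (%x. w x * indicator {s..<t} x)"
    by (simp add: lebesgue_integral_eq_integral)
  also have "\<dots> = integral {a..b} (%x. if x \<in> {s..<t} then w x else 0)"
    by (intro Henstock_Kurzweil_Integration.integral_cong) (auto simp: indicator_def)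
  also have "\<dots> = integral {s..<t} w"
    using st by (intro integral_restrict_subset) auto
  also have "\<dots> = integral {s..t} w"
    by (rule integral_spike_set; rule negligible_subset[of "{t}"]) auto
  finally show ?thesis .
qed

text \<open>Half-open pieces make the cells of one partition disjoint, so every point of an edge
  except its head lies in exactly one of the \<open>n\<close> cells. All cells together form the
  countable family required by \<open>weak_curve_L2_bound\<close>.\<close>

definition cell :: "('v, 'e) network \<Rightarrow> 'e \<times> nat \<times> nat \<Rightarrow> 'e edge_fun" where
  "cell N = (%(e, n, i) (e', x).
     if e' = e then indicator {real i * edge_len N e / real n..<(real i + 1) * edge_len N e / real n} x else 0)"

lemma cell_mem_L2: "cell N k \<in> L2 N"
proof -
  obtain e n i where k: "k = (e, n, i)" by (cases k)
  have "integrable (lebesgue_on {0..l}) (indicat_real {a..<b})" for l a b :: real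
  proof (rule Bochner_Integration.integrable_bound[of _ "%_. 1::real"])
    show "integrable (lebesgue_on {0..l}) (%_. 1::real)"
      using integrable_const_ivl[of 0 l "1::real"] by simp
    show "indicat_real {a..<b} \<in> borel_measurable (lebesgue_on {0..l})"
      by (rule measurable_restrict_space1) (rule borel_measurable_indicator, simp)
  qed (simp add: indicator_def)
  then have "(%x. indicat_real {a..<b} x) \<in> L2_interval 0 l" for l a b :: real
    by (auto simp: L2_interval_def power2_eq_square intro: borel_measurable_integrable simp flip: indicator_inter_arith)
  moreover have "(%x. 0) \<in> L2_interval 0 l" for l by (simp add: L2_interval_def)
  ultimately have "(%x. if e' = e then indicat_real {a..<b} x else 0) \<in> L2_interval 0 l" for e' a b l
    by (cases "e' = e") auto
  then show ?thesis
    unfolding L2_def by (simp add: cell_def k)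
qed

lemma L2_inner_cell:
  assumes N: "wf_network N" and y: "y \<in> L2 N" and e: "e \<in> edges N" and i: "i < n"
  shows "L2_inner N y (cell N (e, n, i))
     = integral {real i * edge_len N e / real n..(real i + 1) * edge_len N e / real n} (%x. y (e, x))"
proof -
  let ?l = "edge_len N e"
  have l: "0 < ?l" using wf_networkD(3)[OF N e] .
  have "L2_inner N y (cell N (e, n, i)) = (\<Sum>e'\<in>edges N. if e' = e then
      (LINT x|lebesgue_on {0..?l}. y (e, x) * indicator {real i * ?l / real n..<(real i + 1) * ?l / real n} x) else 0)"
    unfolding L2_inner_def by (intro sum.cong) (auto simp: cell_def)
  also have "\<dots> = (LINT x|lebesgue_on {0..?l}. y (e, x) * indicator {real i * ?l / real n..<(real i + 1) * ?l / real n} x)"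
    using wf_networkD(1)[OF N] e by simp
  also have "\<dots> = integral {real i * ?l / real n..(real i + 1) * ?l / real n} (%x. y (e, x))"
  proof (rule LINT_indicator_Ico)
    show "integrable (lebesgue_on {0..?l}) (%x. y (e, x))"
      by (rule L2_interval_integrable[OF L2D[OF y e]])
    show "0 \<le> real i * ?l / real n" "real i * ?l / real n \<le> (real i + 1) * ?l / real n"
      using l by (auto simp: divide_right_mono)
    have "(real i + 1) * ?l \<le> real n * ?l" using i l by (intro mult_right_mono) auto
    then show "(real i + 1) * ?l / real n \<le> ?l" using i by (simp add: divide_le_eq mult.commute)
  qed
  finally show ?thesis .
qed

lemma L2_inner_cell_cell:
  assumes N: "wf_network N" and e: "e \<in> edges N" and i: "i < n"
  shows "L2_inner N (cell N (e', n, j)) (cell N (e, n, i)) = (if e' = e \<and> i = j then edge_len N e / real n else 0)"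
proof -
  let ?l = "edge_len N e"
  have l: "0 < ?l" using wf_networkD(3)[OF N e] .
  have n: "0 < real n" using i by simp
  let ?I = "{real i * ?l / real n..(real i + 1) * ?l / real n}"
  have "L2_inner N (cell N (e', n, j)) (cell N (e, n, i)) = integral ?I (%x. cell N (e', n, j) (e, x))"
    by (rule L2_inner_cell[OF N cell_mem_L2 e i])
  also have "\<dots> = integral ?I (%x. if e' = e \<and> i = j then 1 else 0)"
  proof (rule integral_spike[of "{real i * ?l / real n, (real i + 1) * ?l / real n}"])
    fix x assume x: "x \<in> ?I - {real i * ?l / real n, (real i + 1) * ?l / real n}"
    have "i = j" if "real j * ?l / real n \<le> x" "x < (real j + 1) * ?l / real n"
    proof -
      have "real j * ?l / real n < (real i + 1) * ?l / real n" "real i * ?l / real n < (real j + 1) * ?l / real n"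
        using that x by auto
      then have "real j < real i + 1" "real i < real j + 1"
        using l n by (auto simp: divide_less_cancel)
      then show ?thesis by linarith
    qed
    then show "(if e' = e \<and> i = j then 1 else 0) = cell N (e', n, j) (e, x)"
      using x by (auto simp: cell_def indicator_def)
  qed auto
  also have "\<dots> = (if e' = e \<and> i = j then edge_len N e / real n else 0)"
    using l n by (auto simp: divide_right_mono field_simps)
  finally show ?thesis .
qed

text \<open>The cell containing \<open>x\<close> is split at \<open>x\<close> into a part of length
  \<open>\<alpha>\<close> on the left and one of length \<open>\<beta>\<close> on the right. Each
  part is handled by a one-sided Lebesgue limit, and the errors add up in proportion to the
  lengths.\<close>

lemma cell_averages_tendsto:
  fixes y :: "real \<Rightarrow> real"
  assumes l: "0 < l" and x: "0 \<le> x" "x < l" and yi: "y integrable_on {0..l}"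
    and right: "((%h. integral {x..x + h} y / h) \<longlongrightarrow> y x) (at_right 0)"
    and left: "((%h. integral {x - h..x} y / h) \<longlongrightarrow> y x) (at_right 0)"
  shows "(%n. integral {real (nat \<lfloor>x * real (Suc n) / l\<rfloor>) * l / real (Suc n)
       ..(real (nat \<lfloor>x * real (Suc n) / l\<rfloor>) + 1) * l / real (Suc n)} y * (real (Suc n) / l)) \<longlonglongrightarrow> y x"
proof (rule LIMSEQ_I)
  fix r :: real assume r: "0 < r"
  obtain d1 where d1: "0 < d1" "\<And>h. 0 < h ==> h < d1 ==> \<bar>integral {x..x + h} y / h - y x\<bar> < r / 2"
    using tendstoD[OF right, of "r / 2"] r unfolding eventually_at_right_field dist_real_def by auto
  obtain d2 where d2: "0 < d2" "\<And>h. 0 < h ==> h < d2 ==> \<bar>integral {x - h..x} y / h - y x\<bar> < r / 2"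
    using tendstoD[OF left, of "r / 2"] r unfolding eventually_at_right_field dist_real_def by auto
  obtain n0 :: nat where n0: "l / min d1 d2 < real n0" using reals_Archimedean2 by blast
  show "\<exists>no. \<forall>n\<ge>no. norm (integral {real (nat \<lfloor>x * real (Suc n) / l\<rfloor>) * l / real (Suc n)
       ..(real (nat \<lfloor>x * real (Suc n) / l\<rfloor>) + 1) * l / real (Suc n)} y * (real (Suc n) / l) - y x) < r"
  proof (intro exI[of _ n0] allI impI)
    fix n assume n: "n0 \<le> n"
    define m where "m = real (Suc n)"
    define i where "i = real (nat \<lfloor>x * m / l\<rfloor>)"
    have m: "0 < m" "l / m < min d1 d2"
    proof -
      show "0 < m" by (simp add: m_def)
      have "l / min d1 d2 < m" using n0 n by (simp add: m_def)
      then show "l / m < min d1 d2"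
        using l d1(1) d2(1) \<open>0 < m\<close> by (metis divide_less_eq min_less_iff_conj mult.commute)
    qed
    have i: "i \<le> x * m / l" "x * m / l < i + 1" "0 \<le> i"
      using x l m by (auto simp: i_def intro: of_nat_floor)
    define \<alpha> \<beta> where "\<alpha> = x - i * l / m" and "\<beta> = (i + 1) * l / m - x"
    have ab: "0 \<le> \<alpha>" "0 < \<beta>" "\<alpha> + \<beta> = l / m"
      using i m l by (auto simp: \<alpha>_def \<beta>_def field_simps)
    have "i * l / m = x - \<alpha>" "(i + 1) * l / m = x + \<beta>" by (auto simp: \<alpha>_def \<beta>_def)
    have i_le: "x + \<beta> \<le> l"
    proof -
      have "i < m" using i(1) x(2) l m(1) by (smt (verit) divide_less_eq mult.commute mult_less_cancel_left_pos)
      then have "nat \<lfloor>x * m / l\<rfloor> < Suc n" by (simp add: i_def m_def)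
      then have "i + 1 \<le> m" by (simp add: i_def m_def)
      then have "(i + 1) * l \<le> m * l" using l by (intro mult_right_mono) auto
      then show ?thesis using m(1) by (simp add: \<beta>_def divide_le_eq mult.commute)
    qed
    have i_ge: "0 \<le> x - \<alpha>" using i l m by (simp add: \<alpha>_def)
    have comb: "integral {x - \<alpha>..x + \<beta>} y = integral {x - \<alpha>..x} y + integral {x..x + \<beta>} y"
      using ab i_le i_ge
      by (intro Henstock_Kurzweil_Integration.integral_combine[symmetric] integrable_subinterval_real[OF yi]) auto
    \<comment> \<open>\<open>\<alpha>\<close> vanishes when \<open>x\<close> is the left end of its
      cell; \<open>\<beta>\<close> is always positive.\<close>
    have A: "\<bar>integral {x - \<alpha>..x} y - \<alpha> * y x\<bar> \<le> r / 2 * \<alpha>"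
    proof (cases "\<alpha> = 0")
      case False
      then have a: "0 < \<alpha>" using ab by simp
      then have "\<bar>integral {x - \<alpha>..x} y / \<alpha> - y x\<bar> < r / 2"
        using d2(2)[of \<alpha>] ab m by linarith
      then have "\<bar>integral {x - \<alpha>..x} y / \<alpha> - y x\<bar> * \<alpha> \<le> r / 2 * \<alpha>"
        using a by (intro mult_right_mono) auto
      then have "\<bar>(integral {x - \<alpha>..x} y / \<alpha> - y x) * \<alpha>\<bar> \<le> r / 2 * \<alpha>"
        using a by (simp add: abs_mult)
      moreover have "(integral {x - \<alpha>..x} y / \<alpha> - y x) * \<alpha> = integral {x - \<alpha>..x} y - \<alpha> * y x"
        using a by (simp add: field_simps)
      ultimately show ?thesis by simp
    qed simp
    have B: "\<bar>integral {x..x + \<beta>} y - \<beta> * y x\<bar> \<le> r / 2 * \<beta>"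
    proof -
      have "\<bar>integral {x..x + \<beta>} y / \<beta> - y x\<bar> < r / 2"
        using d1(2)[of \<beta>] ab m by linarith
      then have "\<bar>integral {x..x + \<beta>} y / \<beta> - y x\<bar> * \<beta> \<le> r / 2 * \<beta>"
        using ab by (intro mult_right_mono) auto
      then have "\<bar>(integral {x..x + \<beta>} y / \<beta> - y x) * \<beta>\<bar> \<le> r / 2 * \<beta>"
        using ab by (simp add: abs_mult)
      moreover have "(integral {x..x + \<beta>} y / \<beta> - y x) * \<beta> = integral {x..x + \<beta>} y - \<beta> * y x"
        using ab by (simp add: field_simps)
      ultimately show ?thesis by simp
    qed
    have "\<bar>integral {x - \<alpha>..x + \<beta>} y - (\<alpha> + \<beta>) * y x\<bar> \<le> r / 2 * (\<alpha> + \<beta>)"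
      using A B unfolding comb distrib_left distrib_right by linarith
    then have le: "\<bar>integral {x - \<alpha>..x + \<beta>} y - (\<alpha> + \<beta>) * y x\<bar> * (m / l) \<le> r / 2 * (\<alpha> + \<beta>) * (m / l)"
      using l m by (intro mult_right_mono) auto
    have one: "(\<alpha> + \<beta>) * (m / l) = 1" using ab l m by simp
    have eq: "\<bar>integral {x - \<alpha>..x + \<beta>} y - (\<alpha> + \<beta>) * y x\<bar> * (m / l)
        = \<bar>integral {x - \<alpha>..x + \<beta>} y * (m / l) - (\<alpha> + \<beta>) * (m / l) * y x\<bar>"
    proof -
      have "0 < m / l" using l m by simp
      then have "\<bar>integral {x - \<alpha>..x + \<beta>} y - (\<alpha> + \<beta>) * y x\<bar> * (m / l)
          = \<bar>(integral {x - \<alpha>..x + \<beta>} y - (\<alpha> + \<beta>) * y x) * (m / l)\<bar>"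
        unfolding abs_mult by (simp only: abs_of_pos)
      also have "(integral {x - \<alpha>..x + \<beta>} y - (\<alpha> + \<beta>) * y x) * (m / l)
          = integral {x - \<alpha>..x + \<beta>} y * (m / l) - (\<alpha> + \<beta>) * (m / l) * y x"
        unfolding left_diff_distrib by (simp only: mult_ac)
      finally show ?thesis .
    qed
    have "\<bar>integral {x - \<alpha>..x + \<beta>} y * (m / l) - y x\<bar> \<le> r / 2"
      using le unfolding eq mult.assoc[of "r / 2" "\<alpha> + \<beta>" "m / l"] one by simp
    then show "norm (integral {real (nat \<lfloor>x * real (Suc n) / l\<rfloor>) * l / real (Suc n)
       ..(real (nat \<lfloor>x * real (Suc n) / l\<rfloor>) + 1) * l / real (Suc n)} y * (real (Suc n) / l) - y x) < r"
      using r \<open>i * l / m = x - \<alpha>\<close> \<open>(i + 1) * l / m = x + \<beta>\<close> by (simp add: i_def m_def)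
  qed
qed

text \<open>
  The tests with the averages of \<open>y\<close> over the cells of the uniform partitions bound the norms of these
  averages, which converge to \<open>y\<close> almost everywhere.
\<close>

lemma L2_norm_le_by_cells:
  assumes N: "wf_network N" and y: "y \<in> L2 N" and c: "0 \<le> c"
    and test: "\<And>K a. finite K ==> K \<subseteq> edges N \<times> UNIV ==>
       \<bar>L2_inner N y (%z. \<Sum>k\<in>K. a k * cell N k z)\<bar> \<le> c * L2_norm N (%z. \<Sum>k\<in>K. a k * cell N k z)"
  shows "L2_norm N y \<le> c"
proof -
  note fin = wf_networkD(1)[OF N]
  note len = wf_networkD(3)[OF N]
  \<comment> \<open>The coefficient is the average of \<open>y\<close> over the cell, since a cell
    of the \<open>n\<close>-th partition has length \<open>edge_len N e / real n\<close>.\<close>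
  define a where "a = (%(e, n, i). L2_inner N y (cell N (e, n, i)) * (real n / edge_len N e))"
  define K where "K n = (%(e, i). (e, Suc n, i)) ` (edges N \<times> {..<Suc n})" for n :: nat
  define w where "w n = (%z. \<Sum>k\<in>K n. a k * cell N k z)" for n
  have K: "finite (K n)" "K n \<subseteq> edges N \<times> UNIV" for n
    using fin by (auto simp: K_def)
  have wL2: "w n \<in> L2 N" for n unfolding w_def by (intro L2.sum_mem cell_mem_L2)
  \<comment> \<open>Cells of one partition are orthogonal, so \<open>w n\<close> is the projection
    of \<open>y\<close> onto their span; testing with \<open>w n\<close> itself then bounds its norm
    by \<open>c\<close>.\<close>
  have yw: "L2_inner N y (w n) = L2_inner N (w n) (w n)" for n
  proof -
    have "L2_inner N (w n) (w n) = (\<Sum>k\<in>K n. a k * L2_inner N (w n) (cell N k))"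
      using wL2 by (subst (2) w_def) (intro L2.ip_sum_right cell_mem_L2)
    also have "\<dots> = (\<Sum>k\<in>K n. a k * L2_inner N y (cell N k))"
    proof (intro sum.cong refl arg_cong2[of _ _ _ _ "(*)"])
      fix k assume k: "k \<in> K n"
      then obtain e i where k': "k = (e, Suc n, i)" "e \<in> edges N" "i < Suc n" by (auto simp: K_def)
      have "L2_inner N (w n) (cell N k) = (\<Sum>k'\<in>K n. a k' * L2_inner N (cell N k') (cell N k))"
        unfolding w_def by (intro L2.ip_sum_left cell_mem_L2)
      also have "\<dots> = (\<Sum>k'\<in>K n. if k' = k then a k * (edge_len N e / real (Suc n)) else 0)"
      proof (intro sum.cong refl)
        fix k'' assume "k'' \<in> K n"
        then obtain e' j where k'': "k'' = (e', Suc n, j)" by (auto simp: K_def)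
        show "a k'' * L2_inner N (cell N k'') (cell N k) = (if k'' = k then a k * (edge_len N e / real (Suc n)) else 0)"
          using k' by (auto simp: k'' k'(1) L2_inner_cell_cell[OF N])
      qed
      also have "\<dots> = a k * (edge_len N e / real (Suc n))" using K k by simp
      also have "\<dots> = L2_inner N y (cell N k)"
        using len[OF k'(2)] by (simp add: a_def k' del: of_nat_Suc)
      finally show "L2_inner N (w n) (cell N k) = L2_inner N y (cell N k)" .
    qed
    also have "\<dots> = L2_inner N y (w n)"
      using y unfolding w_def by (intro L2.ip_sum_right[symmetric] cell_mem_L2)
    finally show ?thesis by simp
  qed
  have wc: "L2_norm N (w n) \<le> c" for n
  proof -
    have "(L2_norm N (w n))^2 \<le> c * L2_norm N (w n)"
      using test[OF K, of a n] yw[of n] L2_norm_power2[of N "w n"] by (simp flip: w_def)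
    then have "L2_norm N (w n) * L2_norm N (w n) \<le> c * L2_norm N (w n)" by (simp add: power2_eq_square)
    then show ?thesis
      using L2_norm_ge_0[of N "w n"] c by (cases "L2_norm N (w n) = 0") auto
  qed
  have lim: "AE x in lebesgue_on {0..edge_len N e}. (%n. w n (e, x)) \<longlonglongrightarrow> y (e, x)" if e: "e \<in> edges N" for e
  proof -
    let ?l = "edge_len N e"
    have yi: "integrable (lebesgue_on {0..?l}) (%x. y (e, x))"
      by (rule L2_interval_integrable[OF L2D[OF y e]])
    have "AE x in lebesgue_on {0..?l}. x \<noteq> ?l"
      by (rule AE_I'[of "{?l} \<inter> {0..?l}"])
        (auto simp: null_sets_restrict_space negligible_iff_null_sets[symmetric] negligible_Int)
    with lebesgue_differentiation_right[OF yi] lebesgue_differentiation_left[OF yi]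
    have "AE x in lebesgue_on {0..?l}. x \<noteq> ?l \<and>
        ((%h. integral {x..x + h} (%x. y (e, x)) / h) \<longlongrightarrow> y (e, x)) (at_right 0) \<and>
        ((%h. integral {x - h..x} (%x. y (e, x)) / h) \<longlongrightarrow> y (e, x)) (at_right 0)"
      by (simp add: AE_conj_iff)
    then show ?thesis
    proof (rule lebesgue_on_mono)
      fix x assume x: "x \<noteq> ?l \<and> ((%h. integral {x..x + h} (%x. y (e, x)) / h) \<longlongrightarrow> y (e, x)) (at_right 0) \<and>
        ((%h. integral {x - h..x} (%x. y (e, x)) / h) \<longlongrightarrow> y (e, x)) (at_right 0)" "x \<in> {0..?l}"
      have l: "0 < ?l" by (rule len[OF e])
      have "w n (e, x) = integral {real (nat \<lfloor>x * real (Suc n) / ?l\<rfloor>) * ?l / real (Suc n)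
       ..(real (nat \<lfloor>x * real (Suc n) / ?l\<rfloor>) + 1) * ?l / real (Suc n)} (%x. y (e, x)) * (real (Suc n) / ?l)" for n
      proof -
        define m where "m = real (Suc n)"
        have m: "0 < m" by (simp add: m_def)
        define i where "i = nat \<lfloor>x * m / ?l\<rfloor>"
        have i1: "real i \<le> x * m / ?l" "x * m / ?l < real i + 1"
          using x(2) l m by (auto simp: i_def intro: of_nat_floor)
        have i2: "i < Suc n"
        proof -
          have "x * m / ?l < m" using x l m by (simp add: divide_less_eq mult.commute)
          then have "real i < m" using i1 by linarith
          then show ?thesis by (simp add: m_def)
        qed
        have cell_x: "cell N (e', Suc n, j) (e, x) = (if e' = e \<and> j = i then 1 else 0)" for e' j
        proof -
          have "x \<in> {real j * ?l / m..<(real j + 1) * ?l / m} \<longleftrightarrow> real j \<le> x * m / ?l \<and> x * m / ?l < real j + 1"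
            using l m by (auto simp: field_simps)
          also have "\<dots> \<longleftrightarrow> j = i" using i1 by linarith
          finally show ?thesis by (auto simp: cell_def m_def)
        qed
        have "w n (e, x) = (\<Sum>k\<in>K n. if k = (e, Suc n, i) then a k else 0)"
          unfolding w_def by (intro sum.cong refl) (auto simp: K_def cell_x split: if_splits)
        also have "\<dots> = a (e, Suc n, i)"
        proof -
          have "(e, Suc n, i) \<in> K n" using e i2 by (auto simp: K_def)
          then show ?thesis using K by simp
        qed
        finally show ?thesis
          using L2_inner_cell[OF N y e i2] by (simp add: a_def i_def m_def)
      qed
      moreover have "(%x. y (e, x)) integrable_on {0..?l}"
        using yi by (simp add: integrable_lebesgue_on_Icc_iff)
      ultimately show "(%n. w n (e, x)) \<longlonglongrightarrow> y (e, x)"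
        using cell_averages_tendsto[OF l, of x "%x. y (e, x)"] x by auto
    qed
  qed
  have sq: "(\<integral>\<^sup>+x. ennreal ((u (e, x))^2) \<partial>lebesgue_on {0..edge_len N e})
      = ennreal (LINT x|lebesgue_on {0..edge_len N e}. u (e, x) * u (e, x))" if "u \<in> L2 N" "e \<in> edges N" for u e
    using L2D[OF that] by (subst nn_integral_eq_integral) (auto simp: L2_interval_def power2_eq_square)
  have sq_sum: "(\<Sum>e\<in>edges N. \<integral>\<^sup>+x. ennreal ((u (e, x))^2) \<partial>lebesgue_on {0..edge_len N e}) = ennreal ((L2_norm N u)^2)"
    if "u \<in> L2 N" for u
    unfolding L2_norm_power2 L2_inner_def using that by (simp add: sq sum_ennreal)
  have "(\<integral>\<^sup>+x. ennreal ((y (e, x))^2) \<partial>lebesgue_on {0..edge_len N e})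
      \<le> liminf (%n. \<integral>\<^sup>+x. ennreal ((w n (e, x))^2) \<partial>lebesgue_on {0..edge_len N e})" if e: "e \<in> edges N" for e
  proof -
    have "(\<integral>\<^sup>+x. ennreal ((y (e, x))^2) \<partial>lebesgue_on {0..edge_len N e})
        = (\<integral>\<^sup>+x. liminf (%n. ennreal ((w n (e, x))^2)) \<partial>lebesgue_on {0..edge_len N e})"
    proof (rule nn_integral_cong_AE)
      show "AE x in lebesgue_on {0..edge_len N e}. ennreal ((y (e, x))^2) = liminf (%n. ennreal ((w n (e, x))^2))"
        using lim[OF e]
      proof (rule eventually_mono)
        fix x assume "(%n. w n (e, x)) \<longlonglongrightarrow> y (e, x)"
        then have "(%n. ennreal ((w n (e, x))^2)) \<longlonglongrightarrow> ennreal ((y (e, x))^2)"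
          by (intro tendsto_ennrealI tendsto_power)
        then show "ennreal ((y (e, x))^2) = liminf (%n. ennreal ((w n (e, x))^2))"
          by (simp only: lim_imp_Liminf[OF sequentially_bot])
      qed
    qed
    also have "\<dots> \<le> liminf (%n. \<integral>\<^sup>+x. ennreal ((w n (e, x))^2) \<partial>lebesgue_on {0..edge_len N e})"
      using L2_edge_measurable[OF wL2 e] by (intro nn_integral_liminf) simp
    finally show ?thesis .
  qed
  then have "ennreal ((L2_norm N y)^2)
      \<le> (\<Sum>e\<in>edges N. liminf (%n. \<integral>\<^sup>+x. ennreal ((w n (e, x))^2) \<partial>lebesgue_on {0..edge_len N e}))"
    unfolding sq_sum[OF y, symmetric] by (rule sum_mono)
  \<comment> \<open>The sum over the edges is read as an integral over the counting measure, so that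
    Fatou's lemma also moves the lower limit out of the sum.\<close>
  also have "\<dots> = (\<integral>\<^sup>+e. liminf (%n. \<integral>\<^sup>+x. ennreal ((w n (e, x))^2) \<partial>lebesgue_on {0..edge_len N e}) \<partial>count_space (edges N))"
    using fin by (simp add: nn_integral_count_space_finite)
  also have "\<dots> \<le> liminf (%n. \<integral>\<^sup>+e. (\<integral>\<^sup>+x. ennreal ((w n (e, x))^2) \<partial>lebesgue_on {0..edge_len N e}) \<partial>count_space (edges N))"
    by (rule nn_integral_liminf) simp
  also have "\<dots> = liminf (%n. ennreal ((L2_norm N (w n))^2))"
    using fin sq_sum[OF wL2] by (simp add: nn_integral_count_space_finite)
  also have "\<dots> \<le> ennreal (c^2)"
    using wc L2_norm_ge_0 by (intro Liminf_le always_eventually allI ennreal_leI power_mono) auto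
  finally have "(L2_norm N y)^2 \<le> c^2" by simp
  then show ?thesis using c by (rule power2_le_imp_le)
qed

section \<open>Singular perturbation estimates\<close>

lemma AE_lebesgue_on_negligibleE:
  assumes "AE x in lebesgue_on {a..b::real}. P x"
  obtains Z where "negligible Z" "\<And>x. x \<in> {a..b} ==> x \<notin> Z ==> P x"
  using assms by (elim AE_E3) (auto simp: null_sets_restrict_space negligible_iff_null_sets)

lemma integrable_lebesgue_on_Icc_cong_AE:
  fixes f g :: "real \<Rightarrow> real"
  assumes f: "integrable (lebesgue_on {a..b}) f" and ae: "AE x in lebesgue_on {a..b}. g x = f x"
  shows "integrable (lebesgue_on {a..b}) g" "integral {a..b} g = integral {a..b} f"
proof -
  obtain Z where Z: "negligible Z" "\<And>x. x \<in> {a..b} ==> x \<notin> Z ==> g x = f x"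
    by (rule AE_lebesgue_on_negligibleE[OF ae]) (rule that)
  show "integrable (lebesgue_on {a..b}) g"
    unfolding integrable_lebesgue_on_Icc_iff
  proof
    show "g integrable_on {a..b}"
      by (rule integrable_spike[OF _ Z(1), of f]) (use f Z(2) in \<open>auto simp: integrable_lebesgue_on_Icc_iff\<close>)
    show "(%x. \<bar>g x\<bar>) integrable_on {a..b}"
      by (rule integrable_spike[OF _ Z(1), of "%x. \<bar>f x\<bar>"]) (use f Z(2) in \<open>auto simp: integrable_lebesgue_on_Icc_iff\<close>)
  qed
  show "integral {a..b} g = integral {a..b} f"
    by (rule integral_spike[OF Z(1)]) (auto simp: Z(2))
qed

lemma ae_eq_trans:
  assumes "ae_eq N u v" "ae_eq N v w"
  shows "ae_eq N u w"
  unfolding ae_eq_def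
proof
  fix e assume "e \<in> edges N"
  with assms have "AE x in lebesgue_on {0..edge_len N e}. u (e, x) = v (e, x)"
    "AE x in lebesgue_on {0..edge_len N e}. v (e, x) = w (e, x)"
    by (auto simp: ae_eq_def)
  then show "AE x in lebesgue_on {0..edge_len N e}. u (e, x) = w (e, x)"
    by eventually_elim simp
qed

lemma ae_eq_comb:
  assumes "ae_eq N u u'" "ae_eq N v v'"
  shows "ae_eq N (%z. \<alpha> * u z + \<beta> * v z) (%z. \<alpha> * u' z + \<beta> * v' z)"
  unfolding ae_eq_def
proof
  fix e assume "e \<in> edges N"
  with assms have "AE x in lebesgue_on {0..edge_len N e}. u (e, x) = u' (e, x)"
    "AE x in lebesgue_on {0..edge_len N e}. v (e, x) = v' (e, x)"
    by (auto simp: ae_eq_def)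
  then show "AE x in lebesgue_on {0..edge_len N e}. \<alpha> * u (e, x) + \<beta> * v (e, x) = \<alpha> * u' (e, x) + \<beta> * v' (e, x)"
    by eventually_elim simp
qed

lemma ae_eq_diff:
  assumes "ae_eq N u u'" "ae_eq N v v'"
  shows "ae_eq N (%z. u z - v z) (%z. u' z - v' z)"
  using ae_eq_comb[OF assms, of 1 "-1"] by simp

text \<open>Differentiation of the increment identity within the closed interval, one-sided at the
  ends. With \<open>\<phi>\<close> equal to zero it shows that a continuous function with vanishing
  integrals vanishes everywhere, which upgrades almost-everywhere identities to pointwise
  ones.\<close>

lemma derivative_eq_integrand:
  fixes \<phi> g :: "real \<Rightarrow> real"
  assumes g: "continuous_on {0..T} g" and T: "0 < T"
    and \<phi>: "\<And>x. x \<in> {0..T} ==> \<phi> x - \<phi> 0 = integral {0..x} g"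
    and d: "(\<phi> has_real_derivative \<phi>') (at t within {0..T})" and t: "t \<in> {0..T}"
  shows "\<phi>' = g t"
proof -
  have "((%x. integral {0..x} g + \<phi> 0) has_real_derivative g t + 0) (at t within {0..T})"
    by (intro DERIV_add integral_has_real_derivative[OF g t]) simp
  then have d2: "((%x. integral {0..x} g + \<phi> 0) has_real_derivative g t) (at t within {0..T})" by simp
  have "(\<phi> has_real_derivative g t) (at t within {0..T})"
  proof (rule has_field_derivative_transform_within[OF d2, of 1])
    fix x assume "x \<in> {0..T}"
    from \<phi>[OF this] show "integral {0..x} g + \<phi> 0 = \<phi> x" by linarith
  qed (use t in auto)
  with d have "(\<phi> has_vector_derivative \<phi>') (at t within {0..T})" "(\<phi> has_vector_derivative g t) (at t within {0..T})"
    by (simp_all add: has_real_derivative_iff_has_vector_derivative)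
  then show ?thesis
    by (intro vector_derivative_unique_within_closed_interval[OF T, of t \<phi>]) (use t in simp_all)
qed

locale network_problem =
  fixes N :: "('v, 'e) network" and D :: "('v, 'e) flow_data" and a_hi d_lo d_hi :: real
  assumes wf: "wf_network N" and T_pos: "0 < T_end D"
    and a_bounds: "coef_bounds N (coef_a D) 0 a_hi" "0 \<le> a_hi"
    and d_bounds: "coef_bounds N (coef_d D) d_lo d_hi" "0 < d_lo" "0 < d_hi"
begin

abbreviation "T \<equiv> T_end D"
abbreviation "L2_curve T' \<equiv> continuous_curve T' (L2 N) (L2_norm N)"

text \<open>Testing with these functions removes the Lagrange multipliers at the Dirichlet vertices,
  in the continuous as well as in the discrete problem.\<close>

definition V0 :: "'e edge_fun set" where
  "V0 = {q \<in> H1 N. \<forall>v\<in>dirichlet N. vertex_value N q v = 0}"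

lemma V0_diff:
  assumes "q \<in> V0" "q' \<in> V0"
  shows "(%z. q z - q' z) \<in> V0"
  using assms wf_networkD(4)[OF wf] vertex_value_comb[OF wf, of _ q q' 1 "-1"] H1.diff_mem[of q N q']
  by (auto simp: V0_def)

text \<open>
  \<open>x\<close> represents the spatial derivative of \<open>u\<close> for almost all times, and is an arbitrary element of
  \<open>L2 N\<close> at the times at which \<open>u\<close> does not belong to \<open>H1 N\<close>.
\<close>

definition weak_pair where
  "weak_pair T' \<epsilon> u v x y y' g \<longleftrightarrow>
     L2_curve T' u \<and> L2_curve T' v \<and> L2_curve T' y \<and> L2_curve T' y' \<and>
     (\<forall>t\<in>{0..T'}. x t \<in> L2 N) \<and>
     (\<forall>w\<in>L2 N. integrable (lebesgue_on {0..T'}) (%t. L2_inner N (x t) w)) \<and>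
     integrable (lebesgue_on {0..T'}) g \<and> (\<forall>t\<in>{0..T'}. L2_norm N (x t) \<le> g t) \<and>
     (AE t in lebesgue_on {0..T'}. u t \<in> V0 \<and> ae_eq N (edge_deriv N (u t)) (x t)) \<and>
     (\<forall>q\<in>V0. \<forall>s r. 0 \<le> s \<longrightarrow> s \<le> r \<longrightarrow> r \<le> T' \<longrightarrow>
        L2_inner N (%z. u r z - u s z) q
        = integral {s..r} (%\<sigma>. L2_inner N (edge_deriv N q) (v \<sigma>) - L2_inner N (y \<sigma>) q)) \<and>
     (\<forall>w\<in>L2 N. \<forall>s r. 0 \<le> s \<longrightarrow> s \<le> r \<longrightarrow> r \<le> T' \<longrightarrow>
        \<epsilon> * L2_inner N (%z. v r z - v s z) w
        = - integral {s..r} (%\<sigma>. L2_inner N (x \<sigma>) w + L2_inner N (y' \<sigma>) w))"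

text \<open>At almost every time \<open>u t\<close> is itself an admissible test function with
  spatial derivative \<open>x t\<close>, which supplies the hypothesis \<open>eq_u\<close> of the
  abstract energy identity.\<close>

lemma weak_pair_energy:
  assumes wp: "weak_pair T' \<epsilon> u v x y y' g" and R: "0 \<le> R" "R \<le> T'"
  shows "L2_inner N (u R) (u R) + \<epsilon> * L2_inner N (v R) (v R)
       - (L2_inner N (u 0) (u 0) + \<epsilon> * L2_inner N (v 0) (v 0))
     = - 2 * integral {0..R} (%t. L2_inner N (y t) (u t) + L2_inner N (y' t) (v t))"
proof (rule L2.energy_identity[where T = T' and x = x and g = g])
  have c: "L2_curve T' v" and x: "\<forall>t\<in>{0..T'}. x t \<in> L2 N" and qs: "\<And>q s r. q \<in> V0 ==> 0 \<le> s ==> s \<le> r ==> r \<le> T' ==>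
      L2_inner N (%z. u r z - u s z) q
        = integral {s..r} (%\<sigma>. L2_inner N (edge_deriv N q) (v \<sigma>) - L2_inner N (y \<sigma>) q)"
    and ae: "AE t in lebesgue_on {0..T'}. u t \<in> V0 \<and> ae_eq N (edge_deriv N (u t)) (x t)"
    using wp unfolding weak_pair_def by blast+
  show "AE t in lebesgue_on {0..T'}. \<forall>s r. 0 \<le> s \<longrightarrow> s \<le> r \<longrightarrow> r \<le> T' \<longrightarrow>
      L2_inner N (%i. u r i - u s i) (u t) = integral {s..r} (%\<sigma>. L2_inner N (x t) (v \<sigma>) - L2_inner N (y \<sigma>) (u t))"
    using ae
  proof (rule lebesgue_on_mono, intro allI impI)
    fix t s r assume t: "u t \<in> V0 \<and> ae_eq N (edge_deriv N (u t)) (x t)" "t \<in> {0..T'}" and sr: "0 \<le> s" "s \<le> r" "r \<le> T'"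
    have "L2_inner N (edge_deriv N (u t)) (v \<sigma>) = L2_inner N (x t) (v \<sigma>)" if "\<sigma> \<in> {s..r}" for \<sigma>
      using t x sr that c by (intro L2_inner_cong_ae edge_deriv_mem_L2) (auto simp: V0_def continuous_curve_def)
    then have "integral {s..r} (%\<sigma>. L2_inner N (edge_deriv N (u t)) (v \<sigma>) - L2_inner N (y \<sigma>) (u t))
        = integral {s..r} (%\<sigma>. L2_inner N (x t) (v \<sigma>) - L2_inner N (y \<sigma>) (u t))"
      by (intro Henstock_Kurzweil_Integration.integral_cong) simp
    then show "L2_inner N (%i. u r i - u s i) (u t) = integral {s..r} (%\<sigma>. L2_inner N (x t) (v \<sigma>) - L2_inner N (y \<sigma>) (u t))"
      using qs[of "u t" s r] t sr by simp
  qed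
qed (use wp R in \<open>auto simp: weak_pair_def\<close>)

text \<open>The equations are linear and do not depend explicitly on time, so differences between
  times \<open>t + h\<close> and \<open>t\<close> satisfy equations of the same form on a shorter
  interval.\<close>

lemma weak_pair_difference:
  assumes wp: "weak_pair T' \<epsilon> u v x y y' g" and h: "0 \<le> h"
  shows "weak_pair (T' - h) \<epsilon> (%t z. u (t + h) z - u t z) (%t z. v (t + h) z - v t z)
     (%t z. x (t + h) z - x t z) (%t z. y (t + h) z - y t z) (%t z. y' (t + h) z - y' t z) (%t. g (t + h) + g t)"
proof -
  have curves: "L2_curve T' u" "L2_curve T' v" "L2_curve T' y" "L2_curve T' y'"
    and x: "\<And>t. t \<in> {0..T'} ==> x t \<in> L2 N"
    and x_int: "\<And>w. w \<in> L2 N ==> integrable (lebesgue_on {0..T'}) (%t. L2_inner N (x t) w)"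
    and g: "integrable (lebesgue_on {0..T'}) g" "\<And>t. t \<in> {0..T'} ==> L2_norm N (x t) \<le> g t"
    and ae: "AE t in lebesgue_on {0..T'}. u t \<in> V0 \<and> ae_eq N (edge_deriv N (u t)) (x t)"
    and eq1: "\<And>q s r. q \<in> V0 ==> 0 \<le> s ==> s \<le> r ==> r \<le> T' ==> L2_inner N (%z. u r z - u s z) q
        = integral {s..r} (%\<sigma>. L2_inner N (edge_deriv N q) (v \<sigma>) - L2_inner N (y \<sigma>) q)"
    and eq2: "\<And>w s r. w \<in> L2 N ==> 0 \<le> s ==> s \<le> r ==> r \<le> T' ==> \<epsilon> * L2_inner N (%z. v r z - v s z) w
        = - integral {s..r} (%\<sigma>. L2_inner N (x \<sigma>) w + L2_inner N (y' \<sigma>) w)"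
    using wp unfolding weak_pair_def by blast+
  note mem = L2.cont_curve_mem[OF curves(1)] L2.cont_curve_mem[OF curves(2)] L2.cont_curve_mem[OF curves(3)]
    L2.cont_curve_mem[OF curves(4)] x
  have dcurve: "L2_curve (T' - h) (%t z. c (t + h) z - c t z)" if "L2_curve T' c" for c
    using h that by (intro L2.cont_curve_diff continuous_curve_shift continuous_curve_mono[OF that]) auto
  have x_diff: "L2_inner N (%z. x (t + h) z - x t z) w = L2_inner N (x (t + h)) w - L2_inner N (x t) w"
    if "t \<in> {0..T' - h}" "w \<in> L2 N" for t w
    using that h by (intro L2.ip_diff_left x) auto
  have "integrable (lebesgue_on {0..T' - h}) (%t. L2_inner N (%z. x (t + h) z - x t z) w)" if w: "w \<in> L2 N" for w
  proof -
    have "integrable (lebesgue_on {0..T' - h}) (%t. L2_inner N (x (t + h)) w - L2_inner N (x t) w)"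
      using integrable_lebesgue_on_Icc_shift[OF x_int[OF w], of 0 h "T' - h"]
        integrable_lebesgue_on_Icc_subset[OF x_int[OF w], of 0 "T' - h"] h by simp
    moreover have "integrable (lebesgue_on {0..T' - h}) (%t. L2_inner N (%z. x (t + h) z - x t z) w)
        \<longleftrightarrow> integrable (lebesgue_on {0..T' - h}) (%t. L2_inner N (x (t + h)) w - L2_inner N (x t) w)"
      by (rule Bochner_Integration.integrable_cong[OF refl]) (simp add: x_diff w)
    ultimately show ?thesis by simp
  qed
  moreover have "integrable (lebesgue_on {0..T' - h}) (%t. g (t + h) + g t)"
    using integrable_lebesgue_on_Icc_shift[OF g(1), of 0 h "T' - h"]
        integrable_lebesgue_on_Icc_subset[OF g(1), of 0 "T' - h"] h by simp
  moreover have "L2_norm N (%z. x (t + h) z - x t z) \<le> g (t + h) + g t" if "t \<in> {0..T' - h}" for t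
    using L2.nrm_diff_le[OF x x, of "t + h" t] g(2)[of "t + h"] g(2)[of t] that h by simp
  moreover have "AE t in lebesgue_on {0..T' - h}. (%z. u (t + h) z - u t z) \<in> V0 \<and>
      ae_eq N (edge_deriv N (%z. u (t + h) z - u t z)) (%z. x (t + h) z - x t z)"
  proof -
    define good where "good t \<longleftrightarrow> u t \<in> V0 \<and> ae_eq N (edge_deriv N (u t)) (x t)" for t
    obtain Z where Z: "negligible Z" "\<And>t. t \<in> {0..T'} ==> t \<notin> Z ==> good t"
      by (rule AE_lebesgue_on_negligibleE[OF ae[folded good_def]]) (rule that)
    have "negligible ((Z \<union> (+) (- h) ` Z) \<inter> {0..T' - h})"
      by (rule negligible_subset[OF negligible_Un[OF Z(1) negligible_translation[OF Z(1), of "- h"]]]) blast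
    then have "AE t in lebesgue_on {0..T' - h}. t \<notin> (Z \<union> (+) (- h) ` Z) \<inter> {0..T' - h}"
      by (intro AE_not_in) (auto simp: null_sets_restrict_space negligible_iff_null_sets[symmetric])
    then show ?thesis
    proof (rule lebesgue_on_mono)
      fix t assume t: "t \<notin> (Z \<union> (+) (- h) ` Z) \<inter> {0..T' - h}" "t \<in> {0..T' - h}"
      then have "t \<notin> Z" "t + h \<notin> Z" by (auto simp: image_iff)
      then have good: "good t" "good (t + h)" using Z(2) t h by auto
      then have H: "u t \<in> H1 N" "u (t + h) \<in> H1 N" by (auto simp: good_def V0_def)
      have "ae_eq N (edge_deriv N (%z. u (t + h) z - u t z)) (%z. edge_deriv N (u (t + h)) z - edge_deriv N (u t) z)"
        by (rule edge_deriv_diff[OF H(2,1)])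
      then have "ae_eq N (edge_deriv N (%z. u (t + h) z - u t z)) (%z. x (t + h) z - x t z)"
        by (rule ae_eq_trans) (use good in \<open>auto simp: good_def intro: ae_eq_diff\<close>)
      then show "(%z. u (t + h) z - u t z) \<in> V0 \<and>
          ae_eq N (edge_deriv N (%z. u (t + h) z - u t z)) (%z. x (t + h) z - x t z)"
        using V0_diff good by (auto simp: good_def)
    qed
  qed
  moreover have "L2_inner N (%z. (u (r + h) z - u r z) - (u (s + h) z - u s z)) q
      = integral {s..r} (%\<sigma>. L2_inner N (edge_deriv N q) (%z. v (\<sigma> + h) z - v \<sigma> z) - L2_inner N (%z. y (\<sigma> + h) z - y \<sigma> z) q)"
    if q: "q \<in> V0" and sr: "0 \<le> s" "s \<le> r" "r \<le> T' - h" for q s r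
  proof -
    have qL: "q \<in> L2 N" "edge_deriv N q \<in> L2 N"
      using q by (auto simp: V0_def H1_subset_L2 edge_deriv_mem_L2)
    let ?\<phi> = "%\<sigma>. L2_inner N (edge_deriv N q) (v \<sigma>) - L2_inner N (y \<sigma>) q"
    have \<phi>_cont: "continuous_on {0..T'} ?\<phi>"
      unfolding L2_inner_commute[of N "edge_deriv N q"]
      by (intro continuous_intros L2.continuous_on_ip_curve curves qL)
    have \<phi>: "continuous_on {s..r} ?\<phi>" "continuous_on {s..r} (%\<sigma>. ?\<phi> (\<sigma> + h))"
      by (rule continuous_on_subset[OF \<phi>_cont], use sr h in force)
        (rule continuous_on_compose2[OF \<phi>_cont], use sr h in \<open>auto intro!: continuous_intros\<close>)
    have "L2_inner N (%z. (u (r + h) z - u r z) - (u (s + h) z - u s z)) q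
        = L2_inner N (%z. u (r + h) z - u (s + h) z) q - L2_inner N (%z. u r z - u s z) q"
      using mem(1) sr h qL by (simp add: L2.ip_diff_left L2.diff_mem)
    also have "\<dots> = integral {s + h..r + h} ?\<phi> - integral {s..r} ?\<phi>"
      using eq1[OF q, of "s + h" "r + h"] eq1[OF q, of s r] sr h by simp
    also have "\<dots> = integral {s..r} (%\<sigma>. ?\<phi> (\<sigma> + h) - ?\<phi> \<sigma>)"
      unfolding integral_Icc_shift[symmetric]
      by (intro Henstock_Kurzweil_Integration.integral_diff[symmetric] integrable_continuous_interval \<phi>)
    also have "\<dots> = integral {s..r} (%\<sigma>. L2_inner N (edge_deriv N q) (%z. v (\<sigma> + h) z - v \<sigma> z) - L2_inner N (%z. y (\<sigma> + h) z - y \<sigma> z) q)"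
      using mem(2,3) sr h qL
      by (intro Henstock_Kurzweil_Integration.integral_cong) (simp add: L2.ip_diff_left L2.ip_diff_right)
    finally show ?thesis .
  qed
  moreover have "\<epsilon> * L2_inner N (%z. (v (r + h) z - v r z) - (v (s + h) z - v s z)) w
      = - integral {s..r} (%\<sigma>. L2_inner N (%z. x (\<sigma> + h) z - x \<sigma> z) w + L2_inner N (%z. y' (\<sigma> + h) z - y' \<sigma> z) w)"
    if w: "w \<in> L2 N" and sr: "0 \<le> s" "s \<le> r" "r \<le> T' - h" for w s r
  proof -
    let ?\<phi> = "%\<sigma>. L2_inner N (x \<sigma>) w + L2_inner N (y' \<sigma>) w"
    have "integrable (lebesgue_on {0..T'}) (%\<sigma>. L2_inner N (y' \<sigma>) w)"
      by (intro continuous_imp_integrable_real L2.continuous_on_ip_curve curves w)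
    then have "integrable (lebesgue_on {0..T'}) ?\<phi>"
      using x_int[OF w] by simp
    then have "integrable (lebesgue_on {s..r}) ?\<phi>" "integrable (lebesgue_on {s..r}) (%\<sigma>. ?\<phi> (\<sigma> + h))"
      using sr h by (auto intro: integrable_lebesgue_on_Icc_subset integrable_lebesgue_on_Icc_shift)
    then have \<phi>: "?\<phi> integrable_on {s..r}" "(%\<sigma>. ?\<phi> (\<sigma> + h)) integrable_on {s..r}"
      by (auto simp: integrable_lebesgue_on_Icc_iff)
    have "\<epsilon> * L2_inner N (%z. (v (r + h) z - v r z) - (v (s + h) z - v s z)) w
        = \<epsilon> * L2_inner N (%z. v (r + h) z - v (s + h) z) w - \<epsilon> * L2_inner N (%z. v r z - v s z) w"
      using mem(2) sr h w by (simp add: L2.ip_diff_left L2.diff_mem right_diff_distrib)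
    also have "\<dots> = - integral {s + h..r + h} ?\<phi> + integral {s..r} ?\<phi>"
      using eq2[OF w, of "s + h" "r + h"] eq2[OF w, of s r] sr h by simp
    also have "\<dots> = - integral {s..r} (%\<sigma>. ?\<phi> (\<sigma> + h) - ?\<phi> \<sigma>)"
      unfolding integral_Icc_shift[symmetric] Henstock_Kurzweil_Integration.integral_diff[OF \<phi>(2,1)] by simp
    also have "\<dots> = - integral {s..r} (%\<sigma>. L2_inner N (%z. x (\<sigma> + h) z - x \<sigma> z) w + L2_inner N (%z. y' (\<sigma> + h) z - y' \<sigma> z) w)"
      using mem(4,5) sr h w
      by (intro arg_cong[of _ _ uminus] Henstock_Kurzweil_Integration.integral_cong) (simp add: L2.ip_diff_left)
    finally show ?thesis .
  qed
  ultimately show ?thesis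
    unfolding weak_pair_def
    using curves dcurve x h L2.diff_mem[of "x _" N] by (intro conjI ballI allI impI) auto
qed

text \<open>Two ways to treat the residual. The first bound spends half of the damping on it by
  Young's inequality; the second drops the damping and keeps the residual linear in the norm of
  \<open>v\<close>, which is the sharper option for short times when \<open>v\<close> starts at
  zero.\<close>

lemma damped_energy_bound:
  assumes wp: "weak_pair T' \<epsilon> u v x (%t z. coef_a D z * u t z) (%t z. coef_d D z * v t z + \<epsilon> * \<rho> t z) g"
    and \<epsilon>: "0 < \<epsilon>" and \<rho>: "L2_curve T' \<rho>" "\<And>t. t \<in> {0..T'} ==> L2_norm N (\<rho> t) \<le> K"
    and R: "0 \<le> R" "R \<le> T'"
  shows "L2_inner N (u R) (u R) + \<epsilon> * L2_inner N (v R) (v R) + d_lo * integral {0..R} (%t. L2_inner N (v t) (v t))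
       \<le> L2_inner N (u 0) (u 0) + \<epsilon> * L2_inner N (v 0) (v 0) + R * (\<epsilon>^2 * K^2 / d_lo)"
    and "L2_inner N (u R) (u R) + \<epsilon> * L2_inner N (v R) (v R)
       \<le> L2_inner N (u 0) (u 0) + \<epsilon> * L2_inner N (v 0) (v 0) + 2 * \<epsilon> * K * integral {0..R} (%t. L2_norm N (v t))"
proof -
  have u: "L2_curve T' u" and v: "L2_curve T' v"
    and y: "L2_curve T' (%t z. coef_a D z * u t z)" "L2_curve T' (%t z. coef_d D z * v t z + \<epsilon> * \<rho> t z)"
    using wp unfolding weak_pair_def by blast+
  note um = L2.cont_curve_mem[OF u] and vm = L2.cont_curve_mem[OF v] and \<rho>m = L2.cont_curve_mem[OF \<rho>(1)]
  let ?k = "%t. L2_inner N (%z. coef_a D z * u t z) (u t) + L2_inner N (%z. coef_d D z * v t z + \<epsilon> * \<rho> t z) (v t)"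
  have sub: "{0..R} \<subseteq> {0..T'}" using R by auto
  have kc: "continuous_on {0..R} ?k"
    by (rule continuous_on_subset[OF _ sub]) (intro continuous_intros L2.continuous_on_ip_curves u v y)
  have vc: "continuous_on {0..R} (%t. L2_inner N (v t) (v t))" "continuous_on {0..R} (%t. L2_norm N (v t))"
    using continuous_on_subset[OF L2.continuous_on_ip_curves[OF v v] sub]
      continuous_on_subset[OF L2.continuous_on_nrm_curve[OF v] sub] by auto
  have k_ge: "?k t \<ge> d_lo * L2_inner N (v t) (v t) + \<epsilon> * L2_inner N (\<rho> t) (v t)" if "t \<in> {0..R}" for t
  proof -
    have t: "t \<in> {0..T'}" using that sub by auto
    have "0 \<le> L2_inner N (%z. coef_a D z * u t z) (u t)"
      using L2_inner_mult_bounds(1)[OF a_bounds(1) um[OF t]] by simp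
    moreover have "d_lo * L2_inner N (v t) (v t) \<le> L2_inner N (%z. coef_d D z * v t z) (v t)"
      by (rule L2_inner_mult_bounds(1)[OF d_bounds(1) vm[OF t]])
    moreover have "L2_inner N (%z. coef_d D z * v t z + \<epsilon> * \<rho> t z) (v t)
        = L2_inner N (%z. coef_d D z * v t z) (v t) + \<epsilon> * L2_inner N (\<rho> t) (v t)"
      using vm[OF t] \<rho>m[OF t] mult_mem_L2[OF d_bounds(1) vm[OF t]] L2.scale_mem[OF \<rho>m[OF t], of \<epsilon>]
      by (simp add: L2.ip_add_left L2.ip_scale_left)
    ultimately show ?thesis by linarith
  qed
  have \<rho>v: "\<bar>L2_inner N (\<rho> t) (v t)\<bar> \<le> K * L2_norm N (v t)" if "t \<in> {0..R}" for t
  proof -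
    have t: "t \<in> {0..T'}" using that sub by auto
    show ?thesis
      using L2.cauchy_schwarz[OF \<rho>m[OF t] vm[OF t]] mult_right_mono[OF \<rho>(2)[OF t] L2_norm_ge_0[of N "v t"]] by linarith
  qed
  have energy: "L2_inner N (u R) (u R) + \<epsilon> * L2_inner N (v R) (v R)
       = L2_inner N (u 0) (u 0) + \<epsilon> * L2_inner N (v 0) (v 0) - integral {0..R} (%t. 2 * ?k t)"
    using weak_pair_energy[OF wp R] Henstock_Kurzweil_Integration.integral_mult_right[of "{0..R}" 2 ?k] by linarith
  have "integral {0..R} (%t. d_lo * L2_inner N (v t) (v t) - \<epsilon>^2 * K^2 / d_lo) \<le> integral {0..R} (%t. 2 * ?k t)"
  proof (rule integral_le)
    fix t assume t: "t \<in> {0..R}"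
    \<comment> \<open>Young's inequality weighted with \<open>d_lo\<close>: half of the damping in
      \<open>2 * ?k\<close> absorbs the residual and the other half stays in the estimate.\<close>
    have "2 * (\<epsilon> * K) * L2_norm N (v t) \<le> d_lo * L2_inner N (v t) (v t) + \<epsilon>^2 * K^2 / d_lo"
    proof -
      have "0 \<le> (d_lo * L2_norm N (v t) - \<epsilon> * K)^2 / d_lo" using d_bounds by simp
      also have "\<dots> = d_lo * (L2_norm N (v t))^2 - 2 * (\<epsilon> * K) * L2_norm N (v t) + \<epsilon>^2 * K^2 / d_lo"
        using d_bounds by (simp add: power2_eq_square field_simps)
      finally show ?thesis by (simp add: L2_norm_power2)
    qed
    moreover have "\<epsilon> * \<bar>L2_inner N (\<rho> t) (v t)\<bar> \<le> \<epsilon> * (K * L2_norm N (v t))"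
      using \<epsilon> \<rho>v[OF t] by (intro mult_left_mono) auto
    moreover have "- (\<epsilon> * \<bar>L2_inner N (\<rho> t) (v t)\<bar>) \<le> \<epsilon> * L2_inner N (\<rho> t) (v t)"
      using mult_left_mono[OF abs_ge_minus_self[of "L2_inner N (\<rho> t) (v t)"], of \<epsilon>] \<epsilon> by simp
    ultimately show "d_lo * L2_inner N (v t) (v t) - \<epsilon>^2 * K^2 / d_lo \<le> 2 * ?k t"
      using k_ge[OF t] by (simp add: mult.assoc)
  qed (intro integrable_continuous_interval continuous_intros vc kc)+
  moreover have "integral {0..R} (%t. d_lo * L2_inner N (v t) (v t) - \<epsilon>^2 * K^2 / d_lo)
      = d_lo * integral {0..R} (%t. L2_inner N (v t) (v t)) - R * (\<epsilon>^2 * K^2 / d_lo)"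
    using R by (subst Henstock_Kurzweil_Integration.integral_diff)
      (auto intro!: integrable_continuous_interval continuous_intros vc)
  ultimately show "L2_inner N (u R) (u R) + \<epsilon> * L2_inner N (v R) (v R) + d_lo * integral {0..R} (%t. L2_inner N (v t) (v t))
       \<le> L2_inner N (u 0) (u 0) + \<epsilon> * L2_inner N (v 0) (v 0) + R * (\<epsilon>^2 * K^2 / d_lo)"
    using energy by linarith
  have "integral {0..R} (%t. (- 2 * \<epsilon> * K) * L2_norm N (v t)) \<le> integral {0..R} (%t. 2 * ?k t)"
  proof (rule integral_le)
    fix t assume t: "t \<in> {0..R}"
    have "\<epsilon> * \<bar>L2_inner N (\<rho> t) (v t)\<bar> \<le> \<epsilon> * (K * L2_norm N (v t))"
      using \<epsilon> \<rho>v[OF t] by (intro mult_left_mono) auto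
    moreover have "- (\<epsilon> * \<bar>L2_inner N (\<rho> t) (v t)\<bar>) \<le> \<epsilon> * L2_inner N (\<rho> t) (v t)"
      using mult_left_mono[OF abs_ge_minus_self[of "L2_inner N (\<rho> t) (v t)"], of \<epsilon>] \<epsilon> by simp
    moreover have "0 \<le> d_lo * L2_inner N (v t) (v t)"
      using d_bounds L2_inner_self_nonneg[of N "v t"] by simp
    ultimately show "(- 2 * \<epsilon> * K) * L2_norm N (v t) \<le> 2 * ?k t"
      using k_ge[OF t] by (simp add: mult.assoc)
  qed (intro integrable_continuous_interval continuous_intros vc kc)+
  then show "L2_inner N (u R) (u R) + \<epsilon> * L2_inner N (v R) (v R)
       \<le> L2_inner N (u 0) (u 0) + \<epsilon> * L2_inner N (v 0) (v 0) + 2 * \<epsilon> * K * integral {0..R} (%t. L2_norm N (v t))"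
    using energy by simp
qed

text \<open>
  The initial layer is controlled by the quadratic bound \<open>4 \<epsilon> K^2 h^2\<close> for the energy at time \<open>h\<close>;
  it bounds the initial energy of the difference quotients, whose energy inequality gives the
  estimate for the time derivative of \<open>v\<close>.
\<close>

lemma singular_perturbation_bounds:
  assumes wp: "weak_pair T \<epsilon> u v x (%t z. coef_a D z * u t z) (%t z. coef_d D z * v t z + \<epsilon> * \<rho> t z) g"
    and \<epsilon>: "0 < \<epsilon>" "\<epsilon> < 1" and \<rho>: "L2_curve T \<rho>" "\<And>t. t \<in> {0..T} ==> L2_norm N (\<rho> t) \<le> K"
    and lip: "\<And>s t. s \<in> {0..T} ==> t \<in> {0..T} ==> L2_norm N (%z. \<rho> s z - \<rho> t z) \<le> K * \<bar>s - t\<bar>"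
    and init: "L2_norm N (u 0) = 0" "L2_norm N (v 0) = 0"
  shows "\<And>t. t \<in> {0..T} ==> L2_inner N (u t) (u t) \<le> \<epsilon>^2 * (T * K^2 / d_lo)"
    and "integral {0..T} (%t. L2_inner N (v t) (v t)) \<le> \<epsilon>^2 * (T * K^2 / d_lo^2)"
    and "(\<integral>\<^sup>+t. ennreal (L2_inner N (%z. x t z + (coef_d D z * v t z + \<epsilon> * \<rho> t z))
            (%z. x t z + (coef_d D z * v t z + \<epsilon> * \<rho> t z))) \<partial>lebesgue_on {0..T})
       \<le> ennreal (\<epsilon>^2 * ((4 * K^2 + T * K^2 / d_lo) / d_lo))"
proof -
  have u: "L2_curve T u" and v: "L2_curve T v"
    and y: "L2_curve T (%t z. coef_d D z * v t z + \<epsilon> * \<rho> t z)"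
    and x: "\<And>t. t \<in> {0..T} ==> x t \<in> L2 N"
    and x_int: "\<And>w. w \<in> L2 N ==> integrable (lebesgue_on {0..T}) (%t. L2_inner N (x t) w)"
    and eq2: "\<And>w s r. w \<in> L2 N ==> 0 \<le> s ==> s \<le> r ==> r \<le> T ==> \<epsilon> * L2_inner N (%z. v r z - v s z) w
        = - integral {s..r} (%\<sigma>. L2_inner N (x \<sigma>) w + L2_inner N (%z. coef_d D z * v \<sigma> z + \<epsilon> * \<rho> \<sigma> z) w)"
    using wp unfolding weak_pair_def by blast+
  note um = L2.cont_curve_mem[OF u] and vm = L2.cont_curve_mem[OF v]
  have T0: "0 \<in> {0..T}" using T_pos by simp
  have K: "0 \<le> K" using \<rho>(2)[OF T0] L2_norm_ge_0[of N "\<rho> 0"] by linarith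
  have init': "L2_inner N (u 0) (u 0) = 0" "L2_inner N (v 0) (v 0) = 0"
    using init L2_norm_power2[of N "u 0"] L2_norm_power2[of N "v 0"] by auto
  have vv_int: "(%t. L2_inner N (v t) (v t)) integrable_on {0..R}" if "R \<le> T" for R
    using that by (intro integrable_continuous_interval continuous_on_subset[OF L2.continuous_on_ip_curves[OF v v]]) auto
  have vv_nonneg: "0 \<le> integral {0..R} (%t. L2_inner N (v t) (v t))" if "R \<le> T" for R
    by (rule integral_nonneg[OF vv_int[OF that]]) (simp add: L2_inner_self_nonneg)
  show "L2_inner N (u t) (u t) \<le> \<epsilon>^2 * (T * K^2 / d_lo)" if t: "t \<in> {0..T}" for t
  proof -
    have "0 \<le> \<epsilon> * L2_inner N (v t) (v t)" "0 \<le> d_lo * integral {0..t} (%t. L2_inner N (v t) (v t))"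
      using \<epsilon> d_bounds L2_inner_self_nonneg[of N "v t"] vv_nonneg[of t] t by auto
    moreover have "t * (\<epsilon>^2 * K^2 / d_lo) \<le> T * (\<epsilon>^2 * K^2 / d_lo)"
      using t d_bounds by (intro mult_right_mono) auto
    ultimately have "L2_inner N (u t) (u t) \<le> T * (\<epsilon>^2 * K^2 / d_lo)"
      using damped_energy_bound(1)[OF wp \<epsilon>(1) \<rho>, of t] t init' by simp
    then show ?thesis by (simp add: mult_ac)
  qed
  show "integral {0..T} (%t. L2_inner N (v t) (v t)) \<le> \<epsilon>^2 * (T * K^2 / d_lo^2)"
  proof -
    have "0 \<le> \<epsilon> * L2_inner N (v T) (v T)" "0 \<le> L2_inner N (u T) (u T)"
      using \<epsilon> L2_inner_self_nonneg[of N "v T"] L2_inner_self_nonneg[of N "u T"] by auto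
    then have "d_lo * integral {0..T} (%t. L2_inner N (v t) (v t)) \<le> T * (\<epsilon>^2 * K^2 / d_lo)"
      using damped_energy_bound(1)[OF wp \<epsilon>(1) \<rho>, of T] T_pos init' by simp
    then show ?thesis
      using d_bounds by (simp add: field_simps power2_eq_square)
  qed
  \<comment> \<open>With the maximum \<open>m\<close> of the norm of \<open>v\<close> on
    \<open>{0..h}\<close>, the second energy bound gives
    \<open>\<epsilon> * m^2 \<le> 2 * \<epsilon> * K * (h * m)\<close>, hence
    \<open>m \<le> 2 * K * h\<close>. Inserting this once more makes the energy quadratic in
    \<open>h\<close>.\<close>
  have layer: "L2_inner N (u h) (u h) + \<epsilon> * L2_inner N (v h) (v h) \<le> 4 * \<epsilon> * K^2 * h^2" if h: "0 < h" "h \<le> T" for h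
  proof -
    have vnc: "continuous_on {0..R} (%t. L2_norm N (v t))" if "R \<le> T" for R
      using that by (intro continuous_on_subset[OF L2.continuous_on_nrm_curve[OF v]]) auto
    obtain tm where tm: "tm \<in> {0..h}" "\<And>t. t \<in> {0..h} ==> L2_norm N (v t) \<le> L2_norm N (v tm)"
      using continuous_attains_sup[OF compact_Icc _ vnc[OF h(2)]] h by auto
    define m where "m = L2_norm N (v tm)"
    have m0: "0 \<le> m" by (simp add: m_def L2_norm_ge_0)
    have int_le: "integral {0..R} (%t. L2_norm N (v t)) \<le> h * m" if R: "0 \<le> R" "R \<le> h" for R
    proof -
      have "integral {0..R} (%t. L2_norm N (v t)) \<le> integral {0..R} (%t. m)"
        using tm R h by (intro integral_le integrable_continuous_interval vnc) (auto simp: m_def)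
      also have "\<dots> = R * m" using R by simp
      also have "\<dots> \<le> h * m" using R m0 by (intro mult_right_mono) auto
      finally show ?thesis .
    qed
    have E_le: "L2_inner N (u R) (u R) + \<epsilon> * L2_inner N (v R) (v R) \<le> 2 * \<epsilon> * K * (h * m)" if R: "0 \<le> R" "R \<le> h" for R
    proof -
      have "2 * \<epsilon> * K * integral {0..R} (%t. L2_norm N (v t)) \<le> 2 * \<epsilon> * K * (h * m)"
        using int_le[OF R] \<epsilon> K by (intro mult_left_mono) auto
      then show ?thesis
        using damped_energy_bound(2)[OF wp \<epsilon>(1) \<rho>, of R] R h init' by simp
    qed
    have "\<epsilon> * m^2 \<le> 2 * \<epsilon> * K * (h * m)"
      using E_le[of tm] tm L2_inner_self_nonneg[of N "u tm"] by (simp add: m_def L2_norm_power2)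
    then have "\<epsilon> * m * m \<le> \<epsilon> * m * (2 * K * h)" by (simp add: power2_eq_square mult_ac)
    then have "m \<le> 2 * K * h"
      using \<epsilon> m0 K h by (cases "m = 0") (auto simp: mult_le_cancel_left)
    then have "2 * \<epsilon> * K * (h * m) \<le> 2 * \<epsilon> * K * (h * (2 * K * h))"
      using \<epsilon> K h by (intro mult_left_mono) auto
    also have "\<dots> = 4 * \<epsilon> * K^2 * h^2" by (simp add: power2_eq_square)
    finally show ?thesis using E_le[of h] h by linarith
  qed
  \<comment> \<open>The first summand is the initial energy of the difference from
    \<open>layer\<close>, the second its Young term with the residual bounded by
    \<open>K * h\<close>. Both carry the factor \<open>h^2\<close>, and \<open>d_lo\<close> is the
    coefficient of the dissipated integral.\<close>
  define C where "C = (4 * \<epsilon> * K^2 + T * (\<epsilon>^2 * K^2 / d_lo)) / d_lo"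
  have quot: "integral {0..T - h} (%t. L2_inner N (%z. v (t + h) z - v t z) (%z. v (t + h) z - v t z)) \<le> C * h^2"
    if h: "0 < h" "h < T" for h
  proof -
    have "(%t z. coef_a D z * u (t + h) z - coef_a D z * u t z) = (%t z. coef_a D z * (u (t + h) z - u t z))"
      "(%t z. (coef_d D z * v (t + h) z + \<epsilon> * \<rho> (t + h) z) - (coef_d D z * v t z + \<epsilon> * \<rho> t z))
       = (%t z. coef_d D z * (v (t + h) z - v t z) + \<epsilon> * (\<rho> (t + h) z - \<rho> t z))"
      by (simp_all add: algebra_simps)
    then have wp': "weak_pair (T - h) \<epsilon> (%t z. u (t + h) z - u t z) (%t z. v (t + h) z - v t z)
       (%t z. x (t + h) z - x t z) (%t z. coef_a D z * (u (t + h) z - u t z))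
       (%t z. coef_d D z * (v (t + h) z - v t z) + \<epsilon> * (\<rho> (t + h) z - \<rho> t z)) (%t. g (t + h) + g t)"
      using weak_pair_difference[OF wp, of h] h by simp
    have \<rho>': "L2_curve (T - h) (%t z. \<rho> (t + h) z - \<rho> t z)"
      using h by (intro L2.cont_curve_diff continuous_curve_shift \<rho> continuous_curve_mono[OF \<rho>(1)]) auto
    have \<rho>h: "L2_norm N (%z. \<rho> (t + h) z - \<rho> t z) \<le> K * h" if "t \<in> {0..T - h}" for t
      using lip[of "t + h" t] that h by auto
    have hT: "h \<in> {0..T}" using h by auto
    \<comment> \<open>The initial values have norm zero without being the zero function, so
      subtracting them leaves the inner product unchanged.\<close>
    have zero_diff: "L2_inner N (%z. c h z - c 0 z) (%z. c h z - c 0 z) = L2_inner N (c h) (c h)"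
      if "L2_curve T c" "L2_norm N (c 0) = 0" for c
    proof -
      have "c h \<in> L2 N" "c 0 \<in> L2 N" using L2.cont_curve_mem[OF that(1)] hT T0 by auto
      then show ?thesis
        using L2.ip_diff_self[of "c h" N "c 0"] L2_norm_zero_imp_inner_zero[of "c 0" N "c h"]
          L2_norm_zero_imp_inner_zero[of "c 0" N "c 0"] that(2) by (simp add: L2_inner_commute)
    qed
    let ?I = "integral {0..T - h} (%t. L2_inner N (%z. v (t + h) z - v t z) (%z. v (t + h) z - v t z))"
    let ?du = "%z. u (T - h + h) z - u (T - h) z" and ?dv = "%z. v (T - h + h) z - v (T - h) z"
    have "L2_inner N ?du ?du + \<epsilon> * L2_inner N ?dv ?dv + d_lo * ?I
       \<le> L2_inner N (u h) (u h) + \<epsilon> * L2_inner N (v h) (v h) + (T - h) * (\<epsilon>^2 * (K * h)^2 / d_lo)"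
      using damped_energy_bound(1)[OF wp' \<epsilon>(1) \<rho>' \<rho>h, of "T - h"] h zero_diff[OF u init(1)] zero_diff[OF v init(2)]
      by simp
    moreover have "0 \<le> L2_inner N ?du ?du" "0 \<le> \<epsilon> * L2_inner N ?dv ?dv"
      using \<epsilon> L2_inner_self_nonneg[of N ?du] L2_inner_self_nonneg[of N ?dv] by auto
    moreover have "(T - h) * (\<epsilon>^2 * (K * h)^2 / d_lo) \<le> T * (\<epsilon>^2 * (K * h)^2 / d_lo)"
      using h d_bounds by (intro mult_right_mono) auto
    ultimately have "d_lo * ?I \<le> 4 * \<epsilon> * K^2 * h^2 + T * (\<epsilon>^2 * (K * h)^2 / d_lo)"
      using layer[of h] h by linarith
    also have "\<dots> = d_lo * (C * h^2)"
      using d_bounds by (simp add: C_def power_mult_distrib field_simps)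
    finally show ?thesis using d_bounds by simp
  qed
  let ?z = "%t z. x t z + (coef_d D z * v t z + \<epsilon> * \<rho> t z)"
  have ym: "(%z. coef_d D z * v t z + \<epsilon> * \<rho> t z) \<in> L2 N" if "t \<in> {0..T}" for t
    using L2.cont_curve_mem[OF y that] .
  have "(\<integral>\<^sup>+t. ennreal (L2_inner N (?z t) (?z t)) \<partial>lebesgue_on {0..T}) \<le> ennreal (\<epsilon>^2 * C)"
  proof (rule L2.weak_curve_L2_bound[where J = "edges N \<times> UNIV" and \<omega> = "cell N" and v = v])
    show "countable (edges N \<times> (UNIV :: (nat \<times> nat) set))"
      using wf_networkD(1)[OF wf] by (intro countable_SIGMA) (auto intro: countable_finite)
    show "?z t \<in> L2 N" if "t \<in> {0..T}" for t
      using x[OF that] ym[OF that] by (rule L2.add_mem)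
    show "integrable (lebesgue_on {0..T}) (%t. L2_inner N (?z t) w)" if w: "w \<in> L2 N" for w
    proof -
      have "integrable (lebesgue_on {0..T}) (%t. L2_inner N (%z. coef_d D z * v t z + \<epsilon> * \<rho> t z) w)"
        by (intro continuous_imp_integrable_real L2.continuous_on_ip_curve y w)
      then have "integrable (lebesgue_on {0..T}) (%t. L2_inner N (x t) w + L2_inner N (%z. coef_d D z * v t z + \<epsilon> * \<rho> t z) w)"
        using x_int[OF w] by simp
      moreover have "integrable (lebesgue_on {0..T}) (%t. L2_inner N (?z t) w) \<longleftrightarrow>
          integrable (lebesgue_on {0..T}) (%t. L2_inner N (x t) w + L2_inner N (%z. coef_d D z * v t z + \<epsilon> * \<rho> t z) w)"
        by (rule Bochner_Integration.integrable_cong[OF refl]) (simp add: L2.ip_add_left x ym w)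
      ultimately show ?thesis by simp
    qed
    show "\<epsilon> * L2_inner N (%i. v r i - v s i) w = - integral {s..r} (%\<sigma>. L2_inner N (?z \<sigma>) w)"
      if w: "w \<in> L2 N" and sr: "0 \<le> s" "s \<le> r" "r \<le> T" for w s r
    proof -
      have "integral {s..r} (%\<sigma>. L2_inner N (?z \<sigma>) w)
          = integral {s..r} (%\<sigma>. L2_inner N (x \<sigma>) w + L2_inner N (%z. coef_d D z * v \<sigma> z + \<epsilon> * \<rho> \<sigma> z) w)"
        using w sr x ym by (intro Henstock_Kurzweil_Integration.integral_cong L2.ip_add_left) auto
      then show ?thesis using eq2[OF w sr] by simp
    qed
    show "L2_norm N y \<le> c"
      if "y \<in> L2 N" "0 \<le> c" "\<And>K a. finite K ==> K \<subseteq> edges N \<times> UNIV ==>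
         \<bar>L2_inner N y (%i. \<Sum>k\<in>K. a k * cell N k i)\<bar> \<le> c * L2_norm N (%i. \<Sum>k\<in>K. a k * cell N k i)" for y c
      using L2_norm_le_by_cells[OF wf that] .
  qed (use v T_pos \<epsilon> quot cell_mem_L2 in auto)
  \<comment> \<open>\<open>\<epsilon> < 1\<close> removes \<open>\<epsilon>\<close> from
    \<open>C\<close>. The factor \<open>\<epsilon>^2\<close> in front remains; it stems from the
    equation, in which \<open>\<epsilon>\<close> multiplies the time derivative of
    \<open>v\<close>.\<close>
  also have "\<dots> \<le> ennreal (\<epsilon>^2 * ((4 * K^2 + T * K^2 / d_lo) / d_lo))"
  proof (intro ennreal_leI mult_left_mono)
    have "\<epsilon>^2 \<le> 1" using \<epsilon> by (simp add: power_le_one)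
    then have "T * (\<epsilon>^2 * K^2 / d_lo) \<le> T * (1 * K^2 / d_lo)"
      using T_pos d_bounds by (intro mult_left_mono divide_right_mono mult_right_mono) auto
    moreover have "4 * \<epsilon> * K^2 \<le> 4 * K^2" using \<epsilon> by (intro mult_right_mono) auto
    ultimately show "C \<le> (4 * K^2 + T * K^2 / d_lo) / d_lo"
      unfolding C_def using d_bounds by (intro divide_right_mono) auto
  qed simp
  finally show "(\<integral>\<^sup>+t. ennreal (L2_inner N (?z t) (?z t)) \<partial>lebesgue_on {0..T})
       \<le> ennreal (\<epsilon>^2 * ((4 * K^2 + T * K^2 / d_lo) / d_lo))" .
qed

end

section \<open>The parabolic problem\<close>

lemma derivative_curve_map:
  assumes u: "derivative_curve T nX u u'"
    and mem: "\<And>t. t \<in> {0..T} ==> u t \<in> X" "\<And>t. t \<in> {0..T} ==> u' t \<in> X"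
    and lip: "\<And>x y z r. x \<in> X ==> y \<in> X ==> z \<in> X ==>
       \<bar>nY (%i. (L x i - L y i) / r - L z i)\<bar> \<le> C * nX (%i. (x i - y i) / r - z i)"
  shows "derivative_curve T nY (%t. L (u t)) (%t. L (u' t))"
  unfolding derivative_curve_def
proof
  fix t assume t: "t \<in> {0..T}"
  have "((%s. C * nX (%i. (u s i - u t i) / (s - t) - u' t i)) \<longlongrightarrow> C * 0) (at t within {0..T})"
    using u t by (intro tendsto_mult_left) (auto simp: derivative_curve_def)
  then have "((%s. C * nX (%i. (u s i - u t i) / (s - t) - u' t i)) \<longlongrightarrow> 0) (at t within {0..T})" by simp
  then show "((%s. nY (%i. (L (u s) i - L (u t) i) / (s - t) - L (u' t) i)) \<longlongrightarrow> 0) (at t within {0..T})"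
    by (rule tendsto_0_dominated_within) (intro lip mem t)
qed

lemma (in semi_inner) derivative_curve_diff:
  assumes u: "derivative_curve T nrm u u'" and v: "derivative_curve T nrm v v'"
    and mem: "\<And>t. t \<in> {0..T} ==> u t \<in> X" "\<And>t. t \<in> {0..T} ==> u' t \<in> X"
       "\<And>t. t \<in> {0..T} ==> v t \<in> X" "\<And>t. t \<in> {0..T} ==> v' t \<in> X"
  shows "derivative_curve T nrm (%t i. u t i - v t i) (%t i. u' t i - v' t i)"
  unfolding derivative_curve_def
proof
  fix t assume t: "t \<in> {0..T}"
  let ?d = "%u u' s i. (u s i - u t i) / (s - t) - u' t i"
  have "((%s. nrm (?d u u' s) + nrm (?d v v' s)) \<longlongrightarrow> 0 + 0) (at t within {0..T})"
    using u v t by (intro tendsto_add) (auto simp: derivative_curve_def)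
  then have lim: "((%s. nrm (?d u u' s) + nrm (?d v v' s)) \<longlongrightarrow> 0) (at t within {0..T})" by simp
  have "\<bar>nrm (?d (%t i. u t i - v t i) (%t i. u' t i - v' t i) s)\<bar> \<le> nrm (?d u u' s) + nrm (?d v v' s)"
    if s: "s \<in> {0..T}" for s
  proof -
    have d: "?d w w' s \<in> X" if "w s \<in> X" "w t \<in> X" "w' t \<in> X" for w w'
      using diff_mem[OF scale_mem[OF diff_mem[OF that(1,2)], of "1 / (s - t)"] that(3)] by simp
    have mu: "?d u u' s \<in> X" and mv: "?d v v' s \<in> X" using d mem s t by auto
    have "?d (%t i. u t i - v t i) (%t i. u' t i - v' t i) s = (%i. ?d u u' s i - ?d v v' s i)"
      by (auto simp: diff_divide_distrib)
    then show ?thesis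
      using nrm_diff_le[OF mu mv] nrm_nonneg[OF diff_mem[OF mu mv]] by simp
  qed
  from tendsto_0_dominated_within[OF lim this]
  show "((%s. nrm (?d (%t i. u t i - v t i) (%t i. u' t i - v' t i) s)) \<longlongrightarrow> 0) (at t within {0..T})" .
qed

lemma derivative_curve_edge_deriv:
  assumes u: "derivative_curve T (H1_norm N) u u'"
    and mem: "\<And>t. t \<in> {0..T} ==> u t \<in> H1 N" "\<And>t. t \<in> {0..T} ==> u' t \<in> H1 N"
  shows "derivative_curve T (L2_norm N) (%t. edge_deriv N (u t)) (%t. edge_deriv N (u' t))"
proof (rule derivative_curve_map[OF u mem, where C = 1])
  fix x y z r assume xyz: "x \<in> H1 N" "y \<in> H1 N" "z \<in> H1 N"
  let ?q = "%i. (1 / r) * (x i - y i) + (- 1) * z i"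
  let ?w = "%i. (1 / r) * (edge_deriv N x i - edge_deriv N y i) + (- 1) * edge_deriv N z i"
  have q: "(%i. x i - y i) \<in> H1 N" "?q \<in> H1 N"
    by (rule H1.diff_mem[OF xyz(1,2)]) (rule comb_mem_H1[OF H1.diff_mem[OF xyz(1,2)] xyz(3)])
  have w: "?w \<in> L2 N"
    using xyz by (intro L2.comb_mem L2.diff_mem edge_deriv_mem_L2)
  have refl: "ae_eq N w w" for w by (simp add: ae_eq_def)
  have "ae_eq N (edge_deriv N ?q) ?w"
    by (rule ae_eq_trans[OF edge_deriv_comb[OF q(1) xyz(3)] ae_eq_comb[OF edge_deriv_diff[OF xyz(1,2)] refl]])
  then have "L2_norm N ?w = L2_norm N (edge_deriv N ?q)"
    using q w by (intro L2_norm_cong_ae[symmetric] edge_deriv_mem_L2) auto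
  also have "\<dots> \<le> H1_norm N ?q" by (rule L2_norm_edge_deriv_le_H1_norm)
  finally show "\<bar>L2_norm N (%i. (edge_deriv N x i - edge_deriv N y i) / r - edge_deriv N z i)\<bar>
      \<le> 1 * H1_norm N (%i. (x i - y i) / r - z i)"
    by (simp add: L2_norm_ge_0)
qed

lemma derivative_curve_mult:
  assumes u: "derivative_curve T (L2_norm N) u u'"
    and mem: "\<And>t. t \<in> {0..T} ==> u t \<in> L2 N" "\<And>t. t \<in> {0..T} ==> u' t \<in> L2 N"
    and k: "coef_bounds N k lo hi" and lo: "0 \<le> lo" "0 \<le> hi"
  shows "derivative_curve T (L2_norm N) (%t z. k z * u t z) (%t z. k z * u' t z)"
proof (rule derivative_curve_map[OF u mem, where C = hi and L = "%u z. k z * u z"])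
  fix x y z r assume xyz: "x \<in> L2 N" "y \<in> L2 N" "z \<in> L2 N"
  let ?q = "%i. (1 / r) * (x i - y i) + (- 1) * z i"
  have q: "?q \<in> L2 N" using xyz by (intro L2.comb_mem L2.diff_mem)
  have "(%i. (k i * x i - k i * y i) / r - k i * z i) = (%i. k i * ?q i)"
    by (simp add: algebra_simps diff_divide_distrib)
  then show "\<bar>L2_norm N (%i. (k i * x i - k i * y i) / r - k i * z i)\<bar> \<le> hi * L2_norm N (%i. (x i - y i) / r - z i)"
    using L2_norm_mult_le[OF k q lo] by (simp add: L2_norm_ge_0)
qed

lemma (in semi_inner) ip_curve_increment:
  assumes u: "cont_curve T u" and u': "cont_curve T u'" and d: "derivative_curve T nrm u u'"
    and w: "w \<in> X" and sr: "0 \<le> s" "s \<le> r" "r \<le> T"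
  shows "ip (u r) w - ip (u s) w = integral {s..r} (%t. ip (u' t) w)"
proof -
  have "((%t. ip (u' t) w) has_integral ip (u r) w - ip (u s) w) {s..r}"
  proof (rule fundamental_theorem_of_calculus[OF sr(2)])
    fix t assume t: "t \<in> {s..r}"
    then have "((%s. ip (u s) w) has_real_derivative ip (u' t) w) (at t within {0..T})"
      using sr by (intro has_real_derivative_ip_curve[OF u u' d w]) auto
    then show "((%s. ip (u s) w) has_vector_derivative ip (u' t) w) (at t within {s..r})"
      unfolding has_real_derivative_iff_has_vector_derivative[symmetric]
      by (rule has_field_derivative_subset) (use sr in auto)
  qed
  then show ?thesis by (simp add: has_integral_iff)
qed

text \<open>\<open>U j\<close> and \<open>F j\<close> stand for the time derivatives of
  \<open>p0\<close> and of \<open>f\<close>. Two of them are required so that \<open>M 1\<close>,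
  the time derivative of \<open>m0\<close>, is Lipschitz in time.\<close>

locale parabolic_problem = network_problem N D a_hi d_lo d_hi
  for N :: "('v, 'e) network" and D :: "('v, 'e) flow_data" and a_hi d_lo d_hi :: real +
  fixes p0 m0 :: "real \<Rightarrow> 'e edge_fun" and lam0 :: "real \<Rightarrow> 'v \<Rightarrow> real"
    and U F :: "nat \<Rightarrow> real \<Rightarrow> 'e edge_fun" and k :: nat
  assumes sol0: "is_solution N D 0 p0 m0 lam0"
    and k2: "2 \<le> k"
    and U0: "\<And>t. U 0 t = p0 t"
    and U_curve: "\<And>j. j \<le> k ==> continuous_curve T (H1 N) (H1_norm N) (U j)"
    and U_deriv: "\<And>j. j < k ==> derivative_curve T (H1_norm N) (U j) (U (Suc j))"
    and F0: "\<And>t. F 0 t = rhs_f D t"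
    and F_curve: "\<And>j. j \<le> k ==> L2_curve T (F j)"
    and F_deriv: "\<And>j. j < k ==> derivative_curve T (L2_norm N) (F j) (F (Suc j))"
    and g_cont: "\<And>q. q \<in> H1 N ==> continuous_on {0..T} (%t. rhs_g D t q)"
    and r_cont: "\<And>v. v \<in> neumann N ==> continuous_on {0..T} (%t. rhs_r D t v)"
    and h_cont: "\<And>v. v \<in> dirichlet N ==> continuous_on {0..T} (%t. rhs_h D t v)"
begin

text \<open>The \<open>j\<close>-th time derivative of \<open>m0\<close>, obtained from the
  algebraic relation \<open>m0 = d^{-1} (f - K p0)\<close>. Smoothness of \<open>m0\<close> is thus
  inherited from \<open>p0\<close> and \<open>f\<close>; the given \<open>m0\<close> agrees with
  \<open>M 0\<close> up to norm zero.\<close>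

definition M :: "nat \<Rightarrow> real \<Rightarrow> 'e edge_fun" where
  "M j t = (%z. inverse (coef_d D z) * (F j t z - edge_deriv N (U j t) z))"

lemma U_mem: "j \<le> k ==> t \<in> {0..T} ==> U j t \<in> H1 N"
  using U_curve by (auto simp: continuous_curve_def)

lemma F_mem: "j \<le> k ==> t \<in> {0..T} ==> F j t \<in> L2 N"
  using F_curve by (auto simp: continuous_curve_def)

lemma p0_mem: "t \<in> {0..T} ==> p0 t \<in> H1 N"
  using U_mem[of 0 t] by (simp add: U0)

lemma p0_curve: "continuous_curve T (H1 N) (H1_norm N) p0"
proof -
  have "U 0 = p0" by (rule ext) (rule U0)
  then show ?thesis using U_curve[of 0] by simp
qed

lemma f_curve: "L2_curve T (rhs_f D)"
proof -
  have "F 0 = rhs_f D" by (rule ext) (rule F0)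
  then show ?thesis using F_curve[of 0] by simp
qed

lemma m0_curve: "L2_curve T m0"
  using sol0 by (auto simp: is_solution_def intro: Ck_time_continuous)

lemma inv_d_bounds: "coef_bounds N (%z. inverse (coef_d D z)) (inverse d_hi) (inverse d_lo)"
  by (rule coef_bounds_inverse[OF d_bounds(1,2)])

lemma inv_d_pos: "0 \<le> inverse d_hi" "0 \<le> inverse d_lo"
  using d_bounds by auto

lemma M_curve: "j \<le> k ==> L2_curve T (M j)"
  unfolding M_def [abs_def]
  by (intro continuous_curve_mult[OF _ inv_d_bounds inv_d_pos] L2.cont_curve_diff F_curve
      continuous_curve_edge_deriv U_curve)

lemma M_mem: "j \<le> k ==> t \<in> {0..T} ==> M j t \<in> L2 N"
  using M_curve by (auto simp: continuous_curve_def)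

lemma M_deriv: "j < k ==> derivative_curve T (L2_norm N) (M j) (M (Suc j))"
  unfolding M_def [abs_def]
  by (intro derivative_curve_mult[OF _ _ _ inv_d_bounds inv_d_pos] L2.derivative_curve_diff F_deriv
      derivative_curve_edge_deriv U_deriv L2.diff_mem F_mem edge_deriv_mem_L2 U_mem) auto

text \<open>For \<open>\<epsilon> = 0\<close> the residual of the second equation is the weak
  derivative of a constant. It is continuous in time, so it vanishes at every time and not merely
  almost everywhere.\<close>

lemma m0_equation:
  assumes t: "t \<in> {0..T}" and w: "w \<in> L2 N"
  shows "L2_inner N (edge_deriv N (p0 t)) w + L2_inner N (%z. coef_d D z * m0 t z) w = L2_inner N (rhs_f D t) w"
proof -
  let ?g = "%t. L2_inner N (rhs_f D t) w - op_K N (p0 t) w - L2_inner N (%z. coef_d D z * m0 t z) w"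
  have wd: "has_weak_deriv 0 T (%t. 0) ?g"
    using sol0 w by (simp add: is_solution_def)
  have gc: "continuous_on {0..T} ?g"
    unfolding op_K_def
    by (intro continuous_intros L2.continuous_on_ip_curve f_curve continuous_curve_edge_deriv p0_curve
        continuous_curve_mult[OF m0_curve d_bounds(1)] w) (use d_bounds in auto)
  have "0 = ?g t"
  proof (rule derivative_eq_integrand[OF gc T_pos, where \<phi> = "%t. 0"])
    show "0 - 0 = integral {0..x} ?g" if "x \<in> {0..T}" for x
      using weak_deriv_increment[OF wd, of 0 x] that by simp
  qed (use t in auto)
  then show ?thesis by (simp add: op_K_def)
qed

lemma M_0_equation:
  assumes t: "t \<in> {0..T}" and w: "w \<in> L2 N"
  shows "L2_inner N (edge_deriv N (p0 t)) w + L2_inner N (%z. coef_d D z * M 0 t z) w = L2_inner N (rhs_f D t) w"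
proof -
  have fm: "rhs_f D t \<in> L2 N" "edge_deriv N (p0 t) \<in> L2 N"
    using F_mem[of 0 t] edge_deriv_mem_L2[OF p0_mem[OF t]] t by (auto simp: F0)
  have "(%z. coef_d D z * M 0 t z) = (%z. inverse (coef_d D z) * (coef_d D z * (rhs_f D t z - edge_deriv N (p0 t) z)))"
    by (simp add: M_def F0 U0 mult_ac)
  then have "ae_eq N (%z. coef_d D z * M 0 t z) (%z. rhs_f D t z - edge_deriv N (p0 t) z)"
    using coef_bounds_cancel[OF d_bounds(1,2)] by simp
  then have "L2_inner N (%z. coef_d D z * M 0 t z) w = L2_inner N (%z. rhs_f D t z - edge_deriv N (p0 t) z) w"
    using fm w t by (intro L2_inner_cong_ae mult_mem_L2[OF d_bounds(1)] M_mem L2.diff_mem) auto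
  then show ?thesis using fm w by (simp add: L2.ip_diff_left)
qed

text \<open>Both functions satisfy \<open>d m = f - K p0\<close> after testing; testing with their
  difference and the positive lower bound of \<open>d\<close> give the claim.\<close>

lemma m0_eq_M:
  assumes t: "t \<in> {0..T}"
  shows "L2_norm N (%z. m0 t z - M 0 t z) = 0"
proof -
  let ?w = "%z. m0 t z - M 0 t z"
  have mm: "m0 t \<in> L2 N" "M 0 t \<in> L2 N" using L2.cont_curve_mem[OF m0_curve t] M_mem[of 0 t] t by auto
  then have w: "?w \<in> L2 N" by (rule L2.diff_mem)
  have "L2_inner N (%z. coef_d D z * ?w z) ?w = L2_inner N (%z. coef_d D z * m0 t z) ?w - L2_inner N (%z. coef_d D z * M 0 t z) ?w"
    using L2.ip_diff_left[OF mult_mem_L2[OF d_bounds(1) mm(1)] mult_mem_L2[OF d_bounds(1) mm(2)] w]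
    by (simp add: right_diff_distrib)
  also have "\<dots> = 0" using m0_equation[OF t w] M_0_equation[OF t w] by simp
  finally have "d_lo * L2_inner N ?w ?w \<le> 0"
    using L2_inner_mult_bounds(1)[OF d_bounds(1) w] by simp
  then have "L2_inner N ?w ?w \<le> 0" using d_bounds by (simp add: mult_le_0_iff)
  then show ?thesis using L2_inner_self_nonneg[of N ?w] by (simp add: L2_norm_def)
qed

lemma m0_inner:
  assumes "t \<in> {0..T}" "w \<in> L2 N"
  shows "L2_inner N (m0 t) w = L2_inner N (M 0 t) w"
proof -
  have mm: "m0 t \<in> L2 N" "M 0 t \<in> L2 N" using L2.cont_curve_mem[OF m0_curve] M_mem[of 0 t] assms by auto
  from L2_norm_zero_imp_inner_zero[OF L2.diff_mem[OF mm] assms(2) m0_eq_M[OF assms(1)]]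
  show ?thesis using L2.ip_diff_left[OF mm assms(2)] by simp
qed

lemma V0_op_B_adj: "q \<in> V0 ==> op_B_adj N y q = 0"
  by (simp add: op_B_adj_def V0_def)

lemma solution_p_increment:
  assumes sol: "is_solution N D \<epsilon> p m lam" and q: "q \<in> V0" and sr: "0 \<le> s" "s \<le> r" "r \<le> T"
  shows "L2_inner N (p r) q - L2_inner N (p s) q = integral {s..r} (%t. rhs_g D t q - op_C_adj N (rhs_r D t) q
             - L2_inner N (%z. coef_a D z * p t z) q + L2_inner N (edge_deriv N q) (m t))"
proof -
  have qH: "q \<in> H1 N" using q by (simp add: V0_def)
  have p: "L2_curve T p" using sol by (auto simp: is_solution_def intro: Ck_time_continuous)
  have wd: "has_weak_deriv 0 T (%t. L2_inner N (p t) q) (%t. rhs_g D t q - op_C_adj N (rhs_r D t) q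
             - L2_inner N (%z. coef_a D z * p t z) q + op_K_adj N (m t) q - op_B_adj N (lam t) q)"
    using sol qH unfolding is_solution_def by blast
  have "continuous_on {0..T} (%t. L2_inner N (p t) q)"
    by (intro L2.continuous_on_ip_curve p H1_subset_L2 qH)
  from weak_deriv_increment[OF wd this sr] show ?thesis
    by (simp add: V0_op_B_adj[OF q] op_K_adj_def op_K_def)
qed

lemma p_rhs_continuous:
  assumes "L2_curve T p" "L2_curve T m" "q \<in> H1 N"
  shows "continuous_on {0..T} (%t. rhs_g D t q - op_C_adj N (rhs_r D t) q
             - L2_inner N (%z. coef_a D z * p t z) q + L2_inner N (edge_deriv N q) (m t))"
  unfolding L2_inner_commute[of N "edge_deriv N q"] op_C_adj_def
  by (intro continuous_intros g_cont r_cont L2.continuous_on_ip_curve continuous_curve_mult[OF _ a_bounds(1)]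
      assms edge_deriv_mem_L2 H1_subset_L2) (use a_bounds in auto)

text \<open>The curve is differentiable and the integrand of the increment identity is continuous,
  so the weak equation holds at every time. The comparison with the stages needs it at the
  individual stage times.\<close>

lemma p0_equation:
  assumes t: "t \<in> {0..T}" and q: "q \<in> V0"
  shows "L2_inner N (U 1 t) q = rhs_g D t q - op_C_adj N (rhs_r D t) q
             - L2_inner N (%z. coef_a D z * p0 t z) q + L2_inner N (edge_deriv N q) (m0 t)"
proof -
  have qH: "q \<in> H1 N" using q by (simp add: V0_def)
  have pc: "L2_curve T p0" by (rule continuous_curve_H1_L2[OF p0_curve])
  have "U 0 = p0" by (rule ext) (rule U0)
  then have "derivative_curve T (H1_norm N) p0 (U 1)" using U_deriv[of 0] k2 by simp
  then have dL: "derivative_curve T (L2_norm N) p0 (U 1)"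
  proof (rule derivative_curve_map[where L = "%x. x" and C = 1 and X = "H1 N"])
    show "U 1 t \<in> H1 N" if "t \<in> {0..T}" for t using U_mem[of 1 t] that k2 by simp
    show "\<bar>L2_norm N (%i. (x i - y i) / r - z i)\<bar> \<le> 1 * H1_norm N (%i. (x i - y i) / r - z i)" for x y z r
      using L2_norm_le_H1_norm by (simp add: L2_norm_ge_0)
  qed (rule p0_mem)
  have U1: "L2_curve T (U 1)" using continuous_curve_H1_L2[OF U_curve[of 1]] k2 by simp
  show ?thesis
  proof (rule derivative_eq_integrand[OF p_rhs_continuous[OF pc m0_curve qH] T_pos])
    show "L2_inner N (p0 x) q - L2_inner N (p0 0) q = integral {0..x} (%t. rhs_g D t q - op_C_adj N (rhs_r D t) q
             - L2_inner N (%z. coef_a D z * p0 t z) q + L2_inner N (edge_deriv N q) (m0 t))" if "x \<in> {0..T}" for x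
      using solution_p_increment[OF sol0 q, of 0 x] that by simp
    show "((%t. L2_inner N (p0 t) q) has_real_derivative L2_inner N (U 1 t) q) (at t within {0..T})"
      by (rule L2.has_real_derivative_ip_curve[OF pc U1 dL H1_subset_L2[OF qH] t])
  qed (rule t)
qed

text \<open>The trace is continuous on \<open>H1\<close>, so the boundary condition holds at all
  times and can be differentiated. The second part is the hidden constraint that the discretization
  imposes on its stage derivatives.\<close>

lemma p0_boundary:
  assumes v: "v \<in> dirichlet N" and t: "t \<in> {0..T}"
  shows "vertex_value N (p0 t) v = rhs_h D t v"
    and "vector_derivative (%t. rhs_h D t v) (at t within {0..T}) = vertex_value N (U 1 t) v"
proof -
  have vv: "v \<in> verts (graph N)" using wf_networkD(4)[OF wf] v by auto
  obtain C where C: "0 \<le> C" "\<And>q. q \<in> H1 N ==> \<bar>vertex_value N q v\<bar> \<le> C * H1_norm N q"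
    by (rule vertex_value_bounded[OF wf vv]) (rule that)
  have diff: "vertex_value N (%z. q z - q' z) v = vertex_value N q v - vertex_value N q' v"
    if "q \<in> H1 N" "q' \<in> H1 N" for q q'
    using vertex_value_comb[OF wf vv that, of 1 "-1"] by simp
  have bc: "continuous_on {0..T} (%t. vertex_value N (p0 t) v)"
    unfolding continuous_on_def
  proof
    fix t assume t: "t \<in> {0..T}"
    have "((%s. C * H1_norm N (%i. p0 s i - p0 t i)) \<longlongrightarrow> C * 0) (at t within {0..T})"
      using p0_curve t by (intro tendsto_mult_left) (auto simp: continuous_curve_def)
    then have lim: "((%s. C * H1_norm N (%i. p0 s i - p0 t i)) \<longlongrightarrow> 0) (at t within {0..T})" by simp
    have "\<bar>vertex_value N (p0 s) v - vertex_value N (p0 t) v\<bar> \<le> C * H1_norm N (%i. p0 s i - p0 t i)"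
      if "s \<in> {0..T}" for s
      using C(2)[OF H1.diff_mem[OF p0_mem[OF that] p0_mem[OF t]]] diff[OF p0_mem[OF that] p0_mem[OF t]] by simp
    from LIM_zero_cancel[OF tendsto_0_dominated_within[OF lim this]]
    show "((%t. vertex_value N (p0 t) v) \<longlongrightarrow> vertex_value N (p0 t) v) (at t within {0..T})" .
  qed
  have ae: "AE t in lebesgue_on {0..T}. vertex_value N (p0 t) v - rhs_h D t v = 0"
  proof -
    have "AE t in lebesgue_on {0..T}. \<forall>v\<in>dirichlet N. vertex_value N (p0 t) v = rhs_h D t v"
      using sol0 unfolding is_solution_def by blast
    then show ?thesis by (rule eventually_mono) (use v in simp)
  qed
  have eq: "vertex_value N (p0 t) v - rhs_h D t v = 0" if t: "t \<in> {0..T}" for t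
  proof -
    let ?\<psi> = "%t. vertex_value N (p0 t) v - rhs_h D t v"
    have \<psi>: "continuous_on {0..T} ?\<psi>" by (intro continuous_intros bc h_cont v)
    have "0 = ?\<psi> t"
    proof (rule derivative_eq_integrand[OF \<psi> T_pos, where \<phi> = "%t. 0"])
      fix x assume x: "x \<in> {0..T}"
      obtain Z where Z: "negligible Z" "\<And>t. t \<in> {0..T} ==> t \<notin> Z ==> ?\<psi> t = 0"
        by (rule AE_lebesgue_on_negligibleE[OF ae]) (rule that)
      have "integral {0..x} ?\<psi> = integral {0..x} (%t. 0)"
        by (rule integral_spike[OF Z(1)]) (use Z(2) x in auto)
      then show "0 - 0 = integral {0..x} ?\<psi>" by simp
    qed (use t in auto)
    then show ?thesis by simp
  qed
  from eq[OF t] show "vertex_value N (p0 t) v = rhs_h D t v" by simp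
  have "((%s. rhs_h D s v) has_real_derivative vertex_value N (U 1 t) v) (at t within {0..T})"
    unfolding has_field_derivative_iff
  proof (rule LIM_zero_cancel)
    have "U 0 = p0" by (rule ext) (rule U0)
    then have d: "derivative_curve T (H1_norm N) p0 (U 1)" using U_deriv[of 0] k2 by simp
    have "((%s. C * H1_norm N (%i. (p0 s i - p0 t i) / (s - t) - U 1 t i)) \<longlongrightarrow> C * 0) (at t within {0..T})"
      using d t by (intro tendsto_mult_left) (auto simp: derivative_curve_def)
    then have lim: "((%s. C * H1_norm N (%i. (p0 s i - p0 t i) / (s - t) - U 1 t i)) \<longlongrightarrow> 0) (at t within {0..T})" by simp
    show "((%y. (rhs_h D y v - rhs_h D t v) / (y - t) - vertex_value N (U 1 t) v) \<longlongrightarrow> 0) (at t within {0..T})"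
    proof (rule tendsto_0_dominated_within[OF lim])
      fix s assume s: "s \<in> {0..T}"
      have m: "p0 s \<in> H1 N" "p0 t \<in> H1 N" "U 1 t \<in> H1 N"
        using p0_mem s t U_mem[of 1 t] k2 by auto
      have e: "(%i. (p0 s i - p0 t i) / (s - t) - U 1 t i) = (%i. (1 / (s - t)) * (p0 s i - p0 t i) + (- 1) * U 1 t i)"
        by simp
      have mem: "(%i. (p0 s i - p0 t i) / (s - t) - U 1 t i) \<in> H1 N"
        unfolding e by (intro comb_mem_H1 H1.diff_mem m)
      have "vertex_value N (%i. (p0 s i - p0 t i) / (s - t) - U 1 t i) v
          = (1 / (s - t)) * (rhs_h D s v - rhs_h D t v) + (- 1) * vertex_value N (U 1 t) v"
        unfolding e vertex_value_comb[OF wf vv H1.diff_mem[OF m(1,2)] m(3)] diff[OF m(1,2)]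
        using eq[OF s] eq[OF t] by simp
      then show "\<bar>(rhs_h D s v - rhs_h D t v) / (s - t) - vertex_value N (U 1 t) v\<bar>
          \<le> C * H1_norm N (%i. (p0 s i - p0 t i) / (s - t) - U 1 t i)"
        using C(2)[OF mem] by simp
    qed
  qed
  then have "((%s. rhs_h D s v) has_vector_derivative vertex_value N (U 1 t) v) (at t within cbox 0 T)"
    by (simp add: has_real_derivative_iff_has_vector_derivative)
  then show "vector_derivative (%t. rhs_h D t v) (at t within {0..T}) = vertex_value N (U 1 t) v"
    using vector_derivative_within_cbox[of 0 T t "%s. rhs_h D s v" "vertex_value N (U 1 t) v"] T_pos t by simp
qed

text \<open>\<open>\<epsilon> * M 1\<close> is the residual of \<open>(p0, m0)\<close> in the
  hyperbolic system. One constant for its size and its Lipschitz modulus is what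
  \<open>singular_perturbation_bounds\<close> expects; the latter comes from
  \<open>M 2\<close>.\<close>

lemma M_1_bounds:
  obtains K where "0 \<le> K" "\<And>t. t \<in> {0..T} ==> L2_norm N (M 1 t) \<le> K"
    "\<And>s t. s \<in> {0..T} ==> t \<in> {0..T} ==> L2_norm N (%z. M 1 s z - M 1 t z) \<le> K * \<bar>s - t\<bar>"
proof -
  obtain K1 where K1: "0 \<le> K1" "\<And>t. t \<in> {0..T} ==> L2_norm N (M 1 t) \<le> K1"
    using L2.cont_curve_bounded[OF M_curve[of 1]] k2 by auto
  obtain K2 where K2: "0 \<le> K2" "\<And>t. t \<in> {0..T} ==> L2_norm N (M 2 t) \<le> K2"
    using L2.cont_curve_bounded[OF M_curve[of 2]] k2 by auto
  have "L2_norm N (%z. M 1 s z - M 1 t z) \<le> K2 * \<bar>s - t\<bar>" if st: "s \<in> {0..T}" "t \<in> {0..T}" for s t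
  proof -
    have "L2_norm N (%i. M (Suc 0) s i - (\<Sum>l\<le>0. (s - t) ^ l / fact l * M (Suc l) t i)) \<le> K2 * \<bar>s - t\<bar> ^ Suc 0"
    proof (rule L2.curve_taylor[where U = "%j. M (Suc j)" and n = 0])
      show "L2_curve T (M (Suc j))" if "j \<le> Suc 0" for j
        using that k2 by (intro M_curve) auto
      show "derivative_curve T (L2_norm N) (M (Suc j)) (M (Suc (Suc j)))" if "j \<le> 0" for j
        using that k2 by (intro M_deriv) auto
      show "L2_norm N (M (Suc (Suc 0)) t) \<le> K2" if "t \<in> {0..T}" for t
        using K2(2)[OF that] by (simp add: numeral_2_eq_2)
    qed (use st in auto)
    then show ?thesis by simp
  qed
  then have "L2_norm N (%z. M 1 s z - M 1 t z) \<le> max K1 K2 * \<bar>s - t\<bar>" if "s \<in> {0..T}" "t \<in> {0..T}" for s t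
    using that mult_right_mono[of K2 "max K1 K2" "\<bar>s - t\<bar>"] by fastforce
  then show ?thesis
    using K1 by (intro that[of "max K1 K2"]) (auto intro: max.coboundedI1)
qed

lemma m0_increment:
  assumes w: "w \<in> L2 N" and sr: "0 \<le> s" "s \<le> r" "r \<le> T"
  shows "L2_inner N (m0 r) w - L2_inner N (m0 s) w = integral {s..r} (%t. L2_inner N (M 1 t) w)"
proof -
  have "L2_inner N (M 0 r) w - L2_inner N (M 0 s) w = integral {s..r} (%t. L2_inner N (M 1 t) w)"
    using M_deriv[of 0] k2 by (intro L2.ip_curve_increment[OF M_curve M_curve _ w sr]) auto
  then show ?thesis using m0_inner w sr by simp
qed

end

section \<open>Distance of the hyperbolic and the parabolic solution\<close>

context parabolic_problem
begin

text \<open>Outside \<open>H1 N\<close> the value of \<open>edge_deriv\<close> is arbitrary; the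
  default zero keeps the spatial derivative in \<open>L2 N\<close> at the exceptional times.\<close>

definition p_deriv :: "(real \<Rightarrow> 'e edge_fun) \<Rightarrow> real \<Rightarrow> 'e edge_fun" where
  "p_deriv p t = (if p t \<in> H1 N then edge_deriv N (p t) else (%z. 0))"

lemma p_deriv_mem: "p_deriv p t \<in> L2 N"
  by (simp add: p_deriv_def edge_deriv_mem_L2 L2.zero_mem)

lemma
  assumes sol: "is_solution N D \<epsilon> p m lam"
  shows p_curve: "L2_curve T p" and m_curve: "L2_curve T m"
    and p_mem_AE: "AE t in lebesgue_on {0..T}. p t \<in> H1 N"
    and p_boundary_AE: "AE t in lebesgue_on {0..T}. \<forall>v\<in>dirichlet N. vertex_value N (p t) v = rhs_h D t v"
    and p_norm_integrable: "integrable (lebesgue_on {0..T}) (%t. (H1_norm N (p t))^2)"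
  using sol by (auto simp: is_solution_def intro: Ck_time_continuous)

text \<open>Integrability of the complete right-hand side is part of \<open>has_weak_deriv\<close>.
  The other two terms are continuous in time, so integrability of the term with \<open>p\<close>
  follows by subtraction.\<close>

lemma op_K_integrable:
  assumes sol: "is_solution N D \<epsilon> p m lam" and w: "w \<in> L2 N"
  shows "integrable (lebesgue_on {0..T}) (%t. op_K N (p t) w)"
proof -
  have i1: "integrable (lebesgue_on {0..T}) (%t. L2_inner N (rhs_f D t) w - op_K N (p t) w
             - L2_inner N (%z. coef_d D z * m t z) w)"
    using sol w by (auto simp: is_solution_def has_weak_deriv_def)
  have i2: "integrable (lebesgue_on {0..T}) (%t. L2_inner N (rhs_f D t) w)"
    by (intro continuous_imp_integrable_real L2.continuous_on_ip_curve f_curve w)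
  have i3: "integrable (lebesgue_on {0..T}) (%t. L2_inner N (%z. coef_d D z * m t z) w)"
    by (intro continuous_imp_integrable_real L2.continuous_on_ip_curve continuous_curve_mult[OF m_curve[OF sol] d_bounds(1)] w)
      (use d_bounds in auto)
  show ?thesis
    using Bochner_Integration.integrable_diff[OF Bochner_Integration.integrable_diff[OF i2 i3] i1] by simp
qed

lemma p_deriv_integrable:
  assumes sol: "is_solution N D \<epsilon> p m lam" and w: "w \<in> L2 N"
  shows "integrable (lebesgue_on {0..T}) (%t. L2_inner N (p_deriv p t) w)"
  by (rule integrable_lebesgue_on_Icc_cong_AE(1)[OF op_K_integrable[OF sol w]])
    (use p_mem_AE[OF sol] in \<open>auto elim!: eventually_mono simp: p_deriv_def op_K_def\<close>)

lemma p_deriv_norm_integrable: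
  assumes sol: "is_solution N D \<epsilon> p m lam"
  shows "integrable (lebesgue_on {0..T}) (%t. L2_inner N (p_deriv p t) (p_deriv p t))"
proof -
  have "integrable (lebesgue_on {0..T}) (%t. L2_inner N (p t) (p t))"
    by (intro continuous_imp_integrable_real L2.continuous_on_ip_curves p_curve[OF sol])
  then have "integrable (lebesgue_on {0..T}) (%t. (H1_norm N (p t))^2 - L2_inner N (p t) (p t))"
    using p_norm_integrable[OF sol] by simp
  then show ?thesis
    by (rule integrable_lebesgue_on_Icc_cong_AE(1))
      (use p_mem_AE[OF sol] in \<open>auto elim!: eventually_mono simp: p_deriv_def H1_norm_power2 L2_norm_power2\<close>)
qed

lemma p0_deriv_curve: "L2_curve T (%t. edge_deriv N (p0 t))"
  by (rule continuous_curve_edge_deriv[OF p0_curve])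

lemma p0_deriv_mem: "t \<in> {0..T} ==> edge_deriv N (p0 t) \<in> L2 N"
  by (intro edge_deriv_mem_L2 p0_mem)

text \<open>The pair \<open>(p0, m0)\<close> satisfies the second hyperbolic equation up to
  \<open>\<epsilon>\<close> times the derivative \<open>M 1\<close> of \<open>m0\<close>, which
  therefore becomes a source for the difference. The right-hand sides and the boundary values
  cancel.\<close>

lemma weak_pair_of_solution:
  assumes sol: "is_solution N D \<epsilon> p m lam"
  obtains g where "weak_pair T \<epsilon> (%t z. p t z - p0 t z) (%t z. m t z - m0 t z)
     (%t z. p_deriv p t z - edge_deriv N (p0 t) z) (%t z. coef_a D z * (p t z - p0 t z))
     (%t z. coef_d D z * (m t z - m0 t z) + \<epsilon> * M 1 t z) g"
proof -
  let ?u = "%t z. p t z - p0 t z" and ?v = "%t z. m t z - m0 t z"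
  let ?x = "%t z. p_deriv p t z - edge_deriv N (p0 t) z"
  let ?y = "%t z. coef_a D z * ?u t z" and ?y' = "%t z. coef_d D z * ?v t z + \<epsilon> * M 1 t z"
  note pc = p_curve[OF sol] and mc = m_curve[OF sol]
  have p0c: "L2_curve T p0" by (rule continuous_curve_H1_L2[OF p0_curve])
  note pm = L2.cont_curve_mem[OF pc] and p0m = L2.cont_curve_mem[OF p0c]
  note mm = L2.cont_curve_mem[OF mc] and m0m = L2.cont_curve_mem[OF m0_curve]
  have uc: "L2_curve T ?u" and vc: "L2_curve T ?v"
    by (intro L2.cont_curve_diff pc p0c mc m0_curve)+
  have yc: "L2_curve T ?y" "L2_curve T ?y'"
    using a_bounds d_bounds k2
    by (auto intro!: continuous_curve_mult[OF uc a_bounds(1)] continuous_curve_mult[OF vc d_bounds(1)]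
        L2.cont_curve_add L2.cont_curve_scale M_curve)
  have xm: "?x t \<in> L2 N" if "t \<in> {0..T}" for t
    using that by (intro L2.diff_mem p_deriv_mem p0_deriv_mem)
  have x_int: "integrable (lebesgue_on {0..T}) (%t. L2_inner N (?x t) w)" if w: "w \<in> L2 N" for w
  proof -
    have "integrable (lebesgue_on {0..T}) (%t. L2_inner N (edge_deriv N (p0 t)) w)"
      by (intro continuous_imp_integrable_real L2.continuous_on_ip_curve p0_deriv_curve w)
    then have "integrable (lebesgue_on {0..T}) (%t. L2_inner N (p_deriv p t) w - L2_inner N (edge_deriv N (p0 t)) w)"
      using p_deriv_integrable[OF sol w] by simp
    moreover have "integrable (lebesgue_on {0..T}) (%t. L2_inner N (?x t) w) \<longleftrightarrow>
        integrable (lebesgue_on {0..T}) (%t. L2_inner N (p_deriv p t) w - L2_inner N (edge_deriv N (p0 t)) w)"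
      using w by (intro Bochner_Integration.integrable_cong refl) (simp add: L2.ip_diff_left p_deriv_mem p0_deriv_mem)
    ultimately show ?thesis by simp
  qed
  obtain K0 where K0: "0 \<le> K0" "\<And>t. t \<in> {0..T} ==> L2_norm N (edge_deriv N (p0 t)) \<le> K0"
    using L2.cont_curve_bounded[OF p0_deriv_curve] by blast
  \<comment> \<open>Integrable majorant of the spatial derivative: the hyperbolic part is square
    integrable in time, the parabolic part is continuous and hence bounded by
    \<open>K0\<close>.\<close>
  define g where "g t = L2_norm N (p_deriv p t) + K0" for t
  have g_int: "integrable (lebesgue_on {0..T}) g"
  proof -
    have "(%t. L2_norm N (p_deriv p t)) \<in> L2_interval 0 T"
      using p_deriv_norm_integrable[OF sol]
      by (auto simp: L2_interval_def L2_norm_power2 L2_norm_def L2_inner_self_nonneg)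
    then show ?thesis
      unfolding g_def using L2_interval_integrable by auto
  qed
  have xg: "L2_norm N (?x t) \<le> g t" if t: "t \<in> {0..T}" for t
    using L2.nrm_diff_le[OF p_deriv_mem p0_deriv_mem[OF t], of p t] K0(2)[OF t] by (simp add: g_def)
  have ae: "AE t in lebesgue_on {0..T}. ?u t \<in> V0 \<and> ae_eq N (edge_deriv N (?u t)) (?x t)"
  proof -
    have "AE t in lebesgue_on {0..T}. p t \<in> H1 N \<and> (\<forall>v\<in>dirichlet N. vertex_value N (p t) v = rhs_h D t v)"
      using p_mem_AE[OF sol] p_boundary_AE[OF sol] by (simp add: AE_conj_iff)
    then show ?thesis
    proof (rule lebesgue_on_mono)
      fix t assume t: "p t \<in> H1 N \<and> (\<forall>v\<in>dirichlet N. vertex_value N (p t) v = rhs_h D t v)" "t \<in> {0..T}"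
      have "vertex_value N (?u t) v = 0" if v: "v \<in> dirichlet N" for v
      proof -
        have "v \<in> verts (graph N)" using wf_networkD(4)[OF wf] v by auto
        from vertex_value_comb[OF wf this, of "p t" "p0 t" 1 "-1"] show ?thesis
          using t v p0_mem p0_boundary(1)[OF v t(2)] by simp
      qed
      then have "?u t \<in> V0" using t p0_mem by (simp add: V0_def H1.diff_mem)
      moreover have "ae_eq N (edge_deriv N (?u t)) (?x t)"
        using edge_deriv_diff[of "p t" N "p0 t"] t p0_mem by (simp add: p_deriv_def)
      ultimately show "?u t \<in> V0 \<and> ae_eq N (edge_deriv N (?u t)) (?x t)" by simp
    qed
  qed
  have eq1: "L2_inner N (%z. ?u r z - ?u s z) q
      = integral {s..r} (%\<sigma>. L2_inner N (edge_deriv N q) (?v \<sigma>) - L2_inner N (?y \<sigma>) q)"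
    if q: "q \<in> V0" and sr: "0 \<le> s" "s \<le> r" "r \<le> T" for q s r
  proof -
    have qH: "q \<in> H1 N" using q by (simp add: V0_def)
    then have qL: "q \<in> L2 N" "edge_deriv N q \<in> L2 N" by (auto intro: H1_subset_L2 edge_deriv_mem_L2)
    have st: "s \<in> {0..T}" "r \<in> {0..T}" using sr by auto
    let ?A = "%p m t. rhs_g D t q - op_C_adj N (rhs_r D t) q
             - L2_inner N (%z. coef_a D z * p t z) q + L2_inner N (edge_deriv N q) (m t)"
    have i: "?A p m integrable_on {s..r}" "?A p0 m0 integrable_on {s..r}"
      using sr by (auto intro!: integrable_continuous_interval
          continuous_on_subset[OF p_rhs_continuous[OF pc mc qH]] continuous_on_subset[OF p_rhs_continuous[OF p0c m0_curve qH]])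
    have "L2_inner N (%z. ?u r z - ?u s z) q = (L2_inner N (p r) q - L2_inner N (p s) q) - (L2_inner N (p0 r) q - L2_inner N (p0 s) q)"
      using pm[OF st(1)] pm[OF st(2)] p0m[OF st(1)] p0m[OF st(2)] qL by (simp add: L2.ip_diff_left L2.diff_mem)
    also have "\<dots> = integral {s..r} (?A p m) - integral {s..r} (?A p0 m0)"
      using solution_p_increment[OF sol q sr] solution_p_increment[OF sol0 q sr] by simp
    also have "\<dots> = integral {s..r} (%t. ?A p m t - ?A p0 m0 t)"
      by (rule Henstock_Kurzweil_Integration.integral_diff[symmetric, OF i])
    also have "\<dots> = integral {s..r} (%\<sigma>. L2_inner N (edge_deriv N q) (?v \<sigma>) - L2_inner N (?y \<sigma>) q)"
    proof (rule Henstock_Kurzweil_Integration.integral_cong)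
      fix t assume "t \<in> {s..r}"
      then have t: "t \<in> {0..T}" using sr by auto
      have "L2_inner N (?y t) q = L2_inner N (%z. coef_a D z * p t z) q - L2_inner N (%z. coef_a D z * p0 t z) q"
        using L2.ip_diff_left[OF mult_mem_L2[OF a_bounds(1) pm[OF t]] mult_mem_L2[OF a_bounds(1) p0m[OF t]] qL(1)]
        by (simp add: right_diff_distrib)
      moreover have "L2_inner N (edge_deriv N q) (?v t) = L2_inner N (edge_deriv N q) (m t) - L2_inner N (edge_deriv N q) (m0 t)"
        by (rule L2.ip_diff_right[OF mm[OF t] m0m[OF t] qL(2)])
      ultimately show "?A p m t - ?A p0 m0 t = L2_inner N (edge_deriv N q) (?v t) - L2_inner N (?y t) q"
        by simp
    qed
    finally show ?thesis .
  qed
  have eq2: "\<epsilon> * L2_inner N (%z. ?v r z - ?v s z) w = - integral {s..r} (%\<sigma>. L2_inner N (?x \<sigma>) w + L2_inner N (?y' \<sigma>) w)"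
    if w: "w \<in> L2 N" and sr: "0 \<le> s" "s \<le> r" "r \<le> T" for w s r
  proof -
    have st: "s \<in> {0..T}" "r \<in> {0..T}" using sr by auto
    let ?G = "%t. L2_inner N (rhs_f D t) w - op_K N (p t) w - L2_inner N (%z. coef_d D z * m t z) w"
    have wd: "has_weak_deriv 0 T (%t. \<epsilon> * L2_inner N (m t) w) ?G"
      using sol w unfolding is_solution_def by blast
    have mcont: "continuous_on {0..T} (%t. \<epsilon> * L2_inner N (m t) w)"
      by (intro continuous_intros L2.continuous_on_ip_curve mc w)
    have "integrable (lebesgue_on {0..T}) ?G" using wd by (simp add: has_weak_deriv_def)
    then have G: "?G integrable_on {s..r}"
      using sr by (auto simp: integrable_lebesgue_on_Icc_iff intro: integrable_subinterval_real)
    have M1: "(%t. L2_inner N (M 1 t) w) integrable_on {s..r}"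
      using sr k2 w by (intro integrable_continuous_interval continuous_on_subset[OF L2.continuous_on_ip_curve[OF M_curve]]) auto
    have "\<epsilon> * L2_inner N (%z. ?v r z - ?v s z) w
        = (\<epsilon> * L2_inner N (m r) w - \<epsilon> * L2_inner N (m s) w) - \<epsilon> * (L2_inner N (m0 r) w - L2_inner N (m0 s) w)"
      using mm[OF st(1)] mm[OF st(2)] m0m[OF st(1)] m0m[OF st(2)] w
      by (simp add: L2.ip_diff_left L2.diff_mem right_diff_distrib)
    also have "\<dots> = integral {s..r} ?G - \<epsilon> * integral {s..r} (%t. L2_inner N (M 1 t) w)"
      using weak_deriv_increment[OF wd mcont sr] m0_increment[OF w sr] by simp
    also have "\<dots> = integral {s..r} (%t. ?G t - \<epsilon> * L2_inner N (M 1 t) w)"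
      using G M1 by (simp add: Henstock_Kurzweil_Integration.integral_diff integrable_on_mult_right)
    also have "\<dots> = integral {s..r} (%\<sigma>. - (L2_inner N (?x \<sigma>) w + L2_inner N (?y' \<sigma>) w))"
    proof -
      obtain Z where Z: "negligible Z" "\<And>t. t \<in> {0..T} ==> t \<notin> Z ==> p t \<in> H1 N"
        by (rule AE_lebesgue_on_negligibleE[OF p_mem_AE[OF sol]]) (rule that)
      show ?thesis
      proof (rule integral_spike[OF Z(1), symmetric])
        fix t assume "t \<in> {s..r} - Z"
        then have t: "t \<in> {0..T}" and pH: "p t \<in> H1 N" using sr Z(2) by auto
        have "L2_inner N (?x t) w = op_K N (p t) w - L2_inner N (edge_deriv N (p0 t)) w"
          using L2.ip_diff_left[OF p_deriv_mem p0_deriv_mem[OF t] w, of p t] pH by (simp add: p_deriv_def op_K_def)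
        moreover have "L2_inner N (?y' t) w = L2_inner N (%z. coef_d D z * ?v t z) w + \<epsilon> * L2_inner N (M 1 t) w"
        proof -
          have "M 1 t \<in> L2 N" using M_mem[of 1 t] k2 t by simp
          moreover have "(%z. coef_d D z * ?v t z) \<in> L2 N"
            by (intro mult_mem_L2[OF d_bounds(1)] L2.diff_mem mm m0m t)
          ultimately show ?thesis using w by (simp add: L2.ip_add_left L2.scale_mem L2.ip_scale_left)
        qed
        moreover have "L2_inner N (%z. coef_d D z * ?v t z) w
            = L2_inner N (%z. coef_d D z * m t z) w - L2_inner N (%z. coef_d D z * m0 t z) w"
          using L2.ip_diff_left[OF mult_mem_L2[OF d_bounds(1) mm[OF t]] mult_mem_L2[OF d_bounds(1) m0m[OF t]] w]
          by (simp add: right_diff_distrib)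
        ultimately show "?G t - \<epsilon> * L2_inner N (M 1 t) w = - (L2_inner N (?x t) w + L2_inner N (?y' t) w)"
          using m0_equation[OF t w] by simp
      qed
    qed
    finally show ?thesis unfolding Henstock_Kurzweil_Integration.integral_neg .
  qed
  have "weak_pair T \<epsilon> ?u ?v ?x ?y ?y' g"
    unfolding weak_pair_def
    by (intro conjI ballI allI impI uc vc yc xm x_int g_int xg ae eq1 eq2)
  then show ?thesis by (rule that)
qed

text \<open>Of the bounds in \<open>singular_perturbation_bounds\<close>, the third controls the
  spatial derivative plus \<open>d v + \<epsilon> M 1\<close> and the second controls
  \<open>v\<close>; subtraction leaves the spatial derivative of \<open>u\<close>.\<close>

lemma hyperbolic_parabolic_estimate:
  obtains C where "0 \<le> C"
    "\<And>\<epsilon> p m lam. 0 < \<epsilon> ==> \<epsilon> < 1 ==> is_solution N D \<epsilon> p m lam ==>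
       L2_norm N (%z. p 0 z - p0 0 z) = 0 ==> L2_norm N (%z. m 0 z - m0 0 z) = 0 ==>
       (\<forall>t\<in>{0..T}. (L2_norm N (%z. p t z - p0 t z))^2 \<le> \<epsilon>^2 * C) \<and>
       integral {0..T} (%t. (L2_norm N (%z. m t z - m0 t z))^2) \<le> \<epsilon>^2 * C \<and>
       integrable (lebesgue_on {0..T}) (%t. (L2_norm N (%z. p_deriv p t z - edge_deriv N (p0 t) z))^2) \<and>
       integral {0..T} (%t. (L2_norm N (%z. p_deriv p t z - edge_deriv N (p0 t) z))^2) \<le> \<epsilon>^2 * C"
proof -
  obtain K where K: "0 \<le> K" "\<And>t. t \<in> {0..T} ==> L2_norm N (M 1 t) \<le> K"
    "\<And>s t. s \<in> {0..T} ==> t \<in> {0..T} ==> L2_norm N (%z. M 1 s z - M 1 t z) \<le> K * \<bar>s - t\<bar>"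
    by (rule M_1_bounds) (rule that)
  define C1 where "C1 = T * K^2 / d_lo"
  define C2 where "C2 = T * K^2 / d_lo^2"
  define C3 where "C3 = (4 * K^2 + T * K^2 / d_lo) / d_lo"
  \<comment> \<open>Twice \<open>C3\<close> plus twice the constant of \<open>yy_le\<close>, as
    dictated by \<open>par\<close>.\<close>
  define C4 where "C4 = 2 * C3 + 2 * (2 * d_hi^2 * C2 + 2 * K^2 * T)"
  have C_nonneg: "0 \<le> C1" "0 \<le> C2" "0 \<le> C3" "0 \<le> C4"
    using T_pos d_bounds by (auto simp: C1_def C2_def C3_def C4_def)
  have main: "(\<forall>t\<in>{0..T}. (L2_norm N (%z. p t z - p0 t z))^2 \<le> \<epsilon>^2 * C1) \<and>
       integral {0..T} (%t. (L2_norm N (%z. m t z - m0 t z))^2) \<le> \<epsilon>^2 * C2 \<and>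
       integrable (lebesgue_on {0..T}) (%t. (L2_norm N (%z. p_deriv p t z - edge_deriv N (p0 t) z))^2) \<and>
       integral {0..T} (%t. (L2_norm N (%z. p_deriv p t z - edge_deriv N (p0 t) z))^2) \<le> \<epsilon>^2 * C4"
    if \<epsilon>: "0 < \<epsilon>" "\<epsilon> < 1" and sol: "is_solution N D \<epsilon> p m lam"
      and init: "L2_norm N (%z. p 0 z - p0 0 z) = 0" "L2_norm N (%z. m 0 z - m0 0 z) = 0" for \<epsilon> p m lam
  proof -
    let ?v = "%t z. m t z - m0 t z"
    let ?x = "%t z. p_deriv p t z - edge_deriv N (p0 t) z"
    let ?y = "%t z. coef_d D z * ?v t z + \<epsilon> * M 1 t z"
    let ?z = "%t z. ?x t z + ?y t z"
    obtain g where wp: "weak_pair T \<epsilon> (%t z. p t z - p0 t z) ?v ?x (%t z. coef_a D z * (p t z - p0 t z)) ?y g"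
      by (rule weak_pair_of_solution[OF sol]) (rule that)
    have M1: "L2_curve T (M 1)" using M_curve[of 1] k2 by simp
    note bounds = singular_perturbation_bounds[OF wp \<epsilon> M1 K(2,3) init, folded C1_def C2_def C3_def]
    have yc: "L2_curve T ?y" and vc: "L2_curve T ?v" using wp by (auto simp: weak_pair_def)
    note ym = L2.cont_curve_mem[OF yc] and vm = L2.cont_curve_mem[OF vc]
    have xm: "?x t \<in> L2 N" if "t \<in> {0..T}" for t
      using that by (intro L2.diff_mem p_deriv_mem p0_deriv_mem)
    \<comment> \<open>Weak measurability alone does not provide measurability of the norm of
      \<open>p_deriv p\<close>; that comes from the integrable \<open>H1\<close> norm in
      \<open>is_solution\<close>. The cross term is paired with a continuous curve.\<close>
    have xx_meas: "(%t. L2_inner N (?x t) (?x t)) \<in> borel_measurable (lebesgue_on {0..T})"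
    proof -
      have "(%t. L2_inner N (p_deriv p t) (edge_deriv N (p0 t))) \<in> borel_measurable (lebesgue_on {0..T})"
        by (rule L2.measurable_ip_curve[OF p_deriv_mem _ p0_deriv_curve]) (use p_deriv_integrable[OF sol] in auto)
      moreover have "(%t. L2_inner N (edge_deriv N (p0 t)) (edge_deriv N (p0 t))) \<in> borel_measurable (lebesgue_on {0..T})"
        by (intro continuous_imp_measurable_on_sets_lebesgue L2.continuous_on_ip_curves p0_deriv_curve) simp
      ultimately have "(%t. L2_inner N (p_deriv p t) (p_deriv p t) - 2 * L2_inner N (p_deriv p t) (edge_deriv N (p0 t))
          + L2_inner N (edge_deriv N (p0 t)) (edge_deriv N (p0 t))) \<in> borel_measurable (lebesgue_on {0..T})"
        using borel_measurable_integrable[OF p_deriv_norm_integrable[OF sol]]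
        by (intro borel_measurable_add borel_measurable_diff borel_measurable_times borel_measurable_const)
      moreover have "(%t. L2_inner N (?x t) (?x t)) \<in> borel_measurable (lebesgue_on {0..T}) \<longleftrightarrow>
          (%t. L2_inner N (p_deriv p t) (p_deriv p t) - 2 * L2_inner N (p_deriv p t) (edge_deriv N (p0 t))
          + L2_inner N (edge_deriv N (p0 t)) (edge_deriv N (p0 t))) \<in> borel_measurable (lebesgue_on {0..T})"
        by (intro measurable_cong) (simp add: L2.ip_diff_self p_deriv_mem p0_deriv_mem)
      ultimately show ?thesis by simp
    qed
    have yy_cont: "continuous_on {0..T} (%t. L2_inner N (?y t) (?y t))"
      by (rule L2.continuous_on_ip_curves[OF yc yc])
    have yy_meas: "(%t. L2_inner N (?y t) (?y t)) \<in> borel_measurable (lebesgue_on {0..T})"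
      by (intro continuous_imp_measurable_on_sets_lebesgue yy_cont) simp
    have zz_meas: "(%t. L2_inner N (?z t) (?z t)) \<in> borel_measurable (lebesgue_on {0..T})"
    proof -
      have "(%t. L2_inner N (?x t) (?y t)) \<in> borel_measurable (lebesgue_on {0..T})"
        by (rule L2.measurable_ip_curve[OF xm _ yc]) (use wp in \<open>auto simp: weak_pair_def\<close>)
      then have "(%t. L2_inner N (?x t) (?x t) + 2 * L2_inner N (?x t) (?y t) + L2_inner N (?y t) (?y t))
          \<in> borel_measurable (lebesgue_on {0..T})"
        using xx_meas yy_meas
        by (intro borel_measurable_add borel_measurable_times borel_measurable_const)
      moreover have "(%t. L2_inner N (?z t) (?z t)) \<in> borel_measurable (lebesgue_on {0..T}) \<longleftrightarrow>
          (%t. L2_inner N (?x t) (?x t) + 2 * L2_inner N (?x t) (?y t) + L2_inner N (?y t) (?y t))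
          \<in> borel_measurable (lebesgue_on {0..T})"
      proof (intro measurable_cong)
        fix t assume "t \<in> space (lebesgue_on {0..T})"
        then have t: "t \<in> {0..T}" by simp
        show "L2_inner N (?z t) (?z t) = L2_inner N (?x t) (?x t) + 2 * L2_inner N (?x t) (?y t) + L2_inner N (?y t) (?y t)"
          using L2.ip_add_left[OF xm[OF t] ym[OF t] L2.add_mem[OF xm[OF t] ym[OF t]]]
            L2.ip_add_right[OF xm[OF t] ym[OF t] xm[OF t]] L2.ip_add_right[OF xm[OF t] ym[OF t] ym[OF t]]
            L2_inner_commute[of N "?y t" "?x t"] by simp
      qed
      ultimately show ?thesis by simp
    qed
    \<comment> \<open>Equivalent to the nonnegativity of the square of
      \<open>w + 2 * w'\<close>.\<close>
    have par: "L2_inner N w w \<le> 2 * L2_inner N (%z. w z + w' z) (%z. w z + w' z) + 2 * L2_inner N w' w'"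
      if "w \<in> L2 N" "w' \<in> L2 N" for w w'
    proof -
      have "L2_inner N (%z. w z + w' z) (%z. w z + w' z) = L2_inner N w w + 2 * L2_inner N w w' + L2_inner N w' w'"
        using that by (simp add: L2.ip_add_left L2.ip_add_right L2.add_mem L2_inner_commute)
      moreover have "0 \<le> L2_inner N (%z. w z + 2 * w' z) (%z. w z + 2 * w' z)" by (rule L2_inner_self_nonneg)
      moreover have "L2_inner N (%z. w z + 2 * w' z) (%z. w z + 2 * w' z) = L2_inner N w w + 4 * L2_inner N w w' + 4 * L2_inner N w' w'"
        using that by (simp add: L2.ip_add_left L2.ip_add_right L2.add_mem L2.scale_mem L2.ip_scale_left L2.ip_scale_right L2_inner_commute)
      ultimately show ?thesis by linarith
    qed
    have yy_le: "integral {0..T} (%t. L2_inner N (?y t) (?y t)) \<le> \<epsilon>^2 * (2 * d_hi^2 * C2 + 2 * K^2 * T)"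
    proof -
      have vv: "(%t. L2_inner N (?v t) (?v t)) integrable_on {0..T}"
        by (intro integrable_continuous_interval L2.continuous_on_ip_curves vc)
      have "integral {0..T} (%t. L2_inner N (?y t) (?y t))
          \<le> integral {0..T} (%t. 2 * d_hi^2 * L2_inner N (?v t) (?v t) + 2 * \<epsilon>^2 * K^2)"
      proof (rule integral_le)
        show "(%t. L2_inner N (?y t) (?y t)) integrable_on {0..T}" by (rule integrable_continuous_interval[OF yy_cont])
        show "(%t. 2 * d_hi^2 * L2_inner N (?v t) (?v t) + 2 * \<epsilon>^2 * K^2) integrable_on {0..T}"
          by (intro integrable_continuous_interval continuous_intros L2.continuous_on_ip_curves vc)
        fix t assume t: "t \<in> {0..T}"
        have M1m: "M 1 t \<in> L2 N" by (rule L2.cont_curve_mem[OF M1 t])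
        have dv: "(%z. coef_d D z * ?v t z) \<in> L2 N" by (rule mult_mem_L2[OF d_bounds(1) vm[OF t]])
        have "L2_norm N (?y t) \<le> L2_norm N (%z. coef_d D z * ?v t z) + L2_norm N (%z. \<epsilon> * M 1 t z)"
          by (intro L2.nrm_triangle dv L2.scale_mem M1m)
        also have "\<dots> \<le> d_hi * L2_norm N (?v t) + \<epsilon> * K"
          using L2_norm_mult_le[OF d_bounds(1) vm[OF t]] d_bounds L2.nrm_scale[OF M1m, of \<epsilon>] K(2)[OF t] \<epsilon>
          by (intro add_mono) auto
        finally have "(L2_norm N (?y t))^2 \<le> (d_hi * L2_norm N (?v t) + \<epsilon> * K)^2"
          by (rule power_mono) (rule L2_norm_ge_0)
        also have "\<dots> \<le> 2 * (d_hi * L2_norm N (?v t))^2 + 2 * (\<epsilon> * K)^2"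
          using zero_le_power2[of "d_hi * L2_norm N (?v t) - \<epsilon> * K"] by (simp add: power2_sum power2_diff)
        finally show "L2_inner N (?y t) (?y t) \<le> 2 * d_hi^2 * L2_inner N (?v t) (?v t) + 2 * \<epsilon>^2 * K^2"
          by (simp add: L2_norm_power2 power_mult_distrib)
      qed
      also have "\<dots> = 2 * d_hi^2 * integral {0..T} (%t. L2_inner N (?v t) (?v t)) + 2 * \<epsilon>^2 * K^2 * T"
        using vv T_pos by (subst Henstock_Kurzweil_Integration.integral_add) (auto intro: integrable_on_mult_right)
      also have "\<dots> \<le> 2 * d_hi^2 * (\<epsilon>^2 * C2) + 2 * \<epsilon>^2 * K^2 * T"
        using bounds(2) by (intro add_mono mult_left_mono) auto
      finally show ?thesis by (simp add: algebra_simps)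
    qed
    have yy_nn: "(\<integral>\<^sup>+t. ennreal (L2_inner N (?y t) (?y t)) \<partial>lebesgue_on {0..T})
        \<le> ennreal (\<epsilon>^2 * (2 * d_hi^2 * C2 + 2 * K^2 * T))"
    proof -
      have i: "integrable (lebesgue_on {0..T}) (%t. L2_inner N (?y t) (?y t))"
        by (rule continuous_imp_integrable_real[OF yy_cont])
      then have "(\<integral>\<^sup>+t. ennreal (L2_inner N (?y t) (?y t)) \<partial>lebesgue_on {0..T})
          = ennreal (integral {0..T} (%t. L2_inner N (?y t) (?y t)))"
        by (subst nn_integral_eq_integral) (auto simp: L2_inner_self_nonneg lebesgue_integral_eq_integral)
      then show ?thesis using yy_le by (simp add: ennreal_leI)
    qed
    have xx_nn: "(\<integral>\<^sup>+t. ennreal (L2_inner N (?x t) (?x t)) \<partial>lebesgue_on {0..T}) \<le> ennreal (\<epsilon>^2 * C4)"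
    proof -
      have "(\<integral>\<^sup>+t. ennreal (L2_inner N (?x t) (?x t)) \<partial>lebesgue_on {0..T})
          \<le> (\<integral>\<^sup>+t. (2 * ennreal (L2_inner N (?z t) (?z t)) + 2 * ennreal (L2_inner N (?y t) (?y t))) \<partial>lebesgue_on {0..T})"
      proof (rule nn_integral_mono)
        fix t assume "t \<in> space (lebesgue_on {0..T})"
        then have t: "t \<in> {0..T}" by simp
        have "ennreal (L2_inner N (?x t) (?x t)) \<le> ennreal (2 * L2_inner N (?z t) (?z t) + 2 * L2_inner N (?y t) (?y t))"
          by (intro ennreal_leI par xm ym t)
        also have "\<dots> = 2 * ennreal (L2_inner N (?z t) (?z t)) + 2 * ennreal (L2_inner N (?y t) (?y t))"
          by (simp add: ennreal_plus ennreal_mult L2_inner_self_nonneg)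
        finally show "ennreal (L2_inner N (?x t) (?x t)) \<le> 2 * ennreal (L2_inner N (?z t) (?z t)) + 2 * ennreal (L2_inner N (?y t) (?y t))" .
      qed
      also have "\<dots> = 2 * (\<integral>\<^sup>+t. ennreal (L2_inner N (?z t) (?z t)) \<partial>lebesgue_on {0..T})
          + 2 * (\<integral>\<^sup>+t. ennreal (L2_inner N (?y t) (?y t)) \<partial>lebesgue_on {0..T})"
        using zz_meas yy_meas by (subst nn_integral_add) (auto simp: nn_integral_cmult)
      also have "\<dots> \<le> 2 * ennreal (\<epsilon>^2 * C3) + 2 * ennreal (\<epsilon>^2 * (2 * d_hi^2 * C2 + 2 * K^2 * T))"
        using bounds(3) yy_nn by (intro add_mono mult_left_mono) auto
      also have "\<dots> = ennreal (2 * (\<epsilon>^2 * C3) + 2 * (\<epsilon>^2 * (2 * d_hi^2 * C2 + 2 * K^2 * T)))"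
        using C_nonneg T_pos by (simp add: ennreal_plus ennreal_mult)
      also have "2 * (\<epsilon>^2 * C3) + 2 * (\<epsilon>^2 * (2 * d_hi^2 * C2 + 2 * K^2 * T)) = \<epsilon>^2 * C4"
        by (simp add: C4_def algebra_simps)
      finally show ?thesis .
    qed
    have xx_int: "integrable (lebesgue_on {0..T}) (%t. L2_inner N (?x t) (?x t))"
    proof (rule integrableI_bounded[OF xx_meas])
      show "(\<integral>\<^sup>+t. ennreal (norm (L2_inner N (?x t) (?x t))) \<partial>lebesgue_on {0..T}) < \<infinity>"
        using xx_nn by (simp add: L2_inner_self_nonneg) (meson ennreal_less_top le_less_trans)
    qed
    moreover have "integral {0..T} (%t. L2_inner N (?x t) (?x t)) \<le> \<epsilon>^2 * C4"
    proof -
      have "(\<integral>\<^sup>+t. ennreal (L2_inner N (?x t) (?x t)) \<partial>lebesgue_on {0..T})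
          = ennreal (integral {0..T} (%t. L2_inner N (?x t) (?x t)))"
        using xx_int by (subst nn_integral_eq_integral) (auto simp: L2_inner_self_nonneg lebesgue_integral_eq_integral)
      with xx_nn have "ennreal (integral {0..T} (%t. L2_inner N (?x t) (?x t))) \<le> ennreal (\<epsilon>^2 * C4)" by simp
      then show ?thesis using C_nonneg by (subst (asm) ennreal_le_iff) auto
    qed
    ultimately show ?thesis
      unfolding L2_norm_power2 using bounds(1,2) by blast
  qed
  show ?thesis
  proof (rule that[of "C1 + C2 + C4"])
    show "0 \<le> C1 + C2 + C4" using C_nonneg by simp
    fix \<epsilon> p m lam
    assume a: "0 < \<epsilon>" "\<epsilon> < 1" "is_solution N D \<epsilon> p m lam"
      "L2_norm N (%z. p 0 z - p0 0 z) = 0" "L2_norm N (%z. m 0 z - m0 0 z) = 0"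
    have le: "\<epsilon>^2 * C1 \<le> \<epsilon>^2 * (C1 + C2 + C4)" "\<epsilon>^2 * C2 \<le> \<epsilon>^2 * (C1 + C2 + C4)" "\<epsilon>^2 * C4 \<le> \<epsilon>^2 * (C1 + C2 + C4)"
      using C_nonneg by (auto intro!: mult_left_mono)
    show "(\<forall>t\<in>{0..T}. (L2_norm N (%z. p t z - p0 t z))^2 \<le> \<epsilon>^2 * (C1 + C2 + C4)) \<and>
       integral {0..T} (%t. (L2_norm N (%z. m t z - m0 t z))^2) \<le> \<epsilon>^2 * (C1 + C2 + C4) \<and>
       integrable (lebesgue_on {0..T}) (%t. (L2_norm N (%z. p_deriv p t z - edge_deriv N (p0 t) z))^2) \<and>
       integral {0..T} (%t. (L2_norm N (%z. p_deriv p t z - edge_deriv N (p0 t) z))^2) \<le> \<epsilon>^2 * (C1 + C2 + C4)"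
      using main[OF a] le by (meson order_trans)
  qed
qed

end

section \<open>Quadrature and interpolation in time\<close>

context semi_inner
begin

text \<open>Covers \<open>L = 0\<close>, where the Taylor polynomial is empty and the bound is the
  hypothesis itself; this occurs for stage order zero.\<close>

lemma curve_taylor_less:
  assumes U: "\<And>j. j \<le> L ==> cont_curve T (U j)"
    and U': "\<And>j. j < L ==> derivative_curve T nrm (U j) (U (Suc j))"
    and K: "\<And>t. t \<in> {0..T} ==> nrm (U L t) \<le> K"
    and s: "s \<in> {0..T}" and t: "t \<in> {0..T}"
  shows "nrm (%i. U 0 s i - (\<Sum>l<L. (s - t) ^ l / fact l * U l t i)) \<le> K * \<bar>s - t\<bar> ^ L"
proof (cases L)
  case 0
  then show ?thesis using K[OF s] by simp
next
  case (Suc n)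
  have "nrm (%i. U 0 s i - (\<Sum>l\<le>n. (s - t) ^ l / fact l * U l t i)) \<le> K * \<bar>s - t\<bar> ^ Suc n"
    using U U' K s t Suc by (intro curve_taylor) auto
  then show ?thesis by (simp add: Suc lessThan_Suc_atMost)
qed

text \<open>Weights that reproduce the powers \<open>(s - t) ^ l\<close> for \<open>l < L\<close>
  reproduce the Taylor polynomial about \<open>t\<close>, so only remainders survive. Applied to the
  weights \<open>b^T A^{-1}\<close> acting on \<open>f\<close> and to Lagrange
  interpolation.\<close>

lemma weighted_values_defect:
  fixes \<beta> \<sigma> :: "'k \<Rightarrow> real"
  assumes fin: "finite J"
    and U: "\<And>j. j \<le> L ==> cont_curve T (U j)"
    and U': "\<And>j. j < L ==> derivative_curve T nrm (U j) (U (Suc j))"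
    and K: "0 \<le> K" "\<And>t. t \<in> {0..T} ==> nrm (U L t) \<le> K"
    and t: "t \<in> {0..T}" and s: "s \<in> {0..T}" "\<bar>s - t\<bar> \<le> \<rho>"
    and \<sigma>: "\<And>k. k \<in> J ==> \<sigma> k \<in> {0..T}" "\<And>k. k \<in> J ==> \<bar>\<sigma> k - t\<bar> \<le> \<rho>"
    and exact: "\<And>l. l < L ==> (\<Sum>k\<in>J. \<beta> k * (\<sigma> k - t) ^ l) = (s - t) ^ l"
  shows "nrm (%i. (\<Sum>k\<in>J. \<beta> k * U 0 (\<sigma> k) i) - U 0 s i) \<le> K * (1 + (\<Sum>k\<in>J. \<bar>\<beta> k\<bar>)) * \<rho> ^ L"
proof -
  define R where "R r = (%i. U 0 r i - (\<Sum>l<L. (r - t) ^ l / fact l * U l t i))" for r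
  have Um: "U l r \<in> X" if "l \<le> L" "r \<in> {0..T}" for l r by (rule cont_curve_mem[OF U[OF that(1)] that(2)])
  have Rm: "R r \<in> X" if "r \<in> {0..T}" for r
    unfolding R_def using that t by (intro diff_mem sum_mem) (auto intro!: Um)
  have R_le: "nrm (R r) \<le> K * \<rho> ^ L" if r: "r \<in> {0..T}" "\<bar>r - t\<bar> \<le> \<rho>" for r
  proof -
    have "nrm (R r) \<le> K * \<bar>r - t\<bar> ^ L"
      unfolding R_def by (rule curve_taylor_less[OF U U' K(2) r(1) t])
    also have "\<dots> \<le> K * \<rho> ^ L" using K(1) r by (intro mult_left_mono power_mono) auto
    finally show ?thesis .
  qed
  have "(%i. (\<Sum>k\<in>J. \<beta> k * U 0 (\<sigma> k) i) - U 0 s i) = (%i. (\<Sum>k\<in>J. \<beta> k * R (\<sigma> k) i) - R s i)"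
  proof
    fix i
    have "(\<Sum>k\<in>J. \<beta> k * (\<Sum>l<L. (\<sigma> k - t) ^ l / fact l * U l t i)) = (\<Sum>l<L. (s - t) ^ l / fact l * U l t i)"
    proof -
      have "(\<Sum>k\<in>J. \<beta> k * (\<Sum>l<L. (\<sigma> k - t) ^ l / fact l * U l t i))
          = (\<Sum>k\<in>J. \<Sum>l<L. (\<beta> k * (\<sigma> k - t) ^ l) * (U l t i / fact l))"
        by (simp add: sum_distrib_left mult_ac)
      also have "\<dots> = (\<Sum>l<L. (\<Sum>k\<in>J. \<beta> k * (\<sigma> k - t) ^ l) * (U l t i / fact l))"
        by (subst sum.swap) (simp only: sum_distrib_right)
      also have "\<dots> = (\<Sum>l<L. (s - t) ^ l * (U l t i / fact l))"
        by (intro sum.cong) (auto simp: exact)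
      finally show ?thesis by (simp add: mult_ac)
    qed
    then show "(\<Sum>k\<in>J. \<beta> k * U 0 (\<sigma> k) i) - U 0 s i = (\<Sum>k\<in>J. \<beta> k * R (\<sigma> k) i) - R s i"
      by (simp add: R_def right_diff_distrib sum_subtractf)
  qed
  then have "nrm (%i. (\<Sum>k\<in>J. \<beta> k * U 0 (\<sigma> k) i) - U 0 s i) = nrm (%i. (\<Sum>k\<in>J. \<beta> k * R (\<sigma> k) i) - R s i)"
    by simp
  also have "\<dots> \<le> nrm (%i. \<Sum>k\<in>J. \<beta> k * R (\<sigma> k) i) + nrm (R s)"
    using Rm \<sigma> s by (intro nrm_diff_le sum_mem) auto
  also have "nrm (%i. \<Sum>k\<in>J. \<beta> k * R (\<sigma> k) i) \<le> (\<Sum>k\<in>J. \<bar>\<beta> k\<bar> * nrm (R (\<sigma> k)))"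
    using fin Rm \<sigma> by (intro nrm_sum_le) auto
  also have "\<dots> \<le> (\<Sum>k\<in>J. \<bar>\<beta> k\<bar> * (K * \<rho> ^ L))"
    using R_le \<sigma> by (intro sum_mono mult_left_mono) auto
  also have "nrm (R s) \<le> K * \<rho> ^ L" by (rule R_le[OF s])
  finally show ?thesis by (simp add: algebra_simps sum_distrib_left)
qed

text \<open>The exactness hypothesis is the order condition for \<open>\<gamma> = 1\<close> with the
  weights \<open>b\<close>, and the stage order condition for \<open>\<gamma> = c $ i\<close> with a
  row of \<open>A\<close>. The derivative \<open>U 1\<close> is expanded to one degree less than
  \<open>U 0\<close>, and the factor \<open>\<tau>\<close> in front restores the order.\<close>

lemma quadrature_defect:
  fixes \<beta> c :: "'k \<Rightarrow> real"
  assumes fin: "finite J"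
    and U: "\<And>j. j \<le> Suc L ==> cont_curve T (U j)"
    and U': "\<And>j. j \<le> L ==> derivative_curve T nrm (U j) (U (Suc j))"
    and K: "0 \<le> K" "\<And>t. t \<in> {0..T} ==> nrm (U (Suc L) t) \<le> K"
    and \<tau>: "0 \<le> \<tau>" and t: "0 \<le> t" "t + \<tau> \<le> T"
    and c: "\<And>k. k \<in> J ==> 0 \<le> c k \<and> c k \<le> 1" and \<gamma>: "0 \<le> \<gamma>" "\<gamma> \<le> 1"
    and exact: "\<And>l. l < L ==> (\<Sum>k\<in>J. \<beta> k * c k ^ l) = \<gamma> ^ Suc l / real (Suc l)"
  shows "nrm (%i. U 0 t i + \<tau> * (\<Sum>k\<in>J. \<beta> k * U 1 (t + \<tau> * c k) i) - U 0 (t + \<tau> * \<gamma>) i)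
     \<le> K * (1 + (\<Sum>k\<in>J. \<bar>\<beta> k\<bar>)) * \<tau> ^ Suc L"
proof -
  have node: "t + \<tau> * x \<in> {0..T}" if "0 \<le> x" "x \<le> 1" for x
  proof -
    have "\<tau> * x \<le> \<tau> * 1" using \<tau> that by (intro mult_left_mono) auto
    then show ?thesis using \<tau> t that by auto
  qed
  have t0: "t \<in> {0..T}" using node[of 0] by simp
  have Um: "U l r \<in> X" if "l \<le> Suc L" "r \<in> {0..T}" for l r by (rule cont_curve_mem[OF U[OF that(1)] that(2)])
  define R0 where "R0 = (%i. U 0 (t + \<tau> * \<gamma>) i - (\<Sum>l<Suc L. (\<tau> * \<gamma>) ^ l / fact l * U l t i))"
  define R where "R k = (%i. U 1 (t + \<tau> * c k) i - (\<Sum>l<L. (\<tau> * c k) ^ l / fact l * U (Suc l) t i))" for k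
  have R0: "R0 \<in> X" unfolding R0_def using t0 node[OF \<gamma>] by (intro diff_mem sum_mem) (auto intro!: Um)
  have R: "R k \<in> X" if "k \<in> J" for k
    unfolding R_def using t0 node[of "c k"] c[OF that] by (intro diff_mem sum_mem) (auto intro!: Um)
  have R0_le: "nrm R0 \<le> K * \<tau> ^ Suc L"
  proof -
    have "nrm R0 \<le> K * \<bar>t + \<tau> * \<gamma> - t\<bar> ^ Suc L"
      using curve_taylor_less[of "Suc L" T U K "t + \<tau> * \<gamma>" t] U U' K node[OF \<gamma>] t0
      by (simp add: R0_def less_Suc_eq_le del: power_Suc)
    also have "\<dots> \<le> K * \<tau> ^ Suc L"
      using K(1) \<tau> \<gamma> by (intro mult_left_mono power_mono) (auto simp: mult_left_le)
    finally show ?thesis .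
  qed
  have R_le: "nrm (R k) \<le> K * \<tau> ^ L" if k: "k \<in> J" for k
  proof -
    have "nrm (R k) \<le> K * \<bar>t + \<tau> * c k - t\<bar> ^ L"
      using curve_taylor_less[of L T "%j. U (Suc j)" K "t + \<tau> * c k" t] U U' K node[of "c k"] c[OF k] t0
      by (simp add: R_def)
    also have "\<dots> \<le> K * \<tau> ^ L"
      using K(1) \<tau> c[OF k] by (intro mult_left_mono power_mono) (auto simp: mult_left_le)
    finally show ?thesis .
  qed
  have "(%i. U 0 t i + \<tau> * (\<Sum>k\<in>J. \<beta> k * U 1 (t + \<tau> * c k) i) - U 0 (t + \<tau> * \<gamma>) i)
      = (%i. \<tau> * (\<Sum>k\<in>J. \<beta> k * R k i) - R0 i)"
  proof
    fix i
    have "\<tau> * (\<Sum>k\<in>J. \<beta> k * (\<Sum>l<L. (\<tau> * c k) ^ l / fact l * U (Suc l) t i))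
        = (\<Sum>k\<in>J. \<Sum>l<L. (\<beta> k * c k ^ l) * (\<tau> ^ Suc l / fact l * U (Suc l) t i))"
      by (simp add: sum_distrib_left power_mult_distrib mult_ac)
    also have "\<dots> = (\<Sum>l<L. (\<Sum>k\<in>J. \<beta> k * c k ^ l) * (\<tau> ^ Suc l / fact l * U (Suc l) t i))"
      by (subst sum.swap) (simp only: sum_distrib_right)
    also have "\<dots> = (\<Sum>l<L. (\<tau> * \<gamma>) ^ Suc l / fact (Suc l) * U (Suc l) t i)"
    proof (intro sum.cong refl)
      fix l assume "l \<in> {..<L}"
      then show "(\<Sum>k\<in>J. \<beta> k * c k ^ l) * (\<tau> ^ Suc l / fact l * U (Suc l) t i) = (\<tau> * \<gamma>) ^ Suc l / fact (Suc l) * U (Suc l) t i"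
        by (simp add: exact power_mult_distrib mult_ac del: of_nat_Suc power_Suc)
    qed
    \<comment> \<open>The quadrature reproduces all Taylor terms of positive degree; the term of
      degree zero is the value \<open>U 0 t\<close>, which is carried along.\<close>
    also have "\<dots> = (\<Sum>l<Suc L. (\<tau> * \<gamma>) ^ l / fact l * U l t i) - U 0 t i"
      unfolding sum.lessThan_Suc_shift by simp
    finally show "U 0 t i + \<tau> * (\<Sum>k\<in>J. \<beta> k * U 1 (t + \<tau> * c k) i) - U 0 (t + \<tau> * \<gamma>) i
        = \<tau> * (\<Sum>k\<in>J. \<beta> k * R k i) - R0 i"
      by (simp add: R_def R0_def right_diff_distrib sum_subtractf)
  qed
  then have "nrm (%i. U 0 t i + \<tau> * (\<Sum>k\<in>J. \<beta> k * U 1 (t + \<tau> * c k) i) - U 0 (t + \<tau> * \<gamma>) i)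
      = nrm (%i. \<tau> * (\<Sum>k\<in>J. \<beta> k * R k i) - R0 i)" by simp
  also have "\<dots> \<le> nrm (%i. \<tau> * (\<Sum>k\<in>J. \<beta> k * R k i)) + nrm R0"
    using R R0 by (intro nrm_diff_le scale_mem sum_mem)
  also have "nrm (%i. \<tau> * (\<Sum>k\<in>J. \<beta> k * R k i)) = \<tau> * nrm (%i. \<Sum>k\<in>J. \<beta> k * R k i)"
    using \<tau> R by (subst nrm_scale) (auto intro: sum_mem)
  also have "nrm (%i. \<Sum>k\<in>J. \<beta> k * R k i) \<le> (\<Sum>k\<in>J. \<bar>\<beta> k\<bar> * nrm (R k))"
    using fin R by (intro nrm_sum_le)
  also have "\<dots> \<le> (\<Sum>k\<in>J. \<bar>\<beta> k\<bar> * (K * \<tau> ^ L))"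
    using R_le by (intro sum_mono mult_left_mono) auto
  finally have "nrm (%i. U 0 t i + \<tau> * (\<Sum>k\<in>J. \<beta> k * U 1 (t + \<tau> * c k) i) - U 0 (t + \<tau> * \<gamma>) i)
      \<le> \<tau> * (\<Sum>k\<in>J. \<bar>\<beta> k\<bar> * (K * \<tau> ^ L)) + K * \<tau> ^ Suc L"
    using R0_le \<tau> by (simp add: mult_left_mono)
  then show ?thesis by (simp add: algebra_simps sum_distrib_left)
qed

end

text \<open>The difference of both sides is a polynomial in \<open>t\<close> of degree below
  \<open>card I\<close> that vanishes at the \<open>card I\<close> distinct nodes.\<close>

lemma lagrange_exact:
  fixes x :: "nat \<Rightarrow> real" and t :: real
  assumes I: "finite I" and inj: "inj_on x I" and l: "l < card I"
  shows "(\<Sum>k\<in>I. (\<Prod>i\<in>I - {k}. (t - x i) / (x k - x i)) * (x k - s) ^ l) = (t - s) ^ l"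
proof -
  define q where "q = (\<Sum>k\<in>I. smult ((x k - s) ^ l) (\<Prod>i\<in>I - {k}. smult (1 / (x k - x i)) [:- x i, 1:]))
      - [:- s, 1:] ^ l"
  have ev: "poly q y = (\<Sum>k\<in>I. (\<Prod>i\<in>I - {k}. (y - x i) / (x k - x i)) * (x k - s) ^ l) - (y - s) ^ l" for y
    by (simp add: q_def poly_sum poly_prod poly_power mult.commute diff_divide_distrib)
  have "degree q < card I"
  proof -
    have "degree (\<Prod>i\<in>I - {k}. smult (1 / (x k - x i)) [:- x i, 1:]) \<le> card I - 1" if "k \<in> I" for k
    proof -
      have "degree (\<Prod>i\<in>I - {k}. smult (1 / (x k - x i)) [:- x i, 1:])
          \<le> (\<Sum>i\<in>I - {k}. degree (smult (1 / (x k - x i)) [:- x i, 1:]))"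
        using I by (intro degree_prod_sum_le[unfolded o_def]) auto
      also have "\<dots> \<le> (\<Sum>i\<in>I - {k}. 1)"
        by (intro sum_mono order_trans[OF degree_smult_le]) simp
      also have "\<dots> = card I - 1" using I that by simp
      finally show ?thesis .
    qed
    then have "degree (\<Sum>k\<in>I. smult ((x k - s) ^ l) (\<Prod>i\<in>I - {k}. smult (1 / (x k - x i)) [:- x i, 1:])) \<le> card I - 1"
      using I by (intro degree_sum_le order_trans[OF degree_smult_le]) auto
    moreover have "degree ([:- s, 1:] ^ l) \<le> card I - 1"
      using l by (simp add: degree_power_eq)
    ultimately have "degree q \<le> card I - 1" unfolding q_def by (rule degree_diff_le)
    then show ?thesis using l by linarith
  qed
  moreover have "poly q (x j) = 0" if j: "j \<in> I" for j
  proof -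
    have "(\<Sum>k\<in>I. (\<Prod>i\<in>I - {k}. (x j - x i) / (x k - x i)) * (x k - s) ^ l) = (\<Sum>k\<in>I. if k = j then (x j - s) ^ l else 0)"
    proof (intro sum.cong refl)
      fix k assume k: "k \<in> I"
      show "(\<Prod>i\<in>I - {k}. (x j - x i) / (x k - x i)) * (x k - s) ^ l = (if k = j then (x j - s) ^ l else 0)"
      proof (cases "k = j")
        case True
        have "(\<Prod>i\<in>I - {j}. (x j - x i) / (x j - x i)) = 1"
          using inj j by (intro prod.neutral) (auto simp: inj_on_def)
        then show ?thesis using True by simp
      next
        case False
        have "(\<Prod>i\<in>I - {k}. (x j - x i) / (x k - x i)) = 0"
          using I j False by (intro prod_zero) auto
        then show ?thesis using False by simp
      qed
    qed
    then show ?thesis using I j by (simp add: ev)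
  qed
  then have "x ` I \<subseteq> {y. poly q y = 0}" by auto
  ultimately have "q = 0"
  proof -
    assume d: "degree q < card I" and roots: "x ` I \<subseteq> {y. poly q y = 0}"
    show "q = 0"
    proof (rule ccontr)
      assume q: "q \<noteq> 0"
      then have "card (x ` I) \<le> card {y. poly q y = 0}"
        by (intro card_mono roots poly_roots_finite)
      also have "\<dots> \<le> degree q" by (rule card_poly_roots_bound[OF q])
      finally show False using d card_image[OF inj] by simp
    qed
  qed
  then show ?thesis using ev[of t] by simp
qed

text \<open>The window stays on the grid and remains adjacent to the interval with index
  \<open>j\<close>, also where it is pushed back from either end. These inequalities are all that is
  used about the position of the window.\<close>

lemma interp_start_bounds:
  assumes j: "1 \<le> j" "j \<le> n" and \<nu>: "\<nu> \<le> n"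
  shows "interp_start \<nu> n j + \<nu> \<le> n" "j \<le> interp_start \<nu> n j + \<nu> + 1" "interp_start \<nu> n j \<le> j - 1"
  using assms by (auto simp: interp_start_def split: if_splits)

context
  fixes T :: real and n \<nu> :: nat
  assumes T: "0 < T" and n: "1 \<le> n" and \<nu>: "\<nu> \<le> n"
begin

definition time_index :: "real \<Rightarrow> nat" where
  "time_index t = max 1 (nat \<lceil>t / (T / real n)\<rceil>)"

definition window :: "real \<Rightarrow> nat set" where
  "window t = {interp_start \<nu> n (time_index t)..interp_start \<nu> n (time_index t) + \<nu>}"

definition lagrange :: "real \<Rightarrow> nat \<Rightarrow> real" where
  "lagrange t k = (\<Prod>i\<in>window t - {k}. (t - real i * (T / real n)) / (real k * (T / real n) - real i * (T / real n)))"

lemma interpolant_eq: "interpolant T n \<nu> y t = (%z. \<Sum>k\<in>window t. lagrange t k * y k z)"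
  by (rule ext) (simp add: interpolant_def Let_def window_def lagrange_def time_index_def)

lemma time_index:
  assumes t: "t \<in> {0..T}"
  shows "1 \<le> time_index t" "time_index t \<le> n" "real (time_index t - 1) * (T / real n) \<le> t"
    "t \<le> real (time_index t) * (T / real n)"
proof -
  define \<tau> where "\<tau> = T / real n"
  have \<tau>: "0 < \<tau>" and T_eq: "real n * \<tau> = T" using T n by (auto simp: \<tau>_def)
  have "t / \<tau> \<le> real n" using t \<tau> T_eq by (simp add: divide_le_eq)
  then have c: "\<lceil>t / \<tau>\<rceil> \<le> int n" by (simp add: ceiling_le_iff)
  show "1 \<le> time_index t" by (simp add: time_index_def)
  have "nat \<lceil>t / \<tau>\<rceil> \<le> n" using c by linarith
  then show "time_index t \<le> n" using n unfolding time_index_def \<tau>_def by (simp only: max.bounded_iff)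
  show "real (time_index t - 1) * (T / real n) \<le> t"
  proof (cases "1 \<le> \<lceil>t / \<tau>\<rceil>")
    case True
    then have "real (time_index t - 1) = real_of_int \<lceil>t / \<tau>\<rceil> - 1"
      by (simp add: time_index_def of_nat_diff flip: \<tau>_def) linarith
    also have "\<dots> \<le> t / \<tau>" by linarith
    finally show ?thesis using \<tau> by (simp add: le_divide_eq flip: \<tau>_def)
  next
    case False
    then have "time_index t = 1" by (simp add: time_index_def flip: \<tau>_def)
    then show ?thesis using t by simp
  qed
  have "t / \<tau> \<le> real (time_index t)"
    unfolding time_index_def \<tau>_def[symmetric] by linarith
  then show "t \<le> real (time_index t) * (T / real n)" using \<tau> by (simp add: divide_le_eq flip: \<tau>_def)
qed

lemma window_subset: "t \<in> {0..T} ==> window t \<subseteq> {..n}"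
  using interp_start_bounds(1)[OF time_index(1,2) \<nu>] by (auto simp: window_def)

lemma window_distance:
  assumes t: "t \<in> {0..T}" and k: "k \<in> window t"
  shows "\<bar>t - real k * (T / real n)\<bar> \<le> real (\<nu> + 1) * (T / real n)"
proof -
  define \<tau> where "\<tau> = T / real n"
  have \<tau>: "0 < \<tau>" using T n by (auto simp: \<tau>_def)
  note b = interp_start_bounds[OF time_index(1,2)[OF t] \<nu>]
  have k1: "time_index t \<le> k + \<nu> + 1" "k \<le> time_index t - 1 + \<nu>"
    using k b time_index(1)[OF t] by (auto simp: window_def)
  have "real (time_index t) * \<tau> \<le> real (k + \<nu> + 1) * \<tau>" "real k * \<tau> \<le> real (time_index t - 1 + \<nu>) * \<tau>"
    using k1 \<tau> by (auto intro!: mult_right_mono simp del: of_nat_add of_nat_Suc)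
  then show ?thesis
    using time_index(3,4)[OF t] \<tau> by (simp add: algebra_simps abs_le_iff flip: \<tau>_def)
qed

text \<open>Each numerator is at most \<open>\<nu> + 1\<close> steps, each denominator at least one
  step, and there are \<open>\<nu>\<close> factors; the step size cancels.\<close>

lemma lagrange_bound:
  assumes t: "t \<in> {0..T}" and k: "k \<in> window t"
  shows "\<bar>lagrange t k\<bar> \<le> real (\<nu> + 1) ^ \<nu>"
proof -
  define \<tau> where "\<tau> = T / real n"
  have \<tau>: "0 < \<tau>" using T n by (auto simp: \<tau>_def)
  have "\<bar>lagrange t k\<bar> = (\<Prod>i\<in>window t - {k}. \<bar>(t - real i * \<tau>) / (real k * \<tau> - real i * \<tau>)\<bar>)"
    by (simp add: lagrange_def abs_prod \<tau>_def)
  also have "\<dots> \<le> (\<Prod>i\<in>window t - {k}. real (\<nu> + 1))"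
  proof (intro prod_mono conjI)
    fix i assume i: "i \<in> window t - {k}"
    have "1 \<le> \<bar>real k - real i\<bar>" using i by (cases "i < k") auto
    then have "\<tau> \<le> \<bar>real k - real i\<bar> * \<tau>" using \<tau> by simp
    then have d: "\<tau> \<le> \<bar>real k * \<tau> - real i * \<tau>\<bar>" using \<tau> by (simp add: abs_mult flip: left_diff_distrib)
    have "\<bar>(t - real i * \<tau>) / (real k * \<tau> - real i * \<tau>)\<bar> \<le> (real (\<nu> + 1) * \<tau>) / \<tau>"
      unfolding abs_divide using window_distance[OF t, of i] i d \<tau> by (intro frac_le) (auto simp: \<tau>_def)
    then show "\<bar>(t - real i * \<tau>) / (real k * \<tau> - real i * \<tau>)\<bar> \<le> real (\<nu> + 1)" using \<tau> by simp
  qed simp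
  also have "\<dots> = real (\<nu> + 1) ^ \<nu>"
    using k by (simp add: window_def)
  finally show ?thesis .
qed

lemma lagrange_window_exact:
  assumes l: "l < Suc \<nu>"
  shows "(\<Sum>k\<in>window t. lagrange t k * (real k * (T / real n) - s) ^ l) = (t - s) ^ l"
  unfolding lagrange_def
  using T n l by (intro lagrange_exact) (auto simp: window_def inj_on_def)

text \<open>After exchanging the sums it suffices to count: a node \<open>k\<close> occurs only in
  windows whose index lies between \<open>k - \<nu>\<close> and
  \<open>k + \<nu> + 1\<close>.\<close>

lemma sum_window_le:
  fixes y :: "nat \<Rightarrow> real"
  assumes y: "\<And>k. 0 \<le> y k"
  shows "(\<Sum>j=1..n. \<Sum>k\<in>{interp_start \<nu> n j..interp_start \<nu> n j + \<nu>}. y k) \<le> real (2 * \<nu> + 3) * (\<Sum>k\<le>n. y k)"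
proof -
  let ?I = "%j. {interp_start \<nu> n j..interp_start \<nu> n j + \<nu>}"
  have sub: "k \<le> n \<and> k \<le> j + \<nu> \<and> j \<le> k + \<nu> + 1" if "j \<in> {1..n}" "k \<in> ?I j" for j k
    using interp_start_bounds[of j n \<nu>] that \<nu> by auto
  have "(\<Sum>j=1..n. \<Sum>k\<in>?I j. y k) \<le> (\<Sum>j=1..n. \<Sum>k\<le>n. if k \<le> j + \<nu> \<and> j \<le> k + \<nu> + 1 then y k else 0)"
  proof (rule sum_mono)
    fix j assume j: "j \<in> {1..n}"
    have "(\<Sum>k\<in>?I j. y k) = (\<Sum>k\<in>?I j. if k \<le> j + \<nu> \<and> j \<le> k + \<nu> + 1 then y k else 0)"
      using sub[OF j] by (intro sum.cong) auto
    also have "\<dots> \<le> (\<Sum>k\<le>n. if k \<le> j + \<nu> \<and> j \<le> k + \<nu> + 1 then y k else 0)"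
      using sub[OF j] y by (intro sum_mono2) auto
    finally show "(\<Sum>k\<in>?I j. y k) \<le> (\<Sum>k\<le>n. if k \<le> j + \<nu> \<and> j \<le> k + \<nu> + 1 then y k else 0)" .
  qed
  also have "\<dots> = (\<Sum>k\<le>n. \<Sum>j=1..n. if k \<le> j + \<nu> \<and> j \<le> k + \<nu> + 1 then y k else 0)"
    by (rule sum.swap)
  also have "\<dots> \<le> (\<Sum>k\<le>n. real (2 * \<nu> + 3) * y k)"
  proof (rule sum_mono)
    fix k
    have "(\<Sum>j=1..n. if k \<le> j + \<nu> \<and> j \<le> k + \<nu> + 1 then y k else 0)
        = real (card {j\<in>{1..n}. k \<le> j + \<nu> \<and> j \<le> k + \<nu> + 1}) * y k"
      by (simp add: sum.inter_filter[symmetric])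
    also have "\<dots> \<le> real (2 * \<nu> + 3) * y k"
    proof (intro mult_right_mono y)
      have "card {j\<in>{1..n}. k \<le> j + \<nu> \<and> j \<le> k + \<nu> + 1} \<le> card {k - \<nu>..k + \<nu> + 1}"
        by (intro card_mono) auto
      also have "\<dots> \<le> 2 * \<nu> + 3" by simp
      finally show "real (card {j\<in>{1..n}. k \<le> j + \<nu> \<and> j \<le> k + \<nu> + 1}) \<le> real (2 * \<nu> + 3)" by linarith
    qed
    finally show "(\<Sum>j=1..n. if k \<le> j + \<nu> \<and> j \<le> k + \<nu> + 1 then y k else 0) \<le> real (2 * \<nu> + 3) * y k" .
  qed
  finally show ?thesis by (simp add: sum_distrib_left)
qed

end

section \<open>Algebraic stability\<close>

lemma matrix_inv_products:
  fixes A :: "real^'s^'s"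
  assumes "invertible A"
  shows "matrix_inv A ** A = mat 1" "A ** matrix_inv A = mat 1"
proof -
  have "\<exists>A'. A ** A' = mat 1 \<and> A' ** A = mat 1" using assms by (auto simp: invertible_def)
  from someI_ex[OF this] show "matrix_inv A ** A = mat 1" "A ** matrix_inv A = mat 1"
    by (auto simp: matrix_inv_def)
qed

lemma matrix_inv_sums:
  fixes A :: "real^'s^'s"
  assumes "invertible A"
  shows "(\<Sum>k\<in>UNIV. matrix_inv A $ i $ k * A $ k $ j) = (if i = j then 1 else 0)"
    "(\<Sum>k\<in>UNIV. A $ i $ k * matrix_inv A $ k $ j) = (if i = j then 1 else 0)"
  using arg_cong[OF matrix_inv_products(1)[OF assms], of "%m. m $ i $ j"]
    arg_cong[OF matrix_inv_products(2)[OF assms], of "%m. m $ i $ j"]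
  by (simp_all add: matrix_matrix_mult_def mat_def)

lemma rk_weights_sum:
  fixes A :: "real^'s^'s"
  assumes "b \<bullet> (matrix_inv A *v vec 1) = 1"
  shows "(\<Sum>k\<in>UNIV. (b v* matrix_inv A) $ k) = 1"
proof -
  have "b \<bullet> (matrix_inv A *v vec 1) = (\<Sum>i\<in>UNIV. \<Sum>k\<in>UNIV. b $ i * matrix_inv A $ i $ k)"
    by (simp add: inner_vec_def matrix_vector_mult_def sum_distrib_left)
  also have "\<dots> = (\<Sum>k\<in>UNIV. (b v* matrix_inv A) $ k)"
    by (subst sum.swap) (simp add: vector_matrix_mult_def mult.commute)
  finally show ?thesis using assms by simp
qed

lemma rk_weights_mult:
  fixes A :: "real^'s^'s"
  assumes "invertible A"
  shows "(\<Sum>i\<in>UNIV. (b v* matrix_inv A) $ i * A $ i $ j) = b $ j"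
proof -
  have "(\<Sum>i\<in>UNIV. (b v* matrix_inv A) $ i * A $ i $ j)
      = (\<Sum>i\<in>UNIV. \<Sum>k\<in>UNIV. b $ k * (matrix_inv A $ k $ i * A $ i $ j))"
    by (simp add: vector_matrix_mult_def sum_distrib_right sum_distrib_left mult_ac)
  also have "\<dots> = (\<Sum>k\<in>UNIV. b $ k * (\<Sum>i\<in>UNIV. matrix_inv A $ k $ i * A $ i $ j))"
    by (subst sum.swap) (simp add: sum_distrib_left)
  also have "\<dots> = (\<Sum>k\<in>UNIV. if k = j then b $ k else 0)"
    by (intro sum.cong) (simp_all add: matrix_inv_sums[OF assms])
  also have "\<dots> = b $ j" by simp
  finally show ?thesis .
qed

lemma pos_semidef_quadratic:
  "pos_semidef S ==> 0 \<le> (\<Sum>i\<in>UNIV. \<Sum>k\<in>UNIV. S $ i $ k * (x i * x k))"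
proof -
  assume "pos_semidef S"
  then have "0 \<le> (\<chi> i. x i) \<bullet> (S *v (\<chi> i. x i))" by (simp add: pos_semidef_def)
  then show ?thesis
    by (simp add: inner_vec_def matrix_vector_mult_def sum_distrib_left mult_ac)
qed

text \<open>
  If \<open>b $ i = 0\<close>, positive semidefiniteness forces \<open>b $ j * A $ j $ i = 0\<close> for all \<open>j\<close>, so \<open>A\<close> and hence its
  inverse preserve the vectors supported on the stages with vanishing weight.
\<close>

lemma rk_weights_zero:
  fixes A :: "real^'s^'s"
  assumes stab: "algebraically_stable A b" and inv: "invertible A" and i: "b $ i = 0"
  shows "(b v* matrix_inv A) $ i = 0"
proof -
  define S where "S = (\<chi> i j. b $ i * A $ i $ j + b $ j * A $ j $ i - b $ i * b $ j)"
  have psd: "pos_semidef S" using stab by (simp add: algebraically_stable_def S_def)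
  have zero: "b $ j * A $ j $ i = 0" if i: "b $ i = 0" for i j
  proof (cases "j = i")
    case False
    \<comment> \<open>The test vector is one at \<open>j\<close> and \<open>t\<close> at
      \<open>i\<close>. Since \<open>b $ i = 0\<close>, the entry \<open>S $ i $ i\<close> vanishes
      and the form is affine in \<open>t\<close>; nonnegativity for all \<open>t\<close> forces its
      slope to be zero.\<close>
    have q: "0 \<le> S $ j $ j + 2 * t * S $ j $ i" for t
    proof -
      define x where "x l = (if l = j then 1 else if l = i then t else 0)" for l
      have sx: "(\<Sum>l\<in>UNIV. g l * x l) = g j + t * g i" for g :: "'s \<Rightarrow> real"
      proof -
        have "(\<Sum>l\<in>UNIV. g l * x l) = (\<Sum>l\<in>UNIV. (if l = j then g l else 0) + (if l = i then t * g l else 0))"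
          using False by (intro sum.cong) (auto simp: x_def)
        then show ?thesis by (simp add: sum.distrib)
      qed
      have "(\<Sum>l\<in>UNIV. \<Sum>k\<in>UNIV. S $ l $ k * (x l * x k)) = (\<Sum>l\<in>UNIV. (\<Sum>k\<in>UNIV. S $ l $ k * x k) * x l)"
        by (simp add: sum_distrib_left sum_distrib_right mult_ac)
      also have "\<dots> = S $ j $ j + t * S $ j $ i + t * (S $ i $ j + t * S $ i $ i)"
        by (simp add: sx)
      also have "\<dots> = S $ j $ j + 2 * t * S $ j $ i"
        using i by (simp add: S_def algebra_simps)
      finally show ?thesis using pos_semidef_quadratic[OF psd, of x] by simp
    qed
    have "S $ j $ i = 0"
    proof (rule ccontr)
      assume "S $ j $ i \<noteq> 0"
      then show False using q[of "- (S $ j $ j + 1) / (2 * S $ j $ i)"] by (simp add: field_simps)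
    qed
    then show ?thesis using i by (simp add: S_def)
  qed (use i in simp)
  define V where "V = {x :: real^'s. \<forall>j. b $ j \<noteq> 0 \<longrightarrow> x $ j = 0}"
  have V: "subspace V" by (auto simp: V_def subspace_def)
  have AV: "(%x. A *v x) ` V \<subseteq> V"
  proof clarify
    fix x assume x: "x \<in> V"
    have "(A *v x) $ j = 0" if "b $ j \<noteq> 0" for j
    proof -
      have "A $ j $ l * x $ l = 0" for l
        using x zero[of l j] that by (cases "b $ l = 0") (auto simp: V_def)
      then have "(\<Sum>l\<in>UNIV. A $ j $ l * x $ l) = 0" by (intro sum.neutral ballI)
      then show ?thesis by (simp add: matrix_vector_mult_def)
    qed
    then show "A *v x \<in> V" by (simp add: V_def)
  qed
  have injA: "inj (%x. A *v x)"
    using matrix_inv_products(1)[OF inv] by (metis injI matrix_vector_mul_assoc matrix_vector_mul_lid)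
  \<comment> \<open>\<open>A\<close> is injective and maps the finite-dimensional \<open>V\<close>
    into itself, hence onto itself; so the inverse preserves \<open>V\<close> as well.\<close>
  have "dim ((%x. A *v x) ` V) = dim V"
    by (rule dim_image_eq) (use injA in \<open>auto intro: inj_on_subset\<close>)
  then have surj: "(%x. A *v x) ` V = V"
    by (intro subspace_dim_equal AV V) (auto intro!: linear_subspace_image V)
  have inv_zero: "matrix_inv A $ j $ i = 0" if "b $ j \<noteq> 0" for j
  proof -
    have "axis i 1 \<in> V" using i by (auto simp: V_def axis_def)
    then obtain x where x: "x \<in> V" "axis i 1 = A *v x" using surj by blast
    have "matrix_inv A *v axis i 1 = x"
      using x matrix_inv_products(1)[OF inv] by (metis matrix_vector_mul_assoc matrix_vector_mul_lid)
    then have "(matrix_inv A *v axis i 1) $ j = 0" using x that by (simp add: V_def)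
    then show ?thesis by (simp add: matrix_vector_mult_def axis_def if_distrib cong: if_cong)
  qed
  have "matrix_inv A $ k $ i * b $ k = 0" for k
    using inv_zero[of k] by (cases "b $ k = 0") auto
  then have "(\<Sum>k\<in>UNIV. matrix_inv A $ k $ i * b $ k) = 0" by (intro sum.neutral ballI)
  then show ?thesis by (simp add: vector_matrix_mult_def mult.commute)
qed

text \<open>The stage order conditions express \<open>c^l\<close> as \<open>l\<close> times
  \<open>A c^(l-1)\<close>; then \<open>b^T A^{-1} A = b^T\<close> and the order conditions give
  one. The case \<open>l = 0\<close> is the hypothesis \<open>b^T A^{-1} 1 = 1\<close>.\<close>

lemma rk_weights_exact:
  fixes A :: "real^'s^'s"
  assumes order: "rk_order b c P" and stage: "rk_stage_order A c Q" and le: "Q \<le> P"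
    and inv: "invertible A" and one: "b \<bullet> (matrix_inv A *v vec 1) = 1" and l: "l \<le> Q"
  shows "(\<Sum>i\<in>UNIV. (b v* matrix_inv A) $ i * c $ i ^ l) = 1"
proof (cases l)
  case 0
  then show ?thesis using rk_weights_sum[OF one] by simp
next
  case (Suc m)
  have st: "c $ i ^ l = real l * (\<Sum>j\<in>UNIV. A $ i $ j * c $ j ^ m)" for i
    using stage l Suc unfolding rk_stage_order_def by (auto dest!: bspec[of _ _ l] spec[of _ i])
  have "(\<Sum>i\<in>UNIV. (b v* matrix_inv A) $ i * c $ i ^ l)
      = (\<Sum>i\<in>UNIV. \<Sum>j\<in>UNIV. real l * (((b v* matrix_inv A) $ i * A $ i $ j) * c $ j ^ m))"
    by (simp add: st sum_distrib_left mult_ac)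
  also have "\<dots> = real l * (\<Sum>j\<in>UNIV. (\<Sum>i\<in>UNIV. (b v* matrix_inv A) $ i * A $ i $ j) * c $ j ^ m)"
    by (subst sum.swap) (simp only: sum_distrib_left sum_distrib_right)
  also have "\<dots> = real l * (\<Sum>j\<in>UNIV. b $ j * c $ j ^ m)"
    by (simp only: rk_weights_mult[OF inv])
  also have "\<dots> = 1"
    using order l le Suc unfolding rk_order_def by (auto dest!: bspec[of _ _ l])
  finally show ?thesis .
qed

text \<open>The form is nonnegative at each point of the edges, with the values
  \<open>x i (e, y)\<close> as its argument, and this is integrated.\<close>

lemma L2_gram_nonneg:
  fixes S :: "real^'s^'s"
  assumes S: "pos_semidef S" and x: "\<And>i. x i \<in> L2 N"
  shows "0 \<le> (\<Sum>i\<in>UNIV. \<Sum>k\<in>UNIV. S $ i $ k * L2_inner N (x i) (x k))"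
proof -
  have "(\<Sum>i\<in>UNIV. \<Sum>k\<in>UNIV. S $ i $ k * L2_inner N (x i) (x k))
      = (\<Sum>e\<in>edges N. \<Sum>i\<in>UNIV. \<Sum>k\<in>UNIV. S $ i $ k * (LINT y|lebesgue_on {0..edge_len N e}. x i (e, y) * x k (e, y)))"
    unfolding L2_inner_def sum_distrib_left
    by (rule trans[OF sum.cong[OF refl sum.swap] sum.swap])
  also have "\<dots> \<ge> 0"
  proof (rule sum_nonneg)
    fix e assume e: "e \<in> edges N"
    let ?M = "lebesgue_on {0..edge_len N e}"
    have "(\<Sum>i\<in>UNIV. \<Sum>k\<in>UNIV. S $ i $ k * (LINT y|?M. x i (e, y) * x k (e, y)))
        = (LINT y|?M. (\<Sum>i\<in>UNIV. \<Sum>k\<in>UNIV. S $ i $ k * (x i (e, y) * x k (e, y))))"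
      using L2_edge_integrable_mult[OF x x e]
      by (subst Bochner_Integration.integral_sum)
        (auto intro!: sum.cong Bochner_Integration.integrable_sum simp: Bochner_Integration.integral_sum)
    also have "\<dots> \<ge> 0"
      by (intro Bochner_Integration.integral_nonneg pos_semidef_quadratic[OF S])
    finally show "0 \<le> (\<Sum>i\<in>UNIV. \<Sum>k\<in>UNIV. S $ i $ k * (LINT y|?M. x i (e, y) * x k (e, y)))" .
  qed
  finally show ?thesis .
qed

text \<open>The right-hand side minus the left-hand side is \<open>\<tau>^2\<close> times the
  pairing of the algebraic stability matrix with the Gram matrix of the stage derivatives
  \<open>x\<close>.\<close>

lemma algebraic_stability_step:
  fixes A :: "real^'s^'s"
  assumes stab: "algebraically_stable A b" and x: "\<And>i. x i \<in> L2 N" and e: "e \<in> L2 N"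
  shows "L2_inner N (%z. e z + \<tau> * (\<Sum>k\<in>UNIV. b $ k * x k z)) (%z. e z + \<tau> * (\<Sum>k\<in>UNIV. b $ k * x k z))
     \<le> L2_inner N e e + 2 * \<tau> * (\<Sum>i\<in>UNIV. b $ i * L2_inner N (x i) (%z. e z + \<tau> * (\<Sum>k\<in>UNIV. A $ i $ k * x k z)))"
proof -
  define G where "G i k = L2_inner N (x i) (x k)" for i k
  have Gsym: "G i k = G k i" for i k unfolding G_def by (rule L2_inner_commute)
  let ?s = "%z. \<Sum>k\<in>UNIV. b $ k * x k z"
  have s: "?s \<in> L2 N" by (intro L2.sum_mem x)
  have "L2_inner N (%z. e z + \<tau> * ?s z) (%z. e z + \<tau> * ?s z)
      = L2_inner N e e + 2 * \<tau> * L2_inner N ?s e + \<tau>^2 * L2_inner N ?s ?s"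
    using e s L2.scale_mem[OF s, of \<tau>] L2.add_mem[OF e L2.scale_mem[OF s, of \<tau>]]
    by (simp add: L2.ip_add_left L2.ip_add_right L2.ip_scale_left L2.ip_scale_right L2_inner_commute[of N e ?s]
        power2_eq_square algebra_simps)
  moreover have "L2_inner N ?s e = (\<Sum>i\<in>UNIV. b $ i * L2_inner N (x i) e)"
    by (intro L2.ip_sum_left x e)
  moreover have "L2_inner N ?s ?s = (\<Sum>i\<in>UNIV. \<Sum>k\<in>UNIV. b $ i * b $ k * G i k)"
  proof -
    have "L2_inner N ?s ?s = (\<Sum>i\<in>UNIV. b $ i * L2_inner N (x i) ?s)" by (intro L2.ip_sum_left x s)
    also have "\<dots> = (\<Sum>i\<in>UNIV. b $ i * (\<Sum>k\<in>UNIV. b $ k * G i k))"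
      unfolding G_def by (intro sum.cong refl arg_cong2[of _ _ _ _ "(*)"] L2.ip_sum_right x)
    finally show ?thesis by (simp add: sum_distrib_left mult_ac)
  qed
  moreover have "L2_inner N (x i) (%z. e z + \<tau> * (\<Sum>k\<in>UNIV. A $ i $ k * x k z))
      = L2_inner N (x i) e + \<tau> * (\<Sum>k\<in>UNIV. A $ i $ k * G i k)" for i
  proof -
    have a: "(%z. \<Sum>k\<in>UNIV. A $ i $ k * x k z) \<in> L2 N" by (intro L2.sum_mem x)
    have "L2_inner N (x i) (%z. \<Sum>k\<in>UNIV. A $ i $ k * x k z) = (\<Sum>k\<in>UNIV. A $ i $ k * G i k)"
      unfolding G_def by (intro L2.ip_sum_right x)
    then show ?thesis
      using L2.ip_add_right[OF e L2.scale_mem[OF a, of \<tau>] x[of i]] L2.ip_scale_right[OF a x[of i], of \<tau>] by simp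
  qed
  moreover have "0 \<le> 2 * (\<Sum>i\<in>UNIV. \<Sum>k\<in>UNIV. b $ i * A $ i $ k * G i k) - (\<Sum>i\<in>UNIV. \<Sum>k\<in>UNIV. b $ i * b $ k * G i k)"
  proof -
    have "0 \<le> (\<Sum>i\<in>UNIV. \<Sum>k\<in>UNIV. (b $ i * A $ i $ k + b $ k * A $ k $ i - b $ i * b $ k) * G i k)"
      using L2_gram_nonneg[of "\<chi> i j. b $ i * A $ i $ j + b $ j * A $ j $ i - b $ i * b $ j" x N] stab x
      by (simp add: algebraically_stable_def G_def)
    also have "\<dots> = (\<Sum>i\<in>UNIV. \<Sum>k\<in>UNIV. b $ i * A $ i $ k * G i k) + (\<Sum>i\<in>UNIV. \<Sum>k\<in>UNIV. b $ k * A $ k $ i * G i k)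
        - (\<Sum>i\<in>UNIV. \<Sum>k\<in>UNIV. b $ i * b $ k * G i k)"
      by (simp add: left_diff_distrib distrib_right sum.distrib sum_subtractf)
    also have "(\<Sum>i\<in>UNIV. \<Sum>k\<in>UNIV. b $ k * A $ k $ i * G i k) = (\<Sum>i\<in>UNIV. \<Sum>k\<in>UNIV. b $ i * A $ i $ k * G i k)"
      by (subst sum.swap) (simp add: Gsym)
    finally show ?thesis by simp
  qed
  then have "0 \<le> \<tau>^2 * (2 * (\<Sum>i\<in>UNIV. \<Sum>k\<in>UNIV. b $ i * A $ i $ k * G i k) - (\<Sum>i\<in>UNIV. \<Sum>k\<in>UNIV. b $ i * b $ k * G i k))"
    by simp
  ultimately show ?thesis
    by (simp add: distrib_left sum.distrib sum_distrib_left power2_eq_square algebra_simps)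
qed

text \<open>Elements of \<open>H1 N\<close> are continuous representatives, so vanishing almost
  everywhere means vanishing on the closed edges, and then all increments of the derivative's
  primitive are zero. This bridges the initial condition, which identifies \<open>p0 0\<close> with
  the initial value only almost everywhere.\<close>

lemma H1_norm_zero_if_ae_zero:
  assumes N: "wf_network N" and q: "q \<in> H1 N" and ae: "ae_eq N q (%z. 0)"
  shows "H1_norm N q = 0"
proof -
  have zero: "q (e, x) = 0" if e: "e \<in> edges N" and x: "x \<in> {0..edge_len N e}" for e x
  proof -
    obtain Z where Z: "negligible Z" "\<And>x. x \<in> {0..edge_len N e} ==> x \<notin> Z ==> q (e, x) = 0"
      by (rule AE_lebesgue_on_negligibleE[OF ae[unfolded ae_eq_def, rule_format, OF e]]) (rule that)
    have "0 = q (e, x)"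
    proof (rule derivative_eq_integrand[OF H1_continuous_edge[OF q e] wf_networkD(3)[OF N e], where \<phi> = "%t. 0"])
      fix y assume y: "y \<in> {0..edge_len N e}"
      have "integral {0..y} (%x. q (e, x)) = integral {0..y} (%x. 0)"
        by (rule integral_spike[OF Z(1)]) (use Z(2) y in auto)
      then show "0 - 0 = integral {0..y} (%x. q (e, x))" by simp
    qed (use x in auto)
    then show ?thesis by simp
  qed
  have "ae_eq N (edge_deriv N q) (%z. 0)"
    unfolding ae_eq_def
  proof
    fix e assume e: "e \<in> edges N"
    show "AE x in lebesgue_on {0..edge_len N e}. edge_deriv N q (e, x) = 0"
    proof (rule AE_zero_if_increments_zero)
      show "integrable (lebesgue_on {0..edge_len N e}) (%x. edge_deriv N q (e, x))"
        by (rule L2_interval_integrable[OF L2D[OF edge_deriv_mem_L2[OF q] e]])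
      show "integral {s..t} (%x. edge_deriv N q (e, x)) = 0" if "0 \<le> s" "s \<le> t" "t \<le> edge_len N e" for s t
        using weak_deriv_increment[OF edge_deriv_weak[OF q e] H1_continuous_edge[OF q e] that] zero[OF e] that by simp
    qed
  qed
  then have "L2_norm N (edge_deriv N q) = L2_norm N (%z. 0)" "L2_norm N q = L2_norm N (%z. 0)"
    by (rule L2_norm_cong_ae[OF edge_deriv_mem_L2[OF q] L2.zero_mem])
      (rule L2_norm_cong_ae[OF H1_subset_L2[OF q] L2.zero_mem ae])
  then show ?thesis by (simp add: H1_norm_def L2.nrm_zero)
qed

text \<open>Makes Young's inequality available in the products weighted with \<open>a\<close> and
  with \<open>1 / d\<close>, so that cross terms are absorbed by exactly the energy terms of the
  problem.\<close>

lemma semi_inner_weighted: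
  assumes k: "coef_bounds N k lo hi" and lo: "0 \<le> lo"
  shows "semi_inner (L2 N) (%u v. L2_inner N (%z. k z * u z) v)"
proof
  note m = mult_mem_L2[OF k]
  show "L2_inner N (%z. k z * (\<alpha> * u z + \<beta> * v z)) w = \<alpha> * L2_inner N (%z. k z * u z) w + \<beta> * L2_inner N (%z. k z * v z) w"
    if "u \<in> L2 N" "v \<in> L2 N" "w \<in> L2 N" for u v w \<alpha> \<beta>
    using L2.ip_comb_left[OF m[OF that(1)] m[OF that(2)] that(3), of \<alpha> \<beta>] by (simp add: algebra_simps)
  show "L2_inner N (%z. k z * u z) v = L2_inner N (%z. k z * v z) u" for u v
    by (simp add: L2_inner_def mult_ac)
  show "0 \<le> L2_inner N (%z. k z * u z) u" if "u \<in> L2 N" for u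
    using L2_inner_mult_bounds(1)[OF k that] mult_nonneg_nonneg[OF lo L2_inner_self_nonneg[of N u]] by linarith
qed (auto intro: L2.zero_mem L2.comb_mem)

section \<open>Nodal errors of the Runge-Kutta discretization\<close>

lemma square_sum_le: "x \<le> y + z ==> 0 \<le> x ==> x^2 \<le> 2 * y^2 + 2 * z^2" for x y z :: real
proof -
  assume "x \<le> y + z" "0 \<le> x"
  then have "x^2 \<le> (y + z)^2" by (rule power_mono)
  also have "\<dots> \<le> 2 * y^2 + 2 * z^2" using zero_le_power2[of "y - z"] by (simp add: power2_sum power2_diff)
  finally show ?thesis .
qed

context network_problem
begin

lemma V0_H1: "q \<in> V0 ==> q \<in> H1 N"
  by (simp add: V0_def)

lemma V0_comb:
  assumes "q \<in> V0" "q' \<in> V0"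
  shows "(%z. \<alpha> * q z + \<beta> * q' z) \<in> V0"
  using assms wf_networkD(4)[OF wf] vertex_value_comb[OF wf, of _ q q' \<alpha> \<beta>] comb_mem_H1[of q N q' \<alpha> \<beta>]
  by (auto simp: V0_def)

lemma V0_zero: "(%z. 0) \<in> V0"
proof -
  have "vertex_value N (%z. 0) v = 0" if "v \<in> dirichlet N" for v
    using vertex_value_comb[OF wf _ H1.zero_mem H1.zero_mem, of v 0 0] wf_networkD(4)[OF wf] that by auto
  then show ?thesis using H1.zero_mem by (simp add: V0_def)
qed

lemma V0_sum: "(\<And>k. k \<in> K ==> q k \<in> V0) ==> (%z. \<Sum>k\<in>K. c k * q k z) \<in> V0"
proof (induction K rule: infinite_finite_induct)
  case (insert k K)
  then have "(%z. c k * q k z + 1 * (\<Sum>k\<in>K. c k * q k z)) \<in> V0"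
    by (intro V0_comb) auto
  then show ?case using insert by simp
qed (simp_all add: V0_zero)

end

text \<open>Smoothness of order \<open>qq + 2\<close> is fixed here because a step of the reference
  trajectory has an error of this order. The single constant \<open>K\<close> bounds all derivatives
  that enter the error constants.\<close>

locale rk_problem = parabolic_problem N D a_hi d_lo d_hi p0 m0 lam0 U F "Suc (Suc qq)"
  for N :: "('v, 'e) network" and D :: "('v, 'e) flow_data" and a_hi d_lo d_hi :: real
    and p0 m0 :: "real \<Rightarrow> 'e edge_fun" and lam0 :: "real \<Rightarrow> 'v \<Rightarrow> real"
    and U F :: "nat \<Rightarrow> real \<Rightarrow> 'e edge_fun" and qq :: nat +
  fixes A :: "real^'s^'s" and b c :: "real^'s" and pp n :: nat and Mm :: "'v \<Rightarrow> 'v \<Rightarrow> real"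
    and Ps Qs :: "nat \<Rightarrow> 's \<Rightarrow> 'e edge_fun" and slam smu :: "nat \<Rightarrow> 's \<Rightarrow> 'v \<Rightarrow> real"
    and P Q :: "nat \<Rightarrow> 'e edge_fun" and K :: real
  assumes order: "rk_order b c pp" and stage_order: "rk_stage_order A c qq" and qp: "qq + 1 \<le> pp"
    and stab: "algebraically_stable A b" and inv: "invertible A" and bA: "b \<bullet> (matrix_inv A *v vec 1) = 1"
    and c01: "\<And>i. 0 \<le> c $ i \<and> c $ i \<le> 1"
    and n1: "1 \<le> n" and qn: "qq \<le> n"
    and rk: "rk_discretization N D A b c Mm n Ps Qs slam smu P Q"
    and p_init: "p_init D \<in> H1 N" "ae_eq N (p0 0) (p_init D)"
    and m_init: "m_init D \<in> L2 N" "ae_eq N (m_init D) (m0 0)"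
    and K: "0 \<le> K" "\<And>t. t \<in> {0..T_end D} ==> H1_norm N (U (Suc qq) t) \<le> K"
      "\<And>t. t \<in> {0..T_end D} ==> H1_norm N (U (Suc (Suc qq)) t) \<le> K"
      "\<And>t. t \<in> {0..T_end D} ==> L2_norm N (F (Suc qq) t) \<le> K"
      "\<And>t. t \<in> {0..T_end D} ==> L2_norm N (M (Suc qq) t) \<le> K"
begin

definition \<tau> :: real where "\<tau> = T / real n"
definition tm :: "nat \<Rightarrow> real" where "tm j = real j * \<tau>"
definition st :: "nat \<Rightarrow> 's \<Rightarrow> real" where "st j i = tm (j - 1) + \<tau> * c $ i"
definition w :: "'s \<Rightarrow> real" where "w i = (b v* matrix_inv A) $ i"

definition AD :: "nat \<Rightarrow> 's \<Rightarrow> 'e edge_fun" where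
  "AD j i = (%z. \<Sum>k\<in>UNIV. matrix_inv A $ i $ k * ((Ps j k z - P (j - 1) z) / \<tau>))"

text \<open>
  The reference trajectory \<open>R\<close> uses the exact time derivative of \<open>p0\<close> in the Runge-Kutta formulas.  Its error
  is a pure quadrature error, it has the same boundary values as \<open>P\<close>, and \<open>P - R\<close> satisfies the
  Runge-Kutta recursion without defects.
\<close>

primrec R :: "nat \<Rightarrow> 'e edge_fun" where
  "R 0 = P 0"
| "R (Suc j) = (%z. R j z + \<tau> * (\<Sum>k\<in>UNIV. b $ k * U 1 (st (Suc j) k) z))"

definition S :: "nat \<Rightarrow> 's \<Rightarrow> 'e edge_fun" where
  "S j i = (%z. R (j - 1) z + \<tau> * (\<Sum>k\<in>UNIV. A $ i $ k * U 1 (st j k) z))"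

definition err :: "nat \<Rightarrow> 'e edge_fun" where "err j = (%z. P j z - R j z)"
definition errS :: "nat \<Rightarrow> 's \<Rightarrow> 'e edge_fun" where "errS j i = (%z. Ps j i z - S j i z)"
definition errD :: "nat \<Rightarrow> 's \<Rightarrow> 'e edge_fun" where "errD j i = (%z. AD j i z - U 1 (st j i) z)"

lemma \<tau>_pos: "0 < \<tau>" and n_\<tau>: "real n * \<tau> = T"
  using T_pos n1 by (auto simp: \<tau>_def)

lemma tm_mem: "j \<le> n ==> tm j \<in> {0..T}"
  using \<tau>_pos n_\<tau> mult_right_mono[of "real j" "real n" \<tau>] by (simp add: tm_def)

lemma tm_pred: "1 \<le> j ==> tm (j - 1) + \<tau> = tm j"
  by (simp add: tm_def of_nat_diff algebra_simps)

lemma st_mem: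
  assumes "1 \<le> j" "j \<le> n"
  shows "st j i \<in> {0..T}"
proof -
  have "\<tau> * c $ i \<le> \<tau> * 1" "0 \<le> \<tau> * c $ i" using \<tau>_pos c01[of i] by (auto intro: mult_left_mono)
  then show ?thesis
    using tm_mem[of "j - 1"] tm_mem[of j] tm_pred[OF assms(1)] assms by (simp add: st_def)
qed

lemma rkD:
  assumes j: "1 \<le> j" "j \<le> n"
  shows "Ps j i \<in> H1 N" "Qs j i \<in> L2 N"
    "q \<in> H1 N ==> L2_inner N (AD j i) q + L2_inner N (%z. coef_a D z * Ps j i z) q
        - op_K_adj N (Qs j i) q + op_B_adj N (slam j i) q + op_B_adj N (smu j i) q
      = rhs_g D (st j i) q - op_C_adj N (rhs_r D (st j i)) q"
    "v \<in> L2 N ==> op_K N (Ps j i) v + L2_inner N (%z. coef_d D z * Qs j i z) v = L2_inner N (rhs_f D (st j i)) v"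
    "x \<in> dirichlet N ==> vertex_value N (AD j i) x
      = vector_derivative (%t. rhs_h D t x) (at (st j i) within {0..T})"
    "P j = (%z. \<Sum>k\<in>UNIV. w k * Ps j k z)" "Q j = (%z. \<Sum>k\<in>UNIV. w k * Qs j k z)"
  using rk j unfolding rk_discretization_def Let_def AD_def st_def tm_def \<tau>_def w_def by auto

lemma P_0: "P 0 = p_init D" and Q_0: "Q 0 = m_init D"
  using rk by (auto simp: rk_discretization_def Let_def)

lemma P_mem: "j \<le> n ==> P j \<in> H1 N"
proof (cases "j = 0")
  case True
  then show ?thesis using P_0 p_init by simp
next
  case False
  assume "j \<le> n"
  then show ?thesis using rkD(1,6)[of j] False by (auto intro!: H1.sum_mem)
qed

lemma Q_mem: "j \<le> n ==> Q j \<in> L2 N"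
proof (cases "j = 0")
  case True
  then show ?thesis using Q_0 m_init by simp
next
  case False
  assume "j \<le> n"
  then show ?thesis using rkD(2,7)[of j] False by (auto intro!: L2.sum_mem)
qed

lemma U1_mem: "t \<in> {0..T} ==> U 1 t \<in> H1 N"
  using U_mem[of 1 t] by simp

lemma R_mem: "j \<le> n ==> R j \<in> H1 N"
proof (induction j)
  case 0
  then show ?case using P_mem by simp
next
  case (Suc j)
  then have "(%z. \<Sum>k\<in>UNIV. b $ k * U 1 (st (Suc j) k) z) \<in> H1 N"
    using st_mem[of "Suc j"] by (intro H1.sum_mem U1_mem) auto
  then show ?case using Suc H1.add_mem[OF _ H1.scale_mem, of "R j" N _ \<tau>] by simp
qed

lemma AD_mem:
  assumes "1 \<le> j" "j \<le> n"
  shows "AD j i \<in> H1 N"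
proof -
  have "(%z. \<Sum>k\<in>UNIV. (matrix_inv A $ i $ k / \<tau>) * (Ps j k z - P (j - 1) z)) \<in> H1 N"
    using assms P_mem[of "j - 1"] rkD(1)[OF assms] by (intro H1.sum_mem H1.diff_mem) auto
  then show ?thesis by (simp add: AD_def)
qed

lemma S_mem:
  assumes "1 \<le> j" "j \<le> n"
  shows "S j i \<in> H1 N"
proof -
  have "(%z. \<Sum>k\<in>UNIV. A $ i $ k * U 1 (st j k) z) \<in> H1 N"
    using st_mem[OF assms] by (intro H1.sum_mem U1_mem) auto
  then show ?thesis
    unfolding S_def using assms R_mem[of "j - 1"] H1.add_mem[OF _ H1.scale_mem, of "R (j - 1)" N _ \<tau>] by simp
qed

text \<open>The discretization prescribes the trace of its stage derivatives as the time derivative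
  of \<open>h\<close>, which by \<open>p0_boundary\<close> is the trace of \<open>U 1\<close> at the
  same time. Zero boundary values of the remaining errors follow from this by linearity.\<close>

lemma errD_V0:
  assumes "1 \<le> j" "j \<le> n"
  shows "errD j i \<in> V0"
proof -
  note m = AD_mem[OF assms, of i] U1_mem[OF st_mem[OF assms, of i]]
  have "vertex_value N (errD j i) x = 0" if x: "x \<in> dirichlet N" for x
  proof -
    have "x \<in> verts (graph N)" using wf_networkD(4)[OF wf] x by auto
    from vertex_value_comb[OF wf this m, of 1 "-1"] show ?thesis
      using rkD(5)[OF assms x, of i] p0_boundary(2)[OF x st_mem[OF assms, of i]] by (simp add: errD_def)
  qed
  then show ?thesis using H1.diff_mem[OF m] by (simp add: V0_def errD_def)
qed

text \<open>Inverting the definition of \<open>AD\<close> recovers the usual Runge-Kutta form, in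
  which the stages are driven by their time derivatives.\<close>

lemma Ps_eq:
  assumes "1 \<le> j" "j \<le> n"
  shows "Ps j i z = P (j - 1) z + \<tau> * (\<Sum>k\<in>UNIV. A $ i $ k * AD j k z)"
proof -
  have "(\<Sum>k\<in>UNIV. A $ i $ k * AD j k z)
      = (\<Sum>k\<in>UNIV. \<Sum>l\<in>UNIV. (A $ i $ k * matrix_inv A $ k $ l) * ((Ps j l z - P (j - 1) z) / \<tau>))"
    by (simp add: AD_def sum_distrib_left mult.assoc)
  also have "\<dots> = (\<Sum>l\<in>UNIV. (\<Sum>k\<in>UNIV. A $ i $ k * matrix_inv A $ k $ l) * ((Ps j l z - P (j - 1) z) / \<tau>))"
    by (subst sum.swap) (simp only: sum_distrib_right)
  also have "\<dots> = (\<Sum>l\<in>UNIV. if i = l then (Ps j l z - P (j - 1) z) / \<tau> else 0)"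
    by (intro sum.cong refl) (simp add: matrix_inv_sums[OF inv])
  also have "\<dots> = (Ps j i z - P (j - 1) z) / \<tau>" by simp
  finally show ?thesis using \<tau>_pos by simp
qed

lemma w_sum: "(\<Sum>i\<in>UNIV. w i) = 1"
  unfolding w_def by (rule rk_weights_sum[OF bA])

text \<open>Combines \<open>b^T A^{-1} 1 = 1\<close> with \<open>b^T A^{-1} A = b^T\<close>:
  averaging the stages with \<open>w\<close> is the same as the step with weights \<open>b\<close>.
  It applies to exact, discrete and error quantities alike.\<close>

lemma w_stages:
  fixes x :: "'s \<Rightarrow> real"
  shows "(\<Sum>i\<in>UNIV. w i * (y + \<tau> * (\<Sum>k\<in>UNIV. A $ i $ k * x k))) = y + \<tau> * (\<Sum>k\<in>UNIV. b $ k * x k)"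
proof -
  have "(\<Sum>i\<in>UNIV. w i * (\<Sum>k\<in>UNIV. A $ i $ k * x k)) = (\<Sum>i\<in>UNIV. \<Sum>k\<in>UNIV. (w i * A $ i $ k) * x k)"
    by (simp add: sum_distrib_left mult.assoc)
  also have "\<dots> = (\<Sum>k\<in>UNIV. (\<Sum>i\<in>UNIV. w i * A $ i $ k) * x k)"
    by (subst sum.swap) (simp only: sum_distrib_right)
  also have "\<dots> = (\<Sum>k\<in>UNIV. b $ k * x k)"
    unfolding w_def by (simp only: rk_weights_mult[OF inv])
  finally have *: "(\<Sum>i\<in>UNIV. w i * (\<Sum>k\<in>UNIV. A $ i $ k * x k)) = (\<Sum>k\<in>UNIV. b $ k * x k)" .
  have "(\<Sum>i\<in>UNIV. w i * (y + \<tau> * (\<Sum>k\<in>UNIV. A $ i $ k * x k)))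
      = (\<Sum>i\<in>UNIV. w i) * y + \<tau> * (\<Sum>i\<in>UNIV. w i * (\<Sum>k\<in>UNIV. A $ i $ k * x k))"
    by (simp only: distrib_left sum.distrib sum_distrib_right[of _ _ y] mult.left_commute[of _ \<tau>])
      (simp only: sum_distrib_left[of \<tau> "%i. w i * _ i"])
  then show ?thesis by (simp only: w_sum * mult_1)
qed

lemma P_step:
  assumes "1 \<le> j" "j \<le> n"
  shows "P j z = P (j - 1) z + \<tau> * (\<Sum>k\<in>UNIV. b $ k * AD j k z)"
proof -
  have "P j z = (\<Sum>k\<in>UNIV. w k * Ps j k z)" using rkD(6)[OF assms] by simp
  then show ?thesis unfolding Ps_eq[OF assms] by (simp only: w_stages)
qed

lemma R_step: "1 \<le> j ==> R j z = R (j - 1) z + \<tau> * (\<Sum>k\<in>UNIV. b $ k * U 1 (st j k) z)"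
  by (cases j) auto

lemma errS_eq:
  assumes "1 \<le> j" "j \<le> n"
  shows "errS j i = (%z. err (j - 1) z + \<tau> * (\<Sum>k\<in>UNIV. A $ i $ k * errD j k z))"
  by (rule ext) (simp add: errS_def Ps_eq[OF assms] S_def err_def errD_def right_diff_distrib sum_subtractf)

lemma err_step:
  assumes "1 \<le> j" "j \<le> n"
  shows "err j = (%z. err (j - 1) z + \<tau> * (\<Sum>k\<in>UNIV. b $ k * errD j k z))"
  using R_step[OF assms(1)]
  by (intro ext) (simp add: P_step[OF assms] err_def errD_def right_diff_distrib sum_subtractf)

lemma err_weights:
  assumes "1 \<le> j" "j \<le> n"
  shows "err j = (%z. \<Sum>i\<in>UNIV. w i * errS j i z)"
  unfolding err_step[OF assms] errS_eq[OF assms] w_stages ..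

lemma err_0: "err 0 = (%z. 0)"
  by (simp add: err_def)

text \<open>The induction starts at zero because \<open>R\<close> starts at the discrete initial
  value; the deviation of that value from \<open>p0 0\<close> is accounted for in
  \<open>tm_defect\<close>.\<close>

lemma err_V0: "j \<le> n ==> err j \<in> V0"
proof (induction j)
  case 0
  then show ?case by (simp add: err_0 V0_zero)
next
  case (Suc j)
  then have "(%z. \<Sum>k\<in>UNIV. b $ k * errD (Suc j) k z) \<in> V0" by (intro V0_sum errD_V0) auto
  then show ?case
    using V0_comb[of "err j" _ 1 \<tau>] Suc err_step[of "Suc j"] by simp
qed

lemma errS_V0:
  assumes "1 \<le> j" "j \<le> n"
  shows "errS j i \<in> V0"
proof -
  have "(%z. \<Sum>k\<in>UNIV. A $ i $ k * errD j k z) \<in> V0" using assms by (intro V0_sum errD_V0) auto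
  then show ?thesis
    using V0_comb[of "err (j - 1)" _ 1 \<tau>] err_V0[of "j - 1"] assms by (simp add: errS_eq)
qed

definition stage_defect :: "nat \<Rightarrow> 's \<Rightarrow> 'e edge_fun" where
  "stage_defect j i = (%z. S j i z - p0 (st j i) z)"

lemma stage_defect_mem:
  assumes "1 \<le> j" "j \<le> n"
  shows "stage_defect j i \<in> H1 N"
  unfolding stage_defect_def using assms by (intro H1.diff_mem S_mem p0_mem st_mem)

text \<open>Difference of the discrete and the exact first equation at a stage time. The second
  equations, tested with \<open>d^{-1}\<close> times the derivative of \<open>q\<close>, eliminate
  \<open>Qs\<close> and \<open>m0\<close>, and the multipliers vanish on \<open>V0\<close>. What
  remains is the elliptic form applied to \<open>errS\<close> plus the stage defect.\<close>

lemma errD_equation: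
  assumes j: "1 \<le> j" "j \<le> n" and q: "q \<in> V0"
  shows "L2_inner N (errD j i) q
    = - L2_inner N (%z. coef_a D z * errS j i z) q - L2_inner N (%z. coef_a D z * stage_defect j i z) q
      - L2_inner N (%z. inverse (coef_d D z) * edge_deriv N (errS j i) z) (edge_deriv N q)
      - L2_inner N (%z. inverse (coef_d D z) * edge_deriv N (stage_defect j i) z) (edge_deriv N q)"
proof -
  let ?t = "st j i" and ?id = "%z. inverse (coef_d D z)"
  note t = st_mem[OF j, of i]
  have qH: "q \<in> H1 N" using q by (rule V0_H1)
  have qL: "q \<in> L2 N" and dq: "edge_deriv N q \<in> L2 N" using qH by (auto intro: H1_subset_L2 edge_deriv_mem_L2)
  have H: "Ps j i \<in> H1 N" "p0 ?t \<in> H1 N" "errS j i \<in> H1 N" "stage_defect j i \<in> H1 N"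
    using rkD(1)[OF j] p0_mem[OF t] V0_H1[OF errS_V0[OF j]] stage_defect_mem[OF j] by auto
  note HL = H[THEN H1_subset_L2] and Hd = H[THEN edge_deriv_mem_L2]
  have Qm: "Qs j i \<in> L2 N" "m0 ?t \<in> L2 N" using rkD(2)[OF j] L2.cont_curve_mem[OF m0_curve t] by auto
  have sum: "Ps j i z - p0 ?t z = errS j i z + stage_defect j i z" for z
    by (simp add: errS_def stage_defect_def)
  have "L2_inner N (errD j i) q = L2_inner N (AD j i) q - L2_inner N (U 1 ?t) q"
    unfolding errD_def by (rule L2.ip_diff_left[OF H1_subset_L2[OF AD_mem[OF j]] H1_subset_L2[OF U1_mem[OF t]] qL])
  also have "\<dots> = - (L2_inner N (%z. coef_a D z * Ps j i z) q - L2_inner N (%z. coef_a D z * p0 ?t z) q)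
      + (L2_inner N (edge_deriv N q) (Qs j i) - L2_inner N (edge_deriv N q) (m0 ?t))"
    using rkD(3)[OF j qH, of i] p0_equation[OF t q] V0_op_B_adj[OF q] by (simp add: op_K_adj_def op_K_def)
  also have "L2_inner N (%z. coef_a D z * Ps j i z) q - L2_inner N (%z. coef_a D z * p0 ?t z) q
      = L2_inner N (%z. coef_a D z * errS j i z) q + L2_inner N (%z. coef_a D z * stage_defect j i z) q"
  proof -
    have "(%z. coef_a D z * Ps j i z - coef_a D z * p0 ?t z) = (%z. coef_a D z * errS j i z + coef_a D z * stage_defect j i z)"
      unfolding right_diff_distrib[symmetric] sum distrib_left ..
    then show ?thesis
      using L2.ip_diff_left[OF mult_mem_L2[OF a_bounds(1) HL(1)] mult_mem_L2[OF a_bounds(1) HL(2)] qL]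
        L2.ip_add_left[OF mult_mem_L2[OF a_bounds(1) HL(3)] mult_mem_L2[OF a_bounds(1) HL(4)] qL] by simp
  qed
  also have "L2_inner N (edge_deriv N q) (Qs j i) - L2_inner N (edge_deriv N q) (m0 ?t)
      = - L2_inner N (%z. ?id z * edge_deriv N (errS j i) z) (edge_deriv N q)
        - L2_inner N (%z. ?id z * edge_deriv N (stage_defect j i) z) (edge_deriv N q)"
  proof -
    let ?v = "%z. ?id z * edge_deriv N q z"
    have v: "?v \<in> L2 N" by (rule mult_mem_L2[OF inv_d_bounds dq])
    \<comment> \<open>\<open>d\<close> and its inverse cancel only almost everywhere, hence the
      detour through inner products.\<close>
    have cancel: "L2_inner N (%z. coef_d D z * x z) ?v = L2_inner N (edge_deriv N q) x" if x: "x \<in> L2 N" for x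
    proof -
      have "L2_inner N (%z. coef_d D z * x z) ?v = L2_inner N (%z. ?id z * (coef_d D z * edge_deriv N q z)) x"
        by (simp add: L2_inner_def mult_ac)
      also have "\<dots> = L2_inner N (edge_deriv N q) x"
        by (intro L2_inner_cong_ae mult_mem_L2[OF inv_d_bounds] mult_mem_L2[OF d_bounds(1)] dq x
            coef_bounds_cancel[OF d_bounds(1,2)])
      finally show ?thesis .
    qed
    have move: "L2_inner N x ?v = L2_inner N (%z. ?id z * x z) (edge_deriv N q)" for x
      by (simp add: L2_inner_def mult_ac)
    have "L2_inner N (edge_deriv N (Ps j i)) ?v + L2_inner N (edge_deriv N q) (Qs j i)
        = L2_inner N (edge_deriv N (p0 ?t)) ?v + L2_inner N (edge_deriv N q) (m0 ?t)"
      using rkD(4)[OF j v, of i] m0_equation[OF t v] cancel[OF Qm(1)] cancel[OF Qm(2)] by (simp add: op_K_def)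
    moreover have "L2_inner N (edge_deriv N (Ps j i)) ?v - L2_inner N (edge_deriv N (p0 ?t)) ?v
        = L2_inner N (edge_deriv N (errS j i)) ?v + L2_inner N (edge_deriv N (stage_defect j i)) ?v"
      using op_K_diff[OF H(1,2) v] op_K_comb[OF H(3,4) v, of 1 1] by (simp add: sum)
    ultimately show ?thesis unfolding move by linarith
  qed
  finally show ?thesis by simp
qed

text \<open>Young's inequality in the weighted products uses half of the energy of
  \<open>errS\<close> for the cross terms with the stage defect. The remaining \<open>a\<close> part
  is nonnegative and dropped, the remaining derivative part is the dissipation.\<close>

lemma stage_energy:
  assumes j: "1 \<le> j" "j \<le> n"
  shows "2 * L2_inner N (errD j i) (errS j i)
    \<le> - (1 / d_hi) * (L2_norm N (edge_deriv N (errS j i)))^2 + (a_hi + 1 / d_lo) * (H1_norm N (stage_defect j i))^2"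
proof -
  let ?a = "coef_a D" and ?id = "%z. inverse (coef_d D z)"
  let ?e = "errS j i" and ?s = "stage_defect j i"
  have eV: "?e \<in> V0" by (rule errS_V0[OF j])
  have H: "?e \<in> H1 N" "?s \<in> H1 N" using V0_H1[OF eV] stage_defect_mem[OF j] by auto
  note HL = H[THEN H1_subset_L2] and Hd = H[THEN edge_deriv_mem_L2]
  have 1: "2 * \<bar>L2_inner N (%z. ?a z * ?s z) ?e\<bar> \<le> L2_inner N (%z. ?a z * ?s z) ?s + L2_inner N (%z. ?a z * ?e z) ?e"
    using semi_inner.young[OF semi_inner_weighted[OF a_bounds(1) order_refl] HL(2,1), of 1] by simp
  have 2: "2 * \<bar>L2_inner N (%z. ?id z * edge_deriv N ?s z) (edge_deriv N ?e)\<bar>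
      \<le> L2_inner N (%z. ?id z * edge_deriv N ?s z) (edge_deriv N ?s) + L2_inner N (%z. ?id z * edge_deriv N ?e z) (edge_deriv N ?e)"
    using semi_inner.young[OF semi_inner_weighted[OF inv_d_bounds inv_d_pos(1)] Hd(2,1), of 1] by simp
  have 3: "0 \<le> L2_inner N (%z. ?a z * ?e z) ?e"
    using L2_inner_mult_bounds(1)[OF a_bounds(1) HL(1)] by simp
  have 4: "L2_inner N (%z. ?a z * ?s z) ?s \<le> a_hi * (H1_norm N ?s)^2"
  proof -
    have "L2_inner N (%z. ?a z * ?s z) ?s \<le> a_hi * (L2_norm N ?s)^2"
      using L2_inner_mult_bounds(2)[OF a_bounds(1) HL(2)] by (simp add: L2_norm_power2)
    also have "\<dots> \<le> a_hi * (H1_norm N ?s)^2"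
      using a_bounds(2) by (intro mult_left_mono) (simp_all add: H1_norm_power2)
    finally show ?thesis .
  qed
  have 5: "L2_inner N (%z. ?id z * edge_deriv N ?s z) (edge_deriv N ?s) \<le> (1 / d_lo) * (H1_norm N ?s)^2"
  proof -
    have "L2_inner N (%z. ?id z * edge_deriv N ?s z) (edge_deriv N ?s) \<le> inverse d_lo * (L2_norm N (edge_deriv N ?s))^2"
      using L2_inner_mult_bounds(2)[OF inv_d_bounds Hd(2)] by (simp add: L2_norm_power2)
    also have "\<dots> \<le> inverse d_lo * (H1_norm N ?s)^2"
      using d_bounds by (intro mult_left_mono) (simp_all add: H1_norm_power2)
    finally show ?thesis by (simp add: divide_inverse)
  qed
  have 6: "(1 / d_hi) * (L2_norm N (edge_deriv N ?e))^2 \<le> L2_inner N (%z. ?id z * edge_deriv N ?e z) (edge_deriv N ?e)"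
    using L2_inner_mult_bounds(1)[OF inv_d_bounds Hd(1)] by (simp add: L2_norm_power2 divide_inverse)
  show ?thesis
    using errD_equation[OF j eV, of i] 1 2 3 4 5 6 unfolding distrib_right by linarith
qed

section \<open>Quadrature errors of the reference trajectory\<close>

definition B where "B = T * (1 + (\<Sum>k\<in>UNIV. \<bar>b $ k\<bar>))"
text \<open>\<open>K * B\<close> bounds the quadrature error accumulated over the whole time
  interval; \<open>Cs\<close> adds the error of one stage formula, with the sum over all rows of
  \<open>A\<close> in place of a maximum.\<close>

definition Cs where "Cs = K * (B + 1 + (\<Sum>i\<in>UNIV. \<Sum>k\<in>UNIV. \<bar>A $ i $ k\<bar>))"

text \<open>Since \<open>qq + 1 \<le> pp\<close>, the weights \<open>b\<close> integrate powers of
  degree at most \<open>qq\<close> exactly, so each step contributes an error of order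
  \<open>qq + 2\<close>. As \<open>R\<close> is a pure quadrature, these errors add up without
  amplification.\<close>

lemma tm_defect:
  assumes "j \<le> n"
  shows "H1_norm N (%z. R j z - p0 (tm j) z) \<le> real j * (K * (1 + (\<Sum>k\<in>UNIV. \<bar>b $ k\<bar>)) * \<tau> ^ Suc (Suc qq))"
  using assms
proof (induction j)
  case 0
  have m: "p_init D \<in> H1 N" "p0 0 \<in> H1 N" using p_init p0_mem T_pos by auto
  have "ae_eq N (%z. p_init D z - p0 0 z) (%z. 0)"
    using p_init(2) unfolding ae_eq_def by (auto elim!: eventually_mono)
  then have "H1_norm N (%z. p_init D z - p0 0 z) = 0"
    by (intro H1_norm_zero_if_ae_zero[OF wf] H1.diff_mem m)
  then show ?case by (simp add: P_0 tm_def)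
next
  case (Suc j)
  let ?q = "K * (1 + (\<Sum>k\<in>UNIV. \<bar>b $ k\<bar>)) * \<tau> ^ Suc (Suc qq)"
  let ?d = "%z. U 0 (tm j) z + \<tau> * (\<Sum>k\<in>UNIV. b $ k * U 1 (tm j + \<tau> * c $ k) z) - U 0 (tm j + \<tau> * 1) z"
  have t: "tm j \<in> {0..T}" "tm (Suc j) \<in> {0..T}" using tm_mem[of j] tm_mem[of "Suc j"] Suc.prems by simp_all
  have tS: "tm j + \<tau> * 1 = tm (Suc j)" using tm_pred[of "Suc j"] by simp
  have "H1_norm N ?d \<le> ?q"
  proof (rule H1.quadrature_defect[where L = "Suc qq" and T = T])
    show "continuous_curve T (H1 N) (H1_norm N) (U j)" if "j \<le> Suc (Suc qq)" for j using U_curve[OF that] .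
    show "derivative_curve T (H1_norm N) (U j) (U (Suc j))" if "j \<le> Suc qq" for j using U_deriv[of j] that by simp
    show "(\<Sum>k\<in>UNIV. b $ k * c $ k ^ l) = 1 ^ Suc l / real (Suc l)" if "l < Suc qq" for l
      using order qp that unfolding rk_order_def by (auto dest!: bspec[of _ _ "Suc l"])
  qed (use K \<tau>_pos t tS c01 in auto)
  moreover have "?d \<in> H1 N"
  proof -
    have "(%z. \<Sum>k\<in>UNIV. b $ k * U 1 (tm j + \<tau> * c $ k) z) \<in> H1 N"
      using st_mem[of "Suc j"] Suc.prems by (intro H1.sum_mem U1_mem) (auto simp: st_def)
    then show ?thesis
      using t unfolding tS by (intro H1.diff_mem H1.add_mem H1.scale_mem U_mem) auto
  qed
  moreover have "(%z. R (Suc j) z - p0 (tm (Suc j)) z) = (%z. (R j z - p0 (tm j) z) + ?d z)"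
    unfolding tS by (auto simp: U0 st_def)
  moreover have "(%z. R j z - p0 (tm j) z) \<in> H1 N"
    using Suc.prems t by (intro H1.diff_mem R_mem p0_mem) auto
  ultimately have "H1_norm N (%z. R (Suc j) z - p0 (tm (Suc j)) z) \<le> H1_norm N (%z. R j z - p0 (tm j) z) + ?q"
    using H1.nrm_triangle[of "%z. R j z - p0 (tm j) z" N ?d] by simp
  then show ?case using Suc by (simp add: distrib_right)
qed

lemma R_defect:
  assumes "j \<le> n"
  shows "H1_norm N (%z. R j z - p0 (tm j) z) \<le> K * B * \<tau> ^ Suc qq"
proof -
  have "real j * (K * (1 + (\<Sum>k\<in>UNIV. \<bar>b $ k\<bar>)) * \<tau> ^ Suc (Suc qq))
      = tm j * (K * (1 + (\<Sum>k\<in>UNIV. \<bar>b $ k\<bar>)) * \<tau> ^ Suc qq)"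
    by (simp add: tm_def mult_ac)
  also have "\<dots> \<le> T * (K * (1 + (\<Sum>k\<in>UNIV. \<bar>b $ k\<bar>)) * \<tau> ^ Suc qq)"
    using tm_mem[OF assms] K(1) \<tau>_pos by (intro mult_right_mono mult_nonneg_nonneg add_nonneg_nonneg sum_nonneg) auto
  finally show ?thesis using tm_defect[OF assms] by (simp add: B_def mult_ac)
qed

text \<open>The inherited error of \<open>R\<close> plus the error of the stage quadrature. The
  latter belongs to a single step and does not accumulate, so stage order \<open>qq\<close> is
  enough for the power \<open>Suc qq\<close>.\<close>

lemma stage_defect_bound:
  assumes j: "1 \<le> j" "j \<le> n"
  shows "H1_norm N (stage_defect j i) \<le> Cs * \<tau> ^ Suc qq"
proof -
  let ?t = "tm (j - 1)"
  let ?d = "%z. U 0 ?t z + \<tau> * (\<Sum>k\<in>UNIV. A $ i $ k * U 1 (?t + \<tau> * c $ k) z) - U 0 (?t + \<tau> * c $ i) z"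
  have t: "?t \<in> {0..T}" "?t + \<tau> \<in> {0..T}" using j tm_pred[OF j(1)] tm_mem[of j] tm_mem[of "j - 1"] by auto
  have jn: "j - 1 \<le> n" using j by simp
  have "H1_norm N ?d \<le> K * (1 + (\<Sum>k\<in>UNIV. \<bar>A $ i $ k\<bar>)) * \<tau> ^ Suc qq"
  proof (rule H1.quadrature_defect[where L = qq and T = T])
    show "continuous_curve T (H1 N) (H1_norm N) (U j)" if "j \<le> Suc qq" for j using U_curve[of j] that by simp
    show "derivative_curve T (H1_norm N) (U j) (U (Suc j))" if "j \<le> qq" for j using U_deriv[of j] that by simp
    show "(\<Sum>k\<in>UNIV. A $ i $ k * c $ k ^ l) = c $ i ^ Suc l / real (Suc l)" if "l < qq" for l
      using stage_order that unfolding rk_stage_order_def by (auto dest!: bspec[of _ _ "Suc l"])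
  qed (use K \<tau>_pos t c01 in auto)
  moreover have "?d \<in> H1 N"
  proof -
    have "(%z. \<Sum>k\<in>UNIV. A $ i $ k * U 1 (?t + \<tau> * c $ k) z) \<in> H1 N"
      using st_mem[OF j] by (intro H1.sum_mem U1_mem) (auto simp: st_def)
    moreover have "U 0 (?t + \<tau> * c $ i) \<in> H1 N" using U_mem[of 0 "st j i"] st_mem[OF j] by (simp add: st_def)
    moreover have "U 0 ?t \<in> H1 N" using t by (intro U_mem) auto
    ultimately show ?thesis by (intro H1.diff_mem H1.add_mem H1.scale_mem)
  qed
  moreover have "stage_defect j i = (%z. (R (j - 1) z - p0 ?t z) + ?d z)"
    by (auto simp: stage_defect_def S_def U0 st_def)
  moreover have "(%z. R (j - 1) z - p0 ?t z) \<in> H1 N"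
    using j t by (intro H1.diff_mem R_mem p0_mem) auto
  ultimately have "H1_norm N (stage_defect j i) \<le> K * B * \<tau> ^ Suc qq + K * (1 + (\<Sum>k\<in>UNIV. \<bar>A $ i $ k\<bar>)) * \<tau> ^ Suc qq"
    using H1.nrm_triangle[of "%z. R (j - 1) z - p0 ?t z" N ?d] R_defect[OF jn] by simp
  also have "\<dots> = K * (B + 1 + (\<Sum>k\<in>UNIV. \<bar>A $ i $ k\<bar>)) * \<tau> ^ Suc qq" by (simp add: algebra_simps)
  also have "\<dots> \<le> Cs * \<tau> ^ Suc qq"
  proof -
    have "(\<Sum>k\<in>UNIV. \<bar>A $ i $ k\<bar>) \<le> (\<Sum>i\<in>UNIV. \<Sum>k\<in>UNIV. \<bar>A $ i $ k\<bar>)"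
      by (rule member_le_sum[where f = "%i. \<Sum>k\<in>UNIV. \<bar>A $ i $ k\<bar>"]) (auto intro: sum_nonneg)
    then show ?thesis unfolding Cs_def using K(1) \<tau>_pos by (intro mult_right_mono mult_left_mono) auto
  qed
  finally show ?thesis .
qed

section \<open>The discrete energy estimate\<close>

lemma b_sum: "(\<Sum>i\<in>UNIV. b $ i) = 1"
  using order qp unfolding rk_order_def by (auto dest!: bspec[of _ _ 1])

lemma b_nonneg: "0 \<le> b $ i"
  using stab by (simp add: algebraically_stable_def)

definition G where "G = a_hi + 1 / d_lo"

lemma G_nonneg: "0 \<le> G"
  using a_bounds d_bounds by (simp add: G_def)

text \<open>Algebraic stability bounds the growth in a step by the pairings of \<open>errD\<close>
  with \<open>errS\<close>, and \<open>stage_energy\<close> turns these into dissipation plus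
  defect. The defects are weighted with \<open>b\<close>, whose entries are nonnegative with sum
  one, so no Gronwall factor appears.\<close>

lemma discrete_energy:
  assumes "j \<le> n"
  shows "(L2_norm N (err j))^2 + (\<tau> / d_hi) * (\<Sum>l=1..j. \<Sum>i\<in>UNIV. b $ i * (L2_norm N (edge_deriv N (errS l i)))^2)
     \<le> real j * (\<tau> * G * (Cs * \<tau> ^ Suc qq)^2)"
  using assms
proof (induction j)
  case 0
  then show ?case by (simp add: err_0 L2.nrm_zero)
next
  case (Suc j)
  let ?j = "Suc j"
  have j: "1 \<le> ?j" "?j \<le> n" using Suc.prems by auto
  let ?X = "\<Sum>i\<in>UNIV. b $ i * (L2_norm N (edge_deriv N (errS ?j i)))^2"
  have "L2_inner N (err ?j) (err ?j) \<le> L2_inner N (err j) (err j) + 2 * \<tau> * (\<Sum>i\<in>UNIV. b $ i * L2_inner N (errD ?j i) (errS ?j i))"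
  proof -
    have "L2_inner N (%z. err j z + \<tau> * (\<Sum>k\<in>UNIV. b $ k * errD ?j k z)) (%z. err j z + \<tau> * (\<Sum>k\<in>UNIV. b $ k * errD ?j k z))
     \<le> L2_inner N (err j) (err j) + 2 * \<tau> * (\<Sum>i\<in>UNIV. b $ i * L2_inner N (errD ?j i) (%z. err j z + \<tau> * (\<Sum>k\<in>UNIV. A $ i $ k * errD ?j k z)))"
      using errD_V0[OF j] err_V0[of j] Suc.prems
      by (intro algebraic_stability_step[OF stab] H1_subset_L2 V0_H1) auto
    then show ?thesis using err_step[OF j] errS_eq[OF j] by simp
  qed
  also have "2 * \<tau> * (\<Sum>i\<in>UNIV. b $ i * L2_inner N (errD ?j i) (errS ?j i))
      = \<tau> * (\<Sum>i\<in>UNIV. b $ i * (2 * L2_inner N (errD ?j i) (errS ?j i)))"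
    by (simp add: sum_distrib_left mult_ac)
  also have "\<dots> \<le> \<tau> * (\<Sum>i\<in>UNIV. b $ i * (- (1 / d_hi) * (L2_norm N (edge_deriv N (errS ?j i)))^2 + G * (Cs * \<tau> ^ Suc qq)^2))"
  proof (intro mult_left_mono sum_mono b_nonneg)
    fix i
    have "G * (H1_norm N (stage_defect ?j i))^2 \<le> G * (Cs * \<tau> ^ Suc qq)^2"
      using stage_defect_bound[OF j, of i] H1_norm_ge_0 G_nonneg by (intro mult_left_mono power_mono) auto
    then show "2 * L2_inner N (errD ?j i) (errS ?j i)
        \<le> - (1 / d_hi) * (L2_norm N (edge_deriv N (errS ?j i)))^2 + G * (Cs * \<tau> ^ Suc qq)^2"
      using stage_energy[OF j, of i] by (simp add: G_def)
  qed (use \<tau>_pos in auto)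
  also have "\<dots> = - (\<tau> / d_hi) * ?X + \<tau> * G * (Cs * \<tau> ^ Suc qq)^2"
  proof -
    have "(\<Sum>i\<in>UNIV. b $ i * (- (1 / d_hi) * (L2_norm N (edge_deriv N (errS ?j i)))^2 + G * (Cs * \<tau> ^ Suc qq)^2))
        = - (1 / d_hi) * ?X + (\<Sum>i\<in>UNIV. b $ i) * (G * (Cs * \<tau> ^ Suc qq)^2)"
      unfolding sum_distrib_left sum_distrib_right sum.distrib[symmetric]
      by (intro sum.cong refl) (simp only: distrib_left mult_ac)
    then have "\<tau> * (\<Sum>i\<in>UNIV. b $ i * (- (1 / d_hi) * (L2_norm N (edge_deriv N (errS ?j i)))^2 + G * (Cs * \<tau> ^ Suc qq)^2))
        = \<tau> * (- (1 / d_hi) * ?X + G * (Cs * \<tau> ^ Suc qq)^2)"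
      unfolding b_sum by (simp only: mult_1)
    then show ?thesis by (simp only: distrib_left) simp
  qed
  finally have "(L2_norm N (err ?j))^2 \<le> (L2_norm N (err j))^2 - (\<tau> / d_hi) * ?X + \<tau> * G * (Cs * \<tau> ^ Suc qq)^2"
    unfolding L2_norm_power2 by simp
  moreover have "(L2_norm N (err j))^2 + (\<tau> / d_hi) * (\<Sum>l=1..j. \<Sum>i\<in>UNIV. b $ i * (L2_norm N (edge_deriv N (errS l i)))^2)
     \<le> real j * (\<tau> * G * (Cs * \<tau> ^ Suc qq)^2)"
    using Suc by simp
  moreover have "(\<Sum>l=1..?j. \<Sum>i\<in>UNIV. b $ i * (L2_norm N (edge_deriv N (errS l i)))^2)
      = (\<Sum>l=1..j. \<Sum>i\<in>UNIV. b $ i * (L2_norm N (edge_deriv N (errS l i)))^2) + ?X" by simp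
  moreover have "real ?j * (\<tau> * G * (Cs * \<tau> ^ Suc qq)^2)
      = real j * (\<tau> * G * (Cs * \<tau> ^ Suc qq)^2) + \<tau> * G * (Cs * \<tau> ^ Suc qq)^2"
    by (simp add: distrib_right)
  ultimately show ?case by (simp only: distrib_left)
qed

definition Ce where "Ce = T * G * Cs^2"
text \<open>Constant of the weighted Cauchy-Schwarz inequality. For \<open>b $ i = 0\<close> the
  quotient is zero by the convention for division, in accordance with \<open>w i = 0\<close> at such
  stages.\<close>

definition Cw where "Cw = (\<Sum>i\<in>UNIV. (w i)^2 / b $ i)"

lemma Ce_nonneg: "0 \<le> Ce"
  using T_pos G_nonneg by (simp add: Ce_def)

lemma Cw_nonneg: "0 \<le> Cw"
  unfolding Cw_def by (intro sum_nonneg divide_nonneg_nonneg b_nonneg) simp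

lemma energy_total:
  assumes "j \<le> n"
  shows "real j * (\<tau> * G * (Cs * \<tau> ^ Suc qq)^2) \<le> Ce * (\<tau> ^ Suc qq)^2"
proof -
  have "real j * (\<tau> * G * (Cs * \<tau> ^ Suc qq)^2) = tm j * (G * Cs^2 * (\<tau> ^ Suc qq)^2)"
    by (simp add: tm_def power_mult_distrib mult_ac)
  also have "\<dots> \<le> T * (G * Cs^2 * (\<tau> ^ Suc qq)^2)"
    using tm_mem[OF assms] G_nonneg by (intro mult_right_mono) auto
  finally show ?thesis by (simp add: Ce_def mult_ac)
qed

lemma err_L2_bound:
  assumes "j \<le> n"
  shows "(L2_norm N (err j))^2 \<le> Ce * (\<tau> ^ Suc qq)^2"
proof -
  have "0 \<le> (\<tau> / d_hi) * (\<Sum>l=1..j. \<Sum>i\<in>UNIV. b $ i * (L2_norm N (edge_deriv N (errS l i)))^2)"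
    using \<tau>_pos d_bounds b_nonneg by (intro mult_nonneg_nonneg sum_nonneg divide_nonneg_nonneg) auto
  then show ?thesis using discrete_energy[OF assms] energy_total[OF assms] by linarith
qed

text \<open>The dissipation controls the derivatives at the stages only with the weights
  \<open>b\<close>, while the nodal value combines the stages with the weights \<open>w\<close>. By
  \<open>rk_weights_zero\<close>, stages without control do not enter this combination.\<close>

lemma err_deriv_le:
  assumes j: "1 \<le> j" "j \<le> n"
  shows "(L2_norm N (edge_deriv N (err j)))^2 \<le> Cw * (\<Sum>i\<in>UNIV. b $ i * (L2_norm N (edge_deriv N (errS j i)))^2)"
proof -
  have H: "errS j i \<in> H1 N" for i by (rule V0_H1[OF errS_V0[OF j]])
  have eH: "err j \<in> H1 N" by (rule V0_H1[OF err_V0[OF j(2)]])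
  let ?x = "%i. L2_norm N (edge_deriv N (errS j i))"
  let ?de = "edge_deriv N (err j)"
  have de: "?de \<in> L2 N" by (rule edge_deriv_mem_L2[OF eH])
  have "(L2_norm N ?de)^2 = (\<Sum>i\<in>UNIV. w i * L2_inner N (edge_deriv N (errS j i)) ?de)"
    unfolding L2_norm_power2 using op_K_sum[of UNIV "errS j" N ?de w] H de err_weights[OF j] by simp
  also have "\<dots> \<le> (\<Sum>i\<in>UNIV. \<bar>w i\<bar> * (?x i * L2_norm N ?de))"
  proof (rule sum_mono)
    fix i
    have "w i * L2_inner N (edge_deriv N (errS j i)) ?de \<le> \<bar>w i\<bar> * \<bar>L2_inner N (edge_deriv N (errS j i)) ?de\<bar>"
      by (metis abs_ge_self abs_mult)
    also have "\<dots> \<le> \<bar>w i\<bar> * (?x i * L2_norm N ?de)"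
      by (intro mult_left_mono L2.cauchy_schwarz edge_deriv_mem_L2 H eH) auto
    finally show "w i * L2_inner N (edge_deriv N (errS j i)) ?de \<le> \<bar>w i\<bar> * (?x i * L2_norm N ?de)" .
  qed
  also have "\<dots> = L2_norm N ?de * (\<Sum>i\<in>UNIV. \<bar>w i\<bar> * ?x i)"
    by (simp add: sum_distrib_left mult_ac)
  finally have "L2_norm N ?de * L2_norm N ?de \<le> L2_norm N ?de * (\<Sum>i\<in>UNIV. \<bar>w i\<bar> * ?x i)"
    by (simp add: power2_eq_square)
  then have "L2_norm N ?de \<le> (\<Sum>i\<in>UNIV. \<bar>w i\<bar> * ?x i)"
    using L2_norm_ge_0[of N ?de] by (cases "L2_norm N ?de = 0") (auto intro!: sum_nonneg simp: L2_norm_ge_0)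
  also have "(\<Sum>i\<in>UNIV. \<bar>w i\<bar> * ?x i) = (\<Sum>i\<in>UNIV. (\<bar>w i\<bar> / sqrt (b $ i)) * (sqrt (b $ i) * ?x i))"
  proof (intro sum.cong refl)
    fix i
    show "\<bar>w i\<bar> * ?x i = (\<bar>w i\<bar> / sqrt (b $ i)) * (sqrt (b $ i) * ?x i)"
      using rk_weights_zero[OF stab inv, of i] by (cases "b $ i = 0") (auto simp: w_def)
  qed
  finally have "(L2_norm N ?de)^2 \<le> (\<Sum>i\<in>UNIV. (\<bar>w i\<bar> / sqrt (b $ i)) * (sqrt (b $ i) * ?x i))^2"
    by (rule power_mono) (rule L2_norm_ge_0)
  also have "\<dots> \<le> (\<Sum>i\<in>UNIV. (\<bar>w i\<bar> / sqrt (b $ i))^2) * (\<Sum>i\<in>UNIV. (sqrt (b $ i) * ?x i)^2)"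
    by (rule Cauchy_Schwarz_ineq_sum)
  also have "\<dots> = Cw * (\<Sum>i\<in>UNIV. b $ i * (?x i)^2)"
    using b_nonneg by (simp add: Cw_def power_divide power_mult_distrib)
  finally show ?thesis .
qed

lemma err_deriv_sum:
  "\<tau> * (\<Sum>j=1..n. (L2_norm N (edge_deriv N (err j)))^2) \<le> Cw * d_hi * Ce * (\<tau> ^ Suc qq)^2"
proof -
  let ?X = "\<Sum>l=1..n. \<Sum>i\<in>UNIV. b $ i * (L2_norm N (edge_deriv N (errS l i)))^2"
  have "(\<tau> / d_hi) * ?X \<le> Ce * (\<tau> ^ Suc qq)^2"
    using discrete_energy[of n] energy_total[of n] zero_le_power2[of "L2_norm N (err n)"] by linarith
  then have X: "\<tau> * ?X \<le> d_hi * (Ce * (\<tau> ^ Suc qq)^2)" using d_bounds by (simp add: field_simps)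
  have "(\<Sum>j=1..n. (L2_norm N (edge_deriv N (err j)))^2) \<le> (\<Sum>j=1..n. Cw * (\<Sum>i\<in>UNIV. b $ i * (L2_norm N (edge_deriv N (errS j i)))^2))"
    by (intro sum_mono err_deriv_le) auto
  then have "(\<Sum>j=1..n. (L2_norm N (edge_deriv N (err j)))^2) \<le> Cw * ?X" by (simp only: sum_distrib_left)
  then have "\<tau> * (\<Sum>j=1..n. (L2_norm N (edge_deriv N (err j)))^2) \<le> \<tau> * (Cw * ?X)"
    using \<tau>_pos by (intro mult_left_mono) auto
  also have "\<dots> = Cw * (\<tau> * ?X)" by simp
  also have "\<dots> \<le> Cw * (d_hi * (Ce * (\<tau> ^ Suc qq)^2))"
    by (intro mult_left_mono X Cw_nonneg)
  finally show ?thesis by (simp add: mult_ac)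
qed

section \<open>Nodal errors of both variables\<close>

definition perr :: "nat \<Rightarrow> 'e edge_fun" where "perr j = (%z. p0 (tm j) z - P j z)"

lemma perr_mem: "j \<le> n ==> perr j \<in> H1 N"
  unfolding perr_def by (intro H1.diff_mem p0_mem tm_mem P_mem)

definition Cp where "Cp = 2 * Ce + 2 * (K * B)^2"

lemma perr_split:
  assumes j: "j \<le> n"
  shows "L2_norm N (perr j) \<le> L2_norm N (err j) + K * B * \<tau> ^ Suc qq"
    "H1_norm N (perr j) \<le> H1_norm N (err j) + K * B * \<tau> ^ Suc qq"
proof -
  let ?r = "%z. R j z - p0 (tm j) z"
  have m: "err j \<in> H1 N" "?r \<in> H1 N"
    using j by (auto intro: V0_H1[OF err_V0] H1.diff_mem R_mem p0_mem tm_mem)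
  have eq: "perr j = (%z. (-1) * (err j z + ?r z))" by (auto simp: perr_def err_def)
  have "H1_norm N (perr j) = H1_norm N (%z. err j z + ?r z)"
    unfolding eq using H1.nrm_scale[OF H1.add_mem[OF m], of "-1"] by simp
  then show "H1_norm N (perr j) \<le> H1_norm N (err j) + K * B * \<tau> ^ Suc qq"
    using H1.nrm_triangle[OF m] R_defect[OF j] by simp
  note mL = m[THEN H1_subset_L2]
  have "L2_norm N (perr j) = L2_norm N (%z. err j z + ?r z)"
    unfolding eq using L2.nrm_scale[OF L2.add_mem[OF mL], of "-1"] by simp
  then show "L2_norm N (perr j) \<le> L2_norm N (err j) + K * B * \<tau> ^ Suc qq"
    using L2.nrm_triangle[OF mL] R_defect[OF j] L2_norm_le_H1_norm[of N ?r] by simp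
qed

lemma perr_L2_bound:
  assumes j: "j \<le> n"
  shows "(L2_norm N (perr j))^2 \<le> Cp * (\<tau> ^ Suc qq)^2"
  using square_sum_le[OF perr_split(1)[OF j] L2_norm_ge_0] err_L2_bound[OF j]
  by (simp add: Cp_def power_mult_distrib distrib_right del: power_Suc)

definition Ch where "Ch = 2 * T * (2 * Ce + 2 * (K * B)^2) + 2 * Cw * d_hi * Ce"

lemma Ch_nonneg: "0 \<le> Ch"
  unfolding Ch_def using Ce_nonneg Cw_nonneg T_pos d_bounds by (intro add_nonneg_nonneg mult_nonneg_nonneg) auto

text \<open>The derivatives are estimated in the discrete \<open>L2\<close> norm in time, the form
  in which the dissipation controls them; the \<open>L2\<close> part and the reference error are
  bounded uniformly in the node.\<close>

lemma perr_H1_sum: "\<tau> * (\<Sum>j\<le>n. (H1_norm N (perr j))^2) \<le> Ch * (\<tau> ^ Suc qq)^2"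
proof -
  let ?s = "(\<tau> ^ Suc qq)^2"
  have "(H1_norm N (perr j))^2 \<le> (2 * Ce + 2 * (K * B)^2) * ?s + 2 * (L2_norm N (edge_deriv N (err j)))^2" if j: "j \<le> n" for j
    using square_sum_le[OF perr_split(2)[OF j] H1_norm_ge_0] err_L2_bound[OF j]
    by (simp add: H1_norm_power2 power_mult_distrib distrib_right del: power_Suc)
  then have "(\<Sum>j\<le>n. (H1_norm N (perr j))^2)
      \<le> (\<Sum>j\<le>n. (2 * Ce + 2 * (K * B)^2) * ?s + 2 * (L2_norm N (edge_deriv N (err j)))^2)"
    by (intro sum_mono) auto
  also have "\<dots> = real (Suc n) * ((2 * Ce + 2 * (K * B)^2) * ?s) + 2 * (\<Sum>j\<le>n. (L2_norm N (edge_deriv N (err j)))^2)"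
    by (simp add: sum.distrib sum_distrib_left del: power_Suc of_nat_Suc)
  \<comment> \<open>The error at node \<open>0\<close> is the zero function; of its chosen
    derivative, the norm vanishes.\<close>
  also have "(\<Sum>j\<le>n. (L2_norm N (edge_deriv N (err j)))^2) = (\<Sum>j=1..n. (L2_norm N (edge_deriv N (err j)))^2)"
  proof -
    have "ae_eq N (%z. 0) (%z. 0)" by (simp add: ae_eq_def)
    then have "H1_norm N (%z. 0) = 0" by (intro H1_norm_zero_if_ae_zero[OF wf H1.zero_mem])
    then have "L2_norm N (edge_deriv N (err 0)) = 0"
      using L2_norm_edge_deriv_le_H1_norm[of N "%z. 0"] L2_norm_ge_0[of N "edge_deriv N (%z. 0)"] by (simp add: err_0)
    then show ?thesis
      by (simp add: atMost_atLeast0 sum.atLeast_Suc_atMost)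
  qed
  finally have "\<tau> * (\<Sum>j\<le>n. (H1_norm N (perr j))^2) \<le> \<tau> * (real (Suc n) * ((2 * Ce + 2 * (K * B)^2) * ?s)
      + 2 * (\<Sum>j=1..n. (L2_norm N (edge_deriv N (err j)))^2))"
    using \<tau>_pos by (intro mult_left_mono) auto
  also have "\<dots> = (\<tau> * real (Suc n)) * ((2 * Ce + 2 * (K * B)^2) * ?s) + 2 * (\<tau> * (\<Sum>j=1..n. (L2_norm N (edge_deriv N (err j)))^2))"
    by (simp only: distrib_left mult_ac)
  also have "\<dots> \<le> (2 * T) * ((2 * Ce + 2 * (K * B)^2) * ?s) + 2 * (Cw * d_hi * Ce * ?s)"
  proof (intro add_mono mult_right_mono mult_left_mono err_deriv_sum)
    \<comment> \<open>There are \<open>n + 1\<close> nodes for \<open>n\<close> steps, hence the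
      factor two.\<close>
    have "\<tau> * real (Suc n) \<le> \<tau> * (2 * real n)" using n1 \<tau>_pos by (intro mult_left_mono) auto
    then show "\<tau> * real (Suc n) \<le> 2 * T" using n_\<tau> by (simp add: mult_ac)
    show "0 \<le> (2 * Ce + 2 * (K * B)^2) * ?s" using Ce_nonneg by simp
  qed simp
  also have "\<dots> = Ch * ?s" unfolding Ch_def by (simp only: distrib_right mult.assoc mult.left_commute[of 2])
  finally show ?thesis .
qed

definition qerr :: "nat \<Rightarrow> 'e edge_fun" where "qerr j = (%z. M 0 (tm j) z - Q j z)"

lemma qerr_mem: "j \<le> n ==> qerr j \<in> L2 N"
  unfolding qerr_def by (intro L2.diff_mem M_mem tm_mem Q_mem) auto

definition Cf where "Cf = K * (1 + (\<Sum>i\<in>UNIV. \<bar>w i\<bar>))"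

text \<open>The stage equations for \<open>Qs\<close> are algebraic, so combining them with the
  weights \<open>w\<close> expresses \<open>d\<close> times \<open>Q j\<close> by \<open>P j\<close>
  and a combination of the sources. By exactness of \<open>w\<close> that combination differs from
  \<open>f\<close> at \<open>tm j\<close> by a term of order \<open>Suc qq\<close>; the other
  contribution is the derivative of \<open>perr j\<close>. The lower bound of \<open>d\<close>
  finishes the estimate. Node \<open>0\<close> is separate, with the prescribed initial
  value.\<close>

lemma qerr_bound:
  assumes j: "j \<le> n"
  shows "L2_norm N (qerr j) \<le> (Cf * \<tau> ^ Suc qq + H1_norm N (perr j)) / d_lo"
proof (cases "j = 0")
  case True
  have T0: "0 \<in> {0..T}" using T_pos by simp
  have m: "m_init D \<in> L2 N" "m0 0 \<in> L2 N" "M 0 0 \<in> L2 N"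
    using m_init L2.cont_curve_mem[OF m0_curve T0] M_mem[of 0 0] T0 by auto
  have "L2_norm N (%z. m_init D z - M 0 0 z) = L2_norm N (%z. m0 0 z - M 0 0 z)"
  proof (intro L2_norm_cong_ae L2.diff_mem m)
    have "ae_eq N (M 0 0) (M 0 0)" by (simp add: ae_eq_def)
    then show "ae_eq N (%z. m_init D z - M 0 0 z) (%z. m0 0 z - M 0 0 z)" by (rule ae_eq_diff[OF m_init(2)])
  qed
  then have "L2_norm N (qerr 0) = 0"
    using m0_eq_M[OF T0] L2.nrm_diff_commute[OF m(1,3)] by (simp add: qerr_def tm_def Q_0)
  moreover have "0 \<le> Cf" unfolding Cf_def using K(1) by (intro mult_nonneg_nonneg add_nonneg_nonneg sum_nonneg) auto
  ultimately show ?thesis using True H1_norm_ge_0[of N "perr 0"] \<tau>_pos d_bounds by simp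
next
  case False
  then have j1: "1 \<le> j" by simp
  note t = tm_mem[OF j]
  let ?x = "qerr j"
  have x: "?x \<in> L2 N" by (rule qerr_mem[OF j])
  have f_mem: "rhs_f D s \<in> L2 N" if "s \<in> {0..T}" for s by (rule L2.cont_curve_mem[OF f_curve that])
  define \<phi> where "\<phi> = (%z. (\<Sum>i\<in>UNIV. w i * F 0 (st j i) z) - F 0 (tm j) z)"
  \<comment> \<open>The Taylor expansion is taken about the left end of the step, from which
    \<open>tm j\<close> and all stage times have distance at most \<open>\<tau>\<close>.\<close>
  have \<phi>: "L2_norm N \<phi> \<le> Cf * \<tau> ^ Suc qq"
    unfolding \<phi>_def Cf_def
  proof (rule L2.weighted_values_defect[where L = "Suc qq" and T = T and t = "tm (j - 1)"])
    show "L2_curve T (F l)" if "l \<le> Suc qq" for l using F_curve[of l] that by simp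
    show "derivative_curve T (L2_norm N) (F l) (F (Suc l))" if "l < Suc qq" for l using F_deriv[of l] that by simp
    show "\<bar>tm j - tm (j - 1)\<bar> \<le> \<tau>" using tm_pred[OF j1] \<tau>_pos by linarith
    show "\<bar>st j k - tm (j - 1)\<bar> \<le> \<tau>" for k
      using c01[of k] \<tau>_pos by (simp add: st_def abs_mult mult_left_le)
    show "(\<Sum>k\<in>UNIV. w k * (st j k - tm (j - 1)) ^ l) = (tm j - tm (j - 1)) ^ l" if l: "l < Suc qq" for l
    proof -
      have d: "tm j - tm (j - 1) = \<tau>" using tm_pred[OF j1] by linarith
      have "(\<Sum>k\<in>UNIV. w k * (st j k - tm (j - 1)) ^ l) = \<tau> ^ l * (\<Sum>k\<in>UNIV. w k * c $ k ^ l)"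
        by (simp add: st_def power_mult_distrib sum_distrib_left mult_ac)
      also have "(\<Sum>k\<in>UNIV. w k * c $ k ^ l) = 1"
        unfolding w_def using l qp by (intro rk_weights_exact[OF order stage_order _ inv bA]) auto
      finally show ?thesis unfolding d by (simp only: mult_1_right)
    qed
  qed (use K t tm_mem[of "j - 1"] st_mem[OF j1 j] j in auto)
  have \<phi>m: "\<phi> \<in> L2 N"
    unfolding \<phi>_def using st_mem[OF j1 j] t by (intro L2.diff_mem L2.sum_mem F_mem) auto
  have dm: "(%z. coef_d D z * M 0 (tm j) z) \<in> L2 N" "(%z. coef_d D z * Q j z) \<in> L2 N"
    using t by (auto intro!: mult_mem_L2[OF d_bounds(1)] M_mem Q_mem j)
  have dQ: "L2_inner N (%z. coef_d D z * Q j z) ?x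
      = (\<Sum>i\<in>UNIV. w i * L2_inner N (rhs_f D (st j i)) ?x) - L2_inner N (edge_deriv N (P j)) ?x"
  proof -
    have "L2_inner N (%z. coef_d D z * Q j z) ?x = L2_inner N (%z. \<Sum>i\<in>UNIV. w i * (coef_d D z * Qs j i z)) ?x"
      using rkD(7)[OF j1 j] by (simp add: sum_distrib_left mult_ac)
    also have "\<dots> = (\<Sum>i\<in>UNIV. w i * L2_inner N (%z. coef_d D z * Qs j i z) ?x)"
      by (intro L2.ip_sum_left mult_mem_L2[OF d_bounds(1)] rkD(2)[OF j1 j] x)
    also have "\<dots> = (\<Sum>i\<in>UNIV. w i * (L2_inner N (rhs_f D (st j i)) ?x - L2_inner N (edge_deriv N (Ps j i)) ?x))"
    proof (intro sum.cong refl arg_cong2[of _ _ _ _ "(*)"])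
      fix i
      show "L2_inner N (%z. coef_d D z * Qs j i z) ?x = L2_inner N (rhs_f D (st j i)) ?x - L2_inner N (edge_deriv N (Ps j i)) ?x"
        using rkD(4)[OF j1 j x, of i] by (simp add: op_K_def)
    qed
    also have "\<dots> = (\<Sum>i\<in>UNIV. w i * L2_inner N (rhs_f D (st j i)) ?x) - (\<Sum>i\<in>UNIV. w i * L2_inner N (edge_deriv N (Ps j i)) ?x)"
      by (simp only: right_diff_distrib sum_subtractf)
    also have "(\<Sum>i\<in>UNIV. w i * L2_inner N (edge_deriv N (Ps j i)) ?x) = L2_inner N (edge_deriv N (P j)) ?x"
      unfolding rkD(6)[OF j1 j] by (intro op_K_sum[symmetric] rkD(1)[OF j1 j] x)
    finally show ?thesis .
  qed
  have "L2_inner N (%z. coef_d D z * ?x z) ?x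
      = L2_inner N (%z. coef_d D z * M 0 (tm j) z) ?x - L2_inner N (%z. coef_d D z * Q j z) ?x"
    using L2.ip_diff_left[OF dm x] by (simp add: qerr_def right_diff_distrib)
  also have "\<dots> = - L2_inner N \<phi> ?x - L2_inner N (edge_deriv N (perr j)) ?x"
  proof -
    have "L2_inner N \<phi> ?x = (\<Sum>i\<in>UNIV. w i * L2_inner N (rhs_f D (st j i)) ?x) - L2_inner N (rhs_f D (tm j)) ?x"
      unfolding \<phi>_def F0 using f_mem st_mem[OF j1 j] t x
      by (subst L2.ip_diff_left) (auto intro!: L2.sum_mem L2.ip_sum_left)
    moreover have "L2_inner N (edge_deriv N (perr j)) ?x = L2_inner N (edge_deriv N (p0 (tm j))) ?x - L2_inner N (edge_deriv N (P j)) ?x"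
      unfolding perr_def by (intro op_K_diff p0_mem t P_mem j x)
    ultimately show ?thesis using M_0_equation[OF t x] dQ by linarith
  qed
  also have "\<dots> \<le> L2_norm N \<phi> * L2_norm N ?x + L2_norm N (edge_deriv N (perr j)) * L2_norm N ?x"
    using abs_le_D2[OF L2.cauchy_schwarz[OF \<phi>m x]] abs_le_D2[OF L2.cauchy_schwarz[OF edge_deriv_mem_L2[OF perr_mem[OF j]] x]] by linarith
  also have "\<dots> \<le> (Cf * \<tau> ^ Suc qq + H1_norm N (perr j)) * L2_norm N ?x"
    unfolding distrib_right[symmetric] using \<phi> L2_norm_edge_deriv_le_H1_norm[of N "perr j"] L2_norm_ge_0[of N ?x]
    by (intro mult_right_mono add_mono)
  finally have "d_lo * (L2_norm N ?x)^2 \<le> (Cf * \<tau> ^ Suc qq + H1_norm N (perr j)) * L2_norm N ?x"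
    using L2_inner_mult_bounds(1)[OF d_bounds(1) x] unfolding L2_norm_power2 by linarith
  then have le: "(d_lo * L2_norm N ?x) * L2_norm N ?x \<le> (Cf * \<tau> ^ Suc qq + H1_norm N (perr j)) * L2_norm N ?x"
    by (simp add: power2_eq_square mult.assoc)
  show ?thesis
  proof (cases "L2_norm N ?x = 0")
    case True
    have "0 \<le> L2_norm N \<phi>" by (rule L2_norm_ge_0)
    then show ?thesis using True \<phi> H1_norm_ge_0[of N "perr j"] d_bounds by simp
  next
    case False
    then have "0 < L2_norm N ?x" using L2_norm_ge_0[of N ?x] by linarith
    with le have "d_lo * L2_norm N ?x \<le> Cf * \<tau> ^ Suc qq + H1_norm N (perr j)" by (rule mult_right_le_imp_le)
    then show ?thesis using d_bounds by (simp add: pos_le_divide_eq mult.commute)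
  qed
qed

end

section \<open>Interpolation errors of curves\<close>

lemma measurable_time_index:
  assumes "0 < T" "1 \<le> n"
  shows "time_index T n \<in> measurable (lebesgue_on {0..T}) (count_space {1..n})"
proof -
  have "(%t. max 1 (nat \<lceil>t / (T / real n)\<rceil>)) \<in> measurable borel (count_space UNIV)" by measurable
  moreover have "time_index T n = (%t. max 1 (nat \<lceil>t / (T / real n)\<rceil>))"
    by (rule ext) (rule time_index_def[OF assms le0])
  ultimately have "time_index T n \<in> measurable (lebesgue_on {0..T}) (count_space UNIV)"
    by (simp only:) (intro measurable_restrict_space1 measurable_completion, simp)
  then have "time_index T n -` {a} \<inter> space (lebesgue_on {0..T}) \<in> sets (lebesgue_on {0..T})" for a
    by (rule measurable_sets) simp
  then show ?thesis
    unfolding measurable_count_space_eq2[OF finite_atLeastAtMost] using time_index(1,2)[OF assms le0] by auto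
qed

context semi_inner
begin

context
  fixes T :: real and n \<nu> :: nat and V :: "nat \<Rightarrow> real \<Rightarrow> 'i \<Rightarrow> real" and Y :: "nat \<Rightarrow> 'i \<Rightarrow> real" and K :: real
  assumes T: "0 < T" and n: "1 \<le> n" and \<nu>: "\<nu> \<le> n"
    and V: "\<And>j. j \<le> Suc \<nu> ==> cont_curve T (V j)"
    and V': "\<And>j. j < Suc \<nu> ==> derivative_curve T nrm (V j) (V (Suc j))"
    and K: "0 \<le> K" "\<And>t. t \<in> {0..T} ==> nrm (V (Suc \<nu>) t) \<le> K"
    and Y: "\<And>k. k \<le> n ==> Y k \<in> X"
begin

abbreviation (input) "\<delta> \<equiv> T / real n"
abbreviation (input) "\<Lambda> \<equiv> real (\<nu> + 1) ^ \<nu>"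
abbreviation (input) "node_error k \<equiv> nrm (%i. V 0 (real k * \<delta>) i - Y k i)"
abbreviation (input) "\<kappa> \<equiv> K * (1 + real (\<nu> + 1) * \<Lambda>) * real (\<nu> + 1) ^ Suc \<nu> * \<delta> ^ Suc \<nu>"

lemma node_mem:
  assumes "k \<le> n"
  shows "real k * \<delta> \<in> {0..T}" "(%i. V 0 (real k * \<delta>) i - Y k i) \<in> X"
proof -
  have "real k * \<delta> \<le> real n * \<delta>" using assms T by (intro mult_right_mono) auto
  then show t: "real k * \<delta> \<in> {0..T}" using T n by simp
  show "(%i. V 0 (real k * \<delta>) i - Y k i) \<in> X"
    by (intro diff_mem Y assms cont_curve_mem[OF V t]) simp
qed

lemma interpolant_mem:
  assumes t: "t \<in> {0..T}"
  shows "interpolant T n \<nu> Y t \<in> X"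
  unfolding interpolant_eq[OF T n \<nu>] using window_subset[OF T n \<nu> t] by (intro sum_mem Y) auto

text \<open>The interpolant of the exact nodal values is inserted. Expansion about \<open>t\<close>
  itself gives \<open>\<kappa>\<close> for the exact values, and each nodal error is amplified by at
  most \<open>\<Lambda>\<close>.\<close>

lemma interpolation_error:
  assumes t: "t \<in> {0..T}"
  shows "nrm (%i. V 0 t i - interpolant T n \<nu> Y t i) \<le> \<kappa> + \<Lambda> * (\<Sum>k\<in>window T n \<nu> t. node_error k)"
proof -
  let ?W = "window T n \<nu> t" and ?l = "lagrange T n \<nu> t"
  let ?v = "%i. \<Sum>k\<in>?W. ?l k * V 0 (real k * \<delta>) i"
  let ?e = "%i. \<Sum>k\<in>?W. ?l k * (V 0 (real k * \<delta>) i - Y k i)"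
  have W: "finite ?W" "card ?W = \<nu> + 1" by (auto simp: window_def[OF T n \<nu>])
  have Wn: "k \<le> n" if "k \<in> ?W" for k using window_subset[OF T n \<nu> t] that by auto
  have V0: "V 0 s \<in> X" if "s \<in> {0..T}" for s using cont_curve_mem[OF V that] by simp
  have vm: "?v \<in> X" using node_mem(1)[OF Wn] by (intro sum_mem V0)
  have em: "?e \<in> X" using node_mem(2)[OF Wn] by (intro sum_mem)
  have sum_l: "(\<Sum>k\<in>?W. \<bar>?l k\<bar>) \<le> real (\<nu> + 1) * \<Lambda>"
    using sum_bounded_above[of ?W "%k. \<bar>?l k\<bar>" \<Lambda>] lagrange_bound[OF T n \<nu> t] W by simp
  have "nrm (%i. ?v i - V 0 t i) \<le> K * (1 + (\<Sum>k\<in>?W. \<bar>?l k\<bar>)) * (real (\<nu> + 1) * \<delta>) ^ Suc \<nu>"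
  proof (rule weighted_values_defect[where T = T and t = t])
    show "(\<Sum>k\<in>?W. ?l k * (real k * \<delta> - t) ^ l) = (t - t) ^ l" if "l < Suc \<nu>" for l
      by (rule lagrange_window_exact[OF T n \<nu> that])
    show "\<bar>real k * \<delta> - t\<bar> \<le> real (\<nu> + 1) * \<delta>" if "k \<in> ?W" for k
      using window_distance[OF T n \<nu> t that] by (simp only: abs_minus_commute)
    show "\<bar>t - t\<bar> \<le> real (\<nu> + 1) * \<delta>" using T by simp
    show "real k * \<delta> \<in> {0..T}" if "k \<in> ?W" for k by (rule node_mem(1)[OF Wn[OF that]])
  qed (use W V V' K t in auto)
  also have "\<dots> \<le> K * (1 + real (\<nu> + 1) * \<Lambda>) * (real (\<nu> + 1) * \<delta>) ^ Suc \<nu>"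
    using K(1) T sum_l by (intro mult_right_mono mult_left_mono) auto
  also have "\<dots> = \<kappa>" unfolding power_mult_distrib by (simp only: mult.assoc)
  finally have v: "nrm (%i. V 0 t i - ?v i) \<le> \<kappa>"
    unfolding nrm_diff_commute[OF V0[OF t] vm] .
  have "nrm ?e \<le> (\<Sum>k\<in>?W. \<bar>?l k\<bar> * node_error k)"
    using W node_mem(2)[OF Wn] by (intro nrm_sum_le)
  also have "\<dots> \<le> (\<Sum>k\<in>?W. \<Lambda> * node_error k)"
    using lagrange_bound[OF T n \<nu> t] node_mem(2)[OF Wn] by (intro sum_mono mult_right_mono nrm_nonneg)
  finally have e: "nrm ?e \<le> \<Lambda> * (\<Sum>k\<in>?W. node_error k)" by (simp only: sum_distrib_left)
  have "(%i. V 0 t i - interpolant T n \<nu> Y t i) = (%i. (V 0 t i - ?v i) + ?e i)"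
    unfolding interpolant_eq[OF T n \<nu>] by (simp add: right_diff_distrib sum_subtractf)
  then have "nrm (%i. V 0 t i - interpolant T n \<nu> Y t i) = nrm (%i. (V 0 t i - ?v i) + ?e i)" by (simp only:)
  also have "\<dots> \<le> nrm (%i. V 0 t i - ?v i) + nrm ?e"
    by (intro nrm_triangle diff_mem V0 t vm em)
  finally show ?thesis using v e by linarith
qed

lemma interpolation_error_power2:
  assumes t: "t \<in> {0..T}"
  shows "(nrm (%i. V 0 t i - interpolant T n \<nu> Y t i))^2
     \<le> 2 * \<kappa>^2 + 2 * (real (\<nu> + 1) * \<Lambda>^2) * (\<Sum>k\<in>window T n \<nu> t. (node_error k)^2)"
proof -
  let ?W = "window T n \<nu> t"
  have W: "card ?W = \<nu> + 1" by (auto simp: window_def[OF T n \<nu>])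
  have "(nrm (%i. V 0 t i - interpolant T n \<nu> Y t i))^2 \<le> 2 * \<kappa>^2 + 2 * (\<Lambda> * (\<Sum>k\<in>?W. node_error k))^2"
    using cont_curve_mem[OF V[OF le0] t]
    by (intro square_sum_le interpolation_error[OF t] nrm_nonneg diff_mem interpolant_mem[OF t])
  also have "(\<Lambda> * (\<Sum>k\<in>?W. node_error k))^2 \<le> \<Lambda>^2 * ((\<Sum>k\<in>?W. (node_error k)^2) * real (card ?W))"
    unfolding power_mult_distrib by (intro mult_left_mono sum_squared_le_sum_of_squares zero_le_power2)
  finally show ?thesis unfolding W by (simp only: mult_ac)
qed

text \<open>As a function of time the window sum is constant on each step. The majorant
  \<open>f\<close> adds indicators of the closed steps, which overlap in nodes only, so that
  integrability and the integral are computed termwise.\<close>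

lemma integral_window_le:
  fixes y :: "nat \<Rightarrow> real"
  assumes y: "\<And>k. 0 \<le> y k"
  obtains f where "integrable (lebesgue_on {0..T}) f"
    "\<And>t. t \<in> {0..T} ==> (\<Sum>k\<in>window T n \<nu> t. y k) \<le> f t"
    "(LINT t|lebesgue_on {0..T}. f t) \<le> real (2 * \<nu> + 3) * (\<delta> * (\<Sum>k\<le>n. y k))"
proof -
  let ?I = "%j. {interp_start \<nu> n j..interp_start \<nu> n j + \<nu>}" and ?c = "%j. {real (j - 1) * \<delta>..real j * \<delta>}"
  let ?f = "%t. \<Sum>j=1..n. (\<Sum>k\<in>?I j. y k) * indicator (?c j) t"
  have \<delta>: "0 < \<delta>" using T n by simp
  have c: "?c j \<subseteq> {0..T}" if "j \<in> {1..n}" for j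
    using node_mem(1)[of j] node_mem(1)[of "j - 1"] that by auto
  have cs: "?c j \<inter> {0..T} = ?c j" if "j \<in> {1..n}" for j using c[OF that] by blast
  have c_sets: "?c j \<in> sets (lebesgue_on {0..T})" if "j \<in> {1..n}" for j
    using c[OF that] by (intro sets_restrict_space_iff[THEN iffD2]) auto
  have c_meas: "measure (lebesgue_on {0..T}) (?c j) = \<delta>" if "j \<in> {1..n}" for j
  proof -
    have eq: "real (j - 1) * \<delta> = real j * \<delta> - \<delta>"
    proof -
      have "real (j - 1) = real j - 1" using that by (auto simp: of_nat_diff)
      then show ?thesis by (simp only: left_diff_distrib mult_1)
    qed
    have "measure (lebesgue_on {0..T}) (?c j) = measure lebesgue (?c j)"
      using c[OF that] by (intro measure_restrict_space) auto
    also have "\<dots> = \<delta>" using \<delta> unfolding eq by (subst measure_completion) (auto simp: measure_lborel_Icc)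
    finally show ?thesis .
  qed
  have c_fin: "emeasure (lebesgue_on {0..T}) (?c j) < \<infinity>" if "j \<in> {1..n}" for j
    using c[OF that] by (subst emeasure_restrict_space) (auto simp: emeasure_lborel_Icc_eq)
  have int: "integrable (lebesgue_on {0..T}) (%t. (\<Sum>k\<in>?I j. y k) * indicator (?c j) t)" if "j \<in> {1..n}" for j
    using c_sets[OF that] c_fin[OF that] by (intro integrable_mult_right integrable_real_indicator)
  have sp: "space (lebesgue_on {0..T}) = {0..T}" by simp
  have one: "(LINT t|lebesgue_on {0..T}. (\<Sum>k\<in>?I j. y k) * indicator (?c j) t) = (\<Sum>k\<in>?I j. y k) * \<delta>" if "j \<in> {1..n}" for j
    by (simp only: integral_mult_right_zero Bochner_Integration.integral_indicator sp cs[OF that] c_meas[OF that])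
  show ?thesis
  proof
    show "integrable (lebesgue_on {0..T}) ?f" using int by (intro Bochner_Integration.integrable_sum)
    have "(LINT t|lebesgue_on {0..T}. ?f t) = (\<Sum>j=1..n. (\<Sum>k\<in>?I j. y k) * \<delta>)"
      by (subst Bochner_Integration.integral_sum[OF int]) (assumption, intro sum.cong refl one)
    also have "\<dots> = \<delta> * (\<Sum>j=1..n. \<Sum>k\<in>?I j. y k)" by (simp only: sum_distrib_left mult.commute)
    also have "\<dots> \<le> \<delta> * (real (2 * \<nu> + 3) * (\<Sum>k\<le>n. y k))"
      using \<delta> by (intro mult_left_mono sum_window_le[OF T n \<nu>] y) auto
    finally show "(LINT t|lebesgue_on {0..T}. ?f t) \<le> real (2 * \<nu> + 3) * (\<delta> * (\<Sum>k\<le>n. y k))"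
      by (simp only: mult.left_commute)
    fix t assume t: "t \<in> {0..T}"
    let ?j = "time_index T n t"
    note j = time_index[OF T n \<nu> t]
    have "(\<Sum>k\<in>window T n \<nu> t. y k) = (\<Sum>k\<in>?I ?j. y k) * indicator (?c ?j) t"
      using j(3,4) by (simp add: window_def[OF T n \<nu>])
    also have "\<dots> \<le> ?f t"
      using j(1,2) y by (intro member_le_sum[where f = "%j. (\<Sum>k\<in>?I j. y k) * indicator (?c j) t"]) (auto intro!: mult_nonneg_nonneg sum_nonneg)
    finally show "(\<Sum>k\<in>window T n \<nu> t. y k) \<le> ?f t" .
  qed
qed

text \<open>The square is expanded into inner products, so that measurability of the squared norm of
  \<open>x\<close> and of its pairings with fixed elements is enough. For a fixed index of the step
  the coefficients are polynomials in time, and \<open>time_index\<close> takes finitely many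
  values.\<close>

lemma measurable_interpolation_error:
  assumes x: "\<And>t. t \<in> {0..T} ==> x t \<in> X"
    and xx: "(%t. ip (x t) (x t)) \<in> borel_measurable (lebesgue_on {0..T})"
    and xw: "\<And>w. w \<in> X ==> (%t. ip (x t) w) \<in> borel_measurable (lebesgue_on {0..T})"
  shows "(%t. (nrm (%i. x t i - interpolant T n \<nu> Y t i))^2) \<in> borel_measurable (lebesgue_on {0..T})"
proof -
  let ?I = "%j. {interp_start \<nu> n j..interp_start \<nu> n j + \<nu>}"
  define L where "L j k t = (\<Prod>i\<in>?I j - {k}. (t - real i * \<delta>) / (real k * \<delta> - real i * \<delta>))" for j k t
  let ?G = "%j t. ip (x t) (x t) - 2 * (\<Sum>k\<in>?I j. L j k t * ip (x t) (Y k))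
      + (\<Sum>k\<in>?I j. L j k t * (\<Sum>l\<in>?I j. L j l t * ip (Y k) (Y l)))"
  have Im: "Y k \<in> X" if "j \<in> {1..n}" "k \<in> ?I j" for j k
    using interp_start_bounds(1)[of j n \<nu>] \<nu> that by (intro Y) auto
  have "(%t. ?G (time_index T n t) t) \<in> borel_measurable (lebesgue_on {0..T})"
  proof (rule measurable_compose_countable'[OF _ measurable_time_index[OF T n]])
    fix j assume j: "j \<in> {1..n}"
    have L: "L j k \<in> borel_measurable (lebesgue_on {0..T})" for k
    proof -
      have "L j k \<in> borel_measurable borel" unfolding L_def by measurable
      then show ?thesis by (intro measurable_restrict_space1 measurable_completion) simp
    qed
    show "?G j \<in> borel_measurable (lebesgue_on {0..T})"
      by (intro borel_measurable_add borel_measurable_diff borel_measurable_times borel_measurable_sum xx xw L Im[OF j]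
          borel_measurable_const)
  qed simp
  then show ?thesis
  proof (rule measurable_cong[THEN iffD1, rotated])
    fix t assume "t \<in> space (lebesgue_on {0..T})"
    then have t: "t \<in> {0..T}" by simp
    let ?j = "time_index T n t"
    have j: "?j \<in> {1..n}" using time_index(1,2)[OF T n \<nu> t] by simp
    have I: "interpolant T n \<nu> Y t = (%i. \<Sum>k\<in>?I ?j. L ?j k t * Y k i)"
      unfolding interpolant_eq[OF T n \<nu>] window_def[OF T n \<nu>] lagrange_def[OF T n \<nu>] L_def ..
    have Ym: "interpolant T n \<nu> Y t \<in> X" by (rule interpolant_mem[OF t])
    have 1: "ip (x t) (interpolant T n \<nu> Y t) = (\<Sum>k\<in>?I ?j. L ?j k t * ip (x t) (Y k))"
      unfolding I using Im[OF j] x[OF t] by (rule ip_sum_right)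
    have 2: "ip (Y k) (interpolant T n \<nu> Y t) = (\<Sum>l\<in>?I ?j. L ?j l t * ip (Y k) (Y l))" if "k \<in> ?I ?j" for k
      unfolding I using Im[OF j] Im[OF j that] by (rule ip_sum_right)
    have "ip (interpolant T n \<nu> Y t) (interpolant T n \<nu> Y t) = (\<Sum>k\<in>?I ?j. L ?j k t * ip (Y k) (interpolant T n \<nu> Y t))"
      using ip_sum_left[where K = "?I ?j" and u = Y and c = "%k. L ?j k t", OF Im[OF j] Ym] by (simp only: I[symmetric])
    also have "\<dots> = (\<Sum>k\<in>?I ?j. L ?j k t * (\<Sum>l\<in>?I ?j. L ?j l t * ip (Y k) (Y l)))"
      by (intro sum.cong refl) (simp only: 2)
    finally show "?G ?j t = (nrm (%i. x t i - interpolant T n \<nu> Y t i))^2"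
      unfolding nrm_power2[OF diff_mem[OF x[OF t] Ym]] ip_diff_self[OF x[OF t] Ym] 1 by (simp only:)
  qed
qed

text \<open>Applied separately to \<open>p\<close>, to its spatial derivative and to
  \<open>m\<close>.\<close>

lemma interpolation_error_time:
  assumes x: "\<And>t. t \<in> {0..T} ==> x t \<in> X"
    and xx: "(%t. ip (x t) (x t)) \<in> borel_measurable (lebesgue_on {0..T})"
    and xw: "\<And>w. w \<in> X ==> (%t. ip (x t) w) \<in> borel_measurable (lebesgue_on {0..T})"
    and xv: "integrable (lebesgue_on {0..T}) (%t. (nrm (%i. x t i - V 0 t i))^2)"
  shows "integrable (lebesgue_on {0..T}) (%t. (nrm (%i. x t i - interpolant T n \<nu> Y t i))^2)" (is ?int)
    and "(LINT t|lebesgue_on {0..T}. (nrm (%i. x t i - interpolant T n \<nu> Y t i))^2)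
      \<le> 2 * (LINT t|lebesgue_on {0..T}. (nrm (%i. x t i - V 0 t i))^2) + 4 * T * \<kappa>^2
        + 4 * (real (\<nu> + 1) * \<Lambda>^2) * (real (2 * \<nu> + 3) * (\<delta> * (\<Sum>k\<le>n. (node_error k)^2)))" (is "?L \<le> ?R")
proof -
  obtain f where f: "integrable (lebesgue_on {0..T}) f"
    "\<And>t. t \<in> {0..T} ==> (\<Sum>k\<in>window T n \<nu> t. (node_error k)^2) \<le> f t"
    "(LINT t|lebesgue_on {0..T}. f t) \<le> real (2 * \<nu> + 3) * (\<delta> * (\<Sum>k\<le>n. (node_error k)^2))"
    by (rule integral_window_le[of "%k. (node_error k)^2"]) (simp, rule that)
  let ?u = "%t. (nrm (%i. x t i - interpolant T n \<nu> Y t i))^2"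
  let ?e = "%t. (nrm (%i. x t i - V 0 t i))^2"
  let ?c = "real (\<nu> + 1) * \<Lambda>^2"
  \<comment> \<open>\<open>square_sum_le\<close> enters twice: once to insert \<open>V 0 t\<close>,
    once inside \<open>interpolation_error_power2\<close>; this explains the factors two and
    four.\<close>
  let ?g = "%t. 2 * ?e t + (4 * \<kappa>^2 + 4 * ?c * f t)"
  have le: "?u t \<le> ?g t" if t: "t \<in> {0..T}" for t
  proof -
    have m: "x t \<in> X" "V 0 t \<in> X" "interpolant T n \<nu> Y t \<in> X"
      using x[OF t] cont_curve_mem[OF V[OF le0] t] interpolant_mem[OF t] by auto
    have "?u t \<le> 2 * ?e t + 2 * (nrm (%i. V 0 t i - interpolant T n \<nu> Y t i))^2"
      by (intro square_sum_le nrm_triangle_diff m nrm_nonneg diff_mem)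
    also have "(nrm (%i. V 0 t i - interpolant T n \<nu> Y t i))^2 \<le> 2 * \<kappa>^2 + 2 * ?c * f t"
      by (rule order_trans[OF interpolation_error_power2[OF t]]) (intro add_left_mono mult_left_mono f(2)[OF t], simp)
    finally show ?thesis by simp
  qed
  have const: "integrable (lebesgue_on {0..T}) (%t. 4 * \<kappa>^2)"
    by (rule continuous_imp_integrable_real) simp
  have g: "integrable (lebesgue_on {0..T}) ?g"
    by (intro Bochner_Integration.integrable_add integrable_mult_right xv f(1) const)
  show int: ?int
  proof (rule Bochner_Integration.integrable_bound[OF g measurable_interpolation_error[OF x xx xw]])
    show "AE t in lebesgue_on {0..T}. norm (?u t) \<le> norm (?g t)"
    proof (rule AE_I2)
      fix t assume "t \<in> space (lebesgue_on {0..T})"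
      then have "?u t \<le> ?g t" by (intro le) simp
      moreover have "0 \<le> ?u t" by simp
      ultimately show "norm (?u t) \<le> norm (?g t)" unfolding real_norm_def by linarith
    qed
  qed
  have "?L \<le> (LINT t|lebesgue_on {0..T}. ?g t)"
    by (intro integral_mono int g le) simp
  also have "\<dots> = 2 * (LINT t|lebesgue_on {0..T}. ?e t) + ((LINT t|lebesgue_on {0..T}. 4 * \<kappa>^2) + 4 * ?c * (LINT t|lebesgue_on {0..T}. f t))"
    using xv f(1) const by simp
  also have "(LINT t|lebesgue_on {0..T}. 4 * \<kappa>^2) = 4 * T * \<kappa>^2"
    using T by (subst lebesgue_integral_eq_integral[OF const]) auto
  finally show "?L \<le> ?R" using mult_left_mono[OF f(3), of "4 * ?c"] by simp
qed

end

end

section \<open>The total error\<close>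

lemma sqrt_sum_squares_le:
  fixes x y e s :: real
  assumes "0 \<le> x" "0 \<le> y" "0 \<le> e" "0 \<le> s"
  shows "sqrt (x * e^2 + y * s^2) \<le> (e + s) * (sqrt x + sqrt y)"
proof -
  have "sqrt (x * e^2 + y * s^2) \<le> sqrt (x * e^2) + sqrt (y * s^2)"
    using assms by (intro sqrt_add_le_add_sqrt) auto
  also have "\<dots> = sqrt x * e + sqrt y * s" using assms by (simp add: real_sqrt_mult)
  also have "\<dots> \<le> sqrt x * (e + s) + sqrt y * (e + s)" using assms by (intro add_mono mult_left_mono) auto
  finally show ?thesis by (simp only: distrib_left mult.commute)
qed

context rk_problem
begin

definition Cl where "Cl = real (qq + 1) ^ qq"
definition Ck where "Ck = K * (1 + real (qq + 1) * Cl) * real (qq + 1) ^ Suc qq"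
text \<open>The constant of \<open>interpolation_error_time\<close> with the power of
  \<open>\<tau>\<close> split off; \<open>H\<close> is the constant in the bound for the sum of the
  squared nodal errors.\<close>

definition Ci where "Ci H = 4 * T * Ck^2 + 4 * (real (qq + 1) * Cl^2) * (real (2 * qq + 3) * H)"
definition Cm where "Cm = 2 / d_lo^2 * (2 * T * Cf^2 + Ch)"

lemma Ck_nonneg: "0 \<le> Ck"
  unfolding Ck_def Cl_def using K(1) by simp

lemma Ci_nonneg: "0 \<le> H ==> 0 \<le> Ci H"
  unfolding Ci_def using T_pos by simp

lemma Cm_nonneg: "0 \<le> Cm"
  unfolding Cm_def using T_pos Ch_nonneg by simp

lemma Cp_nonneg: "0 \<le> Cp"
  unfolding Cp_def using Ce_nonneg by simp

lemma interpolation_L2: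
  assumes V: "\<And>j. j \<le> Suc qq ==> L2_curve T (V j)"
      "\<And>j. j < Suc qq ==> derivative_curve T (L2_norm N) (V j) (V (Suc j))"
      "\<And>t. t \<in> {0..T} ==> L2_norm N (V (Suc qq) t) \<le> K"
    and Y: "\<And>k. k \<le> n ==> Y k \<in> L2 N"
    and x: "\<And>t. t \<in> {0..T} ==> x t \<in> L2 N"
      "integrable (lebesgue_on {0..T}) (%t. L2_inner N (x t) (x t))"
      "\<And>w. w \<in> L2 N ==> integrable (lebesgue_on {0..T}) (%t. L2_inner N (x t) w)"
    and E: "integrable (lebesgue_on {0..T}) (%t. (L2_norm N (%z. x t z - V 0 t z))^2)"
      "integral {0..T} (%t. (L2_norm N (%z. x t z - V 0 t z))^2) \<le> E"
    and H: "\<tau> * (\<Sum>k\<le>n. (L2_norm N (%z. V 0 (tm k) z - Y k z))^2) \<le> H * (\<tau> ^ Suc qq)^2"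
  shows "integrable (lebesgue_on {0..T}) (%t. (L2_norm N (%z. x t z - interpolant T n qq Y t z))^2)"
    "(LINT t|lebesgue_on {0..T}. (L2_norm N (%z. x t z - interpolant T n qq Y t z))^2) \<le> 2 * E + Ci H * (\<tau> ^ Suc qq)^2"
proof -
  note I = L2.interpolation_error_time[where V = V and Y = Y and x = x, OF T_pos n1 qn V(1) V(2) K(1) V(3) Y x(1)
      borel_measurable_integrable[OF x(2)] borel_measurable_integrable[OF x(3)] E(1),
      folded \<tau>_def, folded tm_def Cl_def, folded Ck_def]
  show "integrable (lebesgue_on {0..T}) (%t. (L2_norm N (%z. x t z - interpolant T n qq Y t z))^2)"
    by (rule I(1))
  have E': "(LINT t|lebesgue_on {0..T}. (L2_norm N (%z. x t z - V 0 t z))^2) \<le> E"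
    using E(2) by (subst lebesgue_integral_eq_integral[OF E(1)]) auto
  have "4 * (real (qq + 1) * Cl^2) * (real (2 * qq + 3) * (\<tau> * (\<Sum>k\<le>n. (L2_norm N (%z. V 0 (tm k) z - Y k z))^2)))
     \<le> 4 * (real (qq + 1) * Cl^2) * (real (2 * qq + 3) * (H * (\<tau> ^ Suc qq)^2))"
    by (intro mult_left_mono H) auto
  moreover have "Ci H * (\<tau> ^ Suc qq)^2
      = 4 * T * (Ck * \<tau> ^ Suc qq)^2 + 4 * (real (qq + 1) * Cl^2) * (real (2 * qq + 3) * (H * (\<tau> ^ Suc qq)^2))"
    unfolding Ci_def distrib_right power_mult_distrib by (simp only: mult.assoc)
  moreover have "(LINT t|lebesgue_on {0..T}. (L2_norm N (%z. x t z - interpolant T n qq Y t z))^2)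
     \<le> 2 * (LINT t|lebesgue_on {0..T}. (L2_norm N (%z. x t z - V 0 t z))^2) + 4 * T * (Ck * \<tau> ^ Suc qq)^2
       + 4 * (real (qq + 1) * Cl^2) * (real (2 * qq + 3) * (\<tau> * (\<Sum>k\<le>n. (L2_norm N (%z. V 0 (tm k) z - Y k z))^2)))"
    by (rule I(2))
  ultimately show "(LINT t|lebesgue_on {0..T}. (L2_norm N (%z. x t z - interpolant T n qq Y t z))^2) \<le> 2 * E + Ci H * (\<tau> ^ Suc qq)^2"
    using E' by linarith
qed

lemma U_deriv_L2:
  assumes "j < Suc qq"
  shows "derivative_curve T (L2_norm N) (U j) (U (Suc j))"
  unfolding derivative_curve_def
proof
  fix t assume t: "t \<in> {0..T}"
  have "((%s. H1_norm N (%z. (U j s z - U j t z) / (s - t) - U (Suc j) t z)) \<longlongrightarrow> 0) (at t within {0..T})"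
    using U_deriv[of j] assms t unfolding derivative_curve_def by auto
  then show "((%s. L2_norm N (%z. (U j s z - U j t z) / (s - t) - U (Suc j) t z)) \<longlongrightarrow> 0) (at t within {0..T})"
    by (rule tendsto_0_dominated_within) (simp add: L2_norm_ge_0 L2_norm_le_H1_norm)
qed

lemma perr_sums:
  "\<tau> * (\<Sum>k\<le>n. (L2_norm N (%z. p0 (tm k) z - P k z))^2) \<le> Ch * (\<tau> ^ Suc qq)^2"
  "\<tau> * (\<Sum>k\<le>n. (L2_norm N (%z. edge_deriv N (p0 (tm k)) z - edge_deriv N (P k) z))^2) \<le> Ch * (\<tau> ^ Suc qq)^2"
proof -
  have "\<tau> * (\<Sum>k\<le>n. (L2_norm N (%z. p0 (tm k) z - P k z))^2) \<le> \<tau> * (\<Sum>k\<le>n. (H1_norm N (perr k))^2)"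
    unfolding perr_def using \<tau>_pos by (intro mult_left_mono sum_mono power_mono L2_norm_le_H1_norm L2_norm_ge_0) auto
  then show "\<tau> * (\<Sum>k\<le>n. (L2_norm N (%z. p0 (tm k) z - P k z))^2) \<le> Ch * (\<tau> ^ Suc qq)^2"
    using perr_H1_sum by linarith
  have d: "L2_norm N (%z. edge_deriv N (p0 (tm k)) z - edge_deriv N (P k) z) \<le> H1_norm N (perr k)" if k: "k \<le> n" for k
  proof -
    have m: "p0 (tm k) \<in> H1 N" "P k \<in> H1 N" "perr k \<in> H1 N"
      using k by (auto intro: p0_mem tm_mem P_mem perr_mem)
    have "L2_norm N (%z. edge_deriv N (p0 (tm k)) z - edge_deriv N (P k) z) = L2_norm N (edge_deriv N (perr k))"
      using ae_eq_sym[OF edge_deriv_diff[OF m(1,2)]] m unfolding perr_def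
      by (intro L2_norm_cong_ae L2.diff_mem edge_deriv_mem_L2 H1.diff_mem)
    also have "\<dots> \<le> H1_norm N (perr k)" by (rule L2_norm_edge_deriv_le_H1_norm)
    finally show ?thesis .
  qed
  have "\<tau> * (\<Sum>k\<le>n. (L2_norm N (%z. edge_deriv N (p0 (tm k)) z - edge_deriv N (P k) z))^2) \<le> \<tau> * (\<Sum>k\<le>n. (H1_norm N (perr k))^2)"
    using \<tau>_pos d by (intro mult_left_mono sum_mono power_mono L2_norm_ge_0) auto
  then show "\<tau> * (\<Sum>k\<le>n. (L2_norm N (%z. edge_deriv N (p0 (tm k)) z - edge_deriv N (P k) z))^2) \<le> Ch * (\<tau> ^ Suc qq)^2"
    using perr_H1_sum by linarith
qed

lemma qerr_sum: "\<tau> * (\<Sum>k\<le>n. (L2_norm N (%z. M 0 (tm k) z - Q k z))^2) \<le> Cm * (\<tau> ^ Suc qq)^2"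
proof -
  let ?s = "\<tau> ^ Suc qq"
  have "(L2_norm N (qerr k))^2 \<le> 2 / d_lo^2 * ((Cf * ?s)^2 + (H1_norm N (perr k))^2)" if "k \<le> n" for k
  proof -
    have "(L2_norm N (qerr k))^2 \<le> 2 * (Cf * ?s / d_lo)^2 + 2 * (H1_norm N (perr k) / d_lo)^2"
      using qerr_bound[OF that] by (intro square_sum_le L2_norm_ge_0) (simp only: add_divide_distrib)
    also have "\<dots> = 2 / d_lo^2 * ((Cf * ?s)^2 + (H1_norm N (perr k))^2)"
      unfolding power_divide distrib_left by simp
    finally show ?thesis .
  qed
  then have "(\<Sum>k\<le>n. (L2_norm N (qerr k))^2) \<le> (\<Sum>k\<le>n. 2 / d_lo^2 * ((Cf * ?s)^2 + (H1_norm N (perr k))^2))"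
    by (intro sum_mono) simp
  also have "\<dots> = 2 / d_lo^2 * (real (Suc n) * (Cf * ?s)^2 + (\<Sum>k\<le>n. (H1_norm N (perr k))^2))"
    unfolding sum_distrib_left[symmetric] sum.distrib by simp
  finally have "\<tau> * (\<Sum>k\<le>n. (L2_norm N (qerr k))^2)
      \<le> \<tau> * (2 / d_lo^2 * (real (Suc n) * (Cf * ?s)^2 + (\<Sum>k\<le>n. (H1_norm N (perr k))^2)))"
    using \<tau>_pos by (intro mult_left_mono) auto
  also have "\<dots> = 2 / d_lo^2 * ((\<tau> * real (Suc n)) * (Cf * ?s)^2 + \<tau> * (\<Sum>k\<le>n. (H1_norm N (perr k))^2))"
    by (simp only: distrib_left mult_ac)
  also have "\<dots> \<le> 2 / d_lo^2 * ((2 * T) * (Cf * ?s)^2 + Ch * ?s^2)"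
  proof (intro mult_left_mono add_mono mult_right_mono perr_H1_sum)
    have "\<tau> * real (Suc n) \<le> \<tau> * (2 * real n)" using n1 \<tau>_pos by (intro mult_left_mono) auto
    then show "\<tau> * real (Suc n) \<le> 2 * T" using n_\<tau> by (simp add: mult_ac)
  qed (use d_bounds in auto)
  also have "\<dots> = Cm * ?s^2"
    unfolding Cm_def power_mult_distrib by (simp only: distrib_right mult.assoc)
  finally show ?thesis by (simp only: qerr_def)
qed

context
  fixes \<epsilon> C :: real and p m :: "real \<Rightarrow> 'e edge_fun" and lam :: "real \<Rightarrow> 'v \<Rightarrow> real"
  assumes \<epsilon>: "0 < \<epsilon>" and sol: "is_solution N D \<epsilon> p m lam" and C: "0 \<le> C"
    and p_close: "\<And>t. t \<in> {0..T} ==> (L2_norm N (%z. p t z - p0 t z))^2 \<le> \<epsilon>^2 * C"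
    and m_close: "integral {0..T} (%t. (L2_norm N (%z. m t z - m0 t z))^2) \<le> \<epsilon>^2 * C"
    and dp_close: "integrable (lebesgue_on {0..T}) (%t. (L2_norm N (%z. p_deriv p t z - edge_deriv N (p0 t) z))^2)"
      "integral {0..T} (%t. (L2_norm N (%z. p_deriv p t z - edge_deriv N (p0 t) z))^2) \<le> \<epsilon>^2 * C"
begin

lemma curve_integrable:
  assumes u: "L2_curve T u" and v: "L2_curve T v"
  shows "integrable (lebesgue_on {0..T}) (%t. L2_inner N (u t) (v t))"
  by (intro continuous_imp_integrable_real L2.continuous_on_ip_curves u v)

lemma curve_norm_integrable:
  assumes u: "L2_curve T u" and v: "L2_curve T v"
  shows "integrable (lebesgue_on {0..T}) (%t. (L2_norm N (%z. u t z - v t z))^2)"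
  unfolding L2_norm_power2 by (intro curve_integrable L2.cont_curve_diff u v)

lemma p_interpolation:
  "integrable (lebesgue_on {0..T}) (%t. (L2_norm N (%z. p t z - interpolant T n qq P t z))^2)"
  "(LINT t|lebesgue_on {0..T}. (L2_norm N (%z. p t z - interpolant T n qq P t z))^2)
     \<le> 2 * (T * (\<epsilon>^2 * C)) + Ci Ch * (\<tau> ^ Suc qq)^2"
proof -
  have U_L2: "L2_curve T (U j)" if "j \<le> Suc qq" for j
    using U_curve[of j] that by (intro continuous_curve_H1_L2) simp
  have K_L2: "L2_norm N (U (Suc qq) t) \<le> K" if "t \<in> {0..T}" for t
    using K(2)[OF that] L2_norm_le_H1_norm[of N "U (Suc qq) t"] by linarith
  have p0: "L2_curve T p0" by (rule continuous_curve_H1_L2[OF p0_curve])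
  note p = p_curve[OF sol]
  have i: "integrable (lebesgue_on {0..T}) (%t. (L2_norm N (%z. p t z - p0 t z))^2)"
    by (rule curve_norm_integrable[OF p p0])
  have "integral {0..T} (%t. (L2_norm N (%z. p t z - p0 t z))^2) \<le> integral {0..T} (%t. \<epsilon>^2 * C)"
    using i p_close by (intro Henstock_Kurzweil_Integration.integral_le) (auto simp: integrable_lebesgue_on_Icc_iff)
  then have E: "integral {0..T} (%t. (L2_norm N (%z. p t z - p0 t z))^2) \<le> T * (\<epsilon>^2 * C)"
    using T_pos by (simp add: mult.left_commute)
  note I = interpolation_L2[where V = U and Y = P and x = p, unfolded U0, OF U_L2 U_deriv_L2 K_L2 H1_subset_L2[OF P_mem]
      L2.cont_curve_mem[OF p] curve_integrable[OF p p] curve_integrable[OF p L2.cont_curve_const] i E perr_sums(1)]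
  show "integrable (lebesgue_on {0..T}) (%t. (L2_norm N (%z. p t z - interpolant T n qq P t z))^2)"
    by (rule I(1))
  show "(LINT t|lebesgue_on {0..T}. (L2_norm N (%z. p t z - interpolant T n qq P t z))^2)
     \<le> 2 * (T * (\<epsilon>^2 * C)) + Ci Ch * (\<tau> ^ Suc qq)^2"
    by (rule I(2))
qed

text \<open>The spatial derivative is treated as an \<open>L2\<close> curve of its own and compared
  with the interpolant of the nodal derivatives; \<open>H1_norm_interpolation\<close> reassembles
  the \<open>H1\<close> norm.\<close>

lemma dp_interpolation:
  "integrable (lebesgue_on {0..T}) (%t. (L2_norm N (%z. p_deriv p t z - interpolant T n qq (%k. edge_deriv N (P k)) t z))^2)"
  "(LINT t|lebesgue_on {0..T}. (L2_norm N (%z. p_deriv p t z - interpolant T n qq (%k. edge_deriv N (P k)) t z))^2)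
     \<le> 2 * (\<epsilon>^2 * C) + Ci Ch * (\<tau> ^ Suc qq)^2"
proof -
  let ?V = "%j t. edge_deriv N (U j t)"
  have V: "L2_curve T (?V j)" if "j \<le> Suc qq" for j
    using U_curve[of j] that by (intro continuous_curve_edge_deriv) simp
  have V': "derivative_curve T (L2_norm N) (?V j) (?V (Suc j))" if "j < Suc qq" for j
    using U_deriv[of j] that by (intro derivative_curve_edge_deriv U_mem) auto
  have K_L2: "L2_norm N (?V (Suc qq) t) \<le> K" if "t \<in> {0..T}" for t
    using K(2)[OF that] L2_norm_edge_deriv_le_H1_norm[of N "U (Suc qq) t"] by linarith
  note I = interpolation_L2[where V = ?V and Y = "%k. edge_deriv N (P k)" and x = "p_deriv p", unfolded U0, OF V V' K_L2
      edge_deriv_mem_L2[OF P_mem] p_deriv_mem p_deriv_norm_integrable[OF sol] p_deriv_integrable[OF sol] dp_close perr_sums(2)]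
  show "integrable (lebesgue_on {0..T}) (%t. (L2_norm N (%z. p_deriv p t z - interpolant T n qq (%k. edge_deriv N (P k)) t z))^2)"
    by (rule I(1))
  show "(LINT t|lebesgue_on {0..T}. (L2_norm N (%z. p_deriv p t z - interpolant T n qq (%k. edge_deriv N (P k)) t z))^2)
     \<le> 2 * (\<epsilon>^2 * C) + Ci Ch * (\<tau> ^ Suc qq)^2"
    by (rule I(2))
qed

lemma m_interpolation:
  "integrable (lebesgue_on {0..T}) (%t. (L2_norm N (%z. m t z - interpolant T n qq Q t z))^2)"
  "(LINT t|lebesgue_on {0..T}. (L2_norm N (%z. m t z - interpolant T n qq Q t z))^2)
     \<le> 2 * (\<epsilon>^2 * C) + Ci Cm * (\<tau> ^ Suc qq)^2"
proof -
  have V: "L2_curve T (M j)" if "j \<le> Suc qq" for j using that by (intro M_curve) simp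
  have V': "derivative_curve T (L2_norm N) (M j) (M (Suc j))" if "j < Suc qq" for j using that by (intro M_deriv) simp
  note m = m_curve[OF sol]
  have i: "integrable (lebesgue_on {0..T}) (%t. (L2_norm N (%z. m t z - M 0 t z))^2)"
    by (rule curve_norm_integrable[OF m V]) simp
  \<comment> \<open>\<open>m0\<close> and \<open>M 0\<close> have distance zero, so the smooth curve
    \<open>M 0\<close> may replace \<open>m0\<close> in the estimate.\<close>
  have "L2_norm N (%z. m t z - M 0 t z) = L2_norm N (%z. m t z - m0 t z)" if t: "t \<in> {0..T}" for t
  proof -
    have mem: "m t \<in> L2 N" "m0 t \<in> L2 N" "M 0 t \<in> L2 N"
      using L2.cont_curve_mem[OF m t] L2.cont_curve_mem[OF m0_curve t] M_mem[of 0 t] t by auto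
    show ?thesis
      using L2.nrm_triangle_diff[OF mem(1,2,3)] L2.nrm_triangle_diff[OF mem(1,3,2)] m0_eq_M[OF t]
        L2.nrm_diff_commute[OF mem(2,3)] by simp
  qed
  then have "integral {0..T} (%t. (L2_norm N (%z. m t z - M 0 t z))^2) = integral {0..T} (%t. (L2_norm N (%z. m t z - m0 t z))^2)"
    by (intro Henstock_Kurzweil_Integration.integral_cong) simp
  then have E: "integral {0..T} (%t. (L2_norm N (%z. m t z - M 0 t z))^2) \<le> \<epsilon>^2 * C" using m_close by simp
  note I = interpolation_L2[where V = M and Y = Q and x = m, OF V V' K(5) Q_mem
      L2.cont_curve_mem[OF m] curve_integrable[OF m m] curve_integrable[OF m L2.cont_curve_const] i E qerr_sum]
  show "integrable (lebesgue_on {0..T}) (%t. (L2_norm N (%z. m t z - interpolant T n qq Q t z))^2)"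
    by (rule I(1))
  show "(LINT t|lebesgue_on {0..T}. (L2_norm N (%z. m t z - interpolant T n qq Q t z))^2)
     \<le> 2 * (\<epsilon>^2 * C) + Ci Cm * (\<tau> ^ Suc qq)^2"
    by (rule I(2))
qed

text \<open>The derivative of the interpolant and the interpolant of the derivatives are equal only
  up to null sets. They have the same pairing with every \<open>L2\<close> function, and pairing
  with either of the two differences shows that the norms coincide.\<close>

lemma H1_norm_interpolation:
  assumes t: "t \<in> {0..T}" and pt: "p t \<in> H1 N"
  shows "(H1_norm N (%z. p t z - interpolant T n qq P t z))^2 = (L2_norm N (%z. p t z - interpolant T n qq P t z))^2
     + (L2_norm N (%z. p_deriv p t z - interpolant T n qq (%k. edge_deriv N (P k)) t z))^2"
proof -
  let ?W = "window T n qq t" and ?l = "lagrange T n qq t"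
  let ?I = "interpolant T n qq P t" and ?J = "interpolant T n qq (%k. edge_deriv N (P k)) t"
  note I_eq = interpolant_eq[OF T_pos n1 qn]
  have Wn: "k \<le> n" if "k \<in> ?W" for k using window_subset[OF T_pos n1 qn t] that by auto
  have I: "?I \<in> H1 N" unfolding I_eq by (intro H1.sum_mem P_mem Wn)
  have J: "?J \<in> L2 N" unfolding I_eq by (intro L2.sum_mem edge_deriv_mem_L2 P_mem Wn)
  let ?d = "edge_deriv N (%z. p t z - ?I z)" and ?d' = "%z. p_deriv p t z - ?J z"
  have d: "?d \<in> L2 N" "?d' \<in> L2 N" using pt I J by (auto intro!: edge_deriv_mem_L2 H1.diff_mem L2.diff_mem p_deriv_mem)
  have eq: "L2_inner N ?d w = L2_inner N ?d' w" if w: "w \<in> L2 N" for w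
  proof -
    have "L2_inner N (edge_deriv N ?I) w = L2_inner N ?J w"
      unfolding I_eq
      using op_K_sum[where K = ?W and u = P and c = ?l, OF P_mem[OF Wn] w]
        L2.ip_sum_left[where K = ?W and u = "%k. edge_deriv N (P k)" and c = ?l, OF edge_deriv_mem_L2[OF P_mem[OF Wn]] w] by simp
    then show ?thesis
      unfolding op_K_diff[OF pt I w] L2.ip_diff_left[OF p_deriv_mem J w] using pt by (simp add: p_deriv_def)
  qed
  have "L2_inner N ?d ?d = L2_inner N ?d' ?d'"
    using eq[OF d(1)] eq[OF d(2)] L2_inner_commute[of N ?d ?d'] by simp
  then show ?thesis unfolding H1_norm_power2 by (simp only: L2_norm_power2)
qed

text \<open>One summand for each of the three norms. They involve the data, the scheme and the
  bounds \<open>K\<close> and \<open>C\<close>, but neither \<open>n\<close> nor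
  \<open>\<epsilon>\<close> nor the discrete solution.\<close>

definition Cdata where
  "Cdata = (sqrt (2 * (T + 1) * C) + sqrt (2 * Ci Ch)) + (sqrt C + (Ck + real (qq + 1) * Cl * sqrt Cp))
     + (sqrt (2 * C) + sqrt (Ci Cm))"

lemma p_H1_error:
  "L2_time_norm T (H1_norm N) (%t z. p t z - interpolant T n qq P t z)
     \<le> ennreal ((\<epsilon> + \<tau> ^ Suc qq) * (sqrt (2 * (T + 1) * C) + sqrt (2 * Ci Ch)))"
proof -
  let ?a = "%t. (L2_norm N (%z. p t z - interpolant T n qq P t z))^2"
  let ?b = "%t. (L2_norm N (%z. p_deriv p t z - interpolant T n qq (%k. edge_deriv N (P k)) t z))^2"
  let ?h = "%t. (H1_norm N (%z. p t z - interpolant T n qq P t z))^2"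
  note a = p_interpolation(1) and b = dp_interpolation(1)
  have ab: "integrable (lebesgue_on {0..T}) (%t. ?a t + ?b t)"
    by (intro Bochner_Integration.integrable_add a b)
  have ae: "AE t in lebesgue_on {0..T}. ?h t = ?a t + ?b t"
    \<comment> \<open>The splitting of the \<open>H1\<close> norm requires \<open>p t\<close> in
      \<open>H1 N\<close>, which is given for almost all times.\<close>
    using p_mem_AE[OF sol] AE_space by eventually_elim (simp add: H1_norm_interpolation)
  note h = integrable_lebesgue_on_Icc_cong_AE[OF ab ae]
  have "(LINT t|lebesgue_on {0..T}. ?h t) = (LINT t|lebesgue_on {0..T}. ?a t + ?b t)"
    using h by (simp add: lebesgue_integral_eq_integral ab)
  also have "\<dots> = (LINT t|lebesgue_on {0..T}. ?a t) + (LINT t|lebesgue_on {0..T}. ?b t)"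
    by (rule Bochner_Integration.integral_add[OF a b])
  also have "\<dots> \<le> (2 * (T * (\<epsilon>^2 * C)) + Ci Ch * (\<tau> ^ Suc qq)^2) + (2 * (\<epsilon>^2 * C) + Ci Ch * (\<tau> ^ Suc qq)^2)"
    by (intro add_mono p_interpolation(2) dp_interpolation(2))
  also have "\<dots> = (2 * (T + 1) * C) * \<epsilon>^2 + (2 * Ci Ch) * (\<tau> ^ Suc qq)^2"
    by (simp add: algebra_simps del: power_Suc)
  finally have "sqrt (LINT t|lebesgue_on {0..T}. ?h t) \<le> sqrt ((2 * (T + 1) * C) * \<epsilon>^2 + (2 * Ci Ch) * (\<tau> ^ Suc qq)^2)"
    by (rule real_sqrt_le_mono)
  also have "\<dots> \<le> (\<epsilon> + \<tau> ^ Suc qq) * (sqrt (2 * (T + 1) * C) + sqrt (2 * Ci Ch))"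
    using T_pos C Ci_nonneg[OF Ch_nonneg] \<epsilon> \<tau>_pos by (intro sqrt_sum_squares_le) auto
  finally show ?thesis unfolding L2_time_norm_def using h(1) by (simp only: if_True ennreal_leI)
qed

lemma m_L2_error:
  "L2_time_norm T (L2_norm N) (%t z. m t z - interpolant T n qq Q t z)
     \<le> ennreal ((\<epsilon> + \<tau> ^ Suc qq) * (sqrt (2 * C) + sqrt (Ci Cm)))"
proof -
  have "sqrt (LINT t|lebesgue_on {0..T}. (L2_norm N (%z. m t z - interpolant T n qq Q t z))^2)
      \<le> sqrt ((2 * C) * \<epsilon>^2 + Ci Cm * (\<tau> ^ Suc qq)^2)"
    using m_interpolation(2) by (intro real_sqrt_le_mono) (simp only: mult_ac)
  also have "\<dots> \<le> (\<epsilon> + \<tau> ^ Suc qq) * (sqrt (2 * C) + sqrt (Ci Cm))"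
    using C Ci_nonneg[OF Cm_nonneg] \<epsilon> \<tau>_pos by (intro sqrt_sum_squares_le) auto
  finally show ?thesis unfolding L2_time_norm_def using m_interpolation(1) by (simp only: if_True ennreal_leI)
qed

lemma p_C_error:
  "C_time_norm T (L2_norm N) (%t z. p t z - interpolant T n qq P t z)
     \<le> ennreal ((\<epsilon> + \<tau> ^ Suc qq) * (sqrt C + (Ck + real (qq + 1) * Cl * sqrt Cp)))"
  unfolding C_time_norm_def
proof (intro SUP_least ennreal_leI)
  fix t assume t: "t \<in> {0..T}"
  let ?s = "\<tau> ^ Suc qq" and ?W = "window T n qq t"
  have Wn: "k \<le> n" if "k \<in> ?W" for k using window_subset[OF T_pos n1 qn t] that by auto
  have W: "card ?W = qq + 1" by (auto simp: window_def[OF T_pos n1 qn])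
  have s: "0 \<le> ?s" using \<tau>_pos by simp
  have U_L2: "L2_curve T (U j)" if "j \<le> Suc qq" for j
    using U_curve[of j] that by (intro continuous_curve_H1_L2) simp
  have K_L2: "L2_norm N (U (Suc qq) t) \<le> K" if "t \<in> {0..T}" for t
    using K(2)[OF that] L2_norm_le_H1_norm[of N "U (Suc qq) t"] by linarith
  have I: "L2_norm N (%z. p0 t z - interpolant T n qq P t z) \<le> Ck * ?s + Cl * (\<Sum>k\<in>?W. L2_norm N (perr k))"
    unfolding perr_def
    by (rule L2.interpolation_error[where V = U and Y = P, OF T_pos n1 qn U_L2 U_deriv_L2 K(1) K_L2 H1_subset_L2[OF P_mem] t, unfolded U0,
        folded \<tau>_def, folded tm_def Cl_def, folded Ck_def])
  have "L2_norm N (perr k) \<le> sqrt Cp * ?s" if "k \<in> ?W" for k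
    using real_sqrt_le_mono[OF perr_L2_bound[OF Wn[OF that]]] s L2_norm_ge_0[of N "perr k"]
    by (simp add: real_sqrt_mult del: power_Suc)
  then have "(\<Sum>k\<in>?W. L2_norm N (perr k)) \<le> real (qq + 1) * (sqrt Cp * ?s)"
    using sum_bounded_above[of ?W "%k. L2_norm N (perr k)" "sqrt Cp * ?s"] unfolding W by simp
  then have S: "Cl * (\<Sum>k\<in>?W. L2_norm N (perr k)) \<le> Cl * (real (qq + 1) * (sqrt Cp * ?s))"
    by (intro mult_left_mono) (auto simp: Cl_def)
  have E: "L2_norm N (%z. p t z - p0 t z) \<le> sqrt C * \<epsilon>"
    using real_sqrt_le_mono[OF p_close[OF t]] \<epsilon> L2_norm_ge_0[of N "%z. p t z - p0 t z"] by (simp add: real_sqrt_mult mult.commute)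
  have mem: "p t \<in> L2 N" "p0 t \<in> L2 N" "interpolant T n qq P t \<in> L2 N"
    using L2.cont_curve_mem[OF p_curve[OF sol] t] H1_subset_L2[OF p0_mem[OF t]]
    unfolding interpolant_eq[OF T_pos n1 qn] by (auto intro!: L2.sum_mem H1_subset_L2[OF P_mem] Wn)
  have "L2_norm N (%z. p t z - interpolant T n qq P t z) \<le> sqrt C * \<epsilon> + (Ck + real (qq + 1) * Cl * sqrt Cp) * ?s"
    using L2.nrm_triangle_diff[OF mem] I S E by (simp add: algebra_simps del: power_Suc)
  also have "\<dots> \<le> sqrt C * (\<epsilon> + ?s) + (Ck + real (qq + 1) * Cl * sqrt Cp) * (\<epsilon> + ?s)"
    using C Ck_nonneg Cp_nonneg \<epsilon> s
    by (intro add_mono mult_left_mono add_nonneg_nonneg mult_nonneg_nonneg) (auto simp: Cl_def)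
  finally show "L2_norm N (%z. p t z - interpolant T n qq P t z)
      \<le> (\<epsilon> + ?s) * (sqrt C + (Ck + real (qq + 1) * Cl * sqrt Cp))"
    by (simp only: distrib_left mult.commute)
qed

lemma total_error:
  "L2_time_norm T (H1_norm N) (%t z. p t z - interpolant T n qq P t z)
   + C_time_norm T (L2_norm N) (%t z. p t z - interpolant T n qq P t z)
   + L2_time_norm T (L2_norm N) (%t z. m t z - interpolant T n qq Q t z)
   \<le> ennreal ((\<epsilon> + (T / real n) ^ (qq + 1)) * Cdata)"
proof -
  let ?e = "\<epsilon> + \<tau> ^ Suc qq"
  have e: "0 \<le> ?e" using \<epsilon> \<tau>_pos by simp
  have n1: "0 \<le> sqrt (2 * (T + 1) * C) + sqrt (2 * Ci Ch)" and n3: "0 \<le> sqrt (2 * C) + sqrt (Ci Cm)"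
    using T_pos C Ci_nonneg[OF Ch_nonneg] Ci_nonneg[OF Cm_nonneg] by auto
  have n2: "0 \<le> sqrt C + (Ck + real (qq + 1) * Cl * sqrt Cp)"
    using C Ck_nonneg Cp_nonneg by (intro add_nonneg_nonneg mult_nonneg_nonneg) (auto simp: Cl_def)
  note sum = add_mono[OF add_mono[OF p_H1_error p_C_error] m_L2_error]
  have add: "ennreal (?e * x) + ennreal (?e * y) + ennreal (?e * z) = ennreal (?e * (x + y + z))"
    if "0 \<le> x" "0 \<le> y" "0 \<le> z" for x y z
    using that e by (simp only: ennreal_plus[symmetric] mult_nonneg_nonneg add_nonneg_nonneg distrib_left)
  show ?thesis
    using sum[unfolded add[OF n1 n2 n3]] unfolding Cdata_def \<tau>_def[symmetric] Suc_eq_plus1[symmetric] .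
qed

end

end

text \<open>Rescaling to the unit ball. Continuity of the functional makes the supremum in
  \<open>dual_norm\<close> a genuine upper bound, and it forces the functional to vanish on elements
  of norm zero.\<close>

lemma (in semi_inner) dual_norm_bound:
  assumes F: "F \<in> dual_space X nrm" and u: "u \<in> X"
  shows "\<bar>F u\<bar> \<le> dual_norm X nrm F * nrm u"
proof -
  obtain C where C: "\<And>v. v \<in> X ==> \<bar>F v\<bar> \<le> C * nrm v"
    using F unfolding dual_space_def by blast
  show ?thesis
  proof (cases "nrm u = 0")
    case True
    then show ?thesis using C[OF u] by simp
  next
    case False
    then have pos: "0 < nrm u" using nrm_nonneg[OF u] by simp
    let ?v = "%i. (1 / nrm u) * u i"
    have v: "?v \<in> X" "nrm ?v \<le> 1" using scale_mem[OF u, of "1 / nrm u"] nrm_scale[OF u, of "1 / nrm u"] pos by simp_all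
    have "F (%i. (1 / nrm u) * u i + 0 * u i) = (1 / nrm u) * F u + 0 * F u"
      using F u unfolding dual_space_def by blast
    then have Fv: "\<bar>F ?v\<bar> = \<bar>F u\<bar> / nrm u" using pos by (simp add: abs_divide)
    have "bdd_above ((%u. \<bar>F u\<bar>) ` {u \<in> X. nrm u \<le> 1})"
    proof (rule bdd_aboveI2)
      fix w assume "w \<in> {u \<in> X. nrm u \<le> 1}"
      then have w: "w \<in> X" "nrm w \<le> 1" by auto
      have "\<bar>F w\<bar> \<le> C * nrm w" by (rule C[OF w(1)])
      also have "\<dots> \<le> \<bar>C\<bar> * 1" using w nrm_nonneg[OF w(1)] by (intro mult_mono) auto
      finally show "\<bar>F w\<bar> \<le> \<bar>C\<bar>" by simp
    qed
    then have "\<bar>F ?v\<bar> \<le> dual_norm X nrm F"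
      unfolding dual_norm_def using v by (intro cSUP_upper) auto
    then show ?thesis unfolding Fv using pos by (simp add: divide_le_eq)
  qed
qed

lemma (in semi_inner) continuous_on_dual_curve:
  assumes g: "continuous_curve T (dual_space X nrm) (dual_norm X nrm) g" and u: "u \<in> X"
  shows "continuous_on {0..T} (%t. g t u)"
  unfolding continuous_on_def
proof
  fix t assume t: "t \<in> {0..T}"
  have diff: "(%v. F v - G v) \<in> dual_space X nrm" if F: "F \<in> dual_space X nrm" and G: "G \<in> dual_space X nrm" for F G
  proof -
    obtain C C' where C: "\<And>v. v \<in> X ==> \<bar>F v\<bar> \<le> C * nrm v" "\<And>v. v \<in> X ==> \<bar>G v\<bar> \<le> C' * nrm v"
      using F G unfolding dual_space_def by blast
    have "\<bar>F v - G v\<bar> \<le> (C + C') * nrm v" if "v \<in> X" for v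
      using C(1)[OF that] C(2)[OF that] unfolding distrib_right by linarith
    then have "\<exists>C. \<forall>v\<in>X. \<bar>F v - G v\<bar> \<le> C * nrm v" by (intro exI[of _ "C + C'"]) simp
    moreover have "F (%i. \<alpha> * u i + \<beta> * v i) - G (%i. \<alpha> * u i + \<beta> * v i) = \<alpha> * (F u - G u) + \<beta> * (F v - G v)"
      if "u \<in> X" "v \<in> X" for u v \<alpha> \<beta>
      using F G that unfolding dual_space_def by (simp add: algebra_simps)
    ultimately show ?thesis unfolding dual_space_def by simp
  qed
  have "((%s. dual_norm X nrm (%v. g s v - g t v)) \<longlongrightarrow> 0) (at t within {0..T})"
    using g t by (auto simp: continuous_curve_def)
  then have "((%s. dual_norm X nrm (%v. g s v - g t v) * nrm u) \<longlongrightarrow> 0) (at t within {0..T})"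
    by (rule tendsto_mult_left_zero)
  then have "((%s. g s u - g t u) \<longlongrightarrow> 0) (at t within {0..T})"
  proof (rule tendsto_0_dominated_within)
    fix s assume "s \<in> {0..T}"
    then have "(%v. g s v - g t v) \<in> dual_space X nrm"
      using g t by (intro diff) (auto simp: continuous_curve_def)
    from dual_norm_bound[OF this u] show "\<bar>g s u - g t u\<bar> \<le> dual_norm X nrm (%v. g s v - g t v) * nrm u" .
  qed
  then show "((%t. g t u) \<longlongrightarrow> g t u) (at t within {0..T})" by (rule LIM_zero_cancel)
qed

lemma continuous_on_L2_set_component:
  assumes y: "continuous_curve T UNIV (%y. L2_set y S) y" and S: "finite S" and v: "v \<in> S"
  shows "continuous_on {0..T} (%t. y t v)"
  unfolding continuous_on_def
proof
  fix t assume t: "t \<in> {0..T}"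
  have le: "\<bar>f v\<bar> \<le> L2_set f S" for f
  proof -
    have "(f v)^2 \<le> (\<Sum>v\<in>S. (f v)^2)" using S v by (intro member_le_sum) auto
    from real_sqrt_le_mono[OF this] show ?thesis by (simp add: L2_set_def)
  qed
  have "((%s. L2_set (%v. y s v - y t v) S) \<longlongrightarrow> 0) (at t within {0..T})"
    using y t by (auto simp: continuous_curve_def)
  then have "((%s. y s v - y t v) \<longlongrightarrow> 0) (at t within {0..T})"
    by (rule tendsto_0_dominated_within) (rule le)
  then show "((%t. y t v) \<longlongrightarrow> y t v) (at t within {0..T})" by (rule LIM_zero_cancel)
qed

section \<open>From the data to the error bound\<close>

lemma parabolic_problem_exists:
  assumes wf: "wf_network N" and adm: "admissible_data N D" and smooth: "smooth_data k N D" and k: "2 \<le> k"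
    and sol: "is_solution N D 0 p0 m0 lam0" and p0: "Ck_time k (T_end D) (H1 N) (H1_norm N) p0"
  obtains a_hi d_lo d_hi U F where "parabolic_problem N D a_hi d_lo d_hi p0 m0 lam0 U F k"
proof -
  let ?T = "T_end D"
  have T: "0 < ?T"
    and meas: "\<And>e. e \<in> edges N ==> (%x. coef_a D (e, x)) \<in> borel_measurable (lebesgue_on {0..edge_len N e})"
      "\<And>e. e \<in> edges N ==> (%x. coef_d D (e, x)) \<in> borel_measurable (lebesgue_on {0..edge_len N e})"
    using adm by (auto simp: admissible_data_def)
  obtain a_hi where a: "\<forall>e\<in>edges N. AE x in lebesgue_on {0..edge_len N e}. 0 \<le> coef_a D (e, x) \<and> coef_a D (e, x) \<le> a_hi"
    using adm unfolding admissible_data_def by auto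
  obtain d_lo d_hi where d: "0 < d_lo"
    "\<forall>e\<in>edges N. AE x in lebesgue_on {0..edge_len N e}. d_lo \<le> coef_d D (e, x) \<and> coef_d D (e, x) \<le> d_hi"
    using adm unfolding admissible_data_def by auto
  \<comment> \<open>The maxima here and in \<open>d_b\<close> make the upper bounds nonnegative and
    positive by construction.\<close>
  have a_b: "coef_bounds N (coef_a D) 0 (max 0 a_hi)"
    unfolding coef_bounds_def using meas(1) a by (auto simp del: AE_conj_iff elim!: eventually_mono)
  have d_b: "coef_bounds N (coef_d D) d_lo (max d_lo d_hi)"
    unfolding coef_bounds_def using meas(2) d(2) by (auto simp del: AE_conj_iff elim!: eventually_mono)
  obtain U where U: "\<And>t. U 0 t = p0 t" "\<And>j. j \<le> k ==> continuous_curve ?T (H1 N) (H1_norm N) (U j)"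
    "\<And>j. j < k ==> derivative_curve ?T (H1_norm N) (U j) (U (Suc j))"
    by (rule Ck_time_curves[OF p0]) (rule that)
  have f: "Ck_time k ?T (L2 N) (L2_norm N) (rhs_f D)"
    and g: "Ck_time k ?T (dual_space (H1 N) (H1_norm N)) (dual_norm (H1 N) (H1_norm N)) (rhs_g D)"
    and h: "Ck_time k ?T UNIV (%y. L2_set y (dirichlet N)) (rhs_h D)"
    and r: "Ck_time k ?T UNIV (%y. L2_set y (neumann N)) (rhs_r D)"
    using smooth by (auto simp: smooth_data_def)
  obtain F where F: "\<And>t. F 0 t = rhs_f D t" "\<And>j. j \<le> k ==> continuous_curve ?T (L2 N) (L2_norm N) (F j)"
    "\<And>j. j < k ==> derivative_curve ?T (L2_norm N) (F j) (F (Suc j))"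
    by (rule Ck_time_curves[OF f]) (rule that)
  show ?thesis
  proof (rule that[of "max 0 a_hi" d_lo "max d_lo d_hi" U F], unfold_locales)
    show "continuous_on {0..?T} (%t. rhs_g D t q)" if "q \<in> H1 N" for q
      by (rule H1.continuous_on_dual_curve[OF Ck_time_continuous[OF g] that])
    show "continuous_on {0..?T} (%t. rhs_r D t v)" if "v \<in> neumann N" for v
      by (rule continuous_on_L2_set_component[OF Ck_time_continuous[OF r] wf_networkD(5)[OF wf] that])
    show "continuous_on {0..?T} (%t. rhs_h D t v)" if "v \<in> dirichlet N" for v
      by (rule continuous_on_L2_set_component[OF Ck_time_continuous[OF h] wf_networkD(2)[OF wf] that])
  qed (use wf T a_b d_b d(1) sol k U F in auto)
qed

theorem theorem6p6:
  fixes A :: "real^'s^'s" and b c :: "real^'s" and \<pp> \<qq> :: nat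
  assumes "rk_order b c \<pp>" and "rk_stage_order A c \<qq>" and "\<qq> + 1 \<le> \<pp>"
    and "algebraically_stable A b"
    and "invertible A" and "b \<bullet> (matrix_inv A *v vec 1) = 1"
    and "\<forall>i. 0 \<le> c $ i \<and> c $ i \<le> 1"
  shows "\<exists>k. \<forall>(N :: ('v, 'e) network) D.
    wf_network N \<longrightarrow> admissible_data N D \<longrightarrow> smooth_data k N D \<longrightarrow>
    (\<exists>C\<^sub>d\<^sub>a\<^sub>t\<^sub>a \<ge> 0. \<forall>p\<^sub>0 m\<^sub>0 lam\<^sub>0.
      solves_P0 N D p\<^sub>0 m\<^sub>0 lam\<^sub>0 \<longrightarrow> Ck_time k (T_end D) (H1 N) (H1_norm N) p\<^sub>0 \<longrightarrow>
      ae_eq N (m_init D) (m\<^sub>0 0) \<longrightarrow>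
      (\<forall>\<epsilon> p m lam n M Ps Qs stlam stmu P Q.
        0 < \<epsilon> \<longrightarrow> \<epsilon> < 1 \<longrightarrow>
        solves_H N D \<epsilon> p m lam \<longrightarrow>
        1 \<le> n \<longrightarrow> \<qq> \<le> n \<longrightarrow>
        invertible_on (dirichlet N) M \<longrightarrow>
        rk_discretization N D A b c M n Ps Qs stlam stmu P Q \<longrightarrow>
        L2_time_norm (T_end D) (H1_norm N) (\<lambda>t z. p t z - interpolant (T_end D) n \<qq> P t z)
        + C_time_norm (T_end D) (L2_norm N) (\<lambda>t z. p t z - interpolant (T_end D) n \<qq> P t z)
        + L2_time_norm (T_end D) (L2_norm N) (\<lambda>t z. m t z - interpolant (T_end D) n \<qq> Q t z)
        \<le> ennreal ((\<epsilon> + (T_end D / real n) ^ (\<qq> + 1)) * C\<^sub>d\<^sub>a\<^sub>t\<^sub>a)))"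
\<comment> \<open>Order \<open>\<qq> + 2\<close> covers the error of a step of the reference
  trajectory and, being at least two, the Lipschitz bound for the time derivative of
  \<open>m0\<close>.\<close>
proof (intro exI[of _ "Suc (Suc \<qq>)"] allI impI)
  fix N :: "('v, 'e) network" and D :: "('v, 'e) flow_data"
  let ?k = "Suc (Suc \<qq>)"
  assume wf: "wf_network N" and adm: "admissible_data N D" and smooth: "smooth_data ?k N D"
  let ?hyp = "%p0 m0 lam0. solves_P0 N D p0 m0 lam0 \<and> Ck_time ?k (T_end D) (H1 N) (H1_norm N) p0 \<and> ae_eq N (m_init D) (m0 0)"
  let ?bound = "%C. \<forall>\<epsilon> p m lam n M Ps Qs stlam stmu P Q.
        0 < \<epsilon> \<longrightarrow> \<epsilon> < 1 \<longrightarrow>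
        solves_H N D \<epsilon> p m lam \<longrightarrow>
        1 \<le> n \<longrightarrow> \<qq> \<le> n \<longrightarrow>
        invertible_on (dirichlet N) M \<longrightarrow>
        rk_discretization N D A b c M n Ps Qs stlam stmu P Q \<longrightarrow>
        L2_time_norm (T_end D) (H1_norm N) (%t z. p t z - interpolant (T_end D) n \<qq> P t z)
        + C_time_norm (T_end D) (L2_norm N) (%t z. p t z - interpolant (T_end D) n \<qq> P t z)
        + L2_time_norm (T_end D) (L2_norm N) (%t z. m t z - interpolant (T_end D) n \<qq> Q t z)
        \<le> ennreal ((\<epsilon> + (T_end D / real n) ^ (\<qq> + 1)) * C)"
  have key: "\<exists>C\<ge>0. ?bound C" if hyp: "?hyp p0 m0 lam0" for p0 m0 lam0
  proof -
    have sol0: "is_solution N D 0 p0 m0 lam0" and p0i: "ae_eq N (p0 0) (p_init D)"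
      and p0: "Ck_time ?k (T_end D) (H1 N) (H1_norm N) p0" and m0i: "ae_eq N (m_init D) (m0 0)"
      using hyp by (auto simp: solves_P0_def)
    obtain a_hi d_lo d_hi U F where "parabolic_problem N D a_hi d_lo d_hi p0 m0 lam0 U F ?k"
      by (rule parabolic_problem_exists[OF wf adm smooth _ sol0 p0]) (simp, rule that)
    then interpret parabolic_problem N D a_hi d_lo d_hi p0 m0 lam0 U F ?k .
    obtain C where C: "0 \<le> C"
      and est: "\<And>\<epsilon> p m lam. 0 < \<epsilon> ==> \<epsilon> < 1 ==> is_solution N D \<epsilon> p m lam ==>
       L2_norm N (%z. p 0 z - p0 0 z) = 0 ==> L2_norm N (%z. m 0 z - m0 0 z) = 0 ==>
       (\<forall>t\<in>{0..T}. (L2_norm N (%z. p t z - p0 t z))^2 \<le> \<epsilon>^2 * C) \<and>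
       integral {0..T} (%t. (L2_norm N (%z. m t z - m0 t z))^2) \<le> \<epsilon>^2 * C \<and>
       integrable (lebesgue_on {0..T}) (%t. (L2_norm N (%z. p_deriv p t z - edge_deriv N (p0 t) z))^2) \<and>
       integral {0..T} (%t. (L2_norm N (%z. p_deriv p t z - edge_deriv N (p0 t) z))^2) \<le> \<epsilon>^2 * C"
      by (rule hyperbolic_parabolic_estimate) (rule that)
    obtain K1 where K1: "0 \<le> K1" "\<And>t. t \<in> {0..T} ==> H1_norm N (U (Suc \<qq>) t) \<le> K1"
      by (rule H1.cont_curve_bounded[OF U_curve[of "Suc \<qq>"]]) (simp, rule that)
    obtain K2 where K2: "0 \<le> K2" "\<And>t. t \<in> {0..T} ==> H1_norm N (U ?k t) \<le> K2"
      by (rule H1.cont_curve_bounded[OF U_curve[of ?k]]) (simp, rule that)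
    obtain K3 where K3: "0 \<le> K3" "\<And>t. t \<in> {0..T} ==> L2_norm N (F (Suc \<qq>) t) \<le> K3"
      by (rule L2.cont_curve_bounded[OF F_curve[of "Suc \<qq>"]]) (simp, rule that)
    obtain K4 where K4: "0 \<le> K4" "\<And>t. t \<in> {0..T} ==> L2_norm N (M (Suc \<qq>) t) \<le> K4"
      by (rule L2.cont_curve_bounded[OF M_curve[of "Suc \<qq>"]]) (simp, rule that)
    \<comment> \<open>The sum of nonnegative bounds majorizes each of them, so one constant serves
      the locale.\<close>
    let ?K = "K1 + K2 + K3 + K4"
    \<comment> \<open>Outside its locale the constant displays what it depends on. It is fixed
      before \<open>\<epsilon>\<close>, \<open>n\<close> and the discrete solution are
      introduced.\<close>
    let ?C = "rk_problem.Cdata D a_hi d_lo d_hi \<qq> A b ?K C"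
    \<comment> \<open>The absolute value secures nonnegativity independently of the existence of a
      discrete solution.\<close>
    have "?bound \<bar>?C\<bar>"
    proof (intro allI impI)
      fix \<epsilon> :: real and p m lam n Mm Ps Qs stlam stmu P Q
      assume \<epsilon>: "0 < \<epsilon>" "\<epsilon> < 1" and H: "solves_H N D \<epsilon> p m lam" and n: "1 \<le> n" "\<qq> \<le> n"
        and rk: "rk_discretization N D A b c Mm n Ps Qs stlam stmu P Q"
      have sol: "is_solution N D \<epsilon> p m lam" and pi: "ae_eq N (p 0) (p_init D)" and mi: "ae_eq N (m 0) (m_init D)"
        using H by (auto simp: solves_H_def)
      have init: "p_init D \<in> H1 N" "m_init D \<in> L2 N" using adm by (auto simp: admissible_data_def)
      have T0: "0 \<in> {0..T}" using T_pos by simp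
      have zero: "L2_norm N (%z. u z - v z) = 0" if "ae_eq N u v" "u \<in> L2 N" "v \<in> L2 N" for u v
      proof -
        have "ae_eq N (%z. u z - v z) (%z. 0)" using that(1) unfolding ae_eq_def by (auto elim!: eventually_mono)
        then have "L2_norm N (%z. u z - v z) = L2_norm N (%z. 0)"
          by (intro L2_norm_cong_ae L2.diff_mem L2.zero_mem that)
        then show ?thesis by (simp add: L2.nrm_zero)
      qed
      have "L2_norm N (%z. p 0 z - p0 0 z) = 0"
        by (rule zero[OF ae_eq_trans[OF pi ae_eq_sym[OF p0i]] L2.cont_curve_mem[OF p_curve[OF sol] T0] H1_subset_L2[OF p0_mem[OF T0]]])
      moreover have "L2_norm N (%z. m 0 z - m0 0 z) = 0"
        by (rule zero[OF ae_eq_trans[OF mi m0i] L2.cont_curve_mem[OF m_curve[OF sol] T0] L2.cont_curve_mem[OF m0_curve T0]])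
      ultimately have e: "\<forall>t\<in>{0..T}. (L2_norm N (%z. p t z - p0 t z))^2 \<le> \<epsilon>^2 * C"
        "integral {0..T} (%t. (L2_norm N (%z. m t z - m0 t z))^2) \<le> \<epsilon>^2 * C"
        "integrable (lebesgue_on {0..T}) (%t. (L2_norm N (%z. p_deriv p t z - edge_deriv N (p0 t) z))^2)"
        "integral {0..T} (%t. (L2_norm N (%z. p_deriv p t z - edge_deriv N (p0 t) z))^2) \<le> \<epsilon>^2 * C"
        using est[OF \<epsilon> sol] by simp_all
      have K: "H1_norm N (U (Suc \<qq>) t) \<le> ?K" "H1_norm N (U ?k t) \<le> ?K" "L2_norm N (F (Suc \<qq>) t) \<le> ?K" "L2_norm N (M (Suc \<qq>) t) \<le> ?K"
        if "t \<in> {0..T}" for t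
        using K1(1) K2(1) K3(1) K4(1) K1(2)[OF that] K2(2)[OF that] K3(2)[OF that] K4(2)[OF that] by linarith+
      interpret rk: rk_problem N D a_hi d_lo d_hi p0 m0 lam0 U F \<qq> A b c \<pp> n Mm Ps Qs stlam stmu P Q ?K
        by unfold_locales (use assms n rk init p0i m0i K1(1) K2(1) K3(1) K4(1) K in auto)
      have "(\<epsilon> + (T / real n) ^ (\<qq> + 1)) * ?C \<le> (\<epsilon> + (T / real n) ^ (\<qq> + 1)) * \<bar>?C\<bar>"
        using \<epsilon> T_pos by (intro mult_left_mono) auto
      from order_trans[OF rk.total_error[OF \<epsilon>(1) sol C bspec[OF e(1)] e(2-4)] ennreal_leI[OF this]]
      show "L2_time_norm T (H1_norm N) (%t z. p t z - interpolant T n \<qq> P t z)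
        + C_time_norm T (L2_norm N) (%t z. p t z - interpolant T n \<qq> P t z)
        + L2_time_norm T (L2_norm N) (%t z. m t z - interpolant T n \<qq> Q t z)
        \<le> ennreal ((\<epsilon> + (T / real n) ^ (\<qq> + 1)) * \<bar>?C\<bar>)" .
    qed
    then show ?thesis by (intro exI[of _ "\<bar>?C\<bar>"]) simp
  qed
  show "\<exists>Cdata\<ge>0. \<forall>p0 m0 lam0. solves_P0 N D p0 m0 lam0 \<longrightarrow> Ck_time ?k (T_end D) (H1 N) (H1_norm N) p0 \<longrightarrow>
      ae_eq N (m_init D) (m0 0) \<longrightarrow> ?bound Cdata"
  \<comment> \<open>The constant must be chosen before \<open>p0\<close>. As the bound does not
    mention \<open>p0\<close>, the constant obtained from one admissible solution serves for all; if
    there is none, the claim is vacuous.\<close>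
  proof (cases "\<exists>p0 m0 lam0. ?hyp p0 m0 lam0")
    case True
    then obtain p0 m0 lam0 where "?hyp p0 m0 lam0" by (elim exE)
    from key[OF this] obtain C where C: "0 \<le> C" "?bound C" by (elim exE conjE)
    show ?thesis by (rule exI[of _ C], rule conjI, rule C(1), (rule allI)+, (rule impI)+, rule C(2))
  next
    case False
    then show ?thesis by (intro exI[of _ 0] conjI order_refl) fast
  qed
qed

end
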